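(* For the general $(2,7)$-curve, a basis of the complex vector space $\Gamma(J,\mathcal O(3\Theta^{[2]}))$ is given by the following $27$ functions: the eight functions $$1,\ \wp_{11},\ \wp_{12},\ \wp_{13},\ \wp_{22},\ \wp_{23},\ \wp_{33},\ \Delta;$$ the ten functions $$\wp_{111},\ \wp_{112},\ \wp_{113},\ \wp_{122},\ \wp_{123},\ \wp_{133},\ \wp_{222},\ \wp_{223},\ \wp_{233},\ \wp_{333};$$ and $$\partial_1\Delta,\ \partial_2\Delta,\ \partial_3\Delta,\ \wp^{[11]},\ \wp^{[12]},\ \wp^{[13]},\ \wp^{[23]},\ \wp^{[33]},\ T,$$ where $$T=\wp_{222}^2-4\wp_{22}^3-Q_{2222}\wp_{22}=2\wp_{22}^3+\wp_{222}^2-\wp_{22}\wp_{2222}.$$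
   Context: Let $C$ be the compact Riemann surface (genus $3$, one point $\infty$ at infinity) of the general $(2,7)$-curve $f(x,y)=0$, assumed non-singular, where $f(x,y)=y^2+(\mu_1x^3+\mu_3x^2+\mu_5x+\mu_7)y-(x^7+\mu_2x^6+\mu_4x^5+\mu_6x^4+\mu_8x^3+\mu_{10}x^2+\mu_{12}x+\mu_{14})$, $\mu_j\in\mathbb C$. Put $\boldsymbol{du}=\big(\frac{dx}{f_y},\frac{x\,dx}{f_y},\frac{x^2dx}{f_y}\big)$, $f_y=\partial f/\partial y$. $\Lambda\subset\mathbb C^3$ is the lattice of all periods of $\boldsymbol{du}$ over $H_1(C,\mathbb Z)$, $J=\mathbb C^3/\Lambda$, $\kappa:\mathbb C^3\to J$ the projection, $W^{[2]}\subset J$ the image of $(P_1,P_2)\mapsto\int_\infty^{P_1}\boldsymbol{du}+\int_\infty^{P_2}\boldsymbol{du}$, and $\Theta^{[2]}=W^{[2]}\cup(-W^{[2]})$. The Kleinian sigma function $\sigma(\boldsymbol u)$, $\boldsymbol u=(u_1,u_2,u_3)$, is $c\exp(\frac12\boldsymbol u\eta'(\omega')^{-1}\boldsymbol u^T)$ times the Riemann theta function whose characteristic gives the Riemann constant with base point $\infty$ ($\omega',\eta'$ being matrices of $\alpha$-periods of $\boldsymbol{du}$ and of an associated standard basis of second kind differentials with poles only at $\infty$; changing that choice only changes each $\wp_{ij}$ by an additive constant). It is entire, has zeros of order one along $\kappa^{-1}(\Theta^{[2]})$ and no other zeros, satisfies $\sigma(-\boldsymbol u)=\sigma(\boldsymbol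 u)$, and $\sigma(\boldsymbol u+\boldsymbol\ell)=\chi(\boldsymbol\ell)\exp(L(\boldsymbol u+\frac12\boldsymbol\ell,\boldsymbol\ell))\sigma(\boldsymbol u)$ for $\boldsymbol\ell\in\Lambda$, with $\chi(\boldsymbol\ell)=\pm1$ and $L(\cdot,\boldsymbol\ell)$ a $\mathbb C$-linear form. For $m\ge2$, $\wp_{i_1\dots i_m}=-\frac{\partial}{\partial u_{i_1}}\cdots\frac{\partial}{\partial u_{i_m}}\log\sigma$. $Q_{ijkl}=\wp_{ijkl}-2\wp_{ij}\wp_{kl}-2\wp_{ik}\wp_{jl}-2\wp_{il}\wp_{jk}$. $\Delta=\wp_{11}\wp_{33}-\wp_{12}\wp_{23}-\wp_{13}^2+\wp_{13}\wp_{22}$. $\partial_i=\partial/\partial u_i$. $\wp^{[ij]}$ is the $(i,j)$ minor (determinant after deleting row $i$ and column $j$) of the symmetric $3\times3$ matrix $[\wp_{ij}]$. $\Gamma(J,\mathcal O(m\Theta^{[2]}))$ is the vector space of meromorphic functions on $\mathbb C^3$ that are periodic with respect to $\Lambda$ and have poles of order at most $m$, occurring only along $\kappa^{-1}(\Theta^{[2]})$. *)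

theory Defs
  imports
    "HOL-Analysis.Analysis"
    "HOL-Homology.Homology"
    "HOL-Computational_Algebra.Polynomial"
    "HOL-Library.Function_Algebras"
begin

section \<open>The curve\<close>

text \<open>Only the coefficients \<open>\<mu> 1, \<dots>, \<mu> 8, \<mu> 10, \<mu> 12, \<mu> 14\<close> of the sequence are used.\<close>

definition curve_poly :: "(nat \<Rightarrow> complex) \<Rightarrow> complex \<Rightarrow> complex \<Rightarrow> complex" where
  "curve_poly \<mu> x y =
     y^2 + (\<mu> 1 * x^3 + \<mu> 3 * x^2 + \<mu> 5 * x + \<mu> 7) * y
     - (x^7 + \<mu> 2 * x^6 + \<mu> 4 * x^5 + \<mu> 6 * x^4 + \<mu> 8 * x^3 + \<mu> 10 * x^2 + \<mu> 12 * x + \<mu> 14)"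

definition curve_poly_x :: "(nat \<Rightarrow> complex) \<Rightarrow> complex \<Rightarrow> complex \<Rightarrow> complex" where
  "curve_poly_x \<mu> x y = deriv (\<lambda>z. curve_poly \<mu> z y) x"

definition curve_poly_y :: "(nat \<Rightarrow> complex) \<Rightarrow> complex \<Rightarrow> complex \<Rightarrow> complex" where
  "curve_poly_y \<mu> x y = deriv (\<lambda>w. curve_poly \<mu> x w) y"

definition affine_curve :: "(nat \<Rightarrow> complex) \<Rightarrow> (complex \<times> complex) set" where
  "affine_curve \<mu> = {(x, y). curve_poly \<mu> x y = 0}"

definition nonsingular :: "(nat \<Rightarrow> complex) \<Rightarrow> bool" where
  "nonsingular \<mu> \<longleftrightarrow>
     (\<forall>(x, y) \<in> affine_curve \<mu>. curve_poly_x \<mu> x y \<noteq> 0 \<or> curve_poly_y \<mu> x y \<noteq> 0)"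

text \<open>The point \<^term>\<open>None\<close> is the unique point at infinity.\<close>

definition compact_curve :: "(nat \<Rightarrow> complex) \<Rightarrow> (complex \<times> complex) option topology" where
  "compact_curve \<mu> = Alexandroff_compactification (top_of_set (affine_curve \<mu>))"


section \<open>Differential forms, integrals, periods\<close>

text \<open>The value of the form \<open>dx / f_y\<close> on the velocity of a path. On the curve
  \<open>f_x dx + f_y dy = 0\<close>, so the form equals \<open>- dy / f_x\<close> at the branch points,
  where \<open>f_y = 0\<close>. It has no zeros and no poles on the affine curve.\<close>

definition base_form_along ::
  "(nat \<Rightarrow> complex) \<Rightarrow> (real \<Rightarrow> complex \<times> complex) \<Rightarrow> real \<Rightarrow> complex" where
  "base_form_along \<mu> \<gamma> t =
     (let (x, y) = \<gamma> t; (dx, dy) = vector_derivative \<gamma> (at t) in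
      if curve_poly_y \<mu> x y \<noteq> 0 then dx / curve_poly_y \<mu> x y else - dy / curve_poly_x \<mu> x y)"

text \<open>The integral over \<open>\<gamma>\<close> restricted to \<open>[a, b]\<close> of the form \<open>h(x, y) dx / f_y\<close>.\<close>

definition form_integral ::
  "(nat \<Rightarrow> complex) \<Rightarrow> (complex \<times> complex \<Rightarrow> complex) \<Rightarrow>
   (real \<Rightarrow> complex \<times> complex) \<Rightarrow> real \<Rightarrow> real \<Rightarrow> complex" where
  "form_integral \<mu> h \<gamma> a b = integral {a..b} (\<lambda>t. h (\<gamma> t) * base_form_along \<mu> \<gamma> t)"

definition du_coeff :: "3 \<Rightarrow> complex \<times> complex \<Rightarrow> complex" where
  "du_coeff i p = (if i = 1 then 1 else if i = 2 then fst p else (fst p)^2)"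

text \<open>Every regular function on the affine curve is \<open>A(x) + B(x) y\<close> for unique polynomials
  \<open>A\<close> and \<open>B\<close>; the forms \<open>(A(x) + B(x) y) dx / f_y\<close> are exactly the meromorphic forms
  whose only poles are at infinity. They are automatically of the second kind, because a form
  with a single pole has residue zero.\<close>

definition regular_fun :: "complex poly \<times> complex poly \<Rightarrow> complex \<times> complex \<Rightarrow> complex" where
  "regular_fun h p = poly (fst h) (fst p) + poly (snd h) (fst p) * snd p"

definition curve_loop :: "(nat \<Rightarrow> complex) \<Rightarrow> (real \<Rightarrow> complex \<times> complex) \<Rightarrow> bool" where
  "curve_loop \<mu> \<gamma> \<longleftrightarrow>
     \<gamma> piecewise_C1_differentiable_on {0..1} \<and> \<gamma> ` {0..1} \<subseteq> affine_curve \<mu> \<and> \<gamma> 0 = \<gamma> 1"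

text \<open>Every class in \<open>H_1(C, \<int>)\<close> is represented by a piecewise smooth loop avoiding
  infinity, so these are the periods of \<open>du\<close> over \<open>H_1(C, \<int>)\<close>.\<close>

definition period_lattice :: "(nat \<Rightarrow> complex) \<Rightarrow> (complex ^ 3) set" where
  "period_lattice \<mu> =
     {(\<chi> i. form_integral \<mu> (du_coeff i) \<gamma> 0 1) | \<gamma>. curve_loop \<mu> \<gamma>}"

text \<open>All values of \<open>\<integral> du\<close> from infinity to \<open>P\<close>. For an affine point \<open>P\<close> the integral
  is the limit over the tails of a path in the affine curve that tends to infinity as the
  parameter tends to \<open>0\<close>.\<close>

definition abel_values ::
  "(nat \<Rightarrow> complex) \<Rightarrow> (complex \<times> complex) option \<Rightarrow> (complex ^ 3) set" where
  "abel_values \<mu> P = (case P of None \<Rightarrow> period_lattice \<mu>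
     | Some p \<Rightarrow> {v. \<exists>\<gamma>.
         \<gamma> ` {0<..1} \<subseteq> affine_curve \<mu> \<and> \<gamma> 1 = p \<and>
         (\<forall>e. 0 < e \<and> e < 1 \<longrightarrow> \<gamma> piecewise_C1_differentiable_on {e..1}) \<and>
         filterlim \<gamma> at_infinity (at_right 0) \<and>
         (\<forall>i. ((\<lambda>e. form_integral \<mu> (du_coeff i) \<gamma> e 1) \<longlongrightarrow> v $ i) (at_right 0))})"

text \<open>The sets \<open>\<kappa>\<^sup>-\<^sup>1(W\<^sup>[\<^sup>2\<^sup>])\<close> and \<open>\<kappa>\<^sup>-\<^sup>1(\<Theta>\<^sup>[\<^sup>2\<^sup>])\<close> in \<open>\<complex>\<^sup>3\<close>.\<close>

definition W2_preimage :: "(nat \<Rightarrow> complex) \<Rightarrow> (complex ^ 3) set" where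
  "W2_preimage \<mu> =
     {v1 + v2 + l | v1 v2 l P1 P2.
        P1 \<in> topspace (compact_curve \<mu>) \<and> P2 \<in> topspace (compact_curve \<mu>) \<and>
        v1 \<in> abel_values \<mu> P1 \<and> v2 \<in> abel_values \<mu> P2 \<and> l \<in> period_lattice \<mu>}"

definition theta_preimage :: "(nat \<Rightarrow> complex) \<Rightarrow> (complex ^ 3) set" where
  "theta_preimage \<mu> = W2_preimage \<mu> \<union> uminus ` W2_preimage \<mu>"


section \<open>Symplectic homology bases\<close>

definition crossings ::
  "(real \<Rightarrow> complex \<times> complex) \<Rightarrow> (real \<Rightarrow> complex \<times> complex) \<Rightarrow> (real \<times> real) set" where
  "crossings \<gamma> \<delta> = {(s, t). s \<in> {0..1} \<and> t \<in> {0..1} \<and> \<gamma> s = \<delta> t}"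

text \<open>Since \<open>dx / f_y\<close> is holomorphic without zeros, a local primitive of it is a local
  coordinate of the Riemann surface; orientation is measured in this coordinate.\<close>

definition crossing_det ::
  "(nat \<Rightarrow> complex) \<Rightarrow> (real \<Rightarrow> complex \<times> complex) \<Rightarrow> (real \<Rightarrow> complex \<times> complex) \<Rightarrow>
   real \<times> real \<Rightarrow> real" where
  "crossing_det \<mu> \<gamma> \<delta> = (\<lambda>(s, t). Im (cnj (base_form_along \<mu> \<gamma> s) * base_form_along \<mu> \<delta> t))"

definition transversal ::
  "(nat \<Rightarrow> complex) \<Rightarrow> (real \<Rightarrow> complex \<times> complex) \<Rightarrow> (real \<Rightarrow> complex \<times> complex) \<Rightarrow> bool" where
  "transversal \<mu> \<gamma> \<delta> \<longleftrightarrow> finite (crossings \<gamma> \<delta>) \<and>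
     (\<forall>(s, t) \<in> crossings \<gamma> \<delta>.
        0 < s \<and> s < 1 \<and> 0 < t \<and> t < 1 \<and>
        \<gamma> differentiable (at s) \<and> \<delta> differentiable (at t) \<and> crossing_det \<mu> \<gamma> \<delta> (s, t) \<noteq> 0)"

definition intersection_number ::
  "(nat \<Rightarrow> complex) \<Rightarrow> (real \<Rightarrow> complex \<times> complex) \<Rightarrow> (real \<Rightarrow> complex \<times> complex) \<Rightarrow> real" where
  "intersection_number \<mu> \<gamma> \<delta> = (\<Sum>st \<in> crossings \<gamma> \<delta>. sgn (crossing_det \<mu> \<gamma> \<delta> st))"

definition loop_chain :: "(real \<Rightarrow> complex \<times> complex) \<Rightarrow> (complex \<times> complex) option chain" where
  "loop_chain \<gamma> = frag_of (restrict (\<lambda>s. Some (\<gamma> (s 1))) (standard_simplex 1))"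

text \<open>The self-intersection numbers vanish by antisymmetry and are not listed.\<close>

definition symplectic_basis ::
  "(nat \<Rightarrow> complex) \<Rightarrow> (3 \<Rightarrow> real \<Rightarrow> complex \<times> complex) \<Rightarrow>
   (3 \<Rightarrow> real \<Rightarrow> complex \<times> complex) \<Rightarrow> bool" where
  "symplectic_basis \<mu> \<alpha> \<beta> \<longleftrightarrow>
     (\<forall>i. curve_loop \<mu> (\<alpha> i) \<and> curve_loop \<mu> (\<beta> i)) \<and>
     (\<forall>c. singular_relcycle 1 (compact_curve \<mu>) {} c \<longrightarrow>
        (\<exists>!mn :: (int ^ 3) \<times> (int ^ 3). homologous_rel 1 (compact_curve \<mu>) {} c
           (\<Sum>i\<in>UNIV. frag_cmul (fst mn $ i) (loop_chain (\<alpha> i))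
                      + frag_cmul (snd mn $ i) (loop_chain (\<beta> i))))) \<and>
     (\<forall>i j. transversal \<mu> (\<alpha> i) (\<beta> j) \<and>
            intersection_number \<mu> (\<alpha> i) (\<beta> j) = (if i = j then 1 else 0)) \<and>
     (\<forall>i j. i \<noteq> j \<longrightarrow>
        transversal \<mu> (\<alpha> i) (\<alpha> j) \<and> intersection_number \<mu> (\<alpha> i) (\<alpha> j) = 0 \<and>
        transversal \<mu> (\<beta> i) (\<beta> j) \<and> intersection_number \<mu> (\<beta> i) (\<beta> j) = 0)"

text \<open>The matrix with \<open>(i, j)\<close> entry the integral of \<open>h_i dx / f_y\<close> over the \<open>j\<close>-th cycle.\<close>

definition period_matrix ::
  "(nat \<Rightarrow> complex) \<Rightarrow> (3 \<Rightarrow> complex \<times> complex \<Rightarrow> complex) \<Rightarrow>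
   (3 \<Rightarrow> real \<Rightarrow> complex \<times> complex) \<Rightarrow> complex ^ 3 ^ 3" where
  "period_matrix \<mu> h \<gamma> = (\<chi> i j. form_integral \<mu> (h i) (\<gamma> j) 0 1)"

text \<open>The forms \<open>h_i dx / f_y\<close> of the second kind complete \<open>du\<close> to a standard (symplectic)
  basis when the generalized Legendre relation holds. The relation among the periods
  of \<open>du\<close> alone is Riemann's bilinear relation and need not be imposed. The sign is that of
  \<open>\<eta>' \<omega>'' - \<eta>'' \<omega>' = 2 \<pi> \<i>\<close> in genus one, which goes with the sign of the exponent
  \<open>+ 1/2 u \<eta>' \<omega>'\<^sup>-\<^sup>1 u\<^sup>T\<close> below.\<close>

definition standard_second_kind ::
  "(nat \<Rightarrow> complex) \<Rightarrow> (3 \<Rightarrow> real \<Rightarrow> complex \<times> complex) \<Rightarrow>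
   (3 \<Rightarrow> real \<Rightarrow> complex \<times> complex) \<Rightarrow> (3 \<Rightarrow> complex poly \<times> complex poly) \<Rightarrow> bool" where
  "standard_second_kind \<mu> \<alpha> \<beta> h \<longleftrightarrow>
     (let \<omega>' = period_matrix \<mu> du_coeff \<alpha>; \<omega>'' = period_matrix \<mu> du_coeff \<beta>;
          \<eta>' = period_matrix \<mu> (\<lambda>i. regular_fun (h i)) \<alpha>;
          \<eta>'' = period_matrix \<mu> (\<lambda>i. regular_fun (h i)) \<beta>
      in \<omega>' ** transpose \<eta>'' - \<omega>'' ** transpose \<eta>' = mat (- (2 * of_real pi * \<i>)) \<and>
         \<eta>' ** transpose \<eta>'' = \<eta>'' ** transpose \<eta>')"


section \<open>Theta and sigma\<close>

definition riemann_theta ::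
  "complex ^ 3 \<Rightarrow> complex ^ 3 \<Rightarrow> complex ^ 3 \<Rightarrow> complex ^ 3 ^ 3 \<Rightarrow> complex" where
  "riemann_theta a b z \<tau> =
     (\<Sum>\<^sub>\<infinity>n \<in> (UNIV :: (int ^ 3) set).
        let m = (\<chi> i. of_int (n $ i) + a $ i) in
        exp (of_real pi * \<i> * (\<Sum>i\<in>UNIV. m $ i * (\<tau> *v m) $ i)
             + 2 * of_real pi * \<i> * (\<Sum>i\<in>UNIV. m $ i * (z $ i + b $ i))))"

text \<open>The half-integer characteristic giving the Riemann constant with base point infinity.
  By Riemann's theorem the zero divisor of the theta function without characteristic
  is the translate of \<open>W\<^sup>[\<^sup>2\<^sup>]\<close>
  by the Riemann constant, and this translate determines the constant, because no
  nonzero translation of \<open>J\<close> maps \<open>W\<^sup>[\<^sup>2\<^sup>]\<close> to itself. It is a half-period because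
  \<open>(2 g - 2) \<infinity> = 4 \<infinity>\<close> is a canonical divisor.\<close>

definition riemann_constant_characteristic ::
  "(nat \<Rightarrow> complex) \<Rightarrow> complex ^ 3 ^ 3 \<Rightarrow> complex ^ 3 ^ 3 \<Rightarrow> complex ^ 3 \<Rightarrow> complex ^ 3 \<Rightarrow> bool" where
  "riemann_constant_characteristic \<mu> \<omega>' \<omega>'' a b \<longleftrightarrow>
     (\<forall>i. 2 * a $ i \<in> \<int> \<and> 2 * b $ i \<in> \<int>) \<and>
     (\<forall>u. riemann_theta a b (matrix_inv \<omega>' *v u) (matrix_inv \<omega>' ** \<omega>'') = 0
          \<longleftrightarrow> u \<in> W2_preimage \<mu>)"

definition kleinian_sigma :: "(nat \<Rightarrow> complex) \<Rightarrow> (complex ^ 3 \<Rightarrow> complex) \<Rightarrow> bool" where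
  "kleinian_sigma \<mu> \<sigma> \<longleftrightarrow>
     (\<exists>\<alpha> \<beta> h a b c.
        let \<omega>' = period_matrix \<mu> du_coeff \<alpha>; \<omega>'' = period_matrix \<mu> du_coeff \<beta>;
            \<eta>' = period_matrix \<mu> (\<lambda>i. regular_fun (h i)) \<alpha>
        in symplectic_basis \<mu> \<alpha> \<beta> \<and> standard_second_kind \<mu> \<alpha> \<beta> h \<and>
           riemann_constant_characteristic \<mu> \<omega>' \<omega>'' a b \<and> c \<noteq> 0 \<and>
           (\<forall>u. \<sigma> u = c * exp (1/2 * (\<Sum>i\<in>UNIV. u $ i * ((\<eta>' ** matrix_inv \<omega>') *v u) $ i))
                       * riemann_theta a b (matrix_inv \<omega>' *v u) (matrix_inv \<omega>' ** \<omega>'')))"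


section \<open>Abelian functions\<close>

definition partial :: "3 \<Rightarrow> (complex ^ 3 \<Rightarrow> complex) \<Rightarrow> complex ^ 3 \<Rightarrow> complex" where
  "partial i g u = deriv (\<lambda>t. g (u + axis i t)) 0"

text \<open>The derivative \<open>\<partial>\<^sub>i log \<sigma>\<close> is written as the single-valued function \<open>\<partial>\<^sub>i \<sigma> / \<sigma>\<close>.
  The list of indices must be nonempty; its length is at least \<open>2\<close> in all uses.\<close>

definition wp :: "(complex ^ 3 \<Rightarrow> complex) \<Rightarrow> 3 list \<Rightarrow> complex ^ 3 \<Rightarrow> complex" where
  "wp \<sigma> js u = - foldr partial (butlast js) (\<lambda>v. partial (last js) \<sigma> v / \<sigma> v) u"

definition Qfun :: "(complex ^ 3 \<Rightarrow> complex) \<Rightarrow> 3 \<Rightarrow> 3 \<Rightarrow> 3 \<Rightarrow> 3 \<Rightarrow> complex ^ 3 \<Rightarrow> complex" where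
  "Qfun \<sigma> i j k l u = wp \<sigma> [i, j, k, l] u
     - 2 * wp \<sigma> [i, j] u * wp \<sigma> [k, l] u
     - 2 * wp \<sigma> [i, k] u * wp \<sigma> [j, l] u
     - 2 * wp \<sigma> [i, l] u * wp \<sigma> [j, k] u"

definition Delta_fun :: "(complex ^ 3 \<Rightarrow> complex) \<Rightarrow> complex ^ 3 \<Rightarrow> complex" where
  "Delta_fun \<sigma> u = wp \<sigma> [1, 1] u * wp \<sigma> [3, 3] u - wp \<sigma> [1, 2] u * wp \<sigma> [2, 3] u
     - (wp \<sigma> [1, 3] u)^2 + wp \<sigma> [1, 3] u * wp \<sigma> [2, 2] u"

definition other_indices :: "3 \<Rightarrow> 3 \<times> 3" where
  "other_indices i = (if i = 1 then (2, 3) else if i = 2 then (1, 3) else (1, 2))"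

definition wp_minor :: "(complex ^ 3 \<Rightarrow> complex) \<Rightarrow> 3 \<Rightarrow> 3 \<Rightarrow> complex ^ 3 \<Rightarrow> complex" where
  "wp_minor \<sigma> i j u =
     (let (r, r') = other_indices i; (s, s') = other_indices j in
      wp \<sigma> [r, s] u * wp \<sigma> [r', s'] u - wp \<sigma> [r, s'] u * wp \<sigma> [r', s] u)"

definition T_fun :: "(complex ^ 3 \<Rightarrow> complex) \<Rightarrow> complex ^ 3 \<Rightarrow> complex" where
  "T_fun \<sigma> u = (wp \<sigma> [2, 2, 2] u)^2 - 4 * (wp \<sigma> [2, 2] u)^3 - Qfun \<sigma> 2 2 2 2 u * wp \<sigma> [2, 2] u"

lemma T_fun_eq:
  "T_fun \<sigma> u = 2 * (wp \<sigma> [2, 2] u)^3 + (wp \<sigma> [2, 2, 2] u)^2 - wp \<sigma> [2, 2] u * wp \<sigma> [2, 2, 2, 2] u"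
  by (simp add: T_fun_def Qfun_def power2_eq_square power3_eq_cube algebra_simps)


section \<open>The space of functions with poles of bounded order\<close>

definition holomorphic_on3 :: "(complex ^ 3 \<Rightarrow> complex) \<Rightarrow> (complex ^ 3) set \<Rightarrow> bool" where
  "holomorphic_on3 g U \<longleftrightarrow> open U \<and>
     (\<forall>u \<in> U. \<exists>a :: complex ^ 3. (g has_derivative (\<lambda>v. \<Sum>i\<in>UNIV. a $ i * v $ i)) (at u))"

text \<open>The function \<open>\<phi>\<close> is a local equation of the reduced divisor \<open>D\<close> on \<open>U\<close>: it vanishes
  exactly on \<open>D\<close>, to order one at a dense set of points of \<open>D\<close>.\<close>

definition local_equation ::
  "(complex ^ 3) set \<Rightarrow> (complex ^ 3) set \<Rightarrow> (complex ^ 3 \<Rightarrow> complex) \<Rightarrow> bool" where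
  "local_equation D U \<phi> \<longleftrightarrow> holomorphic_on3 \<phi> U \<and> {u \<in> U. \<phi> u = 0} = D \<inter> U \<and>
     D \<inter> U \<subseteq> closure {u \<in> D \<inter> U. \<not> (\<phi> has_derivative (\<lambda>_. 0)) (at u)}"

text \<open>A meromorphic function with poles only along \<open>D\<close> is determined by its restriction to the
  complement of \<open>D\<close>. It is represented by the total function that extends
  this restriction by \<open>0\<close> on \<open>D\<close>, also where it has a removable singularity there.\<close>

definition off :: "(complex ^ 3) set \<Rightarrow> (complex ^ 3 \<Rightarrow> complex) \<Rightarrow> complex ^ 3 \<Rightarrow> complex" where
  "off D g = (\<lambda>u. if u \<in> D then 0 else g u)"

definition meromorphic_poles_le ::
  "(complex ^ 3) set \<Rightarrow> nat \<Rightarrow> (complex ^ 3 \<Rightarrow> complex) \<Rightarrow> bool" where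
  "meromorphic_poles_le D m g \<longleftrightarrow> holomorphic_on3 g (- D) \<and>
     (\<forall>p \<in> D. \<exists>U \<phi> h. p \<in> U \<and> local_equation D U \<phi> \<and> holomorphic_on3 h U \<and>
        (\<forall>u \<in> U - D. g u * (\<phi> u)^m = h u))"

definition Gamma_space :: "(nat \<Rightarrow> complex) \<Rightarrow> nat \<Rightarrow> (complex ^ 3 \<Rightarrow> complex) set" where
  "Gamma_space \<mu> m =
     {g. meromorphic_poles_le (theta_preimage \<mu>) m g \<and> off (theta_preimage \<mu>) g = g \<and>
         (\<forall>u. \<forall>l \<in> period_lattice \<mu>. g (u + l) = g u)}"

definition fun_scale :: "complex \<Rightarrow> ('a \<Rightarrow> complex) \<Rightarrow> 'a \<Rightarrow> complex" where
  "fun_scale c g = (\<lambda>u. c * g u)"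

interpretation fun_space: vector_space fun_scale
  by unfold_locales (auto simp: fun_scale_def plus_fun_def algebra_simps)

definition is_basis :: "('a \<Rightarrow> complex) list \<Rightarrow> ('a \<Rightarrow> complex) set \<Rightarrow> bool" where
  "is_basis bs V \<longleftrightarrow>
     distinct bs \<and> fun_space.independent (set bs) \<and> fun_space.span (set bs) = V"

end

theory Submission
 imports Defs "HOL-Complex_Analysis.Complex_Analysis"
begin

text \<open>Write \<open>\<sigma> u = c exp (1/2 u M u) \<theta> (N u)\<close>. Multiplication by \<open>\<sigma>\<^sup>m\<close> identifies the functions with poles
 of order at most \<open>m\<close> along the zero set \<open>D\<close> of \<open>\<sigma>\<close>, periodic under the quasi-periods of \<open>\<sigma>\<close>, with
 entire functions having the multipliers of \<open>\<sigma>\<^sup>m\<close>; counting Fourier coefficients, these form a space of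
 dimension at most \<open>m\<^sup>3\<close>. The vanishing of \<open>\<theta>\<close> exactly on \<open>\<kappa>\<^sup>-\<^sup>1(W\<^sup>[\<^sup>2\<^sup>])\<close> is the only link to the curve, and
 everything else about \<open>\<sigma>\<close> follows from it. By analytic continuation along the curve it suffices to know
 \<open>D\<close> near the sums \<open>A s + A t\<close> of Abel images of points close to infinity, where \<open>x = 1/s\<^sup>2\<close>, \<open>y = 1/t\<^sup>2\<close>
 are the \<open>x\<close>-coordinates and the gradient of \<open>\<sigma>\<close> is proportional to \<open>(x y, - x - y, 1)\<close>. This gives that \<open>\<sigma>\<close> vanishes to
 first order, that its quasi-periods are exactly the periods, that its expansion at the origin starts with
 a nonzero multiple of \<open>u\<^sub>1 u\<^sub>3 - u\<^sub>2\<^sup>2\<close>, and that \<open>\<Delta>\<close> has a pole of order two only. The 27 functions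
 times \<open>\<sigma>\<^sup>3\<close> are then independent by their lowest-order terms at the origin, and 27 is the largest possible
 dimension.\<close>

section \<open>Holomorphic functions of three variables\<close>

text \<open>Two lattices have to be matched: the Fourier count uses the quasi-periods of theta, the
  space uses integrals over loops. For a loop period the ratio of \<open>\<sigma>\<close> and its
  translate is, up to a Gaussian factor, a theta function of order zero, and its multipliers force
  the period into the theta lattice; the converse uses the Gauss map of D. \<open>infsum\<close> is
  0 for a family that is not summable and \<open>matrix_inv\<close> is a choice, so the analytic
  facts about theta are drawn from one point outside D. It exists because D is a countable union of
  images of real dimension four in real dimension six. The series is nonzero there, hence summable,
  and this makes the imaginary part of the symmetrized \<tau> positive; N is invertible because no
  line direction leaves D invariant. Extension across a divisor is done by averaging over circles in
  parallel lines; the obstacle is to find lines that meet the divisor in simple zeros only. All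
  leading terms at the origin carry the factor \<open>\<kappa>^3\<close>, where
  \<open>\<kappa>\<close> is the coefficient of u1 u3 - u2^2 in \<open>\<sigma>\<close>.\<close>

no_notation fps_nth (infixl "$" 75)

abbreviation "hol3 == holomorphic_on3"
abbreviation "entire F == hol3 F UNIV"

lemma has_derivative_vec_componentwise:
 fixes f :: "'a::real_normed_vector => ('b::real_normed_vector)^'n"
 assumes "!!i. ((%x. f x $ i) has_derivative (%h. f' h $ i)) (at x within S)"
 shows "(f has_derivative f') (at x within S)"
proof -
 have bl: "bounded_linear (axis i :: 'b => 'b^'n)" for i :: 'n
 proof (rule bounded_linear_intro[where K=1])
  show "axis i (x + y) = axis i x + (axis i y :: 'b^'n)" for x y
   by (simp add: vec_eq_iff axis_def)
  show "axis i (r *\<^sub>R x) = r *\<^sub>R (axis i x :: 'b^'n)" for r x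
   by (simp add: vec_eq_iff axis_def)
  show "norm (axis i x :: 'b^'n) <= norm x * 1" for x
  proof -
   have "norm (axis i x :: 'b^'n) <= (\<Sum>j\<in>UNIV. norm ((axis i x :: 'b^'n) $ j))"
    unfolding norm_vec_def by (rule L2_set_le_sum) auto
   also have "\<dots> = (\<Sum>j\<in>UNIV. if j = i then norm x else 0)"
    by (rule sum.cong) (auto simp: axis_def)
   finally show ?thesis by simp
  qed
 qed
 have eq: "(\<Sum>i\<in>UNIV. axis i (v $ i)) = (v :: 'b^'n)" for v
  by (simp add: vec_eq_iff axis_def if_distrib cong: if_cong)
 have "((%x. \<Sum>i\<in>UNIV. axis i (f x $ i)) has_derivative (%h. \<Sum>i\<in>UNIV. axis i (f' h $ i))) (at x within S)"
  by (intro has_derivative_sum bounded_linear.has_derivative[OF bl] assms)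
 thus ?thesis by (simp add: eq)
qed

lemma has_field_derivative_chain3:
 fixes g :: "complex^3 => complex"
 assumes g: "(g has_derivative (%v. \<Sum>i\<in>UNIV. a $ i * v $ i)) (at (c t))"
  and c: "!!i. ((%s. c s $ i) has_field_derivative c' $ i) (at t within S)"
 shows "((%s. g (c s)) has_field_derivative (\<Sum>i\<in>UNIV. a $ i * c' $ i)) (at t within S)"
proof -
 have "(c has_derivative (%h. h *s c')) (at t within S)"
  by (rule has_derivative_vec_componentwise)
    (use c in \<open>simp add: has_field_derivative_def mult_commute_abs\<close>)
 from has_derivative_compose[OF this g]
 have "((%s. g (c s)) has_derivative (%h. \<Sum>i\<in>UNIV. a $ i * (h *s c') $ i)) (at t within S)" .
 moreover have "(%h. \<Sum>i\<in>UNIV. a $ i * (h *s c') $ i) = (*) (\<Sum>i\<in>UNIV. a $ i * c' $ i)"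
  by (auto simp: fun_eq_iff sum_distrib_left mult_ac)
 ultimately show ?thesis by (simp add: has_field_derivative_def)
qed

lemma partial_eqI:
 assumes "(g has_derivative (%v. \<Sum>i\<in>UNIV. a $ i * v $ i)) (at u)"
 shows "partial j g u = a $ j"
proof -
 have "DERIV (%t. g (u + axis j t)) 0 :> (\<Sum>i\<in>UNIV. a $ i * axis j 1 $ i)"
  by (rule has_field_derivative_chain3)
    (use assms in \<open>auto simp: axis_def intro!: derivative_eq_intros simp flip: zero_vec_def\<close>)
 moreover have "(\<Sum>i\<in>UNIV. a $ i * axis j 1 $ i) = (\<Sum>i\<in>UNIV. if i = j then a $ j else 0)"
  by (rule sum.cong) (auto simp: axis_def)
 ultimately show ?thesis unfolding partial_def by (auto intro: DERIV_imp_deriv)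
qed

lemma hol3_derivative:
 assumes "hol3 g U" "u \<in> U"
 shows "(g has_derivative (%v. \<Sum>i\<in>UNIV. partial i g u * v $ i)) (at u)"
proof -
 obtain a :: "complex^3" where a: "(g has_derivative (%v. \<Sum>i\<in>UNIV. a $ i * v $ i)) (at u)"
  using assms unfolding holomorphic_on3_def by blast
 show ?thesis using a by (simp add: partial_eqI[OF a])
qed

lemma hol3I:
 assumes "open U" "!!u. u \<in> U ==> (g has_derivative (%v. \<Sum>i\<in>UNIV. a u i * v $ i)) (at u)"
 shows "hol3 g U"
 unfolding holomorphic_on3_def
proof (intro conjI ballI assms(1))
 fix u assume "u \<in> U"
 from assms(2)[OF this] show "\<exists>b::complex^3. (g has_derivative (%v. \<Sum>i\<in>UNIV. b $ i * v $ i)) (at u)"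
  by (intro exI[of _ "\<chi> i. a u i"]) simp
qed

lemma hol3_chain:
 assumes "hol3 g U" "c t \<in> U"
  and "!!i. ((%s. c s $ i) has_field_derivative c' i) (at t within S)"
 shows "((%s. g (c s)) has_field_derivative (\<Sum>i\<in>UNIV. partial i g (c t) * c' i)) (at t within S)"
 using has_field_derivative_chain3[of g "\<chi> i. partial i g (c t)" c t "\<chi> i. c' i" S]
  hol3_derivative[OF assms(1,2)] assms(3) by simp

lemma hol3_continuous: "hol3 g U ==> continuous_on U g"
 by (meson continuous_at_imp_continuous_on has_derivative_continuous hol3_derivative)

lemma hol3_open: "hol3 g U ==> open U"
 by (simp add: holomorphic_on3_def)

lemma hol3_subset: "hol3 g U ==> V <= U ==> open V ==> hol3 g V"
 by (auto simp: holomorphic_on3_def)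

lemma hol3_cong:
 assumes "hol3 f U" "!!u. u \<in> U ==> f u = g u"
 shows "hol3 g U"
proof (rule hol3I[OF hol3_open[OF assms(1)]])
 fix u assume u: "u \<in> U"
 show "(g has_derivative (%v. \<Sum>i\<in>UNIV. partial i f u * v $ i)) (at u)"
  by (rule has_derivative_transform_within_open[OF hol3_derivative[OF assms(1) u] hol3_open[OF assms(1)] u])
    (rule assms(2))
qed

lemma hol3_partial:
 assumes "hol3 g U" "u \<in> U"
 shows "DERIV (%t. g (u + axis i t)) 0 :> partial i g u"
proof -
 have "DERIV (%t. g (u + axis i t)) 0 :> (\<Sum>j\<in>UNIV. partial j g (u + axis i 0) * axis i 1 $ j)"
  by (rule hol3_chain[OF assms(1)])
    (use assms in \<open>auto simp: axis_def intro!: derivative_eq_intros simp flip: zero_vec_def\<close>)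
 moreover have "(\<Sum>j\<in>UNIV. partial j g (u + axis i 0) * axis i 1 $ j) = (\<Sum>j\<in>UNIV. if j = i then partial i g u else 0)"
  by (rule sum.cong) (auto simp: axis_def simp flip: zero_vec_def)
 ultimately show ?thesis by simp
qed

lemma partial_eqI': "DERIV (%t. g (u + axis i t)) 0 :> d ==> partial i g u = d"
 unfolding partial_def by (rule DERIV_imp_deriv)

lemma hol3_const [simp]: "open U ==> hol3 (%u. c) U"
 by (rule hol3I[where a="%_ _. 0"]) auto

lemma hol3_component: "open U ==> hol3 (%u. u $ i) U"
proof (rule hol3I[where a="%_ j. if j = i then 1 else 0"])
 fix u :: "complex^3"
 show "((%u. u $ i) has_derivative (%v. \<Sum>j\<in>UNIV. (if j = i then 1 else 0) * v $ j)) (at u)"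
  by (auto simp: if_distrib if_distribR cong: if_cong
     intro!: bounded_linear.has_derivative[OF bounded_linear_vec_nth] has_derivative_ident)
qed auto

lemma hol3_add:
 assumes "hol3 f U" "hol3 g U"
 shows "hol3 (%u. f u + g u) U"
 by (rule hol3I[OF hol3_open[OF assms(1)], where a="%u i. partial i f u + partial i g u"])
   (auto intro!: derivative_eq_intros hol3_derivative[OF assms(1)] hol3_derivative[OF assms(2)]
    simp: algebra_simps sum.distrib)

lemma hol3_mult:
 assumes "hol3 f U" "hol3 g U"
 shows "hol3 (%u. f u * g u) U"
 by (rule hol3I[OF hol3_open[OF assms(1)], where a="%u i. partial i f u * g u + f u * partial i g u"])
   (auto intro!: derivative_eq_intros hol3_derivative[OF assms(1)] hol3_derivative[OF assms(2)]
    simp: algebra_simps sum.distrib sum_distrib_left)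

lemma hol3_uminus:
 assumes "hol3 f U"
 shows "hol3 (%u. - f u) U"
 using hol3_mult[OF hol3_const[OF hol3_open[OF assms], of "-1"] assms] by simp

lemma hol3_diff:
 assumes "hol3 f U" "hol3 g U"
 shows "hol3 (%u. f u - g u) U"
 using hol3_add[OF assms(1) hol3_uminus[OF assms(2)]] by simp

lemma hol3_compose:
 assumes "hol3 g U" "!!u. u \<in> U ==> DERIV f (g u) :> f' u"
 shows "hol3 (%u. f (g u)) U"
proof (rule hol3I[OF hol3_open[OF assms(1)], where a="%u i. f' u * partial i g u"])
 fix u assume u: "u \<in> U"
 from has_derivative_compose[OF hol3_derivative[OF assms(1) u] assms(2)[OF u, unfolded has_field_derivative_def]]
 show "((%u. f (g u)) has_derivative (%v. \<Sum>i\<in>UNIV. f' u * partial i g u * v $ i)) (at u)"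
  by (simp add: sum_distrib_left mult.assoc)
qed

lemma hol3_inverse:
 assumes "hol3 g U" "!!u. u \<in> U ==> g u ~= 0"
 shows "hol3 (%u. inverse (g u)) U"
 by (rule hol3_compose[OF assms(1)]) (rule DERIV_inverse, use assms(2) in auto)

lemma hol3_divide:
 assumes "hol3 f U" "hol3 g U" "!!u. u \<in> U ==> g u ~= 0"
 shows "hol3 (%u. f u / g u) U"
 unfolding divide_inverse by (intro hol3_mult assms hol3_inverse)

lemma hol3_power: "hol3 f U ==> hol3 (%u. f u ^ n) U"
 by (induction n) (auto intro: hol3_mult dest: hol3_open)

lemma hol3_sum:
 assumes "open U" "!!i. i \<in> I ==> hol3 (f i) U"
 shows "hol3 (%u. \<Sum>i\<in>I. f i u) U"
 using assms(2) by (induction I rule: infinite_finite_induct) (auto intro: hol3_add simp: assms(1))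

lemma hol3_exp: "hol3 f U ==> hol3 (%u. exp (f u)) U"
 by (rule hol3_compose) (auto intro: DERIV_exp)

lemma hol3_affine:
 assumes "hol3 g U" "open V" "!!v. v \<in> V ==> N *v v + w \<in> U"
 shows "hol3 (%v. g (N *v v + w)) V"
proof (rule hol3I[OF assms(2), where a="%v j. \<Sum>i\<in>UNIV. partial i g (N *v v + w) * N $ i $ j"])
 fix v assume v: "v \<in> V"
 have "((%v. N *v v + w) has_derivative (%h. N *v h)) (at v)"
  by (rule has_derivative_vec_componentwise)
    (auto simp: matrix_vector_mult_def intro!: derivative_eq_intros
     bounded_linear.has_derivative[OF bounded_linear_vec_nth])
 from has_derivative_compose[OF this hol3_derivative[OF assms(1) assms(3)[OF v]]]
 have "((%v. g (N *v v + w)) has_derivative (%h. \<Sum>i\<in>UNIV. partial i g (N *v v + w) * (N *v h) $ i)) (at v)" .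
 moreover have "(\<Sum>i\<in>UNIV. partial i g (N *v v + w) * (N *v h) $ i)
   = (\<Sum>j\<in>UNIV. (\<Sum>i\<in>UNIV. partial i g (N *v v + w) * N $ i $ j) * h $ j)" for h
  by (simp add: matrix_vector_mult_def sum_distrib_left sum_distrib_right mult.assoc) (rule sum.swap)
 ultimately show "((%v. g (N *v v + w)) has_derivative (%h. \<Sum>j\<in>UNIV. (\<Sum>i\<in>UNIV. partial i g (N *v v + w) * N $ i $ j) * h $ j)) (at v)"
  by simp
qed

lemma hol3_translate:
 assumes "hol3 g U" "open V" "!!v. v \<in> V ==> v + w \<in> U"
 shows "hol3 (%v. g (v + w)) V"
 using hol3_affine[OF assms(1,2), of "mat 1" w] assms(3) by (simp add: matrix_vector_mul_lid)

lemma continuous_on_axis [continuous_intros]: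
 fixes f :: "'a::topological_space => complex"
 assumes "continuous_on S f"
 shows "continuous_on S (%x. axis i (f x) :: complex^3)"
proof -
 have "continuous_on S (%x. if j = i then f x else 0)" for j
  using assms by (cases "j = i") auto
 thus ?thesis unfolding axis_def by (rule continuous_on_vec_lambda)
qed

lemma axis_zero [simp]: "axis i 0 = (0 :: complex^3)"
 by (simp add: axis_def vec_eq_iff)

lemma axis_add: "axis i (s + t) = axis i s + (axis i t :: complex^3)"
 by (simp add: axis_def vec_eq_iff)

lemma norm_axis_le [simp]: "norm (axis i t :: complex^3) = norm t"
proof (rule antisym)
 have "norm (axis i t :: complex^3) <= (\<Sum>j\<in>UNIV. norm ((axis i t :: complex^3) $ j))"
  unfolding norm_vec_def by (rule L2_set_le_sum) auto
 also have "\<dots> = (\<Sum>j\<in>UNIV. if j = i then norm t else 0)"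
  by (rule sum.cong) (auto simp: axis_def)
 finally show "norm (axis i t :: complex^3) <= norm t" by simp
 show "norm t <= norm (axis i t :: complex^3)"
  using Finite_Cartesian_Product.norm_nth_le[of "axis i t :: complex^3" i] by (simp add: axis_def)
qed

text \<open>The increment is split into three moves parallel to the axes; on each, the mean value
  inequality for \<open>f\<close> minus its linear part costs at most \<open>e / 3\<close> times the
  length of the move.\<close>

lemma has_derivative_from_continuous_partials:
 fixes f :: "complex^3 => complex"
 assumes U: "open U" "u \<in> U"
  and d: "!!v i. v \<in> U ==> DERIV (%t. f (v + axis i t)) 0 :> p i v"
  and c: "!!i. continuous_on U (p i)"
 shows "(f has_derivative (%v. \<Sum>i\<in>UNIV. p i u * v $ i)) (at u)"
proof (subst has_derivative_at_alt, intro conjI allI impI)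
 show "bounded_linear (%v. \<Sum>i\<in>UNIV. p i u * v $ i)"
  by (intro bounded_linear_sum bounded_linear_const_mult bounded_linear_vec_nth)
 fix e :: real assume e: "e > 0"
 obtain r where r: "r > 0" "ball u r <= U" using U open_contains_ball by blast
 have "\<exists>d>0. \<forall>i. \<forall>v. dist v u < d --> v \<in> U & norm (p i v - p i u) <= e / 3"
 proof -
  have "\<exists>d>0. \<forall>v. dist v u < d --> norm (p i v - p i u) <= e / 3" for i
  proof -
   have "isCont (p i) u" using c[of i] U continuous_on_eq_continuous_at by blast
   then obtain d where "d > 0" "!!v. dist v u < d ==> dist (p i v) (p i u) < e / 3"
    unfolding continuous_at_eps_delta using e by (metis divide_pos_pos zero_less_numeral)
   thus ?thesis by (auto simp: dist_norm intro!: exI[of _ d] less_imp_le)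
  qed
  then obtain dd where dd: "!!i. dd i > 0" "!!i v. dist v u < dd i ==> norm (p i v - p i u) <= e / 3"
   by metis
  let ?d = "min r (Min (range dd))"
  have "?d > 0" using dd r by (auto simp: Min_gr_iff)
  moreover have "dist v u < ?d ==> v \<in> U & norm (p i v - p i u) <= e / 3" for i v
   using r dd(2)[of v i] by (auto simp: Min_gr_iff dist_commute)
  ultimately show ?thesis by blast
 qed
 then obtain d0 where d0: "d0 > 0" "!!i v. dist v u < d0 ==> v \<in> U"
   "!!i v. dist v u < d0 ==> norm (p i v - p i u) <= e / 3" by blast
 have step: "norm (f (v + axis i t) - f v - p i u * t) <= e / 3 * norm t"
  if v: "!!s. norm s <= norm t ==> dist (v + axis i s) u < d0" for v i t
 proof -
  let ?g = "%s. f (v + axis i s) - p i u * s"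
  have "norm (?g t - ?g 0) <= e / 3 * norm (t - 0)"
  proof (rule field_differentiable_bound[where S="cball 0 (norm t)" and f'="%s. p i (v + axis i s) - p i u"])
   fix s :: complex assume s: "s \<in> cball 0 (norm t)"
   hence s': "dist (v + axis i s) u < d0" using v by simp
   have "DERIV (%t. f ((v + axis i s) + axis i t)) 0 :> p i (v + axis i s)"
    by (rule d) (use s' d0 in auto)
   hence "DERIV (%t. f (v + axis i (t + s))) 0 :> p i (v + axis i s)"
    by (simp add: axis_add add_ac)
   hence "DERIV (%t. f (v + axis i t)) s :> p i (v + axis i s)"
    using DERIV_shift[of "%t. f (v + axis i t)" "p i (v + axis i s)" 0 s] by simp
   hence "DERIV (?g) s :> p i (v + axis i s) - p i u"
    by (auto intro!: derivative_eq_intros)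
   thus "(?g has_field_derivative p i (v + axis i s) - p i u) (at s within cball 0 (norm t))"
    by (rule has_field_derivative_at_within)
   show "norm (p i (v + axis i s) - p i u) <= e / 3" using d0(3)[OF s'] .
  qed auto
  thus ?thesis by (simp add: algebra_simps)
 qed
 show "\<exists>d>0. \<forall>y. norm (y - u) < d -->
   norm (f y - f u - (\<Sum>i\<in>UNIV. p i u * (y - u) $ i)) <= e * norm (y - u)"
 \<comment> \<open>A third of the radius, so that the intermediate points of the three moves stay
   within \<open>d0\<close> of \<open>u\<close>.\<close>
 proof (intro exI[of _ "d0/3"] conjI allI impI)
  show "d0 / 3 > 0" using d0 by simp
  fix y assume y: "norm (y - u) < d0 / 3"
  define h where "h = y - u"
  have hi: "norm (h $ i) <= norm h" for i by (rule Finite_Cartesian_Product.norm_nth_le)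
  have h: "norm h < d0 / 3" using y by (simp add: h_def)
  define a where "a = u + axis 1 (h $ 1)"
  define b where "b = a + axis 2 (h $ 2)"
  have yb: "y = b + axis 3 (h $ 3)"
   by (auto simp: a_def b_def h_def vec_eq_iff axis_def forall_3)
  have tri: "norm (axis 1 x + axis 2 y + axis 3 z :: complex^3) < d0"
   if "norm x <= norm h" "norm y <= norm h" "norm z <= norm h" for x y z
  proof -
   have "norm (axis 1 x + axis 2 y + axis 3 z :: complex^3) <= norm x + norm y + norm z"
    by (metis (no_types, opaque_lifting) norm_axis_le norm_triangle_mono order_refl)
   thus ?thesis using that h by linarith
  qed
  have A: "norm (f a - f u - p 1 u * h $ 1) <= e / 3 * norm (h $ 1)" unfolding a_def
  proof (rule step)
   fix s :: complex assume "norm s <= norm (h $ 1)"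
   hence "norm s < d0" using hi[of 1] h norm_ge_zero[of h] by linarith
   thus "dist (u + axis 1 s) u < d0" by (simp add: dist_norm)
  qed
  have B: "norm (f b - f a - p 2 u * h $ 2) <= e / 3 * norm (h $ 2)" unfolding b_def
  proof (rule step)
   fix s :: complex assume "norm s <= norm (h $ 2)"
   thus "dist (a + axis 2 s) u < d0" using tri[of "h $ 1" s 0] hi[of 1] hi[of 2]
    by (simp add: dist_norm a_def)
  qed
  have C: "norm (f y - f b - p 3 u * h $ 3) <= e / 3 * norm (h $ 3)" unfolding yb
  proof (rule step)
   fix s :: complex assume "norm s <= norm (h $ 3)"
   thus "dist (b + axis 3 s) u < d0" using tri[of "h $ 1" "h $ 2" s] hi order_trans[OF _ hi[of 3], of "norm s"]
    by (simp add: dist_norm a_def b_def add.assoc)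
  qed
  have "f y - f u - (\<Sum>i\<in>UNIV. p i u * h $ i) =
    (f a - f u - p 1 u * h $ 1) + (f b - f a - p 2 u * h $ 2) + (f y - f b - p 3 u * h $ 3)"
   by (simp add: sum_3)
  also have "norm \<dots> <= e / 3 * norm (h $ 1) + e / 3 * norm (h $ 2) + e / 3 * norm (h $ 3)"
   by (intro norm_triangle_mono A B C)
  also have "\<dots> <= e / 3 * norm h + e / 3 * norm h + e / 3 * norm h"
   by (intro add_mono mult_left_mono hi) (use e in auto)
  finally show "norm (f y - f u - (\<Sum>i\<in>UNIV. p i u * (y - u) $ i)) <= e * norm (y - u)"
   by (simp add: h_def)
 qed
qed

section \<open>Circle averages and Osgood's lemma\<close>

definition unit_circ :: "real => complex" where
 "unit_circ s = exp (2 * of_real pi * \<i> * of_real s)"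

lemma norm_unit_circ [simp]: "norm (unit_circ s) = 1"
 by (simp add: unit_circ_def norm_exp_eq_Re)

lemma unit_circ_nz [simp]: "unit_circ s ~= 0"
 by (simp add: unit_circ_def)

lemma continuous_unit_circ [continuous_intros]: "continuous_on S unit_circ"
 unfolding unit_circ_def by (intro continuous_intros)

lemma circlepath_eq: "circlepath z r s = z + of_real r * unit_circ s"
 by (simp add: circlepath unit_circ_def)

lemma contour_integral_circlepath_eq:
 "contour_integral (circlepath z r) g =
   2 * of_real pi * \<i> * integral {0..1} (%s. g (z + of_real r * unit_circ s) * (of_real r * unit_circ s))"
proof -
 have "contour_integral (circlepath z r) g =
   integral {0..1} (%s. g (circlepath z r s) * vector_derivative (circlepath z r) (at s))"
  by (rule contour_integral_integral)
 also have "\<dots> = integral {0..1} (%s. 2 * of_real pi * \<i> * (g (z + of_real r * unit_circ s) * (of_real r * unit_circ s)))"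
  by (rule arg_cong[where f="integral _"])
    (auto simp: fun_eq_iff circlepath_eq vector_derivative_circlepath unit_circ_def mult_ac)
 finally show ?thesis by simp
qed

lemma circle_mean_value:
 assumes "continuous_on (cball z r) f" "f holomorphic_on ball z r" "r > 0"
 shows "integral {0..1} (%s. f (z + of_real r * unit_circ s)) = f z"
proof -
 have "contour_integral (circlepath z r) (%u. f u / (u - z)) = 2 * of_real pi * \<i> * f z"
  by (rule contour_integral_unique[OF Cauchy_integral_circlepath[OF assms(1,2)]]) (use assms in auto)
 thus ?thesis using assms(3) by (simp add: contour_integral_circlepath_eq)
qed

lemma circle_mean_derivative:
 assumes "continuous_on (cball z r) f" "f holomorphic_on ball z r" "r > 0"
 shows "deriv f z = integral {0..1} (%s. f (z + of_real r * unit_circ s) * (inverse (of_real r * unit_circ s)))"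
proof -
 have "contour_integral (circlepath z r) (%u. f u / (u - z)^2) = 2 * of_real pi * \<i> * deriv f z"
  using Cauchy_contour_integral_circlepath_2[OF assms(1,2), of z] assms(3) by simp
 thus ?thesis using assms(3)
  by (simp add: contour_integral_circlepath_eq power2_eq_square field_simps)
qed

lemma line_axis_derivative:
 assumes "hol3 f U" "u + axis i t \<in> U"
 shows "DERIV (%t. f (u + axis i t)) t :> partial i f (u + axis i t)"
proof -
 have "DERIV (%s. f ((u + axis i t) + axis i s)) 0 :> partial i f (u + axis i t)"
  by (rule hol3_partial[OF assms])
 hence "DERIV (%s. f (u + axis i (s + t))) 0 :> partial i f (u + axis i t)"
  by (simp add: axis_add add_ac)
 thus ?thesis
  using DERIV_shift[of "%t. f (u + axis i t)" "partial i f (u + axis i t)" 0 t] by simp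
qed

text \<open>Cauchy's formula for the derivative, applied to the one-variable slice through
  \<open>u\<close> in direction \<open>i\<close>.\<close>

lemma osgood_partial_formula:
 assumes f: "continuous_on U f" and U: "open U"
  and d: "!!u i. u \<in> U ==> (%t. f (u + axis i t)) field_differentiable (at 0)"
  and r: "r > 0" "cball u r <= U"
 shows "partial i f u = integral {0..1} (%s. f (u + axis i (of_real r * unit_circ s)) * inverse (of_real r * unit_circ s))"
proof -
 have inU: "u + axis i t \<in> U" if "norm t <= r" for t
  using r that by (auto simp: subset_iff dist_norm)
 have "(%t. f (u + axis i t)) field_differentiable (at t)" if "norm t <= r" for t
 proof -
  have "(%s. f ((u + axis i t) + axis i s)) field_differentiable (at 0)"
   by (rule d[OF inU[OF that]])
  then obtain D where "DERIV (%s. f ((u + axis i t) + axis i s)) 0 :> D"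
   by (auto simp: field_differentiable_def)
  hence "DERIV (%s. f (u + axis i (s + t))) 0 :> D"
   by (simp add: axis_add add_ac)
  hence "DERIV (%t. f (u + axis i t)) t :> D"
   using DERIV_shift[of "%t. f (u + axis i t)" D 0 t] by simp
  thus ?thesis by (auto simp: field_differentiable_def)
 qed
 hence hol: "(%t. f (u + axis i t)) holomorphic_on cball 0 r"
  by (auto simp: holomorphic_on_def intro: field_differentiable_at_within)
 show ?thesis unfolding partial_def
  using circle_mean_derivative[of 0 r "%t. f (u + axis i t)"] r
   hol holomorphic_on_imp_continuous_on[OF hol] holomorphic_on_subset[OF hol ball_subset_cball]
  by simp
qed

lemma continuous_param_integral:
 fixes w :: "real => complex^3" and f :: "complex^3 => complex" and k :: "real => complex"
 assumes f: "continuous_on V f" and w: "continuous_on {0..1} w" and k: "continuous_on {0..1} k"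
  and sub: "!!u s. u \<in> U ==> s \<in> {0..1} ==> u + w s \<in> V"
 shows "continuous_on U (%u. integral {0..1} (%s. f (u + w s) * k s))"
proof -
 have 1: "continuous_on (U \<times> cbox 0 1) (%p. w (snd p))"
  by (rule continuous_on_compose2[OF w]) (auto intro: continuous_intros)
 have 2: "continuous_on (U \<times> cbox 0 1) (%p. k (snd p))"
  by (rule continuous_on_compose2[OF k]) (auto intro: continuous_intros)
 have "continuous_on (U \<times> cbox 0 1) (%p. f (fst p + w (snd p)))"
  by (rule continuous_on_compose2[OF f]) (use sub 1 in \<open>auto intro!: continuous_intros simp: cbox_interval\<close>)
 hence "continuous_on (U \<times> cbox 0 1) (%(u, s). f (u + w s) * k s)"
  unfolding case_prod_unfold by (intro continuous_on_mult 2)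
 from integral_continuous_on_param[OF this] show ?thesis by (simp add: cbox_interval)
qed

text \<open>In Cauchy's formula the derivative is an integral of \<open>f\<close> over a circle of
  fixed radius around the moving point, and so inherits joint continuity from \<open>f\<close>.
  Halving the radius keeps these circles inside \<open>U\<close>.\<close>

lemma osgood_partial_continuous:
 assumes f: "continuous_on U f" and U: "open U"
  and d: "!!u i. u \<in> U ==> (%t. f (u + axis i t)) field_differentiable (at 0)"
 shows "continuous_on U (partial i f)"
proof -
 have "isCont (partial i f) u" if u: "u \<in> U" for u
 proof -
  obtain r where r: "r > 0" "cball u r <= U" using U u open_contains_cball by blast
  let ?B = "ball u (r/2)"
  have sub: "cball v (r/2) <= U" if "v \<in> ?B" for v
  proof
   fix x assume "x \<in> cball v (r/2)"
   hence "dist u x <= r" using that dist_triangle[of u x v] by (auto simp: dist_commute)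
   thus "x \<in> U" using r by auto
  qed
  have "continuous_on ?B (%v. integral {0..1} (%s. f (v + axis i (of_real (r/2) * unit_circ s)) * inverse (of_real (r/2) * unit_circ s)))"
  proof (rule continuous_param_integral[OF f])
   show "v + axis i (of_real (r/2) * unit_circ s) \<in> U" if "v \<in> ?B" for v s
    using sub[OF that] r by (auto simp: subset_iff dist_norm norm_mult)
  qed (use r in \<open>auto intro!: continuous_intros\<close>)
  moreover have "partial i f v = integral {0..1} (%s. f (v + axis i (of_real (r/2) * unit_circ s)) * inverse (of_real (r/2) * unit_circ s))" if "v \<in> ?B" for v
   by (rule osgood_partial_formula[OF f U d]) (use r sub[OF that] in auto)
  ultimately have "continuous_on ?B (partial i f)" by (metis (no_types, lifting) continuous_on_eq)
  thus ?thesis using r by (simp add: continuous_on_eq_continuous_at)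
 qed
 thus ?thesis by (simp add: continuous_at_imp_continuous_on)
qed

text \<open>Cauchy's formula on slices makes the partial derivatives continuous, and continuous
  partial derivatives give total differentiability. The holomorphy of parameter integrals and of the
  theta series is deduced from this criterion.\<close>

lemma osgood:
 assumes f: "continuous_on U f" and U: "open U"
  and d: "!!u i. u \<in> U ==> (%t. f (u + axis i t)) field_differentiable (at 0)"
 shows "hol3 f U"
proof (rule hol3I[OF U])
 fix u assume u: "u \<in> U"
 show "(f has_derivative (%v. \<Sum>i\<in>UNIV. partial i f u * v $ i)) (at u)"
  by (rule has_derivative_from_continuous_partials[OF U u])
    (use osgood_partial_continuous[OF f U d] d in
     \<open>auto simp: partial_def field_differentiable_derivI\<close>)
qed

lemma hol3_partial_continuous:
 assumes "hol3 f U"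
 shows "continuous_on U (partial i f)"
 by (rule osgood_partial_continuous[OF hol3_continuous[OF assms] hol3_open[OF assms]])
   (use hol3_partial[OF assms] in \<open>auto simp: field_differentiable_def\<close>)

lemma param_integral_axis_derivative:
 fixes w :: "real => complex^3"
 assumes f: "hol3 f V" and U: "open U"
  and w: "continuous_on {0..1} w" and k: "continuous_on {0..1} k"
  and sub: "!!u s. u \<in> U ==> s \<in> {0..1} ==> u + w s \<in> V" and u: "u \<in> U"
 shows "((%t. integral {0..1} (%s. f (u + axis i t + w s) * k s)) has_field_derivative
      integral {0..1} (%s. partial i f (u + w s) * k s)) (at 0)"
proof -
 obtain r where r: "r > 0" "ball u r <= U" using U u open_contains_ball by blast
 have inU: "u + axis i t \<in> U" if "t \<in> ball 0 r" for t
  using r that by (auto simp: subset_iff dist_norm)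
 have "((%t. integral (cbox 0 1) (%s. f (u + axis i t + w s) * k s)) has_field_derivative
      integral (cbox 0 1) (%s. partial i f (u + axis i 0 + w s) * k s)) (at 0 within ball 0 r)"
 proof (rule leibniz_rule_field_derivative)
  fix t :: complex and s :: real assume ts: "t \<in> ball 0 r" "s \<in> cbox 0 1"
  have eq: "u + axis i t + w s = (u + w s) + axis i t" for t by simp
  have "DERIV (%t. f ((u + w s) + axis i t)) t :> partial i f ((u + w s) + axis i t)"
   by (rule line_axis_derivative[OF f]) (use sub[OF inU[OF ts(1)], of s] ts eq in simp)
  hence "((%t. f ((u + w s) + axis i t)) has_field_derivative partial i f ((u + w s) + axis i t)) (at t within ball 0 r)"
   by (rule has_field_derivative_at_within)
  from DERIV_cmult_right[OF this, of "k s"]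
  show "((%t. f (u + axis i t + w s) * k s) has_field_derivative partial i f (u + axis i t + w s) * k s) (at t within ball 0 r)"
   by (simp only: eq)
 next
  fix t :: complex assume t: "t \<in> ball 0 r"
  have "continuous_on {0..1} (%s. f (u + axis i t + w s))"
   by (rule continuous_on_compose2[OF hol3_continuous[OF f]])
     (use sub[OF inU[OF t]] in \<open>auto intro!: continuous_intros w\<close>)
  hence "continuous_on {0..1} (%s. f (u + axis i t + w s) * k s)"
   by (intro continuous_on_mult k)
  thus "(%s. f (u + axis i t + w s) * k s) integrable_on cbox 0 1"
   by (metis integrable_continuous cbox_interval)
 next
  have 1: "continuous_on (ball (0::complex) r \<times> cbox 0 1) (%p. w (snd p))"
   by (rule continuous_on_compose2[OF w]) (auto intro: continuous_intros)
  have 2: "continuous_on (ball (0::complex) r \<times> cbox 0 1) (%p. k (snd p))"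
   by (rule continuous_on_compose2[OF k]) (auto intro: continuous_intros)
  have "continuous_on (ball 0 r \<times> cbox 0 1) (%p. partial i f (u + axis i (fst p) + w (snd p)))"
   by (rule continuous_on_compose2[OF hol3_partial_continuous[OF f]])
     (use sub inU 1 in \<open>auto intro!: continuous_intros simp: cbox_interval\<close>)
  thus "continuous_on (ball 0 r \<times> cbox 0 1) (%(t, s). partial i f (u + axis i t + w s) * k s)"
   unfolding case_prod_unfold by (intro continuous_on_mult 2)
 qed (use r in auto)
 moreover have "at (0::complex) within ball 0 r = at 0" by (rule at_within_open) (use r in auto)
 ultimately show ?thesis by (simp add: cbox_interval)
qed

text \<open>Only integrands of the form \<open>f (u + w s) * k s\<close> are treated: circle
  averages, zero counts and means over a period all have this shape.\<close>

lemma hol3_param_integral: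
 fixes w :: "real => complex^3"
 assumes f: "hol3 f V" and U: "open U"
  and w: "continuous_on {0..1} w" and k: "continuous_on {0..1} k"
  and sub: "!!u s. u \<in> U ==> s \<in> {0..1} ==> u + w s \<in> V"
 shows "hol3 (%u. integral {0..1} (%s. f (u + w s) * k s)) U"
  and "u \<in> U ==> partial i (%u. integral {0..1} (%s. f (u + w s) * k s)) u
      = integral {0..1} (%s. partial i f (u + w s) * k s)"
proof -
 show "hol3 (%u. integral {0..1} (%s. f (u + w s) * k s)) U"
  by (rule osgood[OF continuous_param_integral[OF hol3_continuous[OF f] w k sub] U])
    (use param_integral_axis_derivative[OF assms] in \<open>auto simp: field_differentiable_def\<close>)
 show "u \<in> U ==> partial i (%u. integral {0..1} (%s. f (u + w s) * k s)) u
      = integral {0..1} (%s. partial i f (u + w s) * k s)"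
  using partial_eqI'[OF param_integral_axis_derivative[OF assms]] .
qed

text \<open>One radius serves all centres \<open>v\<close> near \<open>u\<close> and all
  \<open>f\<close>, so that near \<open>u\<close> the operator \<open>partial i\<close> is a
  parameter integral. Holomorphy of derivatives and their symmetry then follow by differentiating
  under the integral sign.\<close>

lemma hol3_partial_integral_local:
 assumes U: "open U" and u: "u \<in> U"
 obtains r where "r > 0" "ball u r <= U"
  "!!v s. v \<in> ball u r ==> v + axis i (of_real r * unit_circ s) \<in> U"
  "!!f v. hol3 f U ==> v \<in> ball u r ==> partial i f v =
    integral {0..1} (%s. f (v + axis i (of_real r * unit_circ s)) * inverse (of_real r * unit_circ s))"
proof -
 obtain r where r: "r > 0" "cball u r <= U" using U u open_contains_cball by blast
 have sub: "cball v (r/2) <= U" if "v \<in> ball u (r/2)" for v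
 proof
  fix x assume "x \<in> cball v (r/2)"
  hence "dist u x <= r" using that dist_triangle[of u x v] by (auto simp: dist_commute)
  thus "x \<in> U" using r by auto
 qed
 have 1: "v + axis i (of_real (r/2) * unit_circ s) \<in> U" if "v \<in> ball u (r/2)" for v s
  using sub[OF that] r by (auto simp: subset_iff dist_norm norm_mult)
 have 2: "partial i f v = integral {0..1} (%s. f (v + axis i (of_real (r/2) * unit_circ s)) * inverse (of_real (r/2) * unit_circ s))"
  if f: "hol3 f U" and v: "v \<in> ball u (r/2)" for v f
 proof (rule osgood_partial_formula[OF hol3_continuous[OF f] U])
  show "(%t. f (u + axis i t)) field_differentiable at 0" if "u \<in> U" for u i
   using hol3_partial[OF f that] field_differentiable_def by blast
  show "cball v (r/2) <= U" using sub[OF v] .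
 qed (use r in auto)
 have "ball u (r/2) <= U" using r by auto
 with 1 2 r show ?thesis by (intro that[of "r/2"]) simp_all
qed

lemma hol3_locally:
 assumes "!!u. u \<in> U ==> \<exists>V. u \<in> V & hol3 f V" "open U"
 shows "hol3 f U"
 using assms unfolding holomorphic_on3_def by blast

lemma hol3_partial_hol3:
 assumes f: "hol3 f U"
 shows "hol3 (partial i f) U"
proof (rule hol3_locally[OF _ hol3_open[OF f]])
 fix u assume "u \<in> U"
 obtain r where r: "r > 0" "ball u r <= U"
  "!!v s. v \<in> ball u r ==> v + axis i (of_real r * unit_circ s) \<in> U"
  "!!g v. hol3 g U ==> v \<in> ball u r ==> partial i g v =
    integral {0..1} (%s. g (v + axis i (of_real r * unit_circ s)) * inverse (of_real r * unit_circ s))"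
  using hol3_partial_integral_local[OF hol3_open[OF f] \<open>u \<in> U\<close>, of i] by blast
 have "hol3 (%v. integral {0..1} (%s. f (v + axis i (of_real r * unit_circ s)) * inverse (of_real r * unit_circ s))) (ball u r)"
  by (rule hol3_param_integral[OF f]) (use r in \<open>auto intro!: continuous_intros\<close>)
 hence "hol3 (partial i f) (ball u r)"
  by (rule hol3_cong) (simp add: r(4)[OF f])
 thus "\<exists>V. u \<in> V & hol3 (partial i f) V" using r by (intro exI[of _ "ball u r"]) auto
qed

lemma partial_cong_open:
 assumes "open U" "u \<in> U" "!!v. v \<in> U ==> f v = g v"
 shows "partial i f u = partial i g u"
proof -
 obtain r where r: "r > 0" "ball u r <= U" using assms open_contains_ball by blast
 have "\<forall>\<^sub>F t in nhds (0::complex). t \<in> ball 0 r" using r by (intro eventually_nhds_in_open) auto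
 hence "\<forall>\<^sub>F t in nhds (0::complex). f (u + axis i t) = g (u + axis i t)"
  by eventually_elim (use r assms(3) in \<open>auto simp: subset_iff dist_norm\<close>)
 thus ?thesis unfolding partial_def by (rule deriv_cong_ev) simp
qed

lemma partial_commute:
 assumes f: "hol3 f U" and u: "u \<in> U"
 shows "partial i (partial j f) u = partial j (partial i f) u"
proof -
 obtain r where r: "r > 0" "ball u r <= U"
  "!!v s. v \<in> ball u r ==> v + axis j (of_real r * unit_circ s) \<in> U"
  "!!g v. hol3 g U ==> v \<in> ball u r ==> partial j g v =
    integral {0..1} (%s. g (v + axis j (of_real r * unit_circ s)) * inverse (of_real r * unit_circ s))"
  using hol3_partial_integral_local[OF hol3_open[OF f] u, of j] by blast
 have u': "u \<in> ball u r" using r by simp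
 have "partial i (partial j f) u =
   partial i (%v. integral {0..1} (%s. f (v + axis j (of_real r * unit_circ s)) * inverse (of_real r * unit_circ s))) u"
  by (rule partial_cong_open[OF open_ball u' r(4)[OF f]])
 also have "\<dots> = integral {0..1} (%s. partial i f (u + axis j (of_real r * unit_circ s)) * inverse (of_real r * unit_circ s))"
  by (rule hol3_param_integral(2)[OF f open_ball _ _ _ u'])
    (use r in \<open>auto intro!: continuous_intros\<close>)
 also have "\<dots> = partial j (partial i f) u"
  by (rule r(4)[OF hol3_partial_hol3[OF f] u', symmetric])
 finally show ?thesis .
qed

section \<open>Zeros along parallel lines\<close>

text \<open>The argument principle with the weights 1 and t.\<close>

lemma zero_count:
 fixes f :: "complex => complex"
 assumes f: "f holomorphic_on ball 0 R" and r: "0 < r" "r < R"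
  and nz: "!!t. norm t = r ==> f t ~= 0"
 defines "Z \<equiv> {t. norm t < r & f t = 0}"
 shows "finite Z"
  and "integral {0..1} (%s. deriv f (of_real r * unit_circ s) / f (of_real r * unit_circ s)
      * (of_real r * unit_circ s)) = (\<Sum>p\<in>Z. of_int (zorder f p))"
  and "integral {0..1} (%s. deriv f (of_real r * unit_circ s) / f (of_real r * unit_circ s)
      * (of_real r * unit_circ s)^2) = (\<Sum>p\<in>Z. p * of_int (zorder f p))"
  and "!!p. p \<in> Z ==> zorder f p >= 1"
  and "!!p. p \<in> Z ==> zorder f p = 1 \<longleftrightarrow> deriv f p ~= 0"
proof -
 \<comment> \<open>A disc strictly between the two given ones: \<open>f\<close> is still holomorphic
   on its closure, so the zeros there are finite in number, as the argument principle
   demands.\<close>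
 define R0 where "R0 = (r + R) / 2"
 have R0: "r < R0" "R0 < R" using r by (auto simp: R0_def field_simps)
 define S where "S = ball (0::complex) R0"
 have S: "open S" "connected S" by (auto simp: S_def)
 have fS: "f holomorphic_on S" by (rule holomorphic_on_subset[OF f]) (use R0 in \<open>auto simp: S_def\<close>)
 define pz where "pz = {w\<in>S. f w = 0}"
 have "finite {z\<in>cball 0 R0. f z = 0}"
 proof (cases "f constant_on ball 0 R")
  case True
  then obtain c where c: "!!z. z \<in> ball 0 R ==> f z = c" by (auto simp: constant_on_def)
  have "c ~= 0" using c[of "of_real r"] nz[of "of_real r"] r by auto
  hence "f z ~= 0" if "z \<in> cball 0 R0" for z using c[of z] that R0 by simp
  hence "{z\<in>cball 0 R0. f z = 0} = {}" by blast
  thus ?thesis by (metis finite.emptyI)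
 next
  case False
  thus ?thesis
   by (intro holomorphic_compact_finite_zeros[OF f]) (use R0 in auto)
 qed
 hence fin: "finite pz" unfolding pz_def S_def by (rule rev_finite_subset) auto
 have Zpz: "Z <= pz" using R0 by (auto simp: Z_def pz_def S_def)
 show finZ: "finite Z" using finite_subset[OF Zpz fin] .
 have ap: "contour_integral (circlepath 0 r) (%x. deriv f x * h x / f x) =
   2 * of_real pi * \<i> * (\<Sum>p\<in>Z. h p * of_int (zorder f p))" if h: "h holomorphic_on S" for h
 proof -
  have "contour_integral (circlepath 0 r) (%x. deriv f x * h x / f x) =
   2 * pi * \<i> * (\<Sum>p\<in>{w\<in>S. f w = 0 | w \<in> {}}. winding_number (circlepath 0 r) p * h p * zorder f p)"
  proof (rule argument_principle[OF S _ h])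
   show "f holomorphic_on S - {}" using fS by simp
   show "path_image (circlepath 0 r) <= S - {w \<in> S. f w = 0 | w \<in> {}}"
    using nz r R0 by (auto simp: S_def)
   show "\<forall>z. z ~: S --> winding_number (circlepath 0 r) z = 0"
    using r R0 by (intro allI impI winding_number_zero_outside[of _ "cball 0 r"]) (auto simp: S_def)
  qed (use fin in \<open>auto simp: pz_def\<close>)
  also have "(\<Sum>p\<in>{w\<in>S. f w = 0 | w \<in> {}}. winding_number (circlepath 0 r) p * h p * zorder f p)
    = (\<Sum>p\<in>pz. winding_number (circlepath 0 r) p * h p * zorder f p)"
   by (simp add: pz_def)
  also have "\<dots> = (\<Sum>p\<in>Z. winding_number (circlepath 0 r) p * h p * zorder f p)"
  proof (rule sum.mono_neutral_right[OF fin Zpz], safe)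
   fix p assume p: "p \<in> pz" "p ~: Z"
   hence "norm p > r" using nz[of p] by (force simp: pz_def Z_def)
   hence "winding_number (circlepath 0 r) p = 0"
    using r by (intro winding_number_zero_outside[of _ "cball 0 r"]) auto
   thus "winding_number (circlepath 0 r) p * h p * of_int (zorder f p) = 0" by simp
  qed
  also have "\<dots> = (\<Sum>p\<in>Z. h p * of_int (zorder f p))"
   by (rule sum.cong) (auto simp: Z_def winding_number_circlepath)
  finally show ?thesis by simp
 qed
 have "(%s. deriv f (of_real r * unit_circ s) * 1 / f (of_real r * unit_circ s) * (of_real r * unit_circ s))
   = (%s. deriv f (of_real r * unit_circ s) / f (of_real r * unit_circ s) * (of_real r * unit_circ s))" by simp
 with ap[of "%_. 1"]
 show "integral {0..1} (%s. deriv f (of_real r * unit_circ s) / f (of_real r * unit_circ s)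
      * (of_real r * unit_circ s)) = (\<Sum>p\<in>Z. of_int (zorder f p))"
  by (simp add: contour_integral_circlepath_eq)
 have "(%s. deriv f (of_real r * unit_circ s) * (of_real r * unit_circ s) / f (of_real r * unit_circ s) * (of_real r * unit_circ s))
   = (%s. deriv f (of_real r * unit_circ s) / f (of_real r * unit_circ s) * (of_real r * unit_circ s)^2)"
  by (auto simp: power2_eq_square)
 with ap[of "%x. x"]
 show "integral {0..1} (%s. deriv f (of_real r * unit_circ s) / f (of_real r * unit_circ s)
      * (of_real r * unit_circ s)^2) = (\<Sum>p\<in>Z. p * of_int (zorder f p))"
  by (simp add: contour_integral_circlepath_eq)
 fix p assume p: "p \<in> Z"
 have pS: "p \<in> S" using p R0 by (auto simp: Z_def S_def)
 have ex: "\<exists>w\<in>S. f w ~= 0" using nz[of "of_real r"] r R0 by (intro bexI[of _ "of_real r"]) (auto simp: S_def)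
 have fp: "f p = 0" using p by (simp add: Z_def)
 have z: "zorder f p > 0" using zorder_exist_zero[OF fS S pS ex] unfolding fp by (simp only: if_True)
 have "\<exists>r>0. cball p r <= S & zor_poly f p holomorphic_on cball p r
  & (\<forall>w\<in>cball p r. f w = zor_poly f p w * (w - p) ^ nat (zorder f p) & zor_poly f p w ~= 0)"
  by (rule conjunct2[OF zorder_exist_zero[OF fS S pS ex]])
 then obtain q where q: "q > 0" "cball p q <= S" "zor_poly f p holomorphic_on cball p q"
   "!!w. w \<in> cball p q ==> f w = zor_poly f p w * (w - p) ^ nat (zorder f p) & zor_poly f p w ~= 0"
  by blast
 show "zorder f p >= 1" using z by simp
 show "zorder f p = 1 \<longleftrightarrow> deriv f p ~= 0"
 proof
  assume d: "deriv f p ~= 0"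
  show "zorder f p = 1"
  proof (rule zorder_zero_eqI[OF fS S(1) pS])
   fix i assume "i < nat 1"
   hence "i = 0" by simp
   thus "(deriv ^^ i) f p = 0" using p by (simp add: Z_def)
  next
   have "nat 1 = Suc 0" by simp
   thus "(deriv ^^ nat 1) f p ~= 0" using d by (simp only: funpow.simps o_apply id_apply) simp
  qed simp
 next
  assume o: "zorder f p = 1"
  let ?g = "zor_poly f p"
  have "?g holomorphic_on ball p q" by (rule holomorphic_on_subset[OF q(3)]) auto
  hence "?g field_differentiable (at p)"
   using q(1) by (meson centre_in_ball holomorphic_on_imp_differentiable_at open_ball)
  then obtain g' where g': "DERIV (?g) p :> g'" by (auto simp: field_differentiable_def)
  have "DERIV (%w. ?g w * (w - p)) p :> ?g p"
   by (rule derivative_eq_intros g' refl)+ simp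
  hence "DERIV f p :> ?g p"
   by (rule has_field_derivative_transform_within_open[of _ _ _ "ball p q"]) (use q o in auto)
  thus "deriv f p ~= 0" using q(4)[of p] q(1) by (auto dest: DERIV_imp_deriv)
 qed
qed

lemma line_derivative:
 assumes "hol3 f U" "u + t *s e \<in> U"
 shows "((%t. f (u + t *s e)) has_field_derivative (\<Sum>i\<in>UNIV. partial i f (u + t *s e) * e $ i)) (at t within S)"
proof -
 have "((%s. (u + s *s e) $ i) has_field_derivative e $ i) (at t within S)" for i
  by (auto intro!: derivative_eq_intros)
 from hol3_chain[where c="%t. u + t *s e" and t=t, OF assms this] show ?thesis by simp
qed

lemma line_holomorphic:
 assumes "hol3 f U" "!!t. t \<in> T ==> u + t *s e \<in> U"
 shows "(%t. f (u + t *s e)) holomorphic_on T"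
 unfolding holomorphic_on_def field_differentiable_def
 using line_derivative[OF assms(1) assms(2)] by blast

lemma continuous_on_scaleC [continuous_intros]:
 assumes "continuous_on S f"
 shows "continuous_on S (%x. f x *s (e :: complex^'n))"
 unfolding vector_scalar_mult_def by (intro continuous_on_vec_lambda continuous_intros assms)

text \<open>The one-variable identity theorem on the complex line from a point of \<open>V\<close>
  to \<open>u\<close>.\<close>

lemma hol3_zero_from_open:
 assumes f: "entire f" and V: "open V" "V ~= {}" "!!u. u \<in> V ==> f u = 0"
 shows "f u = 0"
proof -
 obtain v where v: "v \<in> V" using V by blast
 define g where "g = (%t. f (v + t *s (u - v)))"
 have hol: "g holomorphic_on UNIV" unfolding g_def by (rule line_holomorphic[OF f]) auto
 have "continuous_on UNIV (%t. v + t *s (u - v))" by (intro continuous_intros)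
 hence "open ((%t. v + t *s (u - v)) -` V)" using V(1) by (auto intro: open_vimage)
 moreover have "0 \<in> (%t. v + t *s (u - v)) -` V" using v by simp
 ultimately obtain e where e: "e > 0" "ball 0 e <= (%t. v + t *s (u - v)) -` V"
  using open_contains_ball by blast
 have "g 1 = 0"
 proof (rule analytic_continuation_open[of "ball 0 e" UNIV g "%_. 0" 1])
  show "ball (0::complex) e ~= {}" using e by simp
  show "g z = 0" if "z \<in> ball 0 e" for z using that e V(3) by (auto simp: g_def)
 qed (use hol in auto)
 thus ?thesis by (simp add: g_def)
qed

text \<open>Compactness of the disc and of the circle: what holds on the line through
  \<open>u0\<close> persists on parallel lines through nearby points.\<close>

lemma tube_nbhd:
 fixes u0 e :: "complex^3"
 assumes V: "open V" and l: "!!t. norm t <= R ==> u0 + t *s e \<in> V"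
  and c: "continuous_on V f" and nz: "!!t. norm t = r ==> f (u0 + t *s e) ~= (0::complex)" and rR: "r <= R"
 obtains h where "h > 0" "!!u t. u \<in> ball u0 h ==> norm t <= R ==> u + t *s e \<in> V"
  "!!u t. u \<in> ball u0 h ==> norm t = r ==> f (u + t *s e) ~= 0"
proof -
 have cont: "continuous_on A (%t. u0 + t *s e)" for A by (intro continuous_intros)
 have "compact ((%t. u0 + t *s e) ` cball 0 R)" by (intro compact_continuous_image cont compact_cball)
 moreover have "(%t. u0 + t *s e) ` cball 0 R <= V" using l by auto
 ultimately obtain h1 where d1: "h1 > 0" "(\<Union>x\<in>(%t. u0 + t *s e) ` cball 0 R. ball x h1) <= V"
  using compact_subset_open_imp_ball_epsilon_subset[OF _ V] by blast
 let ?W = "{u\<in>V. f u ~= 0}"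
 have "open (V \<inter> f -` (-{0}))" by (rule continuous_open_preimage[OF c V]) auto
 hence W: "open ?W" by (simp add: Int_def vimage_def)
 have "compact ((%t. u0 + t *s e) ` sphere 0 r)" by (intro compact_continuous_image cont compact_sphere)
 moreover have "(%t. u0 + t *s e) ` sphere 0 r <= ?W" using l nz rR by auto
 ultimately obtain h2 where d2: "h2 > 0" "(\<Union>x\<in>(%t. u0 + t *s e) ` sphere 0 r. ball x h2) <= ?W"
  using compact_subset_open_imp_ball_epsilon_subset[OF _ W] by blast
 show ?thesis
 proof (rule that[of "min h1 h2"])
  fix u t assume u: "u \<in> ball u0 (min h1 h2)"
  have dd: "dist (u0 + t *s e) (u + t *s e) < min h1 h2" using u by (simp add: dist_norm)
  { assume "norm t <= R" thus "u + t *s e \<in> V" using d1(2) dd by (force simp: subset_iff) }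
  { assume "norm t = r" thus "f (u + t *s e) ~= 0" using d2(2) dd by (force simp: subset_iff) }
 qed (use d1 d2 in auto)
qed

text \<open>\<open>G u\<close> is the mean of \<open>f\<close> over the circle of radius
  \<open>r\<close> around \<open>u\<close> in direction \<open>e\<close>, which stays away from the
  zeros of \<open>g\<close>; hence it is holomorphic even where \<open>g u = 0\<close>. By the mean
  value property it equals \<open>f u\<close> as soon as \<open>f\<close> extends over the disc, and
  \<open>k\<close> stands for such an extension.\<close>

lemma circle_average_extension:
 assumes g: "hol3 g V" and f: "hol3 f {u\<in>V. g u ~= 0}"
  and r: "r > 0" and l: "!!t. norm t <= r ==> u0 + t *s e \<in> V"
  and nz: "!!t. norm t = r ==> g (u0 + t *s e) ~= 0"
 obtains d G where "d > 0" "hol3 G (ball u0 d)" "ball u0 d <= V"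
  "!!u t. u \<in> ball u0 d ==> norm t <= r ==> u + t *s e \<in> V"
  "!!u t. u \<in> ball u0 d ==> norm t = r ==> g (u + t *s e) ~= 0"
  "!!u k. u \<in> ball u0 d ==> g u ~= 0 ==> continuous_on (cball 0 r) k ==> k holomorphic_on ball 0 r ==>
    (!!t. norm t <= r ==> g (u + t *s e) ~= 0 ==> k t = f (u + t *s e)) ==> G u = f u"
proof -
 obtain d where d: "d > 0" "!!u t. u \<in> ball u0 d ==> norm t <= r ==> u + t *s e \<in> V"
  "!!u t. u \<in> ball u0 d ==> norm t = r ==> g (u + t *s e) ~= 0"
  using tube_nbhd[OF hol3_open[OF g] l hol3_continuous[OF g] nz order_refl] by blast
 define G where "G = (%u. integral {0..1} (%s. f (u + (of_real r * unit_circ s) *s e) * 1))"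
 have sub: "ball u0 d <= V"
 proof
  fix u assume "u \<in> ball u0 d" from d(2)[OF this, of 0] r show "u \<in> V" by simp
 qed
 show ?thesis
 proof (rule that[OF d(1) _ sub d(2) d(3)])
  show "hol3 G (ball u0 d)" unfolding G_def
  proof (rule hol3_param_integral[OF f])
   show "u + (of_real r * unit_circ s) *s e \<in> {u \<in> V. g u ~= 0}" if "u \<in> ball u0 d" for u s
    using d(2,3)[OF that, of "of_real r * unit_circ s"] r by (simp add: norm_mult)
  qed (auto intro!: continuous_intros)
  fix u k assume u: "u \<in> ball u0 d" "g u ~= 0" and k: "continuous_on (cball 0 r) k" "k holomorphic_on ball 0 r"
   "!!t. norm t <= r ==> g (u + t *s e) ~= 0 ==> k t = f (u + t *s e)"
  have "G u = integral {0..1} (%s. k (0 + of_real r * unit_circ s))"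
   unfolding G_def using k(3)[of "of_real r * unit_circ s" for s] d(3)[OF u(1), of "of_real r * unit_circ s" for s] r
   by (simp add: norm_mult)
  also have "\<dots> = k 0" by (rule circle_mean_value[OF k(1,2) r])
  also have "\<dots> = f u" using k(3)[of 0] u r by simp
  finally show "G u = f u" .
 qed auto
qed

definition dird :: "complex^3 => (complex^3 => complex) => complex^3 => complex" where
 "dird e f u = (\<Sum>i\<in>UNIV. partial i f u * e $ i)"

lemma hol3_dird: "hol3 f U ==> hol3 (dird e f) U"
 unfolding dird_def
 by (intro hol3_sum hol3_mult hol3_partial_hol3 hol3_const) (auto dest: hol3_open)

lemma line_dird:
 assumes "hol3 f U" "u + t *s e \<in> U"
 shows "((%t. f (u + t *s e)) has_field_derivative dird e f (u + t *s e)) (at t within S)"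
 unfolding dird_def by (rule line_derivative[OF assms])

text \<open>The number of zeros is a continuous integral with integer values, hence constant near
  \<open>u0\<close>. The sum of the zeros is an integral too, so it depends holomorphically on the
  base point, although the single zeros need not.\<close>

lemma zero_count3:
 assumes g: "hol3 g V" and r: "0 < r" "r < R"
  and l: "!!t. norm t <= R ==> u0 + t *s e \<in> V"
  and nz: "!!t. norm t = r ==> g (u0 + t *s e) ~= 0"
 obtains d I n where "d > 0" "hol3 I (ball u0 d)"
  "!!u t. u \<in> ball u0 d ==> norm t <= R ==> u + t *s e \<in> V"
  "!!u t. u \<in> ball u0 d ==> norm t = r ==> g (u + t *s e) ~= 0"
  "!!u. u \<in> ball u0 d ==> finite {t. norm t < r & g (u + t *s e) = 0}"
  "!!u. u \<in> ball u0 d ==> (\<Sum>t | norm t < r & g (u + t *s e) = 0. zorder (%t. g (u + t *s e)) t) = n"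
  "!!u. u \<in> ball u0 d ==> I u = (\<Sum>t | norm t < r & g (u + t *s e) = 0. t * of_int (zorder (%t. g (u + t *s e)) t))"
  "!!u t. u \<in> ball u0 d ==> norm t < r ==> g (u + t *s e) = 0 ==> zorder (%t. g (u + t *s e)) t >= 1"
  "!!u t. u \<in> ball u0 d ==> norm t < r ==> g (u + t *s e) = 0 ==>
    zorder (%t. g (u + t *s e)) t = 1 \<longleftrightarrow> dird e g (u + t *s e) ~= 0"
proof -
 obtain d where d: "d > 0" "!!u t. u \<in> ball u0 d ==> norm t <= R ==> u + t *s e \<in> V"
  "!!u t. u \<in> ball u0 d ==> norm t = r ==> g (u + t *s e) ~= 0"
  using tube_nbhd[OF hol3_open[OF g] l hol3_continuous[OF g] nz less_imp_le[OF r(2)]] by blast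
 define W where "W = {u\<in>V. g u ~= 0}"
 have "open (V \<inter> g -` (-{0}))"
  by (rule continuous_open_preimage[OF hol3_continuous[OF g] hol3_open[OF g]]) auto
 hence W: "open W" by (simp add: W_def Int_def vimage_def)
 have q: "hol3 (%u. dird e g u / g u) W"
  by (intro hol3_divide hol3_subset[OF g] hol3_subset[OF hol3_dird[OF g]] W) (auto simp: W_def)
 have inW: "u + (of_real r * unit_circ s) *s e \<in> W" if "u \<in> ball u0 d" for u s
  using d(2,3)[OF that, of "of_real r * unit_circ s"] r by (simp add: W_def norm_mult)
 define I where "I = (%k u. integral {0..1} (%s. dird e g (u + (of_real r * unit_circ s) *s e) / g (u + (of_real r * unit_circ s) *s e)
    * (of_real r * unit_circ s) ^ k))"
 have I: "hol3 (I k) (ball u0 d)" for k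
  unfolding I_def by (rule hol3_param_integral[OF q]) (use inW in \<open>auto intro!: continuous_intros\<close>)
 define f where "f = (%u t. g (u + t *s e))"
 define Z where "Z = (%u. {t. norm t < r & f u t = 0})"
 have hol: "f u holomorphic_on ball 0 R" if "u \<in> ball u0 d" for u
  unfolding f_def by (rule line_holomorphic[OF g]) (use d(2)[OF that] in auto)
 have fnz: "f u t ~= 0" if "u \<in> ball u0 d" "norm t = r" for u t
  using d(3)[OF that] by (simp add: f_def)
 have der: "deriv (f u) t = dird e g (u + t *s e)" if "u \<in> ball u0 d" "norm t <= R" for u t
  unfolding f_def by (rule DERIV_imp_deriv[OF line_dird[OF g d(2)[OF that]]])
 have Ik: "I k u = integral {0..1} (%s. deriv (f u) (of_real r * unit_circ s) / f u (of_real r * unit_circ s) * (of_real r * unit_circ s) ^ k)"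
  if "u \<in> ball u0 d" for u k
  using der[OF that, of "of_real r * unit_circ s" for s] r by (simp add: I_def f_def norm_mult)
 note zc = zero_count[OF hol r fnz]
 have I1: "I 1 u = of_int (\<Sum>p\<in>Z u. zorder (f u) p)" if "u \<in> ball u0 d" for u
  using zc(2)[OF that that] Ik[OF that, of 1] by (simp add: Z_def)
 have I2: "I 2 u = (\<Sum>p\<in>Z u. p * of_int (zorder (f u) p))" if "u \<in> ball u0 d" for u
  using zc(3)[OF that that] Ik[OF that, of 2] by (simp add: Z_def)
 have "I 1 constant_on ball u0 d"
 proof (rule continuous_discrete_range_constant)
  show "continuous_on (ball u0 d) (I 1)" using hol3_continuous[OF I] .
  fix u assume u: "u \<in> ball u0 d"
  show "\<exists>h>0. \<forall>y. y \<in> ball u0 d & I 1 y ~= I 1 u --> h <= norm (I 1 y - I 1 u)"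
  proof (intro exI[of _ 1] conjI allI impI)
   fix y assume y: "y \<in> ball u0 d & I 1 y ~= I 1 u"
   let ?a = "(\<Sum>p\<in>Z y. zorder (f y) p)" and ?b = "(\<Sum>p\<in>Z u. zorder (f u) p)"
   have "?a ~= ?b" using y u I1 by metis
   hence "1 <= \<bar>?a - ?b\<bar>" by linarith
   hence "1 <= norm (of_int (?a - ?b) :: complex)" by (simp only: norm_of_int of_int_1_le_iff flip: of_int_abs)
   thus "1 <= norm (I 1 y - I 1 u)" using I1 y u by simp
  qed auto
 qed auto
 then obtain c where c: "!!u. u \<in> ball u0 d ==> I 1 u = c" by (auto simp: constant_on_def)
 define n where "n = (\<Sum>p\<in>Z u0. zorder (f u0) p)"
 have n: "(\<Sum>p\<in>Z u. zorder (f u) p) = n" if "u \<in> ball u0 d" for u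
 proof -
  have "of_int (\<Sum>p\<in>Z u. zorder (f u) p) = (of_int n :: complex)"
   using I1[OF that] I1[of u0] c[OF that] c[of u0] d(1) unfolding n_def by simp
  thus ?thesis by (simp only: of_int_eq_iff)
 qed
 show ?thesis
 proof (rule that[of d "I 2" n])
  show "d > 0" "hol3 (I 2) (ball u0 d)" by (fact d(1), rule I)
  fix u assume u: "u \<in> ball u0 d"
  show "u + t *s e \<in> V" if "norm t <= R" for t by (rule d(2)[OF u that])
  show "g (u + t *s e) ~= 0" if "norm t = r" for t by (rule d(3)[OF u that])
  show "finite {t. norm t < r & g (u + t *s e) = 0}" using zc(1)[OF u u] by (simp add: f_def)
  show "(\<Sum>t | norm t < r & g (u + t *s e) = 0. zorder (%t. g (u + t *s e)) t) = n"
   using n[OF u] by (simp add: Z_def f_def)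
  show "I 2 u = (\<Sum>t | norm t < r & g (u + t *s e) = 0. t * of_int (zorder (%t. g (u + t *s e)) t))"
   using I2[OF u] by (simp add: Z_def f_def)
  fix t assume t: "norm t < r" "g (u + t *s e) = 0"
  show "zorder (%t. g (u + t *s e)) t >= 1" using zc(4)[OF u u, of t] t by (simp add: f_def)
  show "zorder (%t. g (u + t *s e)) t = 1 \<longleftrightarrow> dird e g (u + t *s e) ~= 0"
   using zc(5)[OF u u, of t] t der[OF u, of t] r by (simp add: f_def)
 qed
qed

definition regular_zero :: "(complex^3 => complex) => complex^3 => bool" where
 "regular_zero f v \<longleftrightarrow> f v = 0 & (\<exists>i. partial i f v ~= 0)"

text \<open>If every nearby line in direction \<open>e\<close> meets the zero set only once, then a
 multiplicity above one would make \<open>g\<close> vanish to second order along its zero set.\<close>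

lemma unique_zero_simple:
 assumes g: "hol3 g V" and r: "0 < r" "r < R"
  and l: "!!t. norm t <= R ==> w + t *s e \<in> V"
  and nz: "!!t. norm t = r ==> g (w + t *s e) ~= 0"
  and w: "g w = 0" "w \<in> closure {v\<in>V. regular_zero g v}"
  and uniq: "ee > 0" "!!v. v \<in> ball w ee ==> \<exists>!t. norm t < r & g (v + t *s e) = 0"
 shows "dird e g w ~= 0"
proof
 assume d0: "dird e g w = 0"
 show False
 proof (rule zero_count3[OF g r l nz])
 fix q I n assume q: "q > 0" and I: "hol3 I (ball w q)"
  and inV: "!!u t. u \<in> ball w q ==> norm t <= R ==> u + t *s e \<in> V"
  and nz': "!!u t. u \<in> ball w q ==> norm t = r ==> g (u + t *s e) ~= 0"
  and fin: "!!u. u \<in> ball w q ==> finite {t. norm t < r & g (u + t *s e) = 0}"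
  and cnt: "!!u. u \<in> ball w q ==> (\<Sum>t | norm t < r & g (u + t *s e) = 0. zorder (%t. g (u + t *s e)) t) = n"
  "!!u. u \<in> ball w q ==> I u = (\<Sum>t | norm t < r & g (u + t *s e) = 0. t * of_int (zorder (%t. g (u + t *s e)) t))"
  and zo: "!!u t. u \<in> ball w q ==> norm t < r ==> g (u + t *s e) = 0 ==> zorder (%t. g (u + t *s e)) t >= 1"
  "!!u t. u \<in> ball w q ==> norm t < r ==> g (u + t *s e) = 0 ==>
    zorder (%t. g (u + t *s e)) t = 1 \<longleftrightarrow> dird e g (u + t *s e) ~= 0"
 define rr where "rr = min q ee"
 have rr: "rr > 0" "ball w rr <= ball w q" "ball w rr <= ball w ee" using q uniq by (auto simp: rr_def)
 \<comment> \<open>The unique zero as a function of the base point. It carries the whole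
   multiplicity \<open>n\<close>, so it equals \<open>I v / of_int n\<close> and is
   holomorphic.\<close>
 define a where "a = (%v. THE t. norm t < r & g (v + t *s e) = 0)"
 have a: "norm (a v) < r" "g (v + a v *s e) = 0" if "v \<in> ball w rr" for v
  using theI'[OF uniq(2), of v] that rr unfolding a_def by blast+
 have aset: "{t. norm t < r & g (v + t *s e) = 0} = {a v}" if "v \<in> ball w rr" for v
  using uniq(2)[of v] a[OF that] that rr by blast
 have n: "zorder (%t. g (v + t *s e)) (a v) = n" if "v \<in> ball w rr" for v
  using cnt(1)[of v] that rr aset[OF that] by (simp add: subset_iff)
 have "0 \<in> {t. norm t < r & g (w + t *s e) = 0}" using w(1) r by simp
 hence "a w = 0" using aset[of w] rr(1) by simp
 hence n1: "n >= 1" "n ~= 1"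
  using n[of w] zo[of w 0] d0 w(1) r rr q by auto
 have d: "dird e g (v + a v *s e) = 0" if "v \<in> ball w rr" for v
  using zo(2)[of v "a v"] a[OF that] n[OF that] n1 that rr by auto
 have Ia: "I v = a v * of_int n" if "v \<in> ball w rr" for v
  using cnt(2)[of v] aset[OF that] n[OF that] that rr by auto
 have "hol3 (%v. I v / of_int n) (ball w rr)"
  by (intro hol3_divide hol3_subset[OF I]) (use rr n1 in auto)
 hence ah: "hol3 a (ball w rr)"
  by (rule hol3_cong) (use Ia n1 in auto)
 obtain v where v: "v \<in> ball w rr" "v \<in> V" "regular_zero g v"
  using w(2) rr(1) unfolding closure_approachable by (auto simp: dist_commute)
 obtain i where i: "partial i g v ~= 0" and v0: "g v = 0" using v(3) by (auto simp: regular_zero_def)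
 have "0 \<in> {t. norm t < r & g (v + t *s e) = 0}" using v0 r by simp
 hence av: "a v = 0" using aset[OF v(1)] by simp
 define A where "A = (%s. a (v + axis i s))"
 have Ad: "DERIV A 0 :> partial i a v"
  unfolding A_def by (rule hol3_partial[OF ah v(1)])
 obtain B1 where B1: "!!x. x \<in> cball v B1 ==> x \<in> V & x \<in> ball w rr" "B1 > 0"
 proof -
  have "open (V \<inter> ball w rr)" using hol3_open[OF g] by auto
  then obtain B1 where "B1 > 0" "cball v B1 <= V \<inter> ball w rr"
   using v open_contains_cball by (metis IntI)
  thus ?thesis using that by (auto simp: subset_iff)
 qed
 let ?h = "dird e (dird e g)"
 have hh: "hol3 ?h V" by (intro hol3_dird g)
 obtain K where K: "!!x. x \<in> cball v B1 ==> norm (?h x) <= K" "K > 0"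
 proof -
  have "compact (?h ` cball v B1)"
   by (intro compact_continuous_image continuous_on_subset[OF hol3_continuous[OF hh]]) (use B1 in auto)
  then obtain K where "K > 0" "!!y. y \<in> ?h ` cball v B1 ==> norm y <= K"
   using bounded_pos compact_imp_bounded by metis
  thus ?thesis by (intro that[of K]) (auto intro: imageI)
 qed
 \<comment> \<open>On the segment from 0 to \<open>A s\<close> the function and its derivative
   vanish at the end \<open>A s\<close>; integrating a bound on the second derivative twice gives a
   quadratic estimate in \<open>A s\<close>. As \<open>A\<close> is differentiable and vanishes at
   0, the quotient by s tends to 0, against \<open>partial i g v\<close> being nonzero.\<close>
 have est: "norm (g (v + axis i s)) <= K * norm (A s) * norm (A s)"
  if s: "norm (axis i s :: complex^3) + norm (A s *s e) <= B1" "norm s <= B1" for s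
 proof -
  let ?p = "v + axis i s"
  let ?S = "closed_segment 0 (A s)"
  have tn: "norm t <= norm (A s)" if "t \<in> ?S" for t using segment_bound1[OF that] by simp
  have ns: "norm (c *s e) = norm c * norm e" for c
   by (simp add: norm_vec_def norm_mult L2_set_right_distrib)
  have inb: "?p + t *s e \<in> cball v B1" if "t \<in> ?S" for t
  proof -
   have "norm (axis i s + t *s e) <= norm (axis i s :: complex^3) + norm (t *s e)" by (rule norm_triangle_ineq)
   also have "\<dots> <= norm (axis i s :: complex^3) + norm (A s *s e)"
    unfolding ns using tn[OF that] by (simp add: mult_right_mono)
   also have "\<dots> <= B1" by (rule s)
   finally have "norm (axis i s + t *s e) <= B1" .
   moreover have "v - (?p + t *s e) = - (axis i s + t *s e)" by simp
   ultimately show ?thesis by (simp only: dist_norm norm_minus_cancel mem_cball)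
  qed
  have pw: "?p \<in> ball w rr" using B1(1)[of ?p] s(2) by (simp add: dist_norm)
  have z: "g (?p + A s *s e) = 0" "dird e g (?p + A s *s e) = 0"
   using a(2)[OF pw] d[OF pw] by (simp_all add: A_def)
  have 1: "norm (dird e g (?p + t *s e)) <= K * norm (A s)" if t: "t \<in> ?S" for t
  proof -
   have "norm (dird e g (?p + t *s e) - dird e g (?p + A s *s e)) <= K * norm (t - A s)"
   proof (rule field_differentiable_bound[where f="%t. dird e g (?p + t *s e)" and S = ?S and f'="%t. ?h (?p + t *s e)"])
    show "((%t. dird e g (?p + t *s e)) has_field_derivative ?h (?p + z *s e)) (at z within ?S)" if "z \<in> ?S" for z
     by (rule line_dird[OF hol3_dird[OF g]]) (use inb[OF that] B1 in auto)
    show "norm (?h (?p + z *s e)) <= K" if "z \<in> ?S" for z using K(1)[OF inb[OF that]] .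
   qed (use t in auto)
   also have "\<dots> <= K * norm (A s)" using segment_bound(2)[OF t] K(2) by (simp add: norm_minus_commute)
   finally show ?thesis using z by simp
  qed
  have "norm (g (?p + 0 *s e) - g (?p + A s *s e)) <= K * norm (A s) * norm (0 - A s)"
  proof (rule field_differentiable_bound[where f="%t. g (?p + t *s e)" and S = ?S and f'="%t. dird e g (?p + t *s e)"])
   show "((%t. g (?p + t *s e)) has_field_derivative dird e g (?p + z *s e)) (at z within ?S)" if "z \<in> ?S" for z
    by (rule line_dird[OF g]) (use inb[OF that] B1 in auto)
  qed (use 1 in auto)
  thus ?thesis using z by simp
 qed
 have A0: "(A \<longlongrightarrow> 0) (at 0)"
  using DERIV_isCont[OF Ad] av by (simp add: isCont_def A_def)
 have ev: "\<forall>\<^sub>F s in at 0. norm (g (v + axis i s) / s) <= K * norm (A s / s) * norm (A s)"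
 proof -
  have "((%s. norm (axis i s :: complex^3) + norm (A s *s e)) \<longlongrightarrow> norm (axis i 0 :: complex^3) + norm (0 *s e)) (at 0)"
  proof (intro tendsto_intros)
   have "continuous_on UNIV (%t. t *s e)" by (intro continuous_intros)
   hence "isCont (%t. t *s e) 0" by (simp add: continuous_on_eq_continuous_at)
   from isCont_tendsto_compose[OF this A0] show "((%s. A s *s e) \<longlongrightarrow> 0 *s e) (at 0)" .
   have "continuous_on UNIV (%t. axis i t :: complex^3)" by (intro continuous_intros)
   hence "isCont (%t. axis i t :: complex^3) 0" by (simp add: continuous_on_eq_continuous_at)
   thus "((%t. axis i t :: complex^3) \<longlongrightarrow> axis i 0) (at 0)" by (simp add: isCont_def)
  qed
  hence "\<forall>\<^sub>F s in at 0. norm (axis i s :: complex^3) + norm (A s *s e) < B1"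
   using B1(2) by (auto simp: order_tendsto_iff)
  moreover have "\<forall>\<^sub>F s in at 0. norm s < B1" using B1(2) eventually_at[of _ 0] by (metis dist_0_norm dist_commute)
  moreover have "\<forall>\<^sub>F s in at (0::complex). s ~= 0" by (simp add: eventually_at_filter)
  ultimately show ?thesis
   by eventually_elim (use est in \<open>auto simp: norm_divide divide_right_mono intro!: divide_right_mono\<close>)
 qed
 have "((%s. K * norm (A s / s) * norm (A s)) \<longlongrightarrow> K * norm (partial i a v) * norm (0::complex)) (at 0)"
  using Ad av by (intro tendsto_intros A0) (simp add: has_field_derivative_iff A_def)
 hence L1: "((%s. g (v + axis i s) / s) \<longlongrightarrow> 0) (at 0)"
  by (intro Lim_null_comparison[OF ev]) simp
 have L2: "((%s. g (v + axis i s) / s) \<longlongrightarrow> partial i g v) (at 0)"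
  using hol3_partial[OF g v(2), of i] v0 by (simp add: has_field_derivative_iff)
 from LIM_unique[OF L2 L1] i show False by simp
 qed auto
qed

text \<open>Choose in \<open>M\<close> a base point whose line has the largest number of distinct
  zeros. Nearby lines have no more, so none of its zeros can split; each has a disc in which
  neighbouring lines have exactly one zero, and \<open>unique_zero_simple\<close> applies.\<close>

lemma generic_simple_zeros:
 assumes f: "hol3 f V" and r: "0 < r" "r < R"
  and l: "!!t. norm t <= R ==> u0 + t *s e \<in> V"
  and nz: "!!t. norm t = r ==> f (u0 + t *s e) ~= 0"
  and red: "{v\<in>V. f v = 0} <= closure {v\<in>V. regular_zero f v}"
 shows "\<exists>h>0. \<forall>M. open M & M ~= {} & M <= ball u0 h -->
   (\<exists>u\<in>M. \<forall>t. norm t < r & f (u + t *s e) = 0 --> dird e f (u + t *s e) ~= 0)"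
proof (rule zero_count3[OF f r l nz])
 fix h I n assume h: "h > 0" and I: "hol3 I (ball u0 h)"
  and inV: "!!u t. u \<in> ball u0 h ==> norm t <= R ==> u + t *s e \<in> V"
  and nz': "!!u t. u \<in> ball u0 h ==> norm t = r ==> f (u + t *s e) ~= 0"
  and fin: "!!u. u \<in> ball u0 h ==> finite {t. norm t < r & f (u + t *s e) = 0}"
  and cnt: "!!u. u \<in> ball u0 h ==> (\<Sum>t | norm t < r & f (u + t *s e) = 0. zorder (%t. f (u + t *s e)) t) = n"
  and zo: "!!u t. u \<in> ball u0 h ==> norm t < r ==> f (u + t *s e) = 0 ==> zorder (%t. f (u + t *s e)) t >= 1"
 define Z where "Z = (%u. {t. norm t < r & f (u + t *s e) = 0})"
 have card_le: "card (Z u) <= nat n" if u: "u \<in> ball u0 h" for u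
 proof -
  have "int (card (Z u)) = (\<Sum>t\<in>Z u. 1)" by simp
  also have "\<dots> <= (\<Sum>t\<in>Z u. zorder (%t. f (u + t *s e)) t)"
   by (rule sum_mono) (use zo[OF u] in \<open>auto simp: Z_def\<close>)
  also have "\<dots> = n" using cnt[OF u] by (simp add: Z_def)
  finally show ?thesis by simp
 qed
 show ?thesis
 proof (intro exI[of _ h] conjI h allI impI)
  fix M assume M: "open M & M ~= {} & M <= ball u0 h"
  then obtain m where "m \<in> M" by blast
  have "\<exists>u. u \<in> M & (\<forall>y. y \<in> M --> card (Z y) <= card (Z u))"
   by (rule ex_has_greatest_nat[where k=m and b="Suc (nat n)"]) (use \<open>m \<in> M\<close> card_le M in \<open>auto simp: less_Suc_eq_le\<close>)
  then obtain u where u: "u \<in> M" "!!y. y \<in> M ==> card (Z y) <= card (Z u)" by blast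
  have ub: "u \<in> ball u0 h" using u(1) M by blast
  have finu: "finite (Z u)" using fin[OF ub] by (simp add: Z_def)
  have "dird e f (u + t0 *s e) ~= 0" if t0: "t0 \<in> Z u" for t0
  proof -
   \<comment> \<open>Distances of the zeros from the circle and from each other. A third of the
     minimum makes the discs around the zeros disjoint and keeps them inside.\<close>
   define X where "X = (%p. (r - norm p) / 3) ` Z u \<union> (%(p, q). dist p q / 3) ` {(p, q). p \<in> Z u & q \<in> Z u & p ~= q}"
   have "{(p, q). p \<in> Z u & q \<in> Z u & p ~= q} <= Z u \<times> Z u" by auto
   hence "finite {(p, q). p \<in> Z u & q \<in> Z u & p ~= q}" by (rule finite_subset) (use finu in auto)
   hence X: "finite X" "X ~= {}" using finu t0 by (auto simp: X_def)
   have Xpos: "x > 0" if "x \<in> X" for x using that by (auto simp: X_def Z_def)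
   define rr where "rr = Min X"
   have rr: "rr > 0" using X Xpos by (simp add: rr_def)
   have rr1: "norm p + 3 * rr <= r" if "p \<in> Z u" for p
   proof -
    have "rr <= (r - norm p) / 3" unfolding rr_def by (rule Min_le[OF X(1)]) (use that in \<open>auto simp: X_def\<close>)
    thus ?thesis by simp
   qed
   have rr2: "3 * rr <= dist p q" if "p \<in> Z u" "q \<in> Z u" "p ~= q" for p q
   proof -
    have "rr <= dist p q / 3" unfolding rr_def by (rule Min_le[OF X(1)]) (use that in \<open>auto simp: X_def\<close>)
    thus ?thesis by simp
   qed
   have lp: "u + p *s e + t *s e \<in> V" if "p \<in> Z u" "norm t <= 2 * rr" for p t
   proof -
    have "norm (p + t) <= R" using norm_triangle_ineq[of p t] rr1[OF that(1)] that r rr by linarith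
    from inV[OF ub this] show ?thesis by (simp add: vec.scale_left_distrib add.assoc)
   qed
   have np: "f (u + p *s e + t *s e) ~= 0" if "p \<in> Z u" "norm t = rr" for p t
   proof
    assume "f (u + p *s e + t *s e) = 0"
    moreover have "norm (p + t) < r" using norm_triangle_ineq[of p t] rr1[OF that(1)] that rr by linarith
    ultimately have "p + t \<in> Z u" by (simp add: Z_def vec.scale_left_distrib add.assoc)
    moreover have "p + t ~= p" using that rr by auto
    ultimately show False using rr2[OF that(1), of "p + t"] that rr by (auto simp: dist_norm)
   qed
   have ex1: "\<exists>d>0. \<forall>v\<in>ball (u + p *s e) d. \<exists>t. norm t < rr & f (v + t *s e) = 0" if p: "p \<in> Z u" for p
   proof (rule zero_count3[OF f rr, of "2 * rr" "u + p *s e" e])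
    fix d I' n'
    assume d: "d > 0" and cnt': "!!v. v \<in> ball (u + p *s e) d ==> (\<Sum>t | norm t < rr & f (v + t *s e) = 0. zorder (%t. f (v + t *s e)) t) = n'"
     and zo': "!!v t. v \<in> ball (u + p *s e) d ==> norm t < rr ==> f (v + t *s e) = 0 ==> zorder (%t. f (v + t *s e)) t >= 1"
     and fin': "!!v. v \<in> ball (u + p *s e) d ==> finite {t. norm t < rr & f (v + t *s e) = 0}"
    let ?w = "u + p *s e"
    have w: "?w \<in> ball ?w d" using d by simp
    have "0 < (\<Sum>t | norm t < rr & f (?w + t *s e) = 0. zorder (%t. f (?w + t *s e)) t)"
    proof (rule sum_pos[OF fin'[OF w]])
     have "0 \<in> {t. norm t < rr & f (?w + t *s e) = 0}" using p rr by (simp add: Z_def)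
     thus "{t. norm t < rr & f (?w + t *s e) = 0} ~= {}" by blast
    qed (use zo'[OF w] in fastforce)
    hence n': "n' > 0" using cnt'[OF w] by simp
    have "\<exists>t. norm t < rr & f (v + t *s e) = 0" if v: "v \<in> ball ?w d" for v
    proof (rule ccontr)
     assume "\<nexists>t. norm t < rr & f (v + t *s e) = 0"
     hence e: "{t. norm t < rr & f (v + t *s e) = 0} = {}" by blast
     show False using cnt'[OF v] n' unfolding e by simp
    qed
    thus ?thesis using d by blast
   qed (use lp[OF p] np[OF p] rr in auto)
   then obtain d where d: "!!p. p \<in> Z u ==> d p > 0"
    "!!p v. p \<in> Z u ==> v \<in> ball (u + p *s e) (d p) ==> \<exists>t. norm t < rr & f (v + t *s e) = 0" by metis
   obtain d0 where d0: "d0 > 0" "ball u d0 <= M" using M u(1) open_contains_ball by blast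
   have Zne: "Z u ~= {}" using t0 by blast
   define ee where "ee = min d0 (Min (d ` Z u))"
   have ee: "ee > 0" "ee <= d0" "!!p. p \<in> Z u ==> ee <= d p"
    using d0 d(1) finu Zne by (auto simp: ee_def min_le_iff_disj)
   have zex: "\<exists>t. norm (t - p) < rr & t \<in> Z y" if y: "y \<in> ball u ee" and p: "p \<in> Z u" for y p
   proof -
    have "y + p *s e \<in> ball (u + p *s e) (d p)" using y ee(3)[OF p] by (simp add: dist_norm)
    from d(2)[OF p this] obtain t where t: "norm t < rr" "f (y + p *s e + t *s e) = 0" by blast
    have "norm (p + t) < r" using norm_triangle_ineq[of p t] rr1[OF p] t rr by linarith
    thus ?thesis using t by (intro exI[of _ "p + t"]) (simp add: Z_def vec.scale_left_distrib add.assoc)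
   qed
   have uniq: "s1 = s2" if y: "y \<in> ball u ee" and s: "s1 \<in> Z y" "s2 \<in> Z y" "norm (s1 - t0) < rr" "norm (s2 - t0) < rr" for y s1 s2
   proof (rule ccontr)
    assume ne: "s1 ~= s2"
    obtain z where z: "!!p. p \<in> Z u ==> norm (z p - p) < rr" "!!p. p \<in> Z u ==> z p \<in> Z y" using zex[OF y] by metis
    have sep: "a ~= b" if "p \<in> Z u" "q \<in> Z u" "p ~= q" "norm (a - p) < rr" "norm (b - q) < rr" for a b p q
    proof
     assume "a = b"
     hence "dist p q < 2 * rr" using dist_triangle[of p q a] that(4,5) by (simp add: dist_norm norm_minus_commute)
     thus False using rr2[OF that(1-3)] rr by simp
    qed
    have inj: "inj_on z (Z u)"
    proof (rule inj_onI, rule ccontr)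
     fix a b assume ab: "a \<in> Z u" "b \<in> Z u" "z a = z b" "a ~= b"
     from sep[OF ab(1,2,4) z(1)[OF ab(1)] z(1)[OF ab(2)]] ab(3) show False by simp
    qed
    have yM: "y \<in> M" using y ee d0 by auto
    have "finite (Z y)" using fin[of y] yM M by (auto simp: Z_def)
    moreover have "insert s1 (insert s2 (z ` (Z u - {t0}))) <= Z y" using s z by auto
    ultimately have "card (insert s1 (insert s2 (z ` (Z u - {t0})))) <= card (Z y)" by (rule card_mono)
    moreover have "s1 ~: z ` (Z u - {t0})" "s2 ~: z ` (Z u - {t0})"
     using sep[OF _ t0] z(1) s(3,4) by force+
    hence "card (insert s1 (insert s2 (z ` (Z u - {t0})))) = Suc (Suc (card (Z u - {t0})))"
     using ne finu card_image[OF inj_on_diff[OF inj, of "{t0}"]] by simp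
    moreover have "Suc (card (Z u - {t0})) = card (Z u)" using finu t0 by (rule card_Suc_Diff1)
    ultimately show False using u(2)[OF yM] by simp
   qed
   show ?thesis
   proof (rule unique_zero_simple[OF f rr, of "2 * rr"])
    show "rr < 2 * rr" using rr by simp
    show "u + t0 *s e + t *s e \<in> V" if "norm t <= 2 * rr" for t using lp[OF t0 that] .
    show "f (u + t0 *s e + t *s e) ~= 0" if "norm t = rr" for t using np[OF t0 that] .
    show "f (u + t0 *s e) = 0" using t0 by (simp add: Z_def)
    thus "u + t0 *s e \<in> closure {v \<in> V. regular_zero f v}" using red lp[OF t0, of 0] rr by auto
    show "ee > 0" by fact
    fix v assume v: "v \<in> ball (u + t0 *s e) ee"
    define y where "y = v - t0 *s e"
    have y: "y \<in> ball u ee" using v by (simp add: y_def dist_norm algebra_simps)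
    have vy: "v + t *s e = y + (t0 + t) *s e" for t by (simp add: y_def vec.scale_left_distrib)
    obtain t where t: "norm (t - t0) < rr" "t \<in> Z y" using zex[OF y t0] by blast
    show "\<exists>!t. norm t < rr & f (v + t *s e) = 0"
    proof (rule ex1I[of _ "t - t0"])
     show "norm (t - t0) < rr & f (v + (t - t0) *s e) = 0" using t by (simp only: vy) (simp add: Z_def)
     fix t' assume t': "norm t' < rr & f (v + t' *s e) = 0"
     have "norm (t0 + t') < r" using norm_triangle_ineq[of t0 t'] rr1[OF t0] t' rr by linarith
     hence "t0 + t' \<in> Z y" using t' by (simp add: vy Z_def)
     from uniq[OF y this t(2) _ t(1)] t' show "t' = t - t0" by auto
    qed
   qed
  qed
  thus "\<exists>u\<in>M. \<forall>t. norm t < r & f (u + t *s e) = 0 --> dird e f (u + t *s e) ~= 0"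
   using u(1) by (auto simp: Z_def)
 qed
qed auto

section \<open>Extension across a divisor and division by a reduced function\<close>

text \<open>On a line to a point where \<open>f\<close> is nonzero the zeros are isolated, so all
  but finitely many radii below 1 avoid them.\<close>

lemma good_line:
 assumes f: "hol3 f V" and u0: "u0 \<in> V" "u0 \<in> closure {w\<in>V. f w ~= 0}"
 shows "\<exists>e r R. 0 < r & r < R & (\<forall>t. norm t <= R --> u0 + t *s e \<in> V) & (\<forall>t. norm t = r --> f (u0 + t *s e) ~= 0)"
proof -
 obtain q where q: "q > 0" "ball u0 q <= V" using hol3_open[OF f] u0(1) open_contains_ball by blast
 obtain w where w: "w \<in> V" "f w ~= 0" "dist w u0 < q / 2"
  using u0(2) q(1) unfolding closure_approachable by (metis (mono_tags, lifting) half_gt_zero mem_Collect_eq)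
 define e where "e = w - u0"
 have ns: "norm (c *s e) = norm c * norm e" for c
  by (simp add: norm_vec_def norm_mult L2_set_right_distrib)
 have inV: "u0 + t *s e \<in> V" if "norm t < 2" for t
 proof -
  have "norm (t *s e) <= 2 * norm e" unfolding ns using that by (intro mult_right_mono) auto
  also have "\<dots> < q" using w(3) by (simp add: e_def dist_norm)
  finally show ?thesis using q(2) by (auto simp: dist_norm)
 qed
 have hol: "(%t. f (u0 + t *s e)) holomorphic_on ball 0 2"
  by (rule line_holomorphic[OF f]) (use inV in auto)
 have w1: "f (u0 + 1 *s e) ~= 0" using w by (simp add: e_def)
 have "finite {t\<in>cball 0 1. f (u0 + t *s e) = 0}"
 proof (cases "(%t. f (u0 + t *s e)) constant_on ball 0 2")
  case True
  then obtain c where c: "!!t. t \<in> ball 0 2 ==> f (u0 + t *s e) = c" by (auto simp: constant_on_def)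
  have "c ~= 0" using c[of 1] w1 by simp
  hence "{t\<in>cball 0 1. f (u0 + t *s e) = 0} = {}" using c by force
  thus ?thesis by (metis finite.emptyI)
 next
  case False
  show ?thesis by (rule holomorphic_compact_finite_zeros[OF hol _ _ _ _ False]) auto
 qed
 hence "finite (norm ` {t\<in>cball 0 1. f (u0 + t *s e) = 0})" by simp
 moreover have "infinite {0<..<1::real}" by (simp add: infinite_Ioo)
 ultimately obtain r where r: "r \<in> {0<..<1}" "r ~: norm ` {t\<in>cball 0 1. f (u0 + t *s e) = 0}"
  using finite_subset[of "{0<..<1::real}"] by blast
 have "f (u0 + t *s e) ~= 0" if "norm t = r" for t using r that by force
 moreover have "u0 + t *s e \<in> V" if "norm t <= 1" for t using inV that by simp
 ultimately show ?thesis using r by (intro exI[of _ e] exI[of _ r] exI[of _ "1::real"]) auto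
qed

text \<open>The circle average is the candidate. If it differed from \<open>f\<close>, it would do
  so on a nonempty open set; there the assumption supplies a line on which all singularities of
  \<open>f\<close> are removable, and the mean value property forces equality at its base
  point.\<close>

lemma general_extension:
 assumes g: "hol3 g V" and f: "hol3 f {u\<in>V. g u ~= 0}"
  and r: "0 < r" "r < R" and l: "!!t. norm t <= R ==> u0 + t *s e \<in> V"
  and nz: "!!t. norm t = r ==> g (u0 + t *s e) ~= 0"
  and dense: "\<exists>q>0. \<forall>M. open M & M ~= {} & M <= ball u0 q --> (\<exists>u\<in>M. \<forall>p. norm p < r & g (u + p *s e) = 0 -->
      (\<exists>L. ((%t. f (u + t *s e)) \<longlongrightarrow> L) (at p)))"
 shows "\<exists>q>0. \<exists>G. ball u0 q <= V & hol3 G (ball u0 q) & (\<forall>u\<in>ball u0 q. g u ~= 0 --> G u = f u)"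
proof -
 from dense obtain q1 where q1: "q1 > 0" and dense': "\<forall>M. open M & M ~= {} & M <= ball u0 q1 --> (\<exists>u\<in>M. \<forall>p. norm p < r & g (u + p *s e) = 0 -->
      (\<exists>L. ((%t. f (u + t *s e)) \<longlongrightarrow> L) (at p)))"
  by - (erule exE, erule conjE, rule that, assumption, assumption)
 have "\<exists>q>0. \<forall>u\<in>ball u0 q. \<forall>t. norm t <= R --> u + t *s e \<in> V"
 proof (rule tube_nbhd[OF hol3_open[OF g] l hol3_continuous[OF g] nz less_imp_le[OF r(2)]])
  fix q assume "q > 0" "!!u t. u \<in> ball u0 q ==> norm t <= R ==> u + t *s e \<in> V"
  thus "\<exists>q>0. \<forall>u\<in>ball u0 q. \<forall>t. norm t <= R --> u + t *s e \<in> V" by (intro exI[of _ q]) auto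
 qed auto
 then obtain q2 where q2: "q2 > 0" and tube: "!!u t. u \<in> ball u0 q2 ==> norm t <= R ==> u + t *s e \<in> V"
  by (elim exE conjE) blast
 have l': "u0 + t *s e \<in> V" if "norm t <= r" for t using l[of t] that r by simp
 show ?thesis
 proof (rule circle_average_extension[OF g f r(1) l' nz])
  fix q G assume q: "q > 0" and G: "hol3 G (ball u0 q)" "ball u0 q <= V"
   and inV: "!!u t. u \<in> ball u0 q ==> norm t <= r ==> u + t *s e \<in> V"
   and nz': "!!u t. u \<in> ball u0 q ==> norm t = r ==> g (u + t *s e) ~= 0"
   and Gf: "!!u k. u \<in> ball u0 q ==> g u ~= 0 ==> continuous_on (cball 0 r) k ==> k holomorphic_on ball 0 r ==>
    (!!t. norm t <= r ==> g (u + t *s e) ~= 0 ==> k t = f (u + t *s e)) ==> G u = f u"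
  define d where "d = min q (min q1 q2)"
  have d: "d > 0" "ball u0 d <= ball u0 q" "ball u0 d <= ball u0 q1" "ball u0 d <= ball u0 q2"
   using q q1 q2 by (auto simp: d_def)
  define W where "W = {u\<in>V. g u ~= 0}"
  have W: "open W" using hol3_open[OF f] by (simp add: W_def)
  define M where "M = {u \<in> W \<inter> ball u0 d. G u - f u ~= 0}"
  have "continuous_on (W \<inter> ball u0 d) (%u. G u - f u)"
   by (intro continuous_intros continuous_on_subset[OF hol3_continuous[OF G(1)]]
     continuous_on_subset[OF hol3_continuous[OF f]]) (use d in \<open>auto simp: W_def\<close>)
  hence "open ((W \<inter> ball u0 d) \<inter> (%u. G u - f u) -` (-{0}))"
   by (rule continuous_open_preimage) (use W in auto)
  hence M: "open M" by (simp add: M_def Int_def vimage_def)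
  have "M = {}"
  proof (rule ccontr)
   assume "M ~= {}"
   moreover have "M <= ball u0 q1" using d by (auto simp: M_def)
   ultimately have "\<exists>u\<in>M. \<forall>p. norm p < r & g (u + p *s e) = 0 --> (\<exists>L. ((%t. f (u + t *s e)) \<longlongrightarrow> L) (at p))"
    using M by (intro dense'[rule_format] conjI)
   then obtain u where u: "u \<in> M" and
    L': "\<forall>p. norm p < r & g (u + p *s e) = 0 --> (\<exists>L. ((%t. f (u + t *s e)) \<longlongrightarrow> L) (at p))" by (elim bexE)
   have L: "\<exists>L. ((%t. f (u + t *s e)) \<longlongrightarrow> L) (at p)" if "norm p < r" "g (u + p *s e) = 0" for p
    using L' that by (metis (no_types))
   have ub: "u \<in> ball u0 d" "g u ~= 0" using u by (auto simp: M_def W_def)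
   let ?h = "%t. g (u + t *s e)"
   have hol: "?h holomorphic_on ball 0 R"
    by (rule line_holomorphic[OF g]) (use tube ub d in auto)
   define O' where "O' = {t \<in> ball 0 R. ?h t ~= 0}"
   have "open (ball 0 R \<inter> ?h -` (-{0}))"
    by (rule continuous_open_preimage[OF holomorphic_on_imp_continuous_on[OF hol]]) auto
   hence O': "open O'" by (simp add: O'_def Int_def vimage_def)
   have fO: "(%t. f (u + t *s e)) holomorphic_on O'"
    by (rule line_holomorphic[OF f]) (use tube ub d in \<open>auto simp: O'_def\<close>)
   define k where "k = (%t. if ?h t = 0 then (SOME L. ((%t. f (u + t *s e)) \<longlongrightarrow> L) (at t)) else f (u + t *s e))"
   have kO: "k holomorphic_on O'"
    by (rule holomorphic_transform[OF fO]) (auto simp: k_def O'_def)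
   have finZ: "finite {t. norm t < r & ?h t = 0}"
    by (rule zero_count(1)[OF hol r]) (use nz' ub d in auto)
   have cont: "isCont k t" if t: "norm t <= r" for t
   proof (cases "?h t = 0")
    case False
    hence "t \<in> O'" using t r by (simp add: O'_def)
    thus ?thesis using kO O' holomorphic_on_imp_continuous_on continuous_on_eq_continuous_at by blast
   next
    case True
    hence tr: "norm t < r" using t nz'[of u t] ub d by (cases "norm t = r") auto
    have lim: "((%t. f (u + t *s e)) \<longlongrightarrow> k t) (at t)"
     using someI_ex[OF L[OF tr True]] True by (simp add: k_def)
    have "finite ({t. norm t < r & ?h t = 0} - {t})" using finZ by simp
    hence "open (ball 0 r - ({t. norm t < r & ?h t = 0} - {t}))"
     by (intro open_Diff finite_imp_closed) auto
    moreover have "t \<in> ball 0 r - ({t. norm t < r & ?h t = 0} - {t})" using tr by simp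
    ultimately have "\<forall>\<^sub>F s in at t. s \<in> ball 0 r - ({t. norm t < r & ?h t = 0} - {t})"
     by (rule eventually_at_in_open')
    moreover have "\<forall>\<^sub>F s in at t. s ~= t" by (simp add: eventually_at_filter)
    ultimately have "\<forall>\<^sub>F s in at t. f (u + s *s e) = k s"
     by eventually_elim (auto simp: k_def)
    hence "(k \<longlongrightarrow> k t) (at t)" using lim by (simp cong: tendsto_cong)
    thus ?thesis by (simp add: isCont_def)
   qed
   have kc: "continuous_on (cball 0 r) k" by (rule continuous_at_imp_continuous_on) (use cont in auto)
   have kh: "k holomorphic_on ball 0 r"
   proof (rule no_isolated_singularity[OF continuous_on_subset[OF kc] _ _ finZ])
    show "k holomorphic_on ball 0 r - {t. norm t < r & ?h t = 0}"
     by (rule holomorphic_on_subset[OF kO]) (use r in \<open>auto simp: O'_def\<close>)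
   qed auto
   have "G u = f u" by (rule Gf[OF _ ub(2) kc kh]) (use ub d in \<open>auto simp: k_def\<close>)
   thus False using u by (simp add: M_def)
  qed
  have eq: "G u = f u" if "u \<in> ball u0 d" "g u ~= 0" for u
  proof -
   have "u \<in> V" using that(1) d(2) G(2) by blast
   thus ?thesis using \<open>M = {}\<close> that unfolding M_def W_def by fastforce
  qed
  show ?thesis
  proof (intro exI[of _ d] exI[of _ G] conjI ballI impI)
   show "hol3 G (ball u0 d)" by (rule hol3_subset[OF G(1) d(2)]) auto
  qed (use d G eq in auto)
 qed auto
qed

lemma partial_zero [simp]: "partial i (%_. c) v = 0"
 by (simp add: partial_def)

text \<open>If \<open>f\<close> vanished on a ball, so would its partial derivatives, and no zero in
  the ball would be regular.\<close>

lemma reduced_nonzero_closure: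
 assumes f: "hol3 f V" and red: "{v\<in>V. f v = 0} <= closure {v\<in>V. regular_zero f v}" and u0: "u0 \<in> V"
 shows "u0 \<in> closure {w\<in>V. f w ~= 0}"
proof (rule ccontr)
 assume n: "u0 ~: closure {w\<in>V. f w ~= 0}"
 hence "open (V - closure {w\<in>V. f w ~= 0})" using hol3_open[OF f] by auto
 then obtain R where R: "R > 0" "ball u0 R <= V - closure {w\<in>V. f w ~= 0}"
  unfolding open_contains_ball using n u0 by blast
 have z: "f w = 0" if "w \<in> ball u0 R" for w
  using R(2) that closure_subset[of "{w\<in>V. f w ~= 0}"] by blast
 have "u0 \<in> closure {v\<in>V. regular_zero f v}" using red u0 z[of u0] R by auto
 then obtain v where v: "v \<in> ball u0 R" "regular_zero f v"
  using R(1) unfolding closure_approachable mem_ball by (metis (no_types, lifting) dist_commute mem_Collect_eq)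
 have "partial i f v = partial i (%_. 0) v" for i
  by (rule partial_cong_open[OF open_ball v(1)]) (use z in auto)
 thus False using v(2) by (auto simp: regular_zero_def)
qed

text \<open>Along a line meeting the zero set of \<open>g\<close> in simple zeros only, l'Hopital's
  rule gives the limits of \<open>F / g\<close>. Such lines are generic because \<open>g\<close> is
  reduced.\<close>

lemma division_local:
 assumes g: "hol3 g V" and F: "hol3 F V"
  and red: "{v\<in>V. g v = 0} <= closure {v\<in>V. regular_zero g v}"
  and van: "!!v. v \<in> V ==> g v = 0 ==> F v = 0" and u0: "u0 \<in> V"
 shows "\<exists>d>0. \<exists>G. ball u0 d <= V & hol3 G (ball u0 d) & (\<forall>u\<in>ball u0 d. F u = G u * g u)"
proof -
 obtain e r R where r: "0 < r" "r < R" and l: "!!t. norm t <= R ==> u0 + t *s e \<in> V"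
  and nz: "!!t. norm t = r ==> g (u0 + t *s e) ~= 0"
  using good_line[OF g u0 reduced_nonzero_closure[OF g red u0]] by (elim exE conjE) blast
 have W: "open {u\<in>V. g u ~= 0}"
 proof -
  have "open (V \<inter> g -` (-{0}))"
   by (rule continuous_open_preimage[OF hol3_continuous[OF g] hol3_open[OF g]]) auto
  thus ?thesis by (simp add: Int_def vimage_def)
 qed
 have f: "hol3 (%u. F u / g u) {u\<in>V. g u ~= 0}"
  by (intro hol3_divide hol3_subset[OF g] hol3_subset[OF F] W) auto
 have "\<exists>d>0. \<forall>u\<in>ball u0 d. \<forall>t. norm t <= R --> u + t *s e \<in> V"
 proof (rule tube_nbhd[OF hol3_open[OF g] l hol3_continuous[OF g] nz less_imp_le[OF r(2)]])
  fix d assume "d > 0" "!!u t. u \<in> ball u0 d ==> norm t <= R ==> u + t *s e \<in> V"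
  thus "\<exists>d>0. \<forall>u\<in>ball u0 d. \<forall>t. norm t <= R --> u + t *s e \<in> V" by (intro exI[of _ d]) auto
 qed auto
 then obtain d2 where d2: "d2 > 0" and tube: "!!u t. u \<in> ball u0 d2 ==> norm t <= R ==> u + t *s e \<in> V"
  by (elim exE conjE) blast
 have "\<exists>d>0. \<forall>M. open M & M ~= {} & M <= ball u0 d -->
   (\<exists>u\<in>M. \<forall>t. norm t < r & g (u + t *s e) = 0 --> dird e g (u + t *s e) ~= 0)"
  by (rule generic_simple_zeros[OF g r l nz red]) auto
 then obtain d1 where d1: "d1 > 0" and gen: "!!M. open M ==> M ~= {} ==> M <= ball u0 d1 ==>
   \<exists>u\<in>M. \<forall>t. norm t < r & g (u + t *s e) = 0 --> dird e g (u + t *s e) ~= 0"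
  by (elim exE conjE) blast
 have "\<exists>d>0. \<exists>G. ball u0 d <= V & hol3 G (ball u0 d) & (\<forall>u\<in>ball u0 d. g u ~= 0 --> G u = F u / g u)"
 proof (rule general_extension[OF g f r l nz])
  show "\<exists>d>0. \<forall>M. open M & M ~= {} & M <= ball u0 d --> (\<exists>u\<in>M. \<forall>p. norm p < r & g (u + p *s e) = 0 -->
      (\<exists>L. ((%t. F (u + t *s e) / g (u + t *s e)) \<longlongrightarrow> L) (at p)))"
  proof (intro exI[of _ "min d1 d2"] conjI allI impI)
   fix M assume M: "open M & M ~= {} & M <= ball u0 (min d1 d2)"
   hence "M <= ball u0 d1" by auto
   then obtain u where u: "u \<in> M" "!!t. norm t < r ==> g (u + t *s e) = 0 ==> dird e g (u + t *s e) ~= 0"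
    using gen[of M] M by blast
   have ub: "u \<in> ball u0 d2" using u M by auto
   show "\<exists>u\<in>M. \<forall>p. norm p < r & g (u + p *s e) = 0 --> (\<exists>L. ((%t. F (u + t *s e) / g (u + t *s e)) \<longlongrightarrow> L) (at p))"
   proof (intro bexI[OF _ u(1)] allI impI)
    fix p assume p: "norm p < r & g (u + p *s e) = 0"
    have pV: "u + p *s e \<in> V" using tube[OF ub] p r by simp
    show "\<exists>L. ((%t. F (u + t *s e) / g (u + t *s e)) \<longlongrightarrow> L) (at p)"
     by (rule exI, rule lhopital_complex_simple[OF line_dird[OF F pV] line_dird[OF g pV]])
       (use p van[OF pV] u(2) in auto)
   qed
  qed (use d1 d2 in auto)
 qed auto
 then obtain d G where d: "d > 0" "ball u0 d <= V" "hol3 G (ball u0 d)"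
  "!!u. u \<in> ball u0 d ==> g u ~= 0 ==> G u = F u / g u" by (elim exE conjE) blast
 have "F u = G u * g u" if "u \<in> ball u0 d" for u
  using d(4)[OF that] van[of u] d(2) that by (cases "g u = 0") auto
 thus ?thesis using d by blast
qed

lemma continuous_eq_on_dense:
 fixes f g :: "complex^3 => complex"
 assumes U: "open U" and f: "continuous_on U f" and g: "continuous_on U g"
  and D: "!!M. open M ==> M ~= {} ==> \<exists>x\<in>M. x ~: D"
  and eq: "!!u. u \<in> U ==> u ~: D ==> f u = g u" and u: "u \<in> U"
 shows "f u = g u"
proof (rule ccontr)
 assume ne: "f u ~= g u"
 have "continuous_on U (%u. f u - g u)" by (intro continuous_intros f g)
 hence "open (U \<inter> (%u. f u - g u) -` (-{0}))" by (rule continuous_open_preimage[OF _ U]) auto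
 moreover have "u \<in> U \<inter> (%u. f u - g u) -` (-{0})" using u ne by simp
 ultimately obtain x where "x \<in> U \<inter> (%u. f u - g u) -` (-{0})" "x ~: D" using D by blast
 thus False using eq by auto
qed

text \<open>Local extensions agree on overlaps because the complement of \<open>D\<close> is
  dense.\<close>

lemma extension_glue:
 fixes D :: "(complex^3) set"
 assumes f: "hol3 f (-D)"
  and D: "!!M. open M ==> M ~= {} ==> \<exists>x\<in>M. x ~: D"
  and loc: "!!u0. u0 \<in> D ==> \<exists>d>0. \<exists>G. hol3 G (ball u0 d) & (\<forall>u\<in>ball u0 d - D. G u = f u)"
 shows "\<exists>F. entire F & (\<forall>u. u ~: D --> F u = f u)"
proof -
 from loc have "\<forall>u0\<in>D. \<exists>p. fst p > 0 & hol3 (snd p) (ball u0 (fst p)) & (\<forall>u\<in>ball u0 (fst p) - D. snd p u = f u)"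
  by (metis fst_conv snd_conv)
 then obtain p where p: "!!u0. u0 \<in> D ==> fst (p u0) > 0 & hol3 (snd (p u0)) (ball u0 (fst (p u0))) & (\<forall>u\<in>ball u0 (fst (p u0)) - D. snd (p u0) u = f u)"
  by metis
 define d where "d = fst \<circ> p"
 define G where "G = snd \<circ> p"
 have G: "d u0 > 0" "hol3 (G u0) (ball u0 (d u0))" "!!u. u \<in> ball u0 (d u0) ==> u ~: D ==> G u0 u = f u"
  if "u0 \<in> D" for u0 using p[OF that] by (auto simp: d_def G_def)
 define F where "F = (%u. if u \<in> D then G u u else f u)"
 have FG: "F v = G u0 v" if u0: "u0 \<in> D" and v: "v \<in> ball u0 (d u0)" for u0 v
 proof (cases "v \<in> D")
  case True
  have "G v v = G u0 v"
  proof (rule continuous_eq_on_dense[where U="ball u0 (d u0) \<inter> ball v (d v)" and D=D and f="G v" and g="G u0"])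
   show "continuous_on (ball u0 (d u0) \<inter> ball v (d v)) (G v)"
    by (rule continuous_on_subset[OF hol3_continuous[OF G(2)[OF True]]]) auto
   show "continuous_on (ball u0 (d u0) \<inter> ball v (d v)) (G u0)"
    by (rule continuous_on_subset[OF hol3_continuous[OF G(2)[OF u0]]]) auto
  qed (use D G True u0 v in auto)
  thus ?thesis using True by (simp add: F_def)
 qed (use G u0 v in \<open>auto simp: F_def\<close>)
 have "entire F"
 proof (rule hol3_locally)
  fix u :: "complex^3"
  show "\<exists>V. u \<in> V & hol3 F V"
  proof (cases "u \<in> D")
   case True
   have "hol3 F (ball u (d u))" by (rule hol3_cong[OF G(2)[OF True]]) (use FG True in auto)
   thus ?thesis using G(1)[OF True] by (intro exI[of _ "ball u (d u)"]) auto
  next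
   case False
   have "hol3 F (-D)" by (rule hol3_cong[OF f]) (auto simp: F_def)
   thus ?thesis using False by blast
  qed
 qed auto
 thus ?thesis by (intro exI[of _ F]) (auto simp: F_def)
qed

lemma dense_nonzero:
 assumes "entire f" "f w ~= 0" "open M" "M ~= {}"
 shows "\<exists>x\<in>M. x ~: {u. f u = 0}"
 using hol3_zero_from_open[OF assms(1,3,4), of w] assms(2) by auto

lemma division_entire:
 assumes f: "entire f" and F: "entire F"
  and red: "{v. f v = 0} <= closure {v. regular_zero f v}"
  and van: "!!v. f v = 0 ==> F v = 0" and nz: "f w ~= 0"
 shows "\<exists>G. entire G & (\<forall>u. F u = G u * f u)"
proof -
 let ?D = "{u. f u = 0}"
 have op: "open (- ?D)"
  using hol3_continuous[OF f] by (intro open_Compl closed_Collect_eq) auto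
 have "\<exists>G. entire G & (\<forall>u. u ~: ?D --> G u = F u / f u)"
 proof (rule extension_glue)
  show "hol3 (%u. F u / f u) (- ?D)"
   by (intro hol3_divide hol3_subset[OF f] hol3_subset[OF F] op) auto
  show "\<exists>x\<in>M. x ~: ?D" if "open M" "M ~= {}" for M using dense_nonzero[OF f nz that] .
  fix u0 assume "u0 \<in> ?D"
  obtain e G where d: "e > 0" "hol3 G (ball u0 e)" "!!u. u \<in> ball u0 e ==> F u = G u * f u"
   using division_local[OF f F _ _ , of u0] red van by auto
  thus "\<exists>e>0. \<exists>G. hol3 G (ball u0 e) & (\<forall>u\<in>ball u0 e - ?D. G u = F u / f u)"
   by (intro exI[of _ e] conjI exI[of _ G]) auto
 qed
 then obtain G where G: "entire G" "!!u. f u ~= 0 ==> G u = F u / f u" by auto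
 have "F u = G u * f u" for u using G(2)[of u] van[of u] by (cases "f u = 0") auto
 thus ?thesis using G by blast
qed

section \<open>Fourier coefficients and spaces of theta functions\<close>

text \<open>For a primitive \<open>P\<close> the mean is \<open>P (z + 1) - P z\<close>, whose
  derivative vanishes by periodicity. The point is that \<open>z\<close> is complex: the line of
  integration may be moved off the real axis.\<close>

lemma entire_periodic_mean:
 fixes g :: "complex => complex"
 assumes g: "g holomorphic_on UNIV" and per: "!!z. g (z + 1) = g z"
 shows "integral {0..1} (%s. g (z + of_real s)) = integral {0..1} (%s. g (of_real s))"
proof -
 obtain P where P: "!!x. DERIV P x :> g x"
  using holomorphic_convex_primitive[of UNIV "{}" g] g holomorphic_on_imp_continuous_on[OF g]
  by (auto simp: holomorphic_on_def)
 have 1: "integral {0..1} (%s. g (z + of_real s)) = P (z + 1) - P z" for z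
 proof -
  have "((%s. g (z + of_real s)) has_integral P (z + of_real 1) - P (z + of_real 0)) {0..1}"
  proof (rule fundamental_theorem_of_calculus)
   fix s :: real assume "s \<in> {0..1}"
   have "((%s. P (z + of_real s)) has_vector_derivative 1 * g (z + of_real s)) (at s within {0..1})"
    by (rule field_vector_diff_chain_within[where f="%s. z + of_real s" and g=P, unfolded o_def])
      (auto intro!: derivative_eq_intros has_field_derivative_at_within[OF P])
   thus "((%s. P (z + of_real s)) has_vector_derivative g (z + of_real s)) (at s within {0..1})" by simp
  qed auto
  thus ?thesis by (simp add: integral_unique)
 qed
 have "DERIV (%z. P (z + 1) - P z) z :> g (z + 1) - g z" for z
  using DERIV_shift[of P "g (z + 1)" z 1] P[of "z + 1"] by (intro DERIV_diff P) simp
 hence "\<exists>c. \<forall>z\<in>UNIV. P (z + 1) - P z = c"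
  by (intro has_field_derivative_zero_constant) (auto simp: per intro: has_field_derivative_at_within)
 then obtain c where "!!z. P (z + 1) - P z = c" by blast
 from this[of z] this[of 0] show ?thesis using 1[of z] 1[of 0] by simp
qed

definition expi2 :: "complex => complex" where
 "expi2 z = exp (2 * of_real pi * \<i> * z)"

lemma expi2_add: "expi2 (x + y) = expi2 x * expi2 y"
 by (simp add: expi2_def exp_add ring_distribs)

lemma expi2_minus: "expi2 (- x) = inverse (expi2 x)"
 by (simp add: expi2_def exp_minus)

lemma expi2_diff: "expi2 (x - y) = expi2 x / expi2 y"
 by (simp add: expi2_def exp_diff ring_distribs)

lemma expi2_0 [simp]: "expi2 0 = 1" by (simp add: expi2_def)

lemma expi2_nz [simp]: "expi2 z ~= 0" by (simp add: expi2_def)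

lemma expi2_eq_1_iff: "expi2 z = 1 \<longleftrightarrow> z \<in> \<int>"
proof -
 have "expi2 z = 1 \<longleftrightarrow> Im z = 0 & (\<exists>n::int. Re z = of_int n)"
  by (auto simp: expi2_def exp_eq_1)
 also have "\<dots> \<longleftrightarrow> (\<exists>n::int. z = of_int n)" by (auto simp: complex_eq_iff)
 finally show ?thesis by (auto simp: Ints_def)
qed

lemma expi2_of_int [simp]: "expi2 (of_int n) = 1"
 by (simp add: expi2_eq_1_iff)

lemma expi2_surj: "z ~= 0 ==> \<exists>a. expi2 a = z"
 by (intro exI[of _ "Ln z / (2 * of_real pi * \<i>)"]) (simp add: expi2_def)

lemma DERIV_expi2: "(expi2 has_field_derivative 2 * of_real pi * \<i> * expi2 z) (at z within S)"
 unfolding expi2_def by (auto intro!: derivative_eq_intros)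

lemma holomorphic_expi2 [holomorphic_intros]:
 "f holomorphic_on S ==> (%z. expi2 (f z)) holomorphic_on S"
 unfolding expi2_def by (intro holomorphic_intros)

lemma continuous_expi2 [continuous_intros]:
 "continuous_on S f ==> continuous_on S (%z. expi2 (f z))"
 unfolding expi2_def by (intro continuous_intros)

lemma norm_expi2: "norm (expi2 z) = exp (- 2 * pi * Im z)"
 by (simp add: expi2_def norm_exp_eq_Re)

lemma hol3_expi2: "hol3 f U ==> hol3 (%u. expi2 (f u)) U"
 by (rule hol3_compose) (auto intro: DERIV_expi2)

text \<open>For nonzero \<open>n\<close>, moving the line of integration by \<open>\<i>\<close>
  multiplies the integral by a factor of modulus different from 1.\<close>

lemma integral_expi2:
 "integral {0..1} (%s. expi2 (of_int n * of_real s)) = (if n = 0 then 1 else 0)"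
proof (cases "n = 0")
 case False
 let ?g = "%z. expi2 (of_int n * z)"
 have "integral {0..1} (%s. ?g (\<i> + of_real s)) = integral {0..1} (%s. ?g (of_real s))"
  by (rule entire_periodic_mean) (auto intro!: holomorphic_intros simp: ring_distribs expi2_add)
 moreover have "integral {0..1} (%s. ?g (\<i> + of_real s)) = expi2 (of_int n * \<i>) * integral {0..1} (%s. ?g (of_real s))"
  by (simp add: ring_distribs expi2_add)
 moreover have "norm (expi2 (of_int n * \<i>)) ~= 1" using False by (simp add: norm_expi2)
 hence "expi2 (of_int n * \<i>) ~= 1" by auto
 ultimately show ?thesis using False by simp
qed simp

text \<open>Dividing \<open>h - h 0\<close> by \<open>1 - e\<^sup>2\<^sup>\<pi>\<^sup>i\<^sup>z\<close> turns the Fourier coefficients of \<open>h\<close> into differences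
 of coefficients that tend to zero in both directions, so that their sum \<open>h 0\<close> vanishes
 (Chernoff's proof of pointwise convergence).\<close>

lemma fourier_zero_at_0:
 fixes h :: "complex => complex"
 assumes h: "h holomorphic_on UNIV" and per: "!!z. h (z + 1) = h z"
  and c0: "!!n::int. integral {0..1} (%s. h (of_real s) * expi2 (- (of_int n * of_real s))) = 0"
 shows "h 0 = 0"
proof -
 have hint: "h (of_int n) = h 0" for n :: int
 proof -
  have nat: "h (z + of_nat k) = h z" for z k
   by (induction k) (use per[of "z + of_nat k" for k] in \<open>auto simp: add_ac\<close>)
  show ?thesis
  proof (cases "n >= 0")
   case True thus ?thesis using nat[of 0 "nat n"] by simp
  next
   case False thus ?thesis using nat[of "of_int n" "nat (-n)"] by simp
  qed
 qed
 \<comment> \<open>The division is carried out in three variables, on functions of the first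
   coordinate alone, in order to reuse \<open>division_entire\<close>.\<close>
 let ?f = "%u::complex^3. 1 - expi2 (u $ 1)"
 have f: "entire ?f" by (intro hol3_diff hol3_const hol3_expi2 hol3_component) auto
 have F: "hol3 (%u. h (u $ 1) - h 0) UNIV"
 proof (intro hol3_diff hol3_const)
  show "hol3 (%u. h (u $ 1)) UNIV"
   by (rule hol3_compose[OF hol3_component, where f'="%u. deriv h (u $ 1)"])
     (use h in \<open>auto intro: holomorphic_derivI\<close>)
 qed auto
 have reg: "regular_zero ?f u" if "?f u = 0" for u
 proof -
  have "DERIV (%t. ?f (u + axis 1 t)) 0 :> - (2 * of_real pi * \<i> * expi2 (u $ 1))"
   by (auto simp: axis_def expi2_def intro!: derivative_eq_intros)
  from partial_eqI'[OF this] show ?thesis using that by (auto simp: regular_zero_def intro!: exI[of _ 1])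
 qed
 have van: "h (u $ 1) - h 0 = 0" if "?f u = 0" for u :: "complex^3"
 proof -
  have "u $ 1 \<in> \<int>" using that expi2_eq_1_iff[of "u $ 1"] by simp
  then obtain n where "u $ 1 = of_int n" by (auto elim: Ints_cases)
  thus ?thesis using hint by simp
 qed
 have nz: "?f (axis 1 (1/2)) ~= 0"
 proof
  assume "?f (axis 1 (1/2)) = 0"
  hence "(1/2 :: complex) \<in> \<int>" using expi2_eq_1_iff[of "1/2"] by (simp add: axis_def)
  then obtain n :: int where "(1/2 :: complex) = of_int n" by (auto elim: Ints_cases)
  hence "of_int (2 * n) = (of_int 1 :: complex)" by (simp add: mult.commute)
  hence "2 * n = 1" by (simp only: of_int_eq_iff)
  thus False by presburger
 qed
 have "{v. ?f v = 0} <= closure {v. regular_zero ?f v}" using reg closure_subset by blast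
 from division_entire[OF f F this van nz]
 obtain G where G: "entire G" "!!u. h (u $ 1) - h 0 = G u * (1 - expi2 (u $ 1))" by blast
 define K where "K = (%t. G (0 + t *s axis 1 1))"
 have K: "K holomorphic_on UNIV" unfolding K_def by (rule line_holomorphic[OF G(1)]) auto
 have Kh: "h t - h 0 = K t * (1 - expi2 t)" for t
  using G(2)[of "0 + t *s axis 1 1"] by (simp add: K_def axis_def)
 have Kper: "K (t + 1) = K t" for t
 proof -
  let ?S = "ball (1/2 :: complex) (1/4)"
  have "K (t + 1) - K t = 0"
  proof (rule analytic_continuation_open[of ?S UNIV "%t. K (t + 1) - K t" "%_. 0" t])
   show "(%t. K (t + 1) - K t) holomorphic_on UNIV"
    by (intro holomorphic_intros holomorphic_on_compose_gen[OF _ K, unfolded o_def] K) auto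
   fix z :: complex assume z: "z \<in> ?S"
   have "z ~: \<int>"
   proof
    assume "z \<in> \<int>"
    then obtain n where n: "z = of_int n" by (auto elim: Ints_cases)
    have "\<bar>Re (1/2 - z)\<bar> < 1/4" using z abs_Re_le_cmod[of "1/2 - z"] by (simp add: dist_norm)
    hence "\<bar>1 / 2 - real_of_int n\<bar> < 1/4" by (simp add: n)
    hence "0 < real_of_int n" "real_of_int n < 1" by linarith+
    hence "0 < n" "n < 1" by simp_all
    thus False by simp
   qed
   hence "1 - expi2 z ~= 0" using expi2_eq_1_iff[of z] by auto
   moreover have "K (z + 1) * (1 - expi2 z) = K z * (1 - expi2 z)"
    using Kh[of z] Kh[of "z + 1"] per[of z] expi2_of_int[of 1] by (auto simp: expi2_add)
   ultimately show "K (z + 1) - K z = 0" by simp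
  qed auto
  thus ?thesis by simp
 qed
 define c where "c = (%n::int. integral {0..1} (%s. K (of_real s) * expi2 (- (of_int n * of_real s))))"
 have intK: "(%s. K (of_real s) * expi2 (- (of_int n * of_real s))) integrable_on {0..1}" for n :: int
  by (intro integrable_continuous_interval continuous_intros
    continuous_on_compose2[OF holomorphic_on_imp_continuous_on[OF K]]) auto
 have inth: "(%s. h (of_real s) * expi2 (- (of_int n * of_real s))) integrable_on {0..1}" for n :: int
  by (intro integrable_continuous_interval continuous_intros
    continuous_on_compose2[OF holomorphic_on_imp_continuous_on[OF h]]) auto
 \<comment> \<open>The coefficients of \<open>h\<close> vanish, so only the constant
   \<open>h 0\<close> contributes, and \<open>c\<close> can jump at \<open>n = 0\<close>
   alone.\<close>
 have rec: "c n - c (n - 1) = (if n = 0 then - h 0 else 0)" for n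
 proof -
  have "c n - c (n - 1) = integral {0..1} (%s. K (of_real s) * expi2 (- (of_int n * of_real s)) - K (of_real s) * expi2 (- (of_int (n - 1) * of_real s)))"
   unfolding c_def by (rule integral_diff[symmetric]) (rule intK)+
  also have "\<dots> = integral {0..1} (%s. h (of_real s) * expi2 (- (of_int n * of_real s)) - h 0 * expi2 (of_int (- n) * of_real s))"
  proof (rule integral_cong)
   fix s :: real
   define e x where "e = expi2 (- (of_int n * of_real s))" and "x = expi2 (of_real s)"
   have e1: "expi2 (- (of_int (n - 1) * of_real s)) = e * x"
    unfolding e_def x_def by (simp add: algebra_simps flip: expi2_add)
   have e2: "expi2 (of_int (- n) * of_real s) = e" by (simp add: e_def)
   have "K (of_real s) * e - K (of_real s) * (e * x) = (K (of_real s) * (1 - x)) * e" by (simp add: algebra_simps)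
   also have "\<dots> = h (of_real s) * e - h 0 * e" unfolding x_def Kh[symmetric] by (simp add: algebra_simps)
   finally show "K (of_real s) * expi2 (- (of_int n * of_real s)) - K (of_real s) * expi2 (- (of_int (n - 1) * of_real s))
    = h (of_real s) * expi2 (- (of_int n * of_real s)) - h 0 * expi2 (of_int (- n) * of_real s)"
    unfolding e1 e2 by (simp only: e_def)
  qed
  also have "\<dots> = integral {0..1} (%s. h (of_real s) * expi2 (- (of_int n * of_real s))) - integral {0..1} (%s. h 0 * expi2 (of_int (- n) * of_real s))"
   by (rule integral_diff[OF inth]) (intro integrable_continuous_interval continuous_intros)
  also have "\<dots> = (if n = 0 then - h 0 else 0)"
   using integral_expi2[of "-n"] c0[of n] by simp
  finally show ?thesis .
 qed
 have shift: "c n = integral {0..1} (%s. K (z + of_real s) * expi2 (- (of_int n * (z + of_real s))))" for n z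
  unfolding c_def
  by (rule entire_periodic_mean[where g="%t. K t * expi2 (- (of_int n * t))", symmetric])
    (use expi2_of_int[of "-n"] in \<open>auto intro!: holomorphic_intros K simp: Kper ring_distribs expi2_add expi2_diff expi2_minus\<close>)
 \<comment> \<open>The coefficient may be computed on any horizontal line; heights -1 and 1 give
   exponential decay towards plus and minus infinity.\<close>
 have bound: "\<exists>B. \<forall>n. norm (c n) <= B * norm (expi2 (- (of_int n * z)))" for z
 proof -
  have "compact ((%s. K (z + of_real s)) ` {0..1})"
   by (intro compact_continuous_image continuous_intros continuous_on_compose2[OF holomorphic_on_imp_continuous_on[OF K]]) auto
  hence "bounded ((%s. K (z + of_real s)) ` {0..1})" by (rule compact_imp_bounded)
  then obtain B where B: "!!s. s \<in> {0..1} ==> norm (K (z + of_real s)) <= B"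
   unfolding bounded_iff by blast
  have "norm (c n) <= B * norm (expi2 (- (of_int n * z)))" for n
  proof -
   have "norm (integral {0..1} (%s. K (z + of_real s) * expi2 (- (of_int n * (z + of_real s))))) <= (B * norm (expi2 (- (of_int n * z)))) * (1 - 0)"
   proof (rule integral_bound)
    show "continuous_on {0..1} (%s. K (z + of_real s) * expi2 (- (of_int n * (z + of_real s))))"
     by (intro continuous_intros continuous_on_compose2[OF holomorphic_on_imp_continuous_on[OF K]]) auto
    fix s :: real assume "s \<in> {0..1}"
    thus "norm (K (z + of_real s) * expi2 (- (of_int n * (z + of_real s)))) <= B * norm (expi2 (- (of_int n * z)))"
     using B[of s] by (simp add: norm_mult norm_expi2 mult_right_mono)
   qed simp
   thus ?thesis by (simp add: shift[of n z])
  qed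
  thus ?thesis by blast
 qed
 have "c (int n) = c 0" for n
 proof (induction n)
  case (Suc n) thus ?case using rec[of "int (Suc n)"] by simp
 qed simp
 hence pos: "(%n. c (int n)) \<longlonglongrightarrow> c 0" by simp
 have "c (- int (Suc n)) = c (- 1)" for n
 proof (induction n)
  case (Suc n) thus ?case using rec[of "- int (Suc n)"] by (simp add: algebra_simps)
 qed simp
 hence neg: "(%n. c (- int (Suc n))) \<longlonglongrightarrow> c (- 1)" by simp
 have geo: "(%n. B * exp (- 2 * pi * real n)) \<longlonglongrightarrow> 0" for B
 proof -
  have "(%n. B * exp (- 2 * pi) ^ n) \<longlonglongrightarrow> B * 0"
   by (intro tendsto_intros LIMSEQ_power_zero) simp
  thus ?thesis by (simp flip: exp_of_nat_mult add: mult_ac)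
 qed
 obtain B1 where B1: "!!n. norm (c n) <= B1 * norm (expi2 (- (of_int n * (-\<i>))))" using bound[of "-\<i>"] by blast
 have "(%n. c (int n)) \<longlonglongrightarrow> 0"
  by (rule Lim_null_comparison[OF _ geo[of B1]]) (use B1[of "int n" for n] in \<open>auto simp: norm_expi2\<close>)
 hence z0: "c 0 = 0" using pos LIMSEQ_unique by blast
 obtain B2 where B2: "!!n. norm (c n) <= B2 * norm (expi2 (- (of_int n * \<i>)))" using bound[of "\<i>"] by blast
 have "(%n. c (- int (Suc n))) \<longlonglongrightarrow> 0"
  by (rule Lim_null_comparison[OF _ LIMSEQ_Suc[OF geo[of B2]]]) (use B2[of "- int (Suc n)" for n] in \<open>auto simp: norm_expi2 algebra_simps\<close>)
 hence "c (- 1) = 0" using neg LIMSEQ_unique by blast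
 thus ?thesis using rec[of 0] z0 by simp
qed

lemma fourier_zero:
 fixes h :: "complex => complex"
 assumes h: "h holomorphic_on UNIV" and per: "!!z. h (z + 1) = h z"
  and c0: "!!n::int. integral {0..1} (%s. h (of_real s) * expi2 (- (of_int n * of_real s))) = 0"
 shows "h z = 0"
proof -
 have "(%s. h (z + s)) 0 = 0"
 proof (rule fourier_zero_at_0)
  show "(%s. h (z + s)) holomorphic_on UNIV"
   by (intro holomorphic_on_compose_gen[OF _ h, unfolded o_def] holomorphic_intros) auto
  show "h (z + (w + 1)) = h (z + w)" for w using per[of "z + w"] by (simp add: add_ac)
  fix n :: int
  let ?g = "%t. h t * expi2 (- (of_int n * t))"
  have "integral {0..1} (%s. ?g (z + of_real s)) = integral {0..1} (%s. ?g (of_real s))"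
   by (rule entire_periodic_mean)
     (use expi2_of_int[of "-n"] in \<open>auto intro!: holomorphic_intros h simp: per ring_distribs expi2_add expi2_diff expi2_minus\<close>)
  also have "\<dots> = 0" by (rule c0)
  also have "(%s. ?g (z + of_real s)) = (%s. expi2 (- (of_int n * z)) * (h (z + of_real s) * expi2 (- (of_int n * of_real s))))"
   by (auto simp: ring_distribs expi2_diff expi2_minus field_simps)
  finally show "integral {0..1} (%s. h (z + of_real s) * expi2 (- (of_int n * of_real s))) = 0" by simp
 qed
 thus ?thesis by simp
qed

section \<open>Fourier coefficients of periodic entire functions of three variables\<close>

definition mean :: "3 => (complex^3 => complex) => complex^3 => complex" where
 "mean j G z = integral {0..1} (%s. G (z + axis j (of_real s)))"

lemma axis_scaleC: "axis j t = t *s (axis j 1 :: complex^3)"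
 by (simp add: axis_def vec_eq_iff)

lemma line_axis_holomorphic:
 assumes "entire G"
 shows "(%t. G (z + axis j t)) holomorphic_on UNIV"
 by (subst axis_scaleC) (rule line_holomorphic[OF assms], simp)

lemma hol3_mean: "entire G ==> entire (mean j G)"
proof -
 assume G: "entire G"
 have "continuous_on {0..1} (%s. axis j (of_real s) :: complex^3)" by (intro continuous_intros)
 from hol3_param_integral(1)[OF G _ this, of UNIV "%_. 1"]
 show ?thesis unfolding mean_def by simp
qed

lemma mean_invariant:
 assumes "entire G" "!!z. G (z + axis j 1) = G z"
 shows "mean j G (z + axis j t) = mean j G z"
proof -
 have "integral {0..1} (%s. (%t. G (z + axis j t)) (t + of_real s)) = integral {0..1} (%s. (%t. G (z + axis j t)) (of_real s))"
 proof (rule entire_periodic_mean[OF line_axis_holomorphic[OF assms(1)]])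
  fix s show "G (z + axis j (s + 1)) = G (z + axis j s)"
   using assms(2)[of "z + axis j s"] by (simp add: axis_add add_ac)
 qed
 thus ?thesis by (simp add: mean_def axis_add add_ac)
qed

lemma mean_translate: "mean j G (z + p) = mean j (%z. G (z + p)) z"
 by (simp add: mean_def add_ac)

lemma mean_periodic: "(!!z. G (z + p) = G z) ==> mean j G (z + p) = mean j G z"
 unfolding mean_translate by simp

lemma mean_cmult: "mean j (%z. c * G z) z = c * mean j G z"
 by (simp add: mean_def)

lemma mean_mult_invariant:
 assumes "!!z t. E (z + axis j t) = E z"
 shows "mean j (%z. G z * E z) z = mean j G z * E z"
 by (simp add: mean_def assms)

lemma mean_add:
 assumes "entire G" "entire H"
 shows "mean j (%z. G z + H z) z = mean j G z + mean j H z"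
proof -
 have "(%s. F (z + axis j (of_real s))) integrable_on {0..1}" if "entire F" for F
  by (intro integrable_continuous_interval continuous_on_compose2[OF hol3_continuous[OF that]] continuous_intros) auto
 thus ?thesis using assms by (simp add: mean_def integral_add)
qed

lemma mean_fourier_zero:
 assumes K: "entire K" and per: "!!z. K (z + axis j 1) = K z"
  and c0: "!!(n::int) z. mean j (%z. K z * expi2 (- (of_int n * z $ j))) z = 0"
 shows "K z = 0"
proof -
 have "(%t. K (z + axis j t)) 0 = 0"
 proof (rule fourier_zero[OF line_axis_holomorphic[OF K]])
  show "K (z + axis j (t + 1)) = K (z + axis j t)" for t
   using per[of "z + axis j t"] by (simp add: axis_add add_ac)
  fix n :: int
  have "0 = mean j (%z. K z * expi2 (- (of_int n * z $ j))) z" using c0 by simp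
  also have "\<dots> = expi2 (- (of_int n * z $ j)) * integral {0..1} (%s. K (z + axis j (of_real s)) * expi2 (- (of_int n * of_real s)))"
   unfolding mean_def integral_mult_right[symmetric]
   by (rule arg_cong[where f="integral _"]) (auto simp: axis_def ring_distribs expi2_diff expi2_minus field_simps fun_eq_iff)
  finally show "integral {0..1} (%s. K (z + axis j (of_real s)) * expi2 (- (of_int n * of_real s))) = 0" by simp
 qed
 thus ?thesis by simp
qed

text \<open>The constant Fourier coefficient, as an iteration of one-variable means so that the
  shift of contours applies to each coordinate. For periodic entire \<open>G\<close> the base point
  0 is immaterial by \<open>torus_mean_const\<close>.\<close>

definition torus_mean :: "(complex^3 => complex) => complex" where
 "torus_mean G = mean 1 (mean 2 (mean 3 G)) 0"

definition fmode :: "complex^3 => complex^3 => complex" where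
 "fmode n z = expi2 (- (\<Sum>j\<in>UNIV. n $ j * z $ j))"

lemma hol3_fmode: "entire (fmode n)"
proof -
 have "hol3 (%z. expi2 ((-1) * (\<Sum>j\<in>UNIV. n $ j * z $ j))) UNIV"
  by (intro hol3_expi2 hol3_mult hol3_const hol3_sum hol3_component) auto
 thus ?thesis unfolding fmode_def by simp
qed

lemma fmode_add: "fmode n (z + w) = fmode n z * fmode n w"
 by (simp add: fmode_def sum.distrib ring_distribs expi2_diff expi2_minus field_simps)

lemma fmode_add_left: "fmode (n + m) z = fmode n z * fmode m z"
 by (simp add: fmode_def sum.distrib ring_distribs expi2_diff expi2_minus field_simps)

lemma fmode_axis: "fmode n (axis j t) = expi2 (- (n $ j * t))"
 by (simp add: fmode_def axis_def if_distrib cong: if_cong)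

lemma fmode_nz [simp]: "fmode n z ~= 0" by (simp add: fmode_def)

text \<open>Each mean removes the dependence on one complex coordinate, so the iterated mean is
  constant on the whole space and not only along the real torus.\<close>

lemma torus_mean_translate:
 assumes G: "entire G" and per: "!!j z. G (z + axis j 1) = G z"
 shows "torus_mean (%z. G (z + p)) = torus_mean G"
proof -
 let ?M = "mean 1 (mean 2 (mean 3 G))"
 have h: "entire (mean 3 G)" "hol3 (mean 2 (mean 3 G)) UNIV"
  by (intro hol3_mean G)+
 have 1: "?M (z + axis 1 t) = ?M z" for z t
  by (intro mean_invariant h mean_periodic per)
 have 2: "?M (z + axis 2 t) = ?M z" for z t
  by (intro mean_periodic mean_invariant[OF h(1)] per)
 have 3: "?M (z + axis 3 t) = ?M z" for z t
  by (intro mean_periodic mean_invariant[OF G] per)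
 have "p = 0 + axis 1 (p $ 1) + axis 2 (p $ 2) + axis 3 (p $ 3)"
  by (auto simp: vec_eq_iff axis_def forall_3)
 hence "?M p = ?M 0" using 1 2 3 by metis
 thus ?thesis unfolding torus_mean_def
  using mean_translate[of 1 "mean 2 (mean 3 G)" 0 p] by (simp add: mean_translate)
qed

lemma torus_mean_const:
 assumes G: "entire G" and per: "!!j z. G (z + axis j 1) = G z"
 shows "mean 1 (mean 2 (mean 3 G)) p = torus_mean G"
 using torus_mean_translate[OF assms, of p] mean_translate[of 1 "mean 2 (mean 3 G)" 0 p]
 by (simp add: mean_translate torus_mean_def)

lemma torus_mean_cmult: "torus_mean (%z. c * G z) = c * torus_mean G"
proof -
 have "mean j (%z. c * H z) = (%z. c * mean j H z)" for j H by (simp add: fun_eq_iff mean_cmult)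
 thus ?thesis by (simp add: torus_mean_def)
qed

lemma torus_mean_add:
 assumes "entire G" "entire H"
 shows "torus_mean (%z. G z + H z) = torus_mean G + torus_mean H"
proof -
 have "mean j (%z. G z + H z) = (%z. mean j G z + mean j H z)"
  if "entire G" "entire H" for j G H
  using that by (simp add: fun_eq_iff mean_add)
 thus ?thesis using assms by (simp add: torus_mean_def hol3_mean)
qed

lemma torus_mean_zero [simp]: "torus_mean (%_. 0) = 0"
 by (simp add: torus_mean_def mean_def)

lemma torus_mean_sum:
 assumes "!!i. i \<in> I ==> entire (f i)"
 shows "torus_mean (%z. \<Sum>i\<in>I. x i * f i z) = (\<Sum>i\<in>I. x i * torus_mean (f i))"
 using assms
proof (induction I rule: infinite_finite_induct)
 case (insert a I)
 have "entire (%z. x a * f a z)" "entire (%z. \<Sum>i\<in>I. x i * f i z)"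
  using insert.prems by (auto intro!: hol3_mult hol3_sum)
 from torus_mean_add[OF this] insert show ?case by (simp add: torus_mean_cmult)
qed auto

text \<open>One coordinate at a time: a coefficient in the third variable is a periodic function of
  the other two, and its own coefficients are \<open>torus_mean\<close>s of \<open>G\<close> times a
  mode.\<close>

lemma torus_fourier_zero:
 assumes G: "entire G" and per: "!!j z. G (z + axis j 1) = G z"
  and c0: "!!n. (\<forall>j. n $ j \<in> \<int>) ==> torus_mean (%z. G z * fmode n z) = 0"
 shows "G z = 0"
proof -
 define E where "E = (%j (n::int) (z::complex^3). expi2 (- (of_int n * z $ j)))"
 have Eh: "entire (E j n)" for j n
 proof -
  have "hol3 (%z. expi2 ((- of_int n) * z $ j)) UNIV"
   by (intro hol3_expi2 hol3_mult hol3_const hol3_component) auto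
  thus ?thesis by (simp add: E_def)
 qed
 have Einv: "E i n (z + axis j t) = E i n z" if "i ~= j" for i j n z t
  using that by (simp add: E_def axis_def)
 have Eper: "E i n (z + axis j 1) = E i n z" for i j n z
  using expi2_of_int[of n] by (cases "i = j") (auto simp: E_def axis_def ring_distribs expi2_diff expi2_minus expi2_add)
 have mE: "mean j (%z. H z * E i n z) = (%z. mean j H z * E i n z)" if "i ~= j" for i j n H
  by (rule ext, rule mean_mult_invariant) (rule Einv[OF that])
 have K3: "mean 3 (%z. G z * E 3 n3 z) z = 0" for n3 z
 proof (rule mean_fourier_zero[where j=2])
  show "hol3 (mean 3 (%z. G z * E 3 n3 z)) UNIV" by (intro hol3_mean hol3_mult G Eh)
  show "mean 3 (%z. G z * E 3 n3 z) (z + axis 2 1) = mean 3 (%z. G z * E 3 n3 z) z" for z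
   by (intro mean_periodic) (simp add: per Eper)
  fix n2 z
  show "mean 2 (%z. mean 3 (%z. G z * E 3 n3 z) z * expi2 (- (of_int n2 * z $ 2))) z = 0"
  proof (rule mean_fourier_zero[where j=1])
   show "hol3 (mean 2 (%z. mean 3 (%z. G z * E 3 n3 z) z * expi2 (- (of_int n2 * z $ 2)))) UNIV"
    using Eh[of 2 n2] by (intro hol3_mean hol3_mult G Eh) (simp add: E_def)
   show "mean 2 (%z. mean 3 (%z. G z * E 3 n3 z) z * expi2 (- (of_int n2 * z $ 2))) (z + axis 1 1) =
     mean 2 (%z. mean 3 (%z. G z * E 3 n3 z) z * expi2 (- (of_int n2 * z $ 2))) z" for z
    by (intro mean_periodic arg_cong2[where f="(*)"]) (simp_all add: per Eper, simp add: axis_def)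
   fix n1 z
   have "mean 1 (%z. mean 2 (%z. mean 3 (%z. G z * E 3 n3 z) z * E 2 n2 z) z * E 1 n1 z) z
    = mean 1 (mean 2 (mean 3 (%z. G z * E 3 n3 z * E 2 n2 z * E 1 n1 z))) z"
    by (simp add: mE)
   also have "\<dots> = torus_mean (%z. G z * E 3 n3 z * E 2 n2 z * E 1 n1 z)"
    by (rule torus_mean_const) (intro hol3_mult G Eh, simp add: per Eper)
   also have "(%z. G z * E 3 n3 z * E 2 n2 z * E 1 n1 z) = (%z. G z * fmode (vector [of_int n1, of_int n2, of_int n3]) z)"
    by (simp add: fun_eq_iff E_def fmode_def sum_3 expi2_diff expi2_minus expi2_add field_simps)
   also have "torus_mean \<dots> = 0" by (rule c0) (simp add: forall_3)
   finally show "mean 1 (%z. mean 2 (%z. mean 3 (%z. G z * E 3 n3 z) z * expi2 (- (of_int n2 * z $ 2))) z * expi2 (- (of_int n1 * z $ 1))) z = 0"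
    by (simp add: E_def)
  qed
 qed
 show ?thesis
  by (rule mean_fourier_zero[OF G per[of _ 3]]) (use K3 in \<open>simp add: E_def\<close>)
qed

section \<open>Theta functions of order m and the bound on their dimension\<close>

text \<open>Theta functions of order \<open>m\<close> for the lattice spanned by the unit vectors
  and the columns of \<open>\<tau>\<close>; \<open>k\<close> and \<open>l\<close> are the constant
  parts of the multipliers.\<close>

definition quasi_space :: "nat => complex^3^3 => (3 => complex) => (3 => complex) => (complex^3 => complex) set" where
 "quasi_space m \<tau> k l = {G. entire G & (\<forall>j z. G (z + axis j 1) = k j * G z) &
   (\<forall>j z. G (z + column j \<tau>) = l j * expi2 (- (of_nat m * z $ j)) * G z)}"

text \<open>In use \<open>expi2 (a $ j) = k j\<close>, so that the twist by \<open>fmode a\<close>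
  cancels the multipliers \<open>k\<close> and leaves a periodic function.\<close>

definition fcoeff :: "complex^3 => (complex^3 => complex) => complex^3 => complex" where
 "fcoeff a G n = torus_mean (%z. G z * fmode (a + n) z)"

definition int_vec :: "complex^3 => bool" where "int_vec n \<longleftrightarrow> (\<forall>j. n $ j \<in> \<int>)"

lemma expi2_int: "x \<in> \<int> ==> expi2 x = 1" by (simp add: expi2_eq_1_iff)

lemma fcoeff_periodic:
 assumes "G \<in> quasi_space m \<tau> k l" "!!j. expi2 (a $ j) = k j" "int_vec n"
 shows "G (z + axis j 1) * fmode (a + n) (z + axis j 1) = G z * fmode (a + n) z"
proof -
 have "fmode (a + n) (axis j 1) = inverse (k j)"
  using assms(2)[of j] expi2_int[of "n $ j"] assms(3)
  by (simp add: fmode_axis int_vec_def expi2_diff expi2_minus)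
 moreover have "k j ~= 0" using assms(2)[of j] by (metis expi2_nz)
 ultimately show ?thesis using assms(1) by (simp add: quasi_space_def fmode_add)
qed

text \<open>The multiplier for a column of \<open>\<tau>\<close> contains an exponential of
  \<open>m\<close> times the j-th coordinate, and this shifts the Fourier index by \<open>m\<close>.
  Hence one coefficient in each residue class modulo \<open>m\<close> decides whether the whole
  class vanishes.\<close>

lemma fcoeff_shift:
 assumes G: "G \<in> quasi_space m \<tau> k l" and a: "!!j. expi2 (a $ j) = k j" and n: "int_vec n"
 shows "fcoeff a G n = l j * fmode (a + n) (column j \<tau>) * fcoeff a G (n + axis j (of_nat m))"
proof -
 have h: "entire G" using G by (simp add: quasi_space_def)
 have "fcoeff a G n = torus_mean (%z. G (z + column j \<tau>) * fmode (a + n) (z + column j \<tau>))"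
  unfolding fcoeff_def
  by (rule torus_mean_translate[symmetric]) (intro hol3_mult h hol3_fmode, rule fcoeff_periodic[OF assms])
 also have "\<dots> = torus_mean (%z. l j * fmode (a + n) (column j \<tau>) * (G z * fmode (a + (n + axis j (of_nat m))) z))"
 proof -
  have "fmode (axis j (of_nat m)) z = expi2 (- (of_nat m * z $ j))" for z
   by (simp add: fmode_def axis_def if_distrib if_distribR cong: if_cong)
  thus ?thesis using G by (simp add: quasi_space_def fmode_add fmode_add_left mult_ac flip: add.assoc)
 qed
 finally show ?thesis by (simp add: torus_mean_cmult fcoeff_def)
qed

lemma int_vec_add: "int_vec n ==> int_vec k ==> int_vec (n + k)"
 by (simp add: int_vec_def)

lemma int_vec_axis: "x \<in> \<int> ==> int_vec (axis j x)"
 by (simp add: int_vec_def axis_def)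

lemma fcoeff_zero_shift:
 assumes G: "G \<in> quasi_space m \<tau> p l" and a: "!!j. expi2 (a $ j) = p j" and n: "int_vec n" and b: "l j ~= 0"
  and z: "fcoeff a G n = 0"
 shows "fcoeff a G (n + axis j (of_int k * of_nat m)) = 0"
proof -
 have up: "fcoeff a G (n + axis j (of_nat k * of_nat m)) = 0" if "int_vec n" "fcoeff a G n = 0" for n k
 proof (induction k)
  case (Suc k)
  have "int_vec (n + axis j (of_nat k * of_nat m))" by (intro int_vec_add int_vec_axis that) auto
  from fcoeff_shift[OF G a this, of j] Suc b show ?case
   by (simp add: axis_add ring_distribs add_ac)
 qed (use that in simp)
 have down: "fcoeff a G (n - axis j (of_nat k * of_nat m)) = 0" if "int_vec n" "fcoeff a G n = 0" for n k
 proof (induction k)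
  case (Suc k)
  have eq: "n - axis j (of_nat (Suc k) * of_nat m) + axis j (of_nat m) = n - axis j (of_nat k * of_nat m)"
   by (simp add: axis_add ring_distribs)
  have m: "- axis j x = (axis j (- x) :: complex^3)" for x by (simp add: axis_def vec_eq_iff)
  have "int_vec (n + (- axis j (of_nat (Suc k) * of_nat m)))"
   unfolding m by (intro int_vec_add int_vec_axis that) auto
  hence "int_vec (n - axis j (of_nat (Suc k) * of_nat m))" by simp
  from fcoeff_shift[OF G a this, of j] show ?case unfolding eq Suc by simp
 qed (use that in simp)
 show ?thesis
 proof (cases "k >= 0")
  case True
  thus ?thesis using up[OF n z, of "nat k"] by simp
 next
  case False
  have "n + axis j (of_int k * of_nat m) = n - axis j (of_nat (nat (-k)) * of_nat m)"
   using False by (simp add: axis_def vec_eq_iff)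
  thus ?thesis using down[OF n z, of "nat (-k)"] by simp
 qed
qed

lemma quasi_space_zero:
 assumes G: "G \<in> quasi_space m \<tau> k l" and a: "!!j. expi2 (a $ j) = k j" and b: "!!j. l j ~= 0"
  and z: "!!n. int_vec n ==> fcoeff a G n = 0"
 shows "G z = 0"
proof -
 have h: "entire G" using G by (simp add: quasi_space_def)
 have i0: "int_vec 0" by (simp add: int_vec_def)
 have "G z * fmode a z = 0"
 proof (rule torus_fourier_zero)
  show "entire (%z. G z * fmode a z)" by (intro hol3_mult h hol3_fmode)
  show "G (z + axis j 1) * fmode a (z + axis j 1) = G z * fmode a z" for j z
   using fcoeff_periodic[OF G a i0] by simp
  fix n :: "complex^3" assume "\<forall>j. n $ j \<in> \<int>"
  thus "torus_mean (%z. G z * fmode a z * fmode n z) = 0"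
   using z[of n] by (simp add: fcoeff_def int_vec_def fmode_add_left mult.assoc)
 qed
 thus ?thesis by simp
qed

lemma quasi_space_zero_residues:
 assumes G: "G \<in> quasi_space m \<tau> al l" and a: "!!j. expi2 (a $ j) = al j" and b: "!!j. l j ~= 0"
  and m: "m > 0"
  and z: "!!i j k. i < m ==> j < m ==> k < m ==> fcoeff a G (vector [of_nat i, of_nat j, of_nat k]) = 0"
 shows "G z = 0"
proof (rule quasi_space_zero[OF G a b])
 fix n assume n: "int_vec n"
 have "\<forall>j. \<exists>k::int. n $ j = of_int k" using n by (auto simp: int_vec_def elim: Ints_cases)
 then obtain p where p: "!!j. n $ j = of_int (p j)" by metis
 define r where "r = (%j. nat (p j mod int m))"
 define q where "q = (%j. p j div int m)"
 have r: "r j < m" for j using m by (simp add: r_def nat_less_iff)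
 have pj: "of_int (p j) = (of_nat (r j) + of_int (q j) * of_nat m :: complex)" for j
 proof -
  have "p j = int (r j) + q j * int m" using m by (simp add: r_def q_def)
  hence "of_int (p j) = (of_int (int (r j) + q j * int m) :: complex)" by simp
  thus ?thesis by simp
 qed
 let ?v = "vector [of_nat (r 1), of_nat (r 2), of_nat (r 3)] :: complex^3"
 have v: "int_vec ?v" by (simp add: int_vec_def forall_3)
 have ax: "int_vec (axis j (of_int k * of_nat m))" for j k by (rule int_vec_axis) auto
 have "fcoeff a G (?v + axis 1 (of_int (q 1) * of_nat m) + axis 2 (of_int (q 2) * of_nat m) + axis 3 (of_int (q 3) * of_nat m)) = 0"
  by (intro fcoeff_zero_shift[OF G a _ b] int_vec_add v ax z r)
 also have "?v + axis 1 (of_int (q 1) * of_nat m) + axis 2 (of_int (q 2) * of_nat m) + axis 3 (of_int (q 3) * of_nat m) = n"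
  by (simp add: vec_eq_iff forall_3 p pj axis_def)
 finally show "fcoeff a G n = 0" .
qed

text \<open>Elimination: an equation with a nonzero coefficient at \<open>s0\<close> is solved for
  that unknown and substituted into the others.\<close>

lemma homogeneous_system:
 fixes c :: "'r => 's => 'a::field"
 assumes "finite R" "finite S" "card R < card S"
 shows "\<exists>x. (\<exists>s\<in>S. x s ~= 0) & (\<forall>r\<in>R. (\<Sum>s\<in>S. x s * c r s) = 0)"
 using assms
proof (induction R arbitrary: S c rule: finite_induct)
 case empty
 then obtain s where "s \<in> S" by fastforce
 thus ?case by (intro exI[of _ "%_. 1"]) auto
next
 case (insert r R)
 show ?case
 proof (cases "\<forall>s\<in>S. c r s = 0")
  case True
  have "card R < card S" using insert by simp
  from insert.IH[OF insert.prems(1) this, of c] True show ?thesis by auto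
 next
  case False
  then obtain s0 where s0: "s0 \<in> S" "c r s0 ~= 0" by blast
  let ?S = "S - {s0}"
  have "card R < card ?S" using insert s0 by simp
  from insert.IH[OF _ this, of "%q s. c q s - c q s0 * c r s / c r s0"] insert.prems(1)
  obtain x where x: "\<exists>s\<in>?S. x s ~= 0" "!!q. q \<in> R ==> (\<Sum>s\<in>?S. x s * (c q s - c q s0 * c r s / c r s0)) = 0"
   by blast
  define y where "y = (%s. if s = s0 then - (\<Sum>s\<in>?S. x s * c r s) / c r s0 else x s)"
  have sum_y: "(\<Sum>s\<in>S. y s * c q s) = y s0 * c q s0 + (\<Sum>s\<in>?S. x s * c q s)" for q
   by (subst sum.remove[OF insert.prems(1) s0(1)]) (auto simp: y_def intro!: sum.cong)
  have "(\<Sum>s\<in>S. y s * c r s) = 0" unfolding sum_y using s0 by (simp add: y_def)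
  moreover have "(\<Sum>s\<in>S. y s * c q s) = 0" if "q \<in> R" for q
  proof -
   have "(\<Sum>s\<in>?S. x s * c q s) - c q s0 / c r s0 * (\<Sum>s\<in>?S. x s * c r s) = 0"
    using x(2)[OF that] by (simp add: algebra_simps sum_subtractf sum_distrib_left)
   thus ?thesis unfolding sum_y by (simp add: y_def)
  qed
  moreover have "\<exists>s\<in>S. y s ~= 0" using x(1) by (auto simp: y_def)
  ultimately show ?thesis by (intro exI[of _ y]) auto
 qed
qed

lemma quasi_space_sum:
 assumes "!!i. i \<in> I ==> f i \<in> quasi_space m \<tau> k l"
 shows "(%z. \<Sum>i\<in>I. x i * f i z) \<in> quasi_space m \<tau> k l"
proof -
 have f: "entire (f i)" "f i (z + axis j 1) = k j * f i z"
  "f i (z + column j \<tau>) = l j * expi2 (- (of_nat m * z $ j)) * f i z" if "i \<in> I" for i j z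
  using assms[OF that] by (auto simp: quasi_space_def)
 have "entire (%z. \<Sum>i\<in>I. x i * f i z)" by (intro hol3_sum hol3_mult hol3_const f) auto
 moreover have "(\<Sum>i\<in>I. x i * f i (z + axis j 1)) = k j * (\<Sum>i\<in>I. x i * f i z)" for j z
  unfolding sum_distrib_left by (rule sum.cong) (simp_all add: f)
 moreover have "(\<Sum>i\<in>I. x i * f i (z + column j \<tau>)) = l j * expi2 (- (of_nat m * z $ j)) * (\<Sum>i\<in>I. x i * f i z)" for j z
  unfolding sum_distrib_left by (rule sum.cong) (simp_all add: f)
 ultimately show ?thesis by (simp add: quasi_space_def)
qed

text \<open>The \<open>m ^ 3\<close> coefficients with indices below \<open>m\<close> determine an
  element, and more functions than conditions admit a nontrivial combination for which all of them
  vanish.\<close>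

lemma quasi_space_dependent:
 assumes f: "!!i. i \<in> I ==> f i \<in> quasi_space m \<tau> k l"
  and nz: "!!j. k j ~= 0" "!!j. l j ~= 0" and m: "m > 0" and I: "finite I" "card I > m ^ 3"
 shows "\<exists>x. (\<exists>i\<in>I. x i ~= 0) & (\<forall>z. (\<Sum>i\<in>I. x i * f i z) = 0)"
proof -
 have "\<forall>j. \<exists>x. expi2 x = k j" using expi2_surj nz(1) by blast
 then obtain a' where a': "!!j. expi2 (a' j) = k j" by metis
 define a :: "complex^3" where "a = vec_lambda a'"
 have a: "expi2 (a $ j) = k j" for j by (simp add: a_def a')
 define R where "R = {..<m} \<times> {..<m} \<times> {..<m}"
 have R: "finite R" "card R = m ^ 3" by (auto simp: R_def card_cartesian_product power3_eq_cube)
 define C where "C = (%(p, q, s) i. fcoeff a (f i) (vector [of_nat p, of_nat q, of_nat s]))"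
 have "card R < card I" using R(2) I(2) by simp
 from homogeneous_system[OF R(1) I(1) this, of C]
 obtain x where x: "\<exists>i\<in>I. x i ~= 0" "!!r. r \<in> R ==> (\<Sum>i\<in>I. x i * C r i) = 0" by blast
 have "(\<Sum>i\<in>I. x i * f i z) = 0" for z
 proof (rule quasi_space_zero_residues[OF quasi_space_sum[OF f] a nz(2) m])
  fix p q s assume "p < m" "q < m" "s < m"
  hence r: "(p, q, s) \<in> R" by (simp add: R_def)
  let ?n = "vector [of_nat p, of_nat q, of_nat s] :: complex^3"
  have "fcoeff a (%z. \<Sum>i\<in>I. x i * f i z) ?n = torus_mean (%z. \<Sum>i\<in>I. x i * (f i z * fmode (a + ?n) z))"
   by (simp add: fcoeff_def sum_distrib_right mult.assoc)
  also have "\<dots> = (\<Sum>i\<in>I. x i * fcoeff a (f i) ?n)"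
   unfolding fcoeff_def by (rule torus_mean_sum) (use f in \<open>auto simp: quasi_space_def intro!: hol3_mult hol3_fmode\<close>)
  also have "\<dots> = 0" using x(2)[OF r] by (simp add: C_def)
  finally show "fcoeff a (%z. \<Sum>i\<in>I. x i * f i z) ?n = 0" .
 qed auto
 thus ?thesis using x(1) by blast
qed

text \<open>In order zero the translation does not shift the Fourier index, so any nonvanishing
  coefficient ties the multipliers \<open>l\<close> to its index.\<close>

lemma quasi_space_0_mode:
 assumes G: "G \<in> quasi_space 0 \<tau> (%_. 1) l" and nz: "!!j. l j ~= 0" "G z ~= 0"
 shows "\<exists>n. int_vec n & (\<forall>j. l j * fmode n (column j \<tau>) = 1)"
proof -
 have a: "expi2 ((0::complex^3) $ j) = 1" for j by simp
 obtain n where n: "int_vec n" "fcoeff 0 G n ~= 0"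
  using quasi_space_zero[OF G a nz(1)] nz(2) by blast
 have "l j * fmode n (column j \<tau>) = 1" for j
  using fcoeff_shift[OF G a n(1), of j] n(2) by simp
 thus ?thesis using n by blast
qed

section \<open>The Riemann theta series\<close>

definition theta_term :: "complex^3 => complex^3 => complex^3 => complex^3^3 => int^3 => complex" where
 "theta_term a b z \<tau> n = (let m = (\<chi> i. of_int (n $ i) + a $ i) in
   exp (of_real pi * \<i> * (\<Sum>i\<in>UNIV. m $ i * (\<tau> *v m) $ i)
       + 2 * of_real pi * \<i> * (\<Sum>i\<in>UNIV. m $ i * (z $ i + b $ i))))"

lemma riemann_theta_eq: "riemann_theta a b z \<tau> = infsum (theta_term a b z \<tau>) UNIV"
 by (simp add: riemann_theta_def theta_term_def[abs_def])

text \<open>The theta series sees \<open>\<tau>\<close> only through its quadratic form. The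
  translation formula for columns is stated for a symmetric matrix, and the symmetric part gives the
  same series.\<close>

definition symmetrize :: "complex^3^3 => complex^3^3" where
 "symmetrize \<tau> = (\<chi> i j. (\<tau> $ i $ j + \<tau> $ j $ i) / 2)"

lemma symmetrize_sym: "symmetrize \<tau> $ i $ j = symmetrize \<tau> $ j $ i"
 by (simp add: symmetrize_def add.commute)

lemma quadratic_symmetrize:
 "(\<Sum>i\<in>UNIV. m $ i * (symmetrize \<tau> *v m) $ i) = (\<Sum>i\<in>UNIV. m $ i * (\<tau> *v m) $ i)"
 by (simp add: sum_3 matrix_vector_mult_def symmetrize_def field_simps)

lemma riemann_theta_symmetrize: "riemann_theta a b z (symmetrize \<tau>) = riemann_theta a b z \<tau>"
 by (simp add: riemann_theta_def quadratic_symmetrize)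

lemma theta_term_axis:
 "theta_term a b (z + axis j 1) \<tau> n = expi2 (a $ j) * theta_term a b z \<tau> n"
proof -
 have "(\<Sum>i\<in>UNIV. m $ i * ((z + axis j 1) $ i + b $ i)) = (\<Sum>i\<in>UNIV. m $ i * (z $ i + b $ i)) + m $ j" for m :: "complex^3"
  using exhaust_3[of j] by (auto simp: sum_3 axis_def algebra_simps)
 moreover have "expi2 (of_int (n $ j) + a $ j) = expi2 (a $ j)" by (simp add: expi2_add)
 ultimately show ?thesis
  by (simp add: theta_term_def Let_def exp_add ring_distribs expi2_def)
qed

lemma theta_term_column:
 assumes sym: "!!i k. \<tau> $ i $ k = \<tau> $ k $ i"
 shows "theta_term a b (z + column j \<tau>) \<tau> n =
   exp (- (of_real pi * \<i> * \<tau> $ j $ j)) * expi2 (- (z $ j + b $ j)) * theta_term a b z \<tau> (n + axis j 1)"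
proof -
 let ?m = "(\<chi> i. of_int (n $ i) + a $ i) :: complex^3"
 let ?m' = "(\<chi> i. of_int ((n + axis j 1) $ i) + a $ i) :: complex^3"
 have m': "?m' = ?m + axis j 1" by (simp add: vec_eq_iff axis_def)
 have "(\<Sum>i\<in>UNIV. (m + axis j 1) $ i * (\<tau> *v (m + axis j 1)) $ i) =
   (\<Sum>i\<in>UNIV. m $ i * (\<tau> *v m) $ i) + 2 * (\<Sum>i\<in>UNIV. m $ i * \<tau> $ i $ j) + \<tau> $ j $ j" for m :: "complex^3"
  using exhaust_3[of j] sym[of 1 2] sym[of 1 3] sym[of 2 3]
  by (auto simp: sum_3 axis_def matrix_vector_mult_def algebra_simps)
 moreover have "(\<Sum>i\<in>UNIV. (m + axis j 1) $ i * (z $ i + b $ i)) = (\<Sum>i\<in>UNIV. m $ i * (z $ i + b $ i)) + (z $ j + b $ j)" for m :: "complex^3"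
  using exhaust_3[of j] by (auto simp: sum_3 axis_def algebra_simps)
 moreover have "(\<Sum>i\<in>UNIV. m $ i * ((z + column j \<tau>) $ i + b $ i)) = (\<Sum>i\<in>UNIV. m $ i * (z $ i + b $ i)) + (\<Sum>i\<in>UNIV. m $ i * \<tau> $ i $ j)" for m :: "complex^3"
  by (simp add: column_def sum_3 algebra_simps)
 ultimately have eqs:
  "(\<Sum>i\<in>UNIV. (?m + axis j 1) $ i * (\<tau> *v (?m + axis j 1)) $ i) =
   (\<Sum>i\<in>UNIV. ?m $ i * (\<tau> *v ?m) $ i) + 2 * (\<Sum>i\<in>UNIV. ?m $ i * \<tau> $ i $ j) + \<tau> $ j $ j"
  "(\<Sum>i\<in>UNIV. (?m + axis j 1) $ i * (z $ i + b $ i)) = (\<Sum>i\<in>UNIV. ?m $ i * (z $ i + b $ i)) + (z $ j + b $ j)"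
  "(\<Sum>i\<in>UNIV. ?m $ i * ((z + column j \<tau>) $ i + b $ i)) = (\<Sum>i\<in>UNIV. ?m $ i * (z $ i + b $ i)) + (\<Sum>i\<in>UNIV. ?m $ i * \<tau> $ i $ j)"
  by blast+
 define X Y W where "X = (\<Sum>i\<in>UNIV. ?m $ i * (\<tau> *v ?m) $ i)" and "Y = (\<Sum>i\<in>UNIV. ?m $ i * (z $ i + b $ i))"
  and "W = (\<Sum>i\<in>UNIV. ?m $ i * \<tau> $ i $ j)"
 show ?thesis
  unfolding theta_term_def Let_def m' expi2_def exp_add[symmetric] eqs X_def[symmetric] Y_def[symmetric] W_def[symmetric]
  by (intro arg_cong[where f=exp]) (simp add: algebra_simps)
qed

lemma riemann_theta_axis: "riemann_theta a b (z + axis j 1) \<tau> = expi2 (a $ j) * riemann_theta a b z \<tau>"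
 unfolding riemann_theta_eq theta_term_axis by (rule infsum_cmult_right')

lemma riemann_theta_column:
 assumes sym: "!!i k. \<tau> $ i $ k = \<tau> $ k $ i"
 shows "riemann_theta a b (z + column j \<tau>) \<tau> =
   exp (- (of_real pi * \<i> * \<tau> $ j $ j)) * expi2 (- (z $ j + b $ j)) * riemann_theta a b z \<tau>"
proof -
 have "bij_betw (%n :: int^3. n + axis j 1) UNIV UNIV"
  by (rule bij_betw_byWitness[where f'="%n. n - axis j 1"]) auto
 from infsum_reindex_bij_betw[OF this, of "theta_term a b z \<tau>"]
 show ?thesis
  unfolding riemann_theta_eq theta_term_column[OF sym] by (subst infsum_cmult_right') simp
qed

text \<open>Reindexing by n to -n - 2a, which is integral because \<open>a\<close> is a half-integer
  vector; integrality of 2b makes the remaining factor independent of n.\<close>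

lemma riemann_theta_minus:
 assumes a: "!!i. 2 * a $ i \<in> \<int>" and b: "!!i. 2 * b $ i \<in> \<int>"
 shows "riemann_theta a b (- z) \<tau> = expi2 (- (2 * (\<Sum>i\<in>UNIV. a $ i * b $ i))) * riemann_theta a b z \<tau>"
proof -
 have "\<forall>i. \<exists>k::int. 2 * a $ i = of_int k" using a by (metis Ints_cases)
 then obtain A where A: "!!i. 2 * a $ i = of_int (A i)" by metis
 let ?f = "%n :: int^3. (\<chi> i. - (n $ i) - A i) :: int^3"
 have bij: "bij_betw ?f UNIV UNIV"
  by (rule bij_betw_byWitness[where f'="?f"]) (auto simp: vec_eq_iff)
 have tt: "theta_term a b (- z) \<tau> (?f n) = expi2 (- (2 * (\<Sum>i\<in>UNIV. a $ i * b $ i))) * theta_term a b z \<tau> n" for n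
 proof -
  let ?m = "(\<chi> i. of_int (n $ i) + a $ i) :: complex^3"
  have m': "(\<chi> i. of_int (?f n $ i) + a $ i) = - ?m"
   using A by (simp add: vec_eq_iff algebra_simps flip: A)
  have q: "(\<Sum>i\<in>UNIV. (- m) $ i * (\<tau> *v (- m)) $ i) = (\<Sum>i\<in>UNIV. m $ i * (\<tau> *v m) $ i)" for m :: "complex^3"
   by (simp add: sum_3 matrix_vector_mult_def algebra_simps)
  have l: "(\<Sum>i\<in>UNIV. (- m) $ i * ((- z) $ i + b $ i)) = (\<Sum>i\<in>UNIV. m $ i * (z $ i + b $ i)) - 2 * (\<Sum>i\<in>UNIV. m $ i * b $ i)" for m :: "complex^3"
   by (simp add: sum_3 algebra_simps)
  have "(\<Sum>i\<in>UNIV. of_int (n $ i) * (2 * b $ i)) \<in> \<int>" by (intro Ints_sum Ints_mult b) auto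
  hence e1: "expi2 (- (\<Sum>i\<in>UNIV. of_int (n $ i) * (2 * b $ i))) = 1" by (intro expi2_int Ints_minus)
  have "2 * (\<Sum>i\<in>UNIV. ?m $ i * b $ i) = (\<Sum>i\<in>UNIV. of_int (n $ i) * (2 * b $ i)) + 2 * (\<Sum>i\<in>UNIV. a $ i * b $ i)"
   by (simp add: sum_3 algebra_simps)
  hence e2: "expi2 (- (2 * (\<Sum>i\<in>UNIV. ?m $ i * b $ i))) = expi2 (- (2 * (\<Sum>i\<in>UNIV. a $ i * b $ i)))"
   using e1 by (simp add: expi2_add expi2_diff expi2_minus inverse_eq_divide)
  have "theta_term a b (- z) \<tau> (?f n) = expi2 (- (2 * (\<Sum>i\<in>UNIV. ?m $ i * b $ i))) * theta_term a b z \<tau> n"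
   unfolding theta_term_def Let_def m' q l expi2_def exp_add[symmetric]
   by (intro arg_cong[where f=exp]) (simp add: algebra_simps)
  thus ?thesis unfolding e2 .
 qed
 have "riemann_theta a b (- z) \<tau> = infsum (%n. theta_term a b (- z) \<tau> (?f n)) UNIV"
  unfolding riemann_theta_eq by (rule infsum_reindex_bij_betw[OF bij, symmetric])
 thus ?thesis unfolding tt riemann_theta_eq by (simp add: infsum_cmult_right')
qed

section \<open>Positivity of the imaginary part and convergence of the series\<close>

definition im_form :: "complex^3^3 => real^3 => real^3 => real" where
 "im_form \<tau> x y = (\<Sum>i\<in>UNIV. \<Sum>k\<in>UNIV. x $ i * Im (\<tau> $ i $ k) * y $ k)"

lemma norm_theta_term:
 fixes a' b' :: "real^3" and n :: "int^3"
 defines "x \<equiv> (\<chi> i. of_int (n $ i) + a' $ i) :: real^3"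
 assumes "!!i. a $ i = of_real (a' $ i)" "!!i. b $ i = of_real (b' $ i)"
 shows "norm (theta_term a b z \<tau> n) = exp (- pi * im_form \<tau> x x - 2 * pi * (\<Sum>i\<in>UNIV. x $ i * Im (z $ i)))"
 by (simp add: theta_term_def Let_def norm_exp_eq_Re im_form_def sum_3 matrix_vector_mult_def assms algebra_simps)

lemma im_form_bound: "\<exists>K\<ge>0. \<forall>x y. \<bar>im_form \<tau> x y\<bar> <= K * norm x * norm y"
proof -
 let ?K = "\<Sum>i\<in>UNIV. \<Sum>k\<in>UNIV. \<bar>Im (\<tau> $ i $ k)\<bar>"
 have "\<bar>im_form \<tau> x y\<bar> <= ?K * norm x * norm y" for x y
 proof -
  have "\<bar>im_form \<tau> x y\<bar> <= (\<Sum>i\<in>UNIV. \<Sum>k\<in>UNIV. \<bar>x $ i * Im (\<tau> $ i $ k) * y $ k\<bar>)"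
   unfolding im_form_def by (rule order_trans[OF sum_abs]) (intro sum_mono sum_abs)
  also have "\<dots> <= (\<Sum>i\<in>UNIV. \<Sum>k\<in>UNIV. \<bar>Im (\<tau> $ i $ k)\<bar> * (norm x * norm y))"
  proof (intro sum_mono)
   fix i k
   have "\<bar>x $ i\<bar> * \<bar>y $ k\<bar> <= norm x * norm y"
    by (intro mult_mono component_le_norm_cart) auto
   from mult_left_mono[OF this, of "\<bar>Im (\<tau> $ i $ k)\<bar>"]
   show "\<bar>x $ i * Im (\<tau> $ i $ k) * y $ k\<bar> <= \<bar>Im (\<tau> $ i $ k)\<bar> * (norm x * norm y)"
    by (simp add: abs_mult mult_ac)
  qed
  finally show ?thesis by (simp add: sum_distrib_right mult.assoc)
 qed
 moreover have "?K >= 0" by (intro sum_nonneg) auto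
 ultimately show ?thesis by blast
qed

lemma im_form_expand:
 assumes "!!i k. \<tau> $ i $ k = \<tau> $ k $ i"
 shows "im_form \<tau> (q *\<^sub>R k + r) (q *\<^sub>R k + r) = q\<^sup>2 * im_form \<tau> k k + 2 * q * im_form \<tau> k r + im_form \<tau> r r"
 using assms[of 1 2] assms[of 1 3] assms[of 2 3]
 by (simp add: im_form_def sum_3 power2_eq_square algebra_simps)

text \<open>Integer points close to a line on which the form is not positive would give
 infinitely many terms bounded away from zero.\<close>

lemma summable_imp_positive:
 fixes a' b' :: "real^3"
 assumes sum: "theta_term a b z \<tau> summable_on UNIV"
  and sym: "!!i k. \<tau> $ i $ k = \<tau> $ k $ i"
  and a: "!!i. a $ i = of_real (a' $ i)" and b: "!!i. b $ i = of_real (b' $ i)" and k: "k ~= 0"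
 shows "im_form \<tau> k k > 0"
proof (rule ccontr)
 assume "~ im_form \<tau> k k > 0"
 \<comment> \<open>Either the form is negative somewhere, or it is semidefinite and a vector with
   value 0 lies in its radical, since otherwise adding a multiple of it to \<open>r\<close> would
   produce the value -1.\<close>
 have "\<exists>k. k ~= 0 & (im_form \<tau> k k < 0 | im_form \<tau> k k = 0 & (\<forall>r. im_form \<tau> k r = 0))"
 proof (cases "\<exists>k. im_form \<tau> k k < 0")
  case True
  then obtain k where "im_form \<tau> k k < 0" by blast
  thus ?thesis by (intro exI[of _ k]) (auto simp: im_form_def)
 next
  case False
  hence nn: "im_form \<tau> x x >= 0" for x by (meson not_less)
  hence k0: "im_form \<tau> k k = 0" using \<open>~ im_form \<tau> k k > 0\<close> by (meson antisym not_less)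
  have "im_form \<tau> k r = 0" for r
  proof (rule ccontr)
   assume ne: "im_form \<tau> k r ~= 0"
   define q where "q = - (im_form \<tau> r r + 1) / (2 * im_form \<tau> k r)"
   have "im_form \<tau> (q *\<^sub>R k + r) (q *\<^sub>R k + r) = -1"
   proof -
    have "q * (2 * im_form \<tau> k r) = - (im_form \<tau> r r + 1)"
     using nonzero_eq_divide_eq[of "2 * im_form \<tau> k r" q "- (im_form \<tau> r r + 1)"] ne by (simp add: q_def)
    thus ?thesis unfolding im_form_expand[OF sym] k0 by (simp add: mult_ac)
   qed
   thus False using nn[of "q *\<^sub>R k + r"] by simp
  qed
  thus ?thesis using k0 k by blast
 qed
 then obtain k where k: "k ~= 0" and kk: "im_form \<tau> k k < 0 | im_form \<tau> k k = 0 & (\<forall>r. im_form \<tau> k r = 0)" by blast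
 obtain K where K: "K >= 0" "!!x y. \<bar>im_form \<tau> x y\<bar> <= K * norm x * norm y" using im_form_bound by blast
 \<comment> \<open>Rounding a multiple of \<open>k\<close> to integers moves each of the three
   coordinates by at most 1, and \<open>a'\<close> accounts for the characteristic.\<close>
 define R where "R = 3 + norm a'"
 have R: "R >= 0" by (simp add: R_def)
 have "\<exists>C. \<forall>q r. norm r <= R --> im_form \<tau> (q *\<^sub>R k + r) (q *\<^sub>R k + r) <= C"
 proof -
  have rr: "im_form \<tau> r r <= K * R * R" if "norm r <= R" for r
  proof -
   have "im_form \<tau> r r <= K * norm r * norm r" using K(2)[of r r] by simp
   also have "\<dots> <= K * R * R" by (intro mult_mono that K) (use K R in auto)
   finally show ?thesis .
  qed
  show ?thesis using kk
  proof
   assume neg: "im_form \<tau> k k < 0"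
   define d where "d = - im_form \<tau> k k"
   define L where "L = K * norm k * R"
   have d: "d > 0" using neg by (simp add: d_def)
   have "im_form \<tau> (q *\<^sub>R k + r) (q *\<^sub>R k + r) <= L\<^sup>2 / d + K * R * R" if r: "norm r <= R" for q r
   proof -
    have "\<bar>im_form \<tau> k r\<bar> <= L" unfolding L_def
     by (rule order_trans[OF K(2)]) (intro mult_left_mono r, use K in auto)
    hence "\<bar>q\<bar> * \<bar>im_form \<tau> k r\<bar> <= \<bar>q\<bar> * L" by (rule mult_left_mono) simp
    hence "q * im_form \<tau> k r <= \<bar>q\<bar> * L"
     using abs_ge_self[of "q * im_form \<tau> k r"] unfolding abs_mult by linarith
    moreover have "2 * (\<bar>q\<bar> * L) - q\<^sup>2 * d <= L\<^sup>2 / d"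
    proof -
     have "0 <= (\<bar>q\<bar> * d - L)\<^sup>2 / d" using d by simp
     also have "\<dots> = q\<^sup>2 * d - 2 * (\<bar>q\<bar> * L) + L\<^sup>2 / d"
      using d by (simp add: power2_eq_square field_simps)
     finally show ?thesis by simp
    qed
    ultimately show ?thesis unfolding im_form_expand[OF sym] using rr[OF r] by (simp add: d_def)
   qed
   thus ?thesis by blast
  next
   assume "im_form \<tau> k k = 0 & (\<forall>r. im_form \<tau> k r = 0)"
   thus ?thesis unfolding im_form_expand[OF sym] using rr by (intro exI[of _ "K * R * R"]) simp
  qed
 qed
 then obtain C where C: "!!q r. norm r <= R ==> im_form \<tau> (q *\<^sub>R k + r) (q *\<^sub>R k + r) <= C" by blast
 define y where "y = (\<chi> i. Im (z $ i))"
 define p where "p = (%M::nat. (\<chi> i. \<lfloor>of_nat M * k $ i\<rfloor>) :: int^3)"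
 define P where "P = (%M. (\<Sum>i\<in>UNIV. of_int (p M $ i) * y $ i))"
 \<comment> \<open>The sign is chosen so that the linear term in the imaginary part of
   \<open>z\<close> cannot make the series term small.\<close>
 define n where "n = (%M. if P M <= 0 then p M else - p M)"
 define e where "e = exp (- pi * C - 2 * pi * (\<Sum>i\<in>UNIV. a' $ i * y $ i))"
 have big: "e <= norm (theta_term a b z \<tau> (n M))" for M
 proof -
  define x where "x = ((\<chi> i. of_int (n M $ i) + a' $ i) :: real^3)"
  define s :: real where "s = (if P M <= 0 then 1 else -1)"
  define r where "r = x - (s * of_nat M) *\<^sub>R k"
  have nn: "of_int (n M $ i) = s * of_int (p M $ i)" for i by (simp add: n_def s_def)
  have "\<bar>(r - a') $ i\<bar> <= 1" for i
  proof -
   have "\<bar>of_int (p M $ i) - of_nat M * k $ i\<bar> <= (1::real)" unfolding p_def by (simp, linarith)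
   hence "\<bar>s * (of_int (p M $ i) - of_nat M * k $ i)\<bar> <= 1" by (simp add: s_def abs_minus_commute)
   thus ?thesis by (simp add: r_def x_def nn algebra_simps)
  qed
  hence "(\<Sum>i\<in>UNIV. \<bar>(r - a') $ i\<bar>) <= 3" using sum_mono[of UNIV "%i. \<bar>(r - a') $ i\<bar>" "%_::3. 1"] by simp
  hence "norm (r - a') <= 3" using norm_le_l1_cart[of "r - a'"] by linarith
  hence "norm r <= R" using norm_triangle_ineq[of "r - a'" a'] by (simp add: R_def)
  moreover have "x = (s * of_nat M) *\<^sub>R k + r" by (simp add: r_def)
  ultimately have "im_form \<tau> x x <= C" using C by metis
  moreover have "(\<Sum>i\<in>UNIV. x $ i * y $ i) <= (\<Sum>i\<in>UNIV. a' $ i * y $ i)"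
  proof -
   have "(\<Sum>i\<in>UNIV. x $ i * y $ i) = s * P M + (\<Sum>i\<in>UNIV. a' $ i * y $ i)"
    by (simp add: x_def nn P_def sum_distrib_left ring_distribs sum.distrib mult_ac)
   moreover have "s * P M <= 0" by (simp add: s_def)
   ultimately show ?thesis by simp
  qed
  ultimately have "- pi * C - 2 * pi * (\<Sum>i\<in>UNIV. a' $ i * y $ i) <= - pi * im_form \<tau> x x - 2 * pi * (\<Sum>i\<in>UNIV. x $ i * y $ i)"
   by (intro diff_mono) auto
  thus ?thesis unfolding e_def norm_theta_term[OF a b] x_def by (simp add: y_def)
 qed
 have inf: "infinite (range n)"
 proof
  assume fin: "finite (range n)"
  obtain i where i: "k $ i ~= 0" using k by (auto simp: vec_eq_iff)
  define B where "B = Max ((%v. \<bar>v $ i\<bar>) ` range n)"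
  have B: "\<bar>n M $ i\<bar> <= B" for M unfolding B_def by (rule Max_ge) (use fin in auto)
  obtain M :: nat where M: "of_nat M * \<bar>k $ i\<bar> > of_int B + 1"
   using reals_Archimedean3[of "\<bar>k $ i\<bar>"] i by auto
  have "\<bar>n M $ i\<bar> = \<bar>\<lfloor>of_nat M * k $ i\<rfloor>\<bar>" by (simp add: n_def p_def)
  hence "\<bar>\<lfloor>of_nat M * k $ i\<rfloor>\<bar> <= B" using B[of M] by simp
  hence "\<bar>of_int \<lfloor>of_nat M * k $ i\<rfloor>\<bar> <= (of_int B :: real)" by (metis of_int_abs of_int_le_iff)
  hence "\<bar>of_nat M * k $ i\<bar> <= of_int B + 1" by linarith
  thus False using M by (simp add: abs_mult)
 qed
 have abs: "(%n. norm (theta_term a b z \<tau> n)) summable_on UNIV"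
  using sum by (simp add: summable_on_iff_abs_summable_on_complex)
 have e: "e > 0" by (simp add: e_def)
 define S where "S = infsum (%n. norm (theta_term a b z \<tau> n)) UNIV"
 obtain F where F: "F <= range n" "finite F" "card F = nat \<lceil>S / e\<rceil> + 1"
  using infinite_arbitrarily_large[OF inf] by blast
 have "of_nat (card F) * e <= (\<Sum>m\<in>F. norm (theta_term a b z \<tau> m))"
  by (rule sum_bounded_below) (use F big in auto)
 also have "\<dots> <= S" unfolding S_def by (rule finite_sum_le_infsum[OF abs F(2)]) auto
 finally have "of_nat (card F) <= S / e" using e by (simp add: field_simps)
 thus False unfolding F(3) by linarith
qed

lemma summable_exp_int: "(%n::int. exp (- \<bar>real_of_int n\<bar>)) summable_on UNIV"
proof (rule nonneg_bdd_above_summable_on)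
 have geo: "(\<Sum>k\<le>K. exp (- real k)) <= 1 / (1 - exp (-1))" for K :: nat
 proof -
  have "(\<Sum>k\<le>K. exp (- real k)) = (\<Sum>k\<le>K. exp (-1) ^ k)"
   by (rule sum.cong) (auto simp flip: exp_of_nat_mult)
  also have "\<dots> = (1 - exp (-1) ^ Suc K) / (1 - exp (-1))" by (rule sum_gp0[THEN trans]) simp
  also have "\<dots> <= 1 / (1 - exp (-1))" by (intro divide_right_mono) auto
  finally show ?thesis .
 qed
 show "bdd_above (sum (%n::int. exp (- \<bar>real_of_int n\<bar>)) ` {F. F <= UNIV & finite F})"
 proof (rule bdd_aboveI2)
  fix F :: "int set" assume "F \<in> {F. F <= UNIV & finite F}"
  hence F: "finite F" by simp
  define K where "K = nat (Max (insert 0 (abs ` F)))"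
  have K: "\<bar>n\<bar> <= int K" if "n \<in> F" for n
  proof -
   have "\<bar>n\<bar> <= Max (insert 0 (abs ` F))" by (rule Max_ge) (use F that in auto)
   moreover have "0 <= Max (insert 0 (abs ` F))" by (rule Max_ge) (use F in auto)
   ultimately show ?thesis by (simp add: K_def)
  qed
  have sub: "F <= int ` {..K} \<union> (%k. - int k) ` {..K}"
  proof
   fix n assume "n \<in> F"
   from K[OF this] have "n = int (nat n) & nat n <= K | n = - int (nat (-n)) & nat (-n) <= K" by auto
   thus "n \<in> int ` {..K} \<union> (%k. - int k) ` {..K}" by blast
  qed
  have "(\<Sum>n\<in>F. exp (- \<bar>real_of_int n\<bar>)) <= (\<Sum>n\<in>int ` {..K} \<union> (%k. - int k) ` {..K}. exp (- \<bar>real_of_int n\<bar>))"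
   by (rule sum_mono2) (use sub in auto)
  also have "\<dots> <= (\<Sum>n\<in>int ` {..K}. exp (- \<bar>real_of_int n\<bar>)) + (\<Sum>n\<in>(%k. - int k) ` {..K}. exp (- \<bar>real_of_int n\<bar>))"
   by (subst sum.union_inter[symmetric]) (auto intro!: sum_nonneg)
  also have "\<dots> = (\<Sum>k\<le>K. exp (- real k)) + (\<Sum>k\<le>K. exp (- real k))"
   by (subst (1 2) sum.reindex) (auto simp: inj_on_def)
  also have "\<dots> <= 2 * (1 / (1 - exp (-1)))" using geo[of K] by simp
  finally show "(\<Sum>n\<in>F. exp (- \<bar>real_of_int n\<bar>)) <= 2 * (1 / (1 - exp (-1)))" .
 qed
qed auto

lemma summable_exp_int3: "(%n::int^3. exp (- (\<Sum>i\<in>UNIV. \<bar>real_of_int (n $ i)\<bar>))) summable_on UNIV"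
proof (rule nonneg_bdd_above_summable_on)
 define S where "S = infsum (%n::int. exp (- \<bar>real_of_int n\<bar>)) UNIV"
 show "bdd_above (sum (%n::int^3. exp (- (\<Sum>i\<in>UNIV. \<bar>real_of_int (n $ i)\<bar>))) ` {F. F <= UNIV & finite F})"
 proof (rule bdd_aboveI2)
  fix F :: "(int^3) set" assume "F \<in> {F. F <= UNIV & finite F}"
  hence F: "finite F" by simp
  define B where "B = (%i. (%n. n $ i) ` F)"
  have B: "finite (B i)" for i using F by (simp add: B_def)
  have inj: "inj_on vec_nth F" by (simp add: inj_on_def vec_nth_inject)
  have "(\<Sum>n\<in>F. exp (- (\<Sum>i\<in>UNIV. \<bar>real_of_int (n $ i)\<bar>))) = (\<Sum>n\<in>F. \<Prod>i\<in>UNIV. exp (- \<bar>real_of_int (n $ i)\<bar>))"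
   by (simp add: exp_sum flip: sum_negf)
  also have "\<dots> = (\<Sum>g\<in>vec_nth ` F. \<Prod>i\<in>UNIV. exp (- \<bar>real_of_int (g i)\<bar>))"
   by (subst sum.reindex[OF inj]) simp
  also have "\<dots> <= (\<Sum>g\<in>Pi\<^sub>E UNIV B. \<Prod>i\<in>UNIV. exp (- \<bar>real_of_int (g i)\<bar>))"
   by (rule sum_mono2) (use B in \<open>auto intro!: finite_PiE prod_nonneg simp: B_def\<close>)
  also have "\<dots> = (\<Prod>i\<in>(UNIV :: 3 set). \<Sum>n\<in>B i. exp (- \<bar>real_of_int n\<bar>))"
   by (rule prod_sum_PiE[symmetric]) (use B in auto)
  also have "\<dots> <= (\<Prod>i\<in>(UNIV :: 3 set). S)"
   unfolding S_def by (intro prod_mono conjI sum_nonneg finite_sum_le_infsum[OF summable_exp_int B]) auto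
  finally show "(\<Sum>n\<in>F. exp (- (\<Sum>i\<in>UNIV. \<bar>real_of_int (n $ i)\<bar>))) <= (\<Prod>i\<in>(UNIV :: 3 set). S)" .
 qed
qed auto

lemma positive_form_coercive:
 assumes "!!x. x ~= 0 ==> im_form \<tau> x x > 0"
 shows "\<exists>c>0. \<forall>x. im_form \<tau> x x >= c * (norm x)\<^sup>2"
proof -
 have cont: "continuous_on (sphere 0 1) (%x. im_form \<tau> x x)"
  unfolding im_form_def by (intro continuous_intros)
 have "axis 1 1 \<in> sphere (0 :: real^3) 1" by (simp add: norm_axis_1)
 then obtain k where k: "k \<in> sphere 0 1" "!!x. x \<in> sphere 0 1 ==> im_form \<tau> k k <= im_form \<tau> x x"
  using continuous_attains_inf[OF compact_sphere _ cont] by blast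
 have "k ~= 0" using k(1) by auto
 hence "im_form \<tau> k k > 0" by (rule assms)
 moreover have "im_form \<tau> x x >= im_form \<tau> k k * (norm x)\<^sup>2" for x
 proof (cases "x = 0")
  case True thus ?thesis by (simp add: im_form_def)
 next
  case False
  have "im_form \<tau> (x /\<^sub>R norm x) (x /\<^sub>R norm x) = im_form \<tau> x x / (norm x)\<^sup>2"
   by (simp add: im_form_def sum_divide_distrib power2_eq_square divide_inverse mult_ac sum_distrib_left)
  moreover have "im_form \<tau> k k <= im_form \<tau> (x /\<^sub>R norm x) (x /\<^sub>R norm x)" by (rule k(2)) (use False in simp)
  ultimately have "im_form \<tau> k k <= im_form \<tau> x x / (norm x)\<^sup>2" by (simp only:)
  thus ?thesis using False by (simp add: pos_le_divide_eq)
 qed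
 ultimately show ?thesis by blast
qed

text \<open>The positive form dominates a multiple of the squared norm, and completing the square in
  each coordinate turns Gaussian decay into exponential decay, uniformly on the strip.\<close>

lemma theta_term_bound:
 fixes a' b' :: "real^3"
 assumes a: "!!i. a $ i = of_real (a' $ i)" and b: "!!i. b $ i = of_real (b' $ i)"
  and pos: "!!x. x ~= 0 ==> im_form \<tau> x x > 0" and R: "R >= 0"
 shows "\<exists>K. \<forall>n z. (\<forall>i. \<bar>Im (z $ i)\<bar> <= R) --> norm (theta_term a b z \<tau> n) <= K * exp (- (\<Sum>i\<in>UNIV. \<bar>real_of_int (n $ i)\<bar>))"
proof -
 obtain c where c: "c > 0" "!!x. im_form \<tau> x x >= c * (norm x)\<^sup>2" using positive_form_coercive[OF pos] by blast
 define B where "B = 2 * pi * R + 1"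
 define k where "k = (\<Sum>i\<in>(UNIV::3 set). B\<^sup>2 / (4 * pi * c) + \<bar>a' $ i\<bar>)"
 have "norm (theta_term a b z \<tau> n) <= exp k * exp (- (\<Sum>i\<in>UNIV. \<bar>real_of_int (n $ i)\<bar>))"
  if z: "!!i. \<bar>Im (z $ i)\<bar> <= R" for n z
 proof -
  define x where "x = ((\<chi> i. of_int (n $ i) + a' $ i) :: real^3)"
  have one: "- pi * c * t\<^sup>2 + 2 * pi * R * \<bar>t\<bar> <= B\<^sup>2 / (4 * pi * c) + \<bar>s\<bar> - \<bar>m\<bar>" if "t = m + s" for t m s :: real
  proof -
   have "0 <= (2 * pi * c * \<bar>t\<bar> - B)\<^sup>2 / (4 * pi * c)" using c(1) by simp
   also have "\<dots> = pi * c * t\<^sup>2 - B * \<bar>t\<bar> + B\<^sup>2 / (4 * pi * c)"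
    using c(1) by (simp add: power2_eq_square field_simps)
   finally have "- pi * c * t\<^sup>2 + B * \<bar>t\<bar> <= B\<^sup>2 / (4 * pi * c)" by simp
   moreover have "\<bar>m\<bar> <= \<bar>t\<bar> + \<bar>s\<bar>" using that by simp
   ultimately show ?thesis by (simp add: B_def algebra_simps)
  qed
  have "- pi * im_form \<tau> x x <= - pi * c * (norm x)\<^sup>2" using mult_left_mono[OF c(2)[of x] pi_ge_zero] by (simp add: mult.assoc)
  also have "\<dots> = (\<Sum>i\<in>UNIV. - pi * c * (x $ i)\<^sup>2)"
   by (simp add: norm_vec_def L2_set_def sum_nonneg sum_distrib_left sum_negf)
  finally have 1: "- pi * im_form \<tau> x x <= (\<Sum>i\<in>UNIV. - pi * c * (x $ i)\<^sup>2)" .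
  have 2: "- 2 * pi * (\<Sum>i\<in>UNIV. x $ i * Im (z $ i)) <= (\<Sum>i\<in>UNIV. 2 * pi * R * \<bar>x $ i\<bar>)"
   unfolding sum_distrib_left
  proof (rule sum_mono)
   fix i
   have "- (x $ i * Im (z $ i)) <= \<bar>x $ i\<bar> * \<bar>Im (z $ i)\<bar>" using abs_ge_minus_self[of "x $ i * Im (z $ i)"] by (simp add: abs_mult)
   also have "\<dots> <= \<bar>x $ i\<bar> * R" by (rule mult_left_mono[OF z]) simp
   finally have "2 * pi * (- (x $ i * Im (z $ i))) <= 2 * pi * (\<bar>x $ i\<bar> * R)" by (rule mult_left_mono) simp
   thus "- 2 * pi * (x $ i * Im (z $ i)) <= 2 * pi * R * \<bar>x $ i\<bar>" by (simp add: mult_ac)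
  qed
  have "- pi * im_form \<tau> x x - 2 * pi * (\<Sum>i\<in>UNIV. x $ i * Im (z $ i)) <= (\<Sum>i\<in>UNIV. - pi * c * (x $ i)\<^sup>2 + 2 * pi * R * \<bar>x $ i\<bar>)"
   unfolding sum.distrib using 1 2 by linarith
  also have "\<dots> <= (\<Sum>i\<in>UNIV. B\<^sup>2 / (4 * pi * c) + \<bar>a' $ i\<bar> - \<bar>real_of_int (n $ i)\<bar>)"
   by (rule sum_mono, rule one) (simp add: x_def)
  also have "\<dots> = k + - (\<Sum>i\<in>UNIV. \<bar>real_of_int (n $ i)\<bar>)" by (simp add: k_def sum.distrib sum_subtractf)
  finally show ?thesis unfolding norm_theta_term[OF a b] x_def[symmetric] exp_add[symmetric] by simp
 qed
 thus ?thesis by blast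
qed

lemma hol3_theta_term: "entire (%z. theta_term a b z \<tau> n)"
 unfolding theta_term_def Let_def
 by (intro hol3_exp hol3_add hol3_mult hol3_const hol3_sum hol3_component) auto

text \<open>The series converges uniformly on strips, so the sum is continuous and holomorphic in
  each coordinate, and Osgood's lemma applies.\<close>

lemma riemann_theta_entire:
 fixes a' b' :: "real^3"
 assumes a: "!!i. a $ i = of_real (a' $ i)" and b: "!!i. b $ i = of_real (b' $ i)"
  and pos: "!!x. x ~= 0 ==> im_form \<tau> x x > 0"
 shows "entire (%z. riemann_theta a b z \<tau>)"
proof -
 have ul: "uniform_limit {z. \<forall>i. \<bar>Im (z $ i)\<bar> <= R} (%F z. \<Sum>n\<in>F. theta_term a b z \<tau> n)
   (%z. riemann_theta a b z \<tau>) (finite_subsets_at_top UNIV)" if R: "R >= 0" for R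
 proof -
  obtain K where K: "!!n z. (\<forall>i. \<bar>Im (z $ i)\<bar> <= R) ==> norm (theta_term a b z \<tau> n) <= K * exp (- (\<Sum>i\<in>UNIV. \<bar>real_of_int (n $ i)\<bar>))"
   using theta_term_bound[OF a b pos R] by blast
  show ?thesis unfolding riemann_theta_eq
   by (rule Weierstrass_m_test_general[where M="%n. K * exp (- (\<Sum>i\<in>UNIV. \<bar>real_of_int (n $ i)\<bar>))"])
     (use K summable_on_cmult_right[OF summable_exp_int3] in auto)
 qed
 show ?thesis
 proof (rule osgood)
  have "continuous_on {z. \<forall>i. \<bar>Im (z $ i)\<bar> <= R} (%z. riemann_theta a b z \<tau>)" if "R >= 0" for R
  proof (rule uniform_limit_theorem[OF _ ul[OF that]])
   show "\<forall>\<^sub>F F in finite_subsets_at_top UNIV. continuous_on {z. \<forall>i. \<bar>Im (z $ i)\<bar> <= R} (%z. \<Sum>n\<in>F. theta_term a b z \<tau> n)"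
    by (intro always_eventually allI continuous_intros continuous_on_subset[OF hol3_continuous[OF hol3_theta_term]]) auto
  qed (auto simp: finite_subsets_at_top_neq_bot)
  note cont = this
  have "isCont (%z. riemann_theta a b z \<tau>) z" for z :: "complex^3"
  proof -
   define R where "R = norm z + 1"
   have "ball (0::complex^3) R <= {z. \<forall>i. \<bar>Im (z $ i)\<bar> <= R}"
   proof safe
    fix w :: "complex^3" and i assume "w \<in> ball 0 R"
    thus "\<bar>Im (w $ i)\<bar> <= R" using abs_Im_le_cmod[of "w $ i"] Finite_Cartesian_Product.norm_nth_le[of w i] by simp
   qed
   hence "continuous_on (ball 0 R) (%z. riemann_theta a b z \<tau>)"
    by (rule continuous_on_subset[OF cont, rotated]) (simp add: R_def)
   thus ?thesis by (simp add: continuous_on_eq_continuous_at R_def)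
  qed
  thus "continuous_on UNIV (%z. riemann_theta a b z \<tau>)" by (simp add: continuous_at_imp_continuous_on)
  fix u :: "complex^3" and i
  define R where "R = norm u + 1"
  have sub: "u + axis i t \<in> {z. \<forall>i. \<bar>Im (z $ i)\<bar> <= R}" if "t \<in> cball 0 1" for t
  proof safe
   fix j
   have "\<bar>Im ((u + axis i t) $ j)\<bar> <= norm (u + axis i t)"
    using abs_Im_le_cmod[of "(u + axis i t) $ j"] Finite_Cartesian_Product.norm_nth_le[of "u + axis i t" j] by linarith
   also have "\<dots> <= R" using norm_triangle_ineq[of u "axis i t"] that by (simp add: R_def)
   finally show "\<bar>Im ((u + axis i t) $ j)\<bar> <= R" .
  qed
  have ul1: "uniform_limit (cball 0 1) (%F t. \<Sum>n\<in>F. theta_term a b (u + axis i t) \<tau> n)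
   (%t. riemann_theta a b (u + axis i t) \<tau>) (finite_subsets_at_top UNIV)"
   using uniform_limit_compose'[OF ul[of R], of "%t. u + axis i t" "cball 0 1"] sub by (simp add: R_def Pi_iff)
  have ev1: "\<forall>\<^sub>F F in finite_subsets_at_top UNIV. continuous_on (cball 0 1) (%t. \<Sum>n\<in>F. theta_term a b (u + axis i t) \<tau> n)
    & (%t. \<Sum>n\<in>F. theta_term a b (u + axis i t) \<tau> n) holomorphic_on ball 0 1"
  proof (intro always_eventually allI)
   fix F
   have hol: "(%t. \<Sum>n\<in>F. theta_term a b (u + axis i t) \<tau> n) holomorphic_on UNIV"
    by (intro holomorphic_intros line_axis_holomorphic[OF hol3_theta_term])
   show "continuous_on (cball 0 1) (%t. \<Sum>n\<in>F. theta_term a b (u + axis i t) \<tau> n)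
    & (%t. \<Sum>n\<in>F. theta_term a b (u + axis i t) \<tau> n) holomorphic_on ball 0 1"
    by (intro conjI continuous_on_subset[OF holomorphic_on_imp_continuous_on[OF hol]] holomorphic_on_subset[OF hol]) auto
  qed
  have "(%t. riemann_theta a b (u + axis i t) \<tau>) holomorphic_on ball 0 1"
   by (rule holomorphic_uniform_limit[OF ev1 ul1 finite_subsets_at_top_neq_bot])
  thus "(%t. riemann_theta a b (u + axis i t) \<tau>) field_differentiable at 0"
   by (rule holomorphic_on_imp_differentiable_at) auto
 qed auto
qed

lemma riemann_theta_quasi_space:
 assumes a: "!!i. 2 * a $ i \<in> \<int>" and b: "!!i. 2 * b $ i \<in> \<int>" and nz: "riemann_theta a b z0 \<tau> ~= 0"
 defines "\<tau>' \<equiv> symmetrize \<tau>"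
 shows "(%z. riemann_theta a b z \<tau>) \<in> quasi_space 1 \<tau>' (%j. expi2 (a $ j))
      (%j. exp (- (of_real pi * \<i> * \<tau>' $ j $ j)) * expi2 (- (b $ j)))"
proof -
 have half: "\<exists>c'::real^3. \<forall>i. c $ i = of_real (c' $ i)" if "!!i. 2 * c $ i \<in> \<int>" for c :: "complex^3"
 proof -
  have "\<forall>i. \<exists>k::int. 2 * c $ i = of_int k" using that by (metis Ints_cases)
  then obtain k :: "3 => int" where k: "!!i. 2 * c $ i = of_int (k i)" by metis
  have "c $ i = of_real (of_int (k i) / 2)" for i
   using k[of i] by (simp add: eq_divide_eq mult.commute)
  thus ?thesis by (intro exI[of _ "\<chi> i. of_int (k i) / 2"]) simp
 qed
 obtain a' b' :: "real^3" where a': "!!i. a $ i = of_real (a' $ i)" and b': "!!i. b $ i = of_real (b' $ i)"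
  using half[OF a] half[OF b] by blast
 have sym: "\<tau>' $ i $ k = \<tau>' $ k $ i" for i k unfolding \<tau>'_def by (rule symmetrize_sym)
 have eq: "riemann_theta a b z \<tau>' = riemann_theta a b z \<tau>" for z
  unfolding \<tau>'_def by (rule riemann_theta_symmetrize)
 \<comment> \<open>\<open>infsum\<close> of a family that is not summable is 0, so a single nonzero
   value already proves summability.\<close>
 have "theta_term a b z0 \<tau>' summable_on UNIV"
  using nz eq[of z0] unfolding riemann_theta_eq by (metis infsum_not_exists)
 from summable_imp_positive[OF this sym a' b']
 have pos: "k ~= 0 ==> im_form \<tau>' k k > 0" for k .
 have "entire (%z. riemann_theta a b z \<tau>')" by (rule riemann_theta_entire[OF a' b' pos])
 moreover have "riemann_theta a b (z + column j \<tau>') \<tau>' = exp (- (of_real pi * \<i> * \<tau>' $ j $ j)) * expi2 (- (b $ j)) * expi2 (- (of_nat 1 * z $ j)) * riemann_theta a b z \<tau>'" for j z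
  unfolding riemann_theta_column[OF sym] by (simp add: expi2_diff expi2_minus expi2_add field_simps)
 ultimately show ?thesis unfolding quasi_space_def eq using riemann_theta_axis[of a b _ _ \<tau>] by auto
qed

section \<open>Charts of the curve\<close>

definition hpol :: "(nat => complex) => complex => complex" where
 "hpol \<mu> x = \<mu> 1 * x^3 + \<mu> 3 * x^2 + \<mu> 5 * x + \<mu> 7"

definition gpol :: "(nat => complex) => complex => complex" where
 "gpol \<mu> x = x^7 + \<mu> 2 * x^6 + \<mu> 4 * x^5 + \<mu> 6 * x^4 + \<mu> 8 * x^3 + \<mu> 10 * x^2 + \<mu> 12 * x + \<mu> 14"

definition disc :: "(nat => complex) => complex => complex" where
 "disc \<mu> x = (hpol \<mu> x)^2 + 4 * gpol \<mu> x"

text \<open>The polynomial of the curve in the coordinate s = 1/x at infinity, written out so that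
  it makes sense at s = 0, where its value is 4.\<close>

definition rev_disc :: "(nat => complex) => complex => complex" where
 "rev_disc \<mu> s = s * (\<mu> 1 + \<mu> 3 * s + \<mu> 5 * s^2 + \<mu> 7 * s^3)^2
   + 4 * (1 + \<mu> 2 * s + \<mu> 4 * s^2 + \<mu> 6 * s^3 + \<mu> 8 * s^4 + \<mu> 10 * s^5 + \<mu> 12 * s^6 + \<mu> 14 * s^7)"

text \<open>Completing the square, the curve is \<open>Y\<^sup>2 = disc x\<close> with \<open>Y = f\<^sub>y\<close>.\<close>

definition Yc :: "(nat => complex) => complex \<times> complex => complex" where
 "Yc \<mu> p = 2 * snd p + hpol \<mu> (fst p)"

lemma holomorphic_hpol [holomorphic_intros]: "f holomorphic_on S ==> (%z. hpol \<mu> (f z)) holomorphic_on S"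
 unfolding hpol_def by (intro holomorphic_intros)

lemma holomorphic_disc [holomorphic_intros]: "f holomorphic_on S ==> (%z. disc \<mu> (f z)) holomorphic_on S"
 unfolding disc_def gpol_def by (intro holomorphic_intros)

lemma holomorphic_rev_disc [holomorphic_intros]: "f holomorphic_on S ==> (%z. rev_disc \<mu> (f z)) holomorphic_on S"
 unfolding rev_disc_def by (intro holomorphic_intros)

lemma entire_DERIV: "f holomorphic_on UNIV ==> (f has_field_derivative deriv f z) (at z within S)"
 by (metis UNIV_I has_field_derivative_at_within holomorphic_derivI open_UNIV)

lemma DERIV_hpol: "(hpol \<mu> has_field_derivative deriv (hpol \<mu>) z) (at z within S)"
 by (rule entire_DERIV) (use holomorphic_hpol[of "%z. z" UNIV \<mu>] in \<open>simp add: holomorphic_on_ident\<close>)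

lemma DERIV_disc: "(disc \<mu> has_field_derivative deriv (disc \<mu>) z) (at z within S)"
 by (rule entire_DERIV) (use holomorphic_disc[of "%z. z" UNIV \<mu>] in \<open>simp add: holomorphic_on_ident\<close>)

lemma holomorphic_deriv_disc: "deriv (disc \<mu>) holomorphic_on S"
proof -
 have "disc \<mu> holomorphic_on UNIV"
  using holomorphic_disc[of "%z. z" UNIV \<mu>] by (simp add: holomorphic_on_ident)
 hence "deriv (disc \<mu>) holomorphic_on UNIV" by (intro holomorphic_deriv) auto
 thus ?thesis by (rule holomorphic_on_subset) auto
qed

lemma curve_poly_disc: "4 * curve_poly \<mu> x y = (2 * y + hpol \<mu> x)^2 - disc \<mu> x"
 by (simp add: curve_poly_def disc_def hpol_def gpol_def power2_eq_square algebra_simps)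

lemma affine_curve_iff: "p \<in> affine_curve \<mu> \<longleftrightarrow> (Yc \<mu> p)^2 = disc \<mu> (fst p)"
 using curve_poly_disc[of \<mu> "fst p" "snd p"] by (auto simp: affine_curve_def Yc_def split: prod.splits)

lemma curve_poly_y_eq: "curve_poly_y \<mu> x y = Yc \<mu> (x, y)"
proof -
 have "DERIV (%w. curve_poly \<mu> x w) y :> Yc \<mu> (x, y)"
  unfolding curve_poly_def Yc_def hpol_def by (auto intro!: derivative_eq_intros)
 thus ?thesis unfolding curve_poly_y_def by (rule DERIV_imp_deriv)
qed

lemma curve_poly_x_eq: "4 * curve_poly_x \<mu> x y = 2 * Yc \<mu> (x, y) * deriv (hpol \<mu>) x - deriv (disc \<mu>) x"
proof -
 have "DERIV (%z. ((2 * y + hpol \<mu> z)^2 - disc \<mu> z) / 4) x :> (2 * Yc \<mu> (x, y) * deriv (hpol \<mu>) x - deriv (disc \<mu>) x) / 4"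
  by (auto intro!: derivative_eq_intros DERIV_hpol DERIV_disc simp: Yc_def)
 moreover have "(%z. curve_poly \<mu> z y) = (%z. ((2 * y + hpol \<mu> z)^2 - disc \<mu> z) / 4)"
  by (simp add: fun_eq_iff flip: curve_poly_disc)
 ultimately show ?thesis unfolding curve_poly_x_def by (simp add: DERIV_imp_deriv)
qed

lemma nonsingular_disc:
 assumes "nonsingular \<mu>" "p \<in> affine_curve \<mu>" "Yc \<mu> p = 0"
 shows "deriv (disc \<mu>) (fst p) ~= 0"
proof -
 have "curve_poly_x \<mu> (fst p) (snd p) ~= 0 | curve_poly_y \<mu> (fst p) (snd p) ~= 0"
  using assms(1,2) unfolding nonsingular_def by (cases p) auto
 thus ?thesis using assms(3) curve_poly_x_eq[of \<mu> "fst p" "snd p"] by (auto simp: curve_poly_y_eq)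
qed

text \<open>A local coordinate z with its parametrization \<open>par\<close>, an inverse
  \<open>coo\<close> defined on pairs (x, y), a primitive \<open>prim\<close> of \<open>du\<close>,
  and the factor \<open>den\<close> in dx / f_y = \<open>den\<close> z dz.\<close>

record curve_chart =
 dom :: "complex set"
 par :: "complex => complex \<times> complex"
 coo :: "complex \<times> complex => complex"
 prim :: "complex => complex^3"
 den :: "complex => complex"

definition patch :: "curve_chart => (complex \<times> complex) set" where
 "patch c = par c ` dom c"

text \<open>The derivatives of x and Y are given as multiples of \<open>den\<close>, in a form that
  is meaningful at branch points as well. Differentiability of \<open>coo\<close> in the ambient
  plane lets a path on the curve be pulled back to the coordinate.\<close>

definition is_chart :: "(nat => complex) => curve_chart => bool" where
 "is_chart \<mu> c \<longleftrightarrow> open (dom c) & connected (dom c) &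
   openin (top_of_set (affine_curve \<mu>)) (patch c) &
   (\<forall>z\<in>dom c. coo c (par c z) = z & coo c differentiable (at (par c z)) & den c z ~= 0 &
    DERIV (%z. fst (par c z)) z :> Yc \<mu> (par c z) * den c z &
    DERIV (%z. Yc \<mu> (par c z)) z :> deriv (disc \<mu>) (fst (par c z)) * den c z / 2 &
    (\<forall>i. DERIV (%z. prim c z $ i) z :> du_coeff i (par c z) * den c z))"

lemma is_chartD:
 assumes "is_chart \<mu> c"
 shows "open (dom c)" "connected (dom c)" "openin (top_of_set (affine_curve \<mu>)) (patch c)" "patch c <= affine_curve \<mu>"
  and "!!z. z \<in> dom c ==> coo c (par c z) = z"
  and "!!z. z \<in> dom c ==> coo c differentiable (at (par c z))"
  and "!!z. z \<in> dom c ==> den c z ~= 0"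
  and "!!z. z \<in> dom c ==> DERIV (%z. fst (par c z)) z :> Yc \<mu> (par c z) * den c z"
  and "!!z. z \<in> dom c ==> DERIV (%z. Yc \<mu> (par c z)) z :> deriv (disc \<mu>) (fst (par c z)) * den c z / 2"
  and "!!z i. z \<in> dom c ==> DERIV (%z. prim c z $ i) z :> du_coeff i (par c z) * den c z"
 using assms unfolding is_chart_def by (auto dest: openin_imp_subset)

lemma primitive3:
 assumes "convex S" "open S" "!!i. f i holomorphic_on S"
 shows "\<exists>F :: complex => complex^3. \<forall>z\<in>S. \<forall>i. DERIV (%z. F z $ i) z :> f i z"
proof -
 have "\<exists>g. \<forall>z\<in>S. DERIV g z :> f i z" for i
 proof -
  obtain g where "!!x. x \<in> S ==> (g has_field_derivative f i x) (at x within S)"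
   using holomorphic_convex_primitive[of S "{}" "f i"] assms holomorphic_on_imp_continuous_on[OF assms(3)]
    holomorphic_on_imp_differentiable_at[OF assms(3,2)] assms(2) by (auto simp: interior_open)
  thus ?thesis using at_within_open[OF _ assms(2)] by metis
 qed
 then obtain g where "!!i z. z \<in> S ==> DERIV (g i) z :> f i z" by metis
 thus ?thesis by (intro exI[of _ "%z. \<chi> i. g i z"]) auto
qed

lemma holomorphic_du_coeff:
 assumes "(%z. fst (f z)) holomorphic_on S"
 shows "(%z. du_coeff i (f z)) holomorphic_on S"
 unfolding du_coeff_def using assms by (cases "i = 1"; cases "i = 2") (auto intro!: holomorphic_intros)

lemma openin_affine_Collect:
 assumes "open {p. Q p}"
 shows "openin (top_of_set (affine_curve \<mu>)) {p \<in> affine_curve \<mu>. Q p}"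
 using assms by (auto simp: openin_open Int_def)

lemma has_derivative_Yc: "(Yc \<mu> has_derivative (%h. 2 * snd h + deriv (hpol \<mu>) (fst p) * fst h)) (at p)"
proof -
 have "((%p. hpol \<mu> (fst p)) has_derivative (%h. deriv (hpol \<mu>) (fst p) * fst h)) (at p)"
  by (rule has_derivative_compose[of fst fst p UNIV "hpol \<mu>", simplified])
    (use DERIV_hpol[of \<mu> "fst p"] in \<open>auto simp: has_field_derivative_def intro!: derivative_eq_intros\<close>)
 thus ?thesis unfolding Yc_def[abs_def] by (auto intro!: derivative_eq_intros)
qed

lemma continuous_Yc [continuous_intros]: "continuous_on S (Yc \<mu>)"
 by (intro continuous_at_imp_continuous_on ballI has_derivative_continuous[OF has_derivative_Yc])

text \<open>The coordinate is x, and Y is \<open>Y0'\<close> times the principal root of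
  \<open>disc \<mu> x / Y0'^2\<close>, whose argument is 1 at the centre and so keeps away from the
  branch cut. Positive real part of Y / \<open>Y0'\<close> selects the sheet.\<close>

lemma chart_at_unramified:
 assumes p0: "p0 \<in> affine_curve \<mu>" and Y0: "Yc \<mu> p0 ~= 0"
 shows "\<exists>c. is_chart \<mu> c & p0 \<in> patch c"
proof -
 define x0 Y0' where "x0 = fst p0" and "Y0' = Yc \<mu> p0"
 have Y0': "Y0' ~= 0" "Y0'^2 = disc \<mu> x0" using p0 Y0 by (auto simp: affine_curve_iff x0_def Y0'_def)
 have dd: "(%x. disc \<mu> x / Y0'^2) holomorphic_on UNIV"
  using Y0' by (intro holomorphic_intros) (auto simp: holomorphic_on_ident)
 have "open {x. Re (disc \<mu> x / Y0'^2) > 0}"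
  by (intro open_Collect_less continuous_intros holomorphic_on_imp_continuous_on[OF dd])
 moreover have "x0 \<in> {x. Re (disc \<mu> x / Y0'^2) > 0}" using Y0' by (simp flip: Y0'(2))
 ultimately obtain d where d: "d > 0" "ball x0 d <= {x. Re (disc \<mu> x / Y0'^2) > 0}"
  using open_contains_ball by blast
 define B where "B = ball x0 d"
 have pos: "Re (disc \<mu> x / Y0'^2) > 0" if "x \<in> B" for x using d that by (auto simp: B_def)
 define g where "g = (%x. Y0' * csqrt (disc \<mu> x / Y0'^2))"
 have g2: "(g x)^2 = disc \<mu> x" for x using Y0'(1) by (simp add: g_def power_mult_distrib)
 have gnz: "g x ~= 0" if "x \<in> B" for x using pos[OF that] g2[of x] by auto
 have "(%x. disc \<mu> x / Y0'\<^sup>2) holomorphic_on B" using dd by (rule holomorphic_on_subset) auto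
 moreover have "disc \<mu> x / Y0'^2 ~: \<real>\<^sub>\<le>\<^sub>0" if "x \<in> B" for x using pos[OF that] by (auto simp: complex_nonpos_Reals_iff)
 ultimately have "(%x. csqrt (disc \<mu> x / Y0'\<^sup>2)) holomorphic_on B" by (rule holomorphic_on_csqrt')
 hence gh: "g holomorphic_on B" unfolding g_def by (intro holomorphic_on_mult holomorphic_on_const)
 have "\<exists>F :: complex => complex^3. \<forall>z\<in>B. \<forall>i. DERIV (%z. F z $ i) z :> du_coeff i (z, (g z - hpol \<mu> z) / 2) * inverse (g z)"
  by (rule primitive3, goal_cases)
    (use gnz in \<open>auto simp: B_def[symmetric] intro!: holomorphic_intros holomorphic_du_coeff gh\<close>, simp_all add: B_def)
 then obtain F :: "complex => complex^3" where F: "!!z i. z \<in> B ==> DERIV (%z. F z $ i) z :> du_coeff i (z, (g z - hpol \<mu> z) / 2) * inverse (g z)"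
  by blast
 define c where "c = \<lparr>dom = B, par = (%z. (z, (g z - hpol \<mu> z) / 2)), coo = fst, prim = F, den = (%z. inverse (g z))\<rparr>"
 have Yg: "Yc \<mu> (z, (g z - hpol \<mu> z) / 2) = g z" for z by (simp add: Yc_def diff_divide_distrib)
 have patch: "patch c = {p \<in> affine_curve \<mu>. fst p \<in> B & Re (Yc \<mu> p / Y0') > 0}"
 proof (intro subset_antisym subsetI)
  fix p assume "p \<in> patch c"
  then obtain z where z: "z \<in> B" "p = (z, (g z - hpol \<mu> z) / 2)" by (auto simp: patch_def c_def)
  have "Re (csqrt (disc \<mu> z / Y0'^2)) > 0" using pos[OF z(1)] csqrt_principal[of "disc \<mu> z / Y0'^2"]
   by (smt (verit) complex_Re_numeral csqrt_eq_0 power2_csqrt Re_power2 zero_less_power2 zero_complex.sel(1) power2_eq_square mult_nonneg_nonneg not_sum_power2_lt_zero zero_le_power2)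
  thus "p \<in> {p \<in> affine_curve \<mu>. fst p \<in> B & Re (Yc \<mu> p / Y0') > 0}"
   using z Y0' by (simp add: affine_curve_iff Yg g2) (simp add: g_def)
 next
  fix p assume p: "p \<in> {p \<in> affine_curve \<mu>. fst p \<in> B & Re (Yc \<mu> p / Y0') > 0}"
  have "(Yc \<mu> p / Y0')^2 = disc \<mu> (fst p) / Y0'^2" using p by (simp add: affine_curve_iff power_divide)
  hence "csqrt (disc \<mu> (fst p) / Y0'^2) = Yc \<mu> p / Y0'" using p by (intro csqrt_unique) auto
  hence "g (fst p) = Yc \<mu> p" using Y0' by (simp add: g_def)
  hence "p = (fst p, (g (fst p) - hpol \<mu> (fst p)) / 2)" by (cases p) (simp add: Yc_def)
  thus "p \<in> patch c" using p unfolding patch_def c_def by (auto intro!: image_eqI[of _ _ "fst p"])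
 qed
 have "is_chart \<mu> c"
  unfolding is_chart_def
 proof (intro conjI ballI allI)
  show "openin (top_of_set (affine_curve \<mu>)) (patch c)" unfolding patch
  proof (rule openin_affine_Collect)
   have "open {p :: complex \<times> complex. fst p \<in> B}"
    unfolding B_def mem_ball by (intro open_Collect_less continuous_intros)
   moreover have "open {p. Re (Yc \<mu> p / Y0') > 0}" using Y0' by (intro open_Collect_less continuous_intros) auto
   ultimately show "open {p. fst p \<in> B & Re (Yc \<mu> p / Y0') > 0}" by (rule open_Collect_conj)
  qed
  fix z assume z: "z \<in> dom c"
  hence zB: "z \<in> B" by (simp add: c_def)
  have gd: "DERIV g z :> deriv g z"
   using gh zB by (intro holomorphic_derivI[of g B]) (auto simp: B_def)
  have "DERIV (%z. (g z)^2) z :> 2 * g z * deriv g z"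
   by (auto intro!: derivative_eq_intros gd)
  hence "DERIV (disc \<mu>) z :> 2 * g z * deriv g z" by (simp add: g2)
  hence "deriv (disc \<mu>) z = 2 * g z * deriv g z" by (rule DERIV_imp_deriv)
  hence "deriv (disc \<mu>) z * inverse (g z) / 2 = deriv g z" using gnz[OF zB] by simp
  thus "DERIV (%z. Yc \<mu> (par c z)) z :> deriv (disc \<mu>) (fst (par c z)) * den c z / 2"
   using gd by (simp add: c_def Yg)
  show "DERIV (%z. fst (par c z)) z :> Yc \<mu> (par c z) * den c z"
   using gnz[OF zB] by (simp add: c_def Yg)
  show "coo c differentiable (at (par c z))" by (simp add: c_def bounded_linear_imp_differentiable bounded_linear_fst)
  show "DERIV (%z. prim c z $ i) z :> du_coeff i (par c z) * den c z" for i
   using F[OF zB] by (simp add: c_def)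
 qed (use gnz in \<open>auto simp: c_def B_def\<close>)
 moreover have "p0 \<in> patch c" unfolding patch using p0 Y0' d(1) by (simp add: B_def x0_def Y0'_def)
 ultimately show ?thesis by blast
qed

text \<open>The coordinate is Y: where \<open>disc\<close> has nonzero derivative it is inverted
  locally, and x is the value of the inverse at Y^2. From 2 Y dY = disc'(x) dx the form dx / Y
  becomes 2 dY / disc'(x).\<close>

lemma chart_at_ramified:
 assumes p0: "p0 \<in> affine_curve \<mu>" and Y0: "Yc \<mu> p0 = 0" and d0: "deriv (disc \<mu>) (fst p0) ~= 0"
 shows "\<exists>c. is_chart \<mu> c & p0 \<in> patch c"
proof -
 define x0 where "x0 = fst p0"
 have dh: "disc \<mu> holomorphic_on S" for S
  using holomorphic_disc[of "%z. z" S \<mu>] by (simp add: holomorphic_on_ident)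
 obtain r where r: "r > 0" "open (disc \<mu> ` ball x0 r)" "inj_on (disc \<mu>) (ball x0 r)"
  using has_complex_derivative_locally_invertible[OF dh, of x0 UNIV] d0 by (auto simp: x0_def)
 obtain h where h: "h holomorphic_on disc \<mu> ` ball x0 r"
  "!!z. z \<in> ball x0 r ==> deriv (disc \<mu>) z * deriv h (disc \<mu> z) = 1"
  "!!z. z \<in> ball x0 r ==> h (disc \<mu> z) = z"
  using holomorphic_has_inverse[OF dh open_ball r(3)] by blast
 have z0: "disc \<mu> x0 = 0" using p0 Y0 by (simp add: affine_curve_iff x0_def)
 have "0 \<in> disc \<mu> ` ball x0 r" using z0 r(1) by (metis centre_in_ball imageI)
 then obtain e where e: "e > 0" "ball 0 e <= disc \<mu> ` ball x0 r" using r(2) open_contains_ball by blast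
 define B where "B = ball (0::complex) (sqrt e)"
 have sq: "Y^2 \<in> disc \<mu> ` ball x0 r" if "Y \<in> B" for Y
 proof -
  have "norm Y ^ 2 < (sqrt e)^2" using that by (intro power_strict_mono) (auto simp: B_def)
  hence "Y^2 \<in> ball 0 e" using e(1) by (simp add: norm_power)
  thus ?thesis using e by blast
 qed
 define X where "X = (%Y. h (Y^2))"
 have X: "X Y \<in> ball x0 r" "disc \<mu> (X Y) = Y^2" if Y: "Y \<in> B" for Y
  using sq[OF Y] h(3) unfolding X_def by auto
 have Xh: "X holomorphic_on B" unfolding X_def
  by (intro holomorphic_on_compose_gen[OF _ h(1), unfolded o_def] holomorphic_intros) (use sq in auto)
 have dnz: "deriv (disc \<mu>) (X Y) ~= 0" if "Y \<in> B" for Y using h(2)[OF X(1)[OF that]] by auto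
 have dX: "DERIV X Y :> 2 * Y / deriv (disc \<mu>) (X Y)" if Y: "Y \<in> B" for Y
 proof -
  have d: "DERIV X Y :> deriv X Y"
   using Xh Y by (intro holomorphic_derivI[of X B]) (auto simp: B_def)
  have "DERIV (%Y. disc \<mu> (X Y)) Y :> deriv (disc \<mu>) (X Y) * deriv X Y"
   by (rule DERIV_chain2[OF DERIV_disc d])
  hence "DERIV (%Y. Y^2) Y :> deriv (disc \<mu>) (X Y) * deriv X Y"
   by (rule has_field_derivative_transform_within_open[of _ _ _ B]) (use X Y in \<open>auto simp: B_def\<close>)
  moreover have "DERIV (%Y. Y^2) Y :> 2 * Y" by (auto intro!: derivative_eq_intros)
  ultimately have "deriv (disc \<mu>) (X Y) * deriv X Y = 2 * Y" by (rule DERIV_unique)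
  hence "deriv X Y = 2 * Y / deriv (disc \<mu>) (X Y)" using dnz[OF Y] by (simp add: field_simps)
  thus ?thesis using d by simp
 qed
 define f where "f = (%Y. (X Y, (Y - hpol \<mu> (X Y)) / 2))"
 define w where "w = (%Y. 2 / deriv (disc \<mu>) (X Y))"
 have wh: "w holomorphic_on B" unfolding w_def
  by (intro holomorphic_intros holomorphic_on_compose_gen[OF Xh holomorphic_deriv_disc, unfolded o_def]) (use dnz in auto)
 have "\<exists>F :: complex => complex^3. \<forall>z\<in>B. \<forall>i. DERIV (%z. F z $ i) z :> du_coeff i (f z) * w z"
  by (rule primitive3) (auto simp: f_def intro!: holomorphic_on_mult wh holomorphic_du_coeff Xh, simp_all add: B_def)
 then obtain F :: "complex => complex^3" where F: "!!z i. z \<in> B ==> DERIV (%z. F z $ i) z :> du_coeff i (f z) * w z"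
  by blast
 define c where "c = \<lparr>dom = B, par = f, coo = Yc \<mu>, prim = F, den = w\<rparr>"
 have Yf: "Yc \<mu> (f z) = z" for z by (simp add: Yc_def f_def diff_divide_distrib)
 have patch: "patch c = {p \<in> affine_curve \<mu>. fst p \<in> ball x0 r & Yc \<mu> p \<in> B}"
 proof (intro subset_antisym subsetI)
  fix p assume "p \<in> patch c"
  then obtain z where z: "z \<in> B" "p = f z" by (auto simp: patch_def c_def)
  show "p \<in> {p \<in> affine_curve \<mu>. fst p \<in> ball x0 r & Yc \<mu> p \<in> B}"
   using z X[OF z(1)] by (simp only: mem_Collect_eq affine_curve_iff Yf) (simp add: f_def)
 next
  fix p assume p: "p \<in> {p \<in> affine_curve \<mu>. fst p \<in> ball x0 r & Yc \<mu> p \<in> B}"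
  hence "X (Yc \<mu> p) = fst p" using h(3)[of "fst p"] by (simp add: X_def affine_curve_iff)
  hence "p = f (Yc \<mu> p)" by (cases p) (simp add: f_def Yc_def)
  thus "p \<in> patch c" using p unfolding patch_def c_def by (auto intro!: image_eqI[of _ _ "Yc \<mu> p"])
 qed
 have "is_chart \<mu> c"
  unfolding is_chart_def
 proof (intro conjI ballI allI)
  show "openin (top_of_set (affine_curve \<mu>)) (patch c)" unfolding patch
  proof (rule openin_affine_Collect)
   have "open {p :: complex \<times> complex. fst p \<in> ball x0 r}"
    unfolding mem_ball by (intro open_Collect_less continuous_intros)
   moreover have "open {p. Yc \<mu> p \<in> B}"
    unfolding B_def mem_ball by (intro open_Collect_less continuous_intros)
   ultimately show "open {p. fst p \<in> ball x0 r & Yc \<mu> p \<in> B}" by (rule open_Collect_conj)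
  qed
  fix z assume z: "z \<in> dom c"
  hence zB: "z \<in> B" by (simp add: c_def)
  show "DERIV (%z. Yc \<mu> (par c z)) z :> deriv (disc \<mu>) (fst (par c z)) * den c z / 2"
   using dnz[OF zB] by (simp add: c_def Yf) (simp add: f_def w_def)
  show "DERIV (%z. fst (par c z)) z :> Yc \<mu> (par c z) * den c z"
   using dX[OF zB] by (simp add: c_def Yf) (simp add: f_def w_def mult.commute)
  show "coo c differentiable (at (par c z))" using has_derivative_Yc[of \<mu> "f z"] by (auto simp: c_def differentiable_def)
  show "DERIV (%z. prim c z $ i) z :> du_coeff i (par c z) * den c z" for i
   using F[OF zB] by (simp add: c_def)
 qed (use dnz in \<open>auto simp: c_def B_def w_def Yf\<close>)
 moreover have "p0 \<in> patch c" unfolding patch using p0 Y0 e(1) r(1) by (simp add: B_def x0_def)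
 ultimately show ?thesis by blast
qed

lemma disc_rev: "x ~= 0 ==> disc \<mu> x = x^7 * rev_disc \<mu> (1 / x)"
 by (simp add: disc_def rev_disc_def hpol_def gpol_def power2_eq_square power_divide field_simps eval_nat_numeral)

text \<open>Near infinity \<open>x = t\<^sup>-\<^sup>2\<close> and \<open>Y = t\<^sup>-\<^sup>7 P t\<close> with \<open>P\<close> even; the form \<open>dx / Y\<close> is \<open>t\<^sup>4 Q t dt\<close> with \<open>Q = - 2 / P\<close>.\<close>

lemma chart_at_infinity:
 "\<exists>c r (A :: complex => complex^3) Q. is_chart \<mu> c & r > 0 & dom c = ball 0 r - {0} & prim c = A & A 0 = 0 &
   patch c = {p \<in> affine_curve \<mu>. norm (fst p) > 1 / r^2} &
   Q holomorphic_on ball 0 r & (\<forall>t\<in>ball 0 r. Q t ~= 0) &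
   (\<forall>t\<in>ball 0 r. DERIV (%z. A z $ 1) t :> Q t * t^4) &
   (\<forall>t\<in>ball 0 r. DERIV (%z. A z $ 2) t :> Q t * t^2) &
   (\<forall>t\<in>ball 0 r. DERIV (%z. A z $ 3) t :> Q t) &
   (\<forall>t\<in>ball 0 r. A (- t) = - A t) &
   (\<forall>t\<in>dom c. fst (par c t) = 1 / t^2) &
   (\<forall>p\<in>patch c. coo c p ^ 2 = 1 / fst p)"
proof -
 have rd: "rev_disc \<mu> holomorphic_on UNIV"
  using holomorphic_rev_disc[of "%z. z" UNIV \<mu>] by (simp add: holomorphic_on_ident)
 have "open {s. Re (rev_disc \<mu> s) > 0}"
  by (intro open_Collect_less continuous_intros holomorphic_on_imp_continuous_on[OF rd])
 moreover have "0 \<in> {s. Re (rev_disc \<mu> s) > 0}" by (simp add: rev_disc_def)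
 ultimately obtain R where R: "R > 0" "ball 0 R <= {s. Re (rev_disc \<mu> s) > 0}"
  using open_contains_ball by blast
 define r where "r = sqrt R"
 have r: "r > 0" "r^2 = R" using R(1) by (auto simp: r_def)
 have sq: "t^2 \<in> ball 0 R" if "t \<in> ball 0 r" for t :: complex
 proof -
  have "norm t ^ 2 < r^2" using that by (intro power_strict_mono) auto
  thus ?thesis by (simp add: r norm_power)
 qed
 define q where "q = (%s. csqrt (rev_disc \<mu> s))"
 have qh: "q holomorphic_on ball 0 R" unfolding q_def
  by (intro holomorphic_on_csqrt' holomorphic_on_subset[OF rd]) (use R in \<open>auto simp: complex_nonpos_Reals_iff\<close>)
 have q2: "(q s)^2 = rev_disc \<mu> s" for s by (simp add: q_def)
 have qnz: "q s ~= 0" if "s \<in> ball 0 R" for s using R(2) that q2[of s] by auto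
 define P where "P = (%t::complex. q (t^2))"
 have Ph: "P holomorphic_on ball 0 r" unfolding P_def
  by (intro holomorphic_on_compose_gen[OF _ qh, unfolded o_def] holomorphic_intros) (use sq in auto)
 have Pnz: "P t ~= 0" if "t \<in> ball 0 r" for t unfolding P_def using qnz[OF sq[OF that]] .
 define Q where "Q = (%t. - 2 / P t)"
 have Qh: "Q holomorphic_on ball 0 r" unfolding Q_def by (intro holomorphic_intros Ph) (use Pnz in auto)
 define f where "f = (%(i::3) t. if i = 1 then Q t * t^4 else if i = 2 then Q t * t^2 else Q t)"
 have "\<exists>F :: complex => complex^3. \<forall>z\<in>ball 0 r. \<forall>i. DERIV (%z. F z $ i) z :> f i z"
 proof (rule primitive3)
  show "f i holomorphic_on ball 0 r" for i
   unfolding f_def by (cases "i = 1"; cases "i = 2") (auto intro!: holomorphic_intros Qh)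
 qed auto
 then obtain F :: "complex => complex^3" where F: "!!z i. z \<in> ball 0 r ==> DERIV (%z. F z $ i) z :> f i z"
  by blast
 define A where "A = (%t. F t - F 0)"
 have A: "DERIV (%z. A z $ i) t :> f i t" if "t \<in> ball 0 r" for t i
  using F[OF that, of i] by (auto simp: A_def intro!: derivative_eq_intros)
 have odd: "A (- t) = - A t" if t: "t \<in> ball 0 r" for t
 proof -
  have "A z $ i + A (- z) $ i = 0" if z: "z \<in> ball 0 r" for z i
  proof -
   have "\<exists>c. \<forall>z\<in>ball 0 r. A z $ i + A (- z) $ i = c"
   proof (rule has_field_derivative_zero_constant)
    fix z assume z: "z \<in> ball (0::complex) r"
    have even: "f i (- z) = f i z" by (simp add: f_def Q_def P_def)
    have "DERIV (%z. A (- z) $ i) z :> f i (- z) * (-1)"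
     by (rule DERIV_chain2[OF A]) (use z in \<open>auto intro!: derivative_eq_intros\<close>)
    hence "DERIV (%z. A z $ i + A (- z) $ i) z :> f i z + f i (- z) * (-1)"
     by (rule DERIV_add[OF A[OF z]])
    thus "((%z. A z $ i + A (- z) $ i) has_field_derivative 0) (at z within ball 0 r)"
     unfolding even by (simp add: has_field_derivative_at_within)
   qed auto
   then obtain c where c: "!!z. z \<in> ball 0 r ==> A z $ i + A (- z) $ i = c" by blast
   have "c = 0" using c[of 0] r by (simp add: A_def)
   thus ?thesis using c z by blast
  qed
  thus ?thesis using t by (auto simp: vec_eq_iff add_eq_0_iff)
 qed
 define B where "B = ball (0::complex) r - {0}"
 define Yt where "Yt = (%t. P t / t^7)"
 define g where "g = (%t. (1 / t^2, (Yt t - hpol \<mu> (1 / t^2)) / 2))"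
 \<comment> \<open>Since x = t^-2 and Y = t^-7 P(t), the coordinate is recovered as t = x^3 P(t) /
   Y, where P(t) depends only on t^2 = 1/x.\<close>
 define y where "y = (%p. (fst p)^3 * q (1 / fst p) / Yc \<mu> p)"
 define w where "w = (%t. t^4 * Q t)"
 define c where "c = \<lparr>dom = B, par = g, coo = y, prim = A, den = w\<rparr>"
 have Yg: "Yc \<mu> (g t) = Yt t" for t by (simp add: Yc_def g_def diff_divide_distrib)
 have Ynz: "Yt t ~= 0" if "t \<in> B" for t using that Pnz[of t] by (simp add: Yt_def B_def)
 have Yd: "(Yt t)^2 = disc \<mu> (1 / t^2)" if "t \<in> B" for t
  using that by (subst disc_rev) (auto simp: Yt_def P_def B_def power_divide q2 power_mult[symmetric])
 have zp: "y (g t) = t" if "t \<in> B" for t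
 proof -
  have "y (g t) = (1 / t^2)^3 * P t / (P t / t^7)"
   unfolding y_def Yg by (simp add: g_def P_def Yt_def)
  also have "\<dots> = t" using that Pnz[of t] by (simp add: B_def power_divide field_simps eval_nat_numeral)
  finally show ?thesis .
 qed
 have inv: "y p \<in> B & (y p)^2 = 1 / fst p & p = g (y p)" if p: "p \<in> affine_curve \<mu>" "norm (fst p) > 1 / r^2" for p
 proof -
  have x: "fst p ~= 0" using p(2) r by auto
  have small: "1 / fst p \<in> ball 0 R"
   using p(2) r x R(1) by (simp add: norm_divide field_simps)
  have Y2: "(Yc \<mu> p)^2 = (fst p)^7 * (q (1 / fst p))^2"
   using p(1) x by (simp add: affine_curve_iff disc_rev q2)
  have Y: "Yc \<mu> p ~= 0" using Y2 x qnz[OF small] by auto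
  have t2: "(y p)^2 = 1 / fst p"
  proof -
   have e7: "a^7 = a^6 * a" for a :: complex by (simp add: eval_nat_numeral)
   have "(y p)^2 = ((fst p)^6 * (q (1 / fst p))^2) / ((fst p)^7 * (q (1 / fst p))^2)"
    unfolding y_def power_divide power_mult_distrib Y2 by (simp flip: power_mult)
   thus ?thesis unfolding e7 using x qnz[OF small] by simp
  qed
  have tnz: "y p ~= 0" using t2 x by auto
  have "norm (y p) ^ 2 < r^2" using arg_cong[OF t2, of norm] small r by (simp add: norm_power)
  hence "norm (y p) < r" by (rule power2_less_imp_less) (use r in simp)
  hence tB: "y p \<in> B" using tnz by (simp add: B_def)
  have "Yt (y p) = Yc \<mu> p"
  proof -
   have "(y p)^7 = ((y p)^2)^3 * y p" by (simp add: eval_nat_numeral)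
   also have "\<dots> = q (1 / fst p) / Yc \<mu> p" unfolding t2 using x by (simp add: y_def power_divide field_simps)
   finally show ?thesis using Y qnz[OF small] by (simp add: Yt_def P_def t2)
  qed
  hence "p = g (y p)" by (intro prod_eqI) (simp_all add: g_def t2 Yc_def)
  thus ?thesis using tB t2 by simp
 qed
 have patch: "patch c = {p \<in> affine_curve \<mu>. norm (fst p) > 1 / r^2}"
 proof (intro subset_antisym subsetI)
  fix p assume "p \<in> patch c"
  then obtain t where t: "t \<in> B" "p = g t" by (auto simp: patch_def c_def)
  have "norm t ^ 2 < r^2" using t(1) by (intro power_strict_mono) (auto simp: B_def)
  hence "1 / r^2 < 1 / (norm t)^2"
   using t(1) r(1) by (intro divide_strict_left_mono) (auto simp: B_def)
  hence "norm (fst p) > 1 / r^2" using t(2) by (simp add: g_def norm_divide norm_power)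
  moreover have "p \<in> affine_curve \<mu>" unfolding affine_curve_iff t(2) Yg Yd[OF t(1)] by (simp add: g_def)
  ultimately show "p \<in> {p \<in> affine_curve \<mu>. norm (fst p) > 1 / r^2}" by simp
 next
  fix p assume "p \<in> {p \<in> affine_curve \<mu>. norm (fst p) > 1 / r^2}"
  hence "y p \<in> B" "p = g (y p)" using inv by blast+
  thus "p \<in> patch c" unfolding patch_def c_def by auto
 qed
 have "is_chart \<mu> c"
  unfolding is_chart_def
 proof (intro conjI ballI allI)
  show "openin (top_of_set (affine_curve \<mu>)) (patch c)" unfolding patch
   by (intro openin_affine_Collect open_Collect_less continuous_intros)
  show "connected (dom c)" unfolding c_def B_def
   by (simp add: connected_open_delete)
  fix t assume t: "t \<in> dom c"
  hence tB: "t \<in> B" by (simp add: c_def)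
  hence t0: "t ~= 0" and tb: "t \<in> ball 0 r" by (auto simp: B_def)
  have x': "DERIV (%t. 1 / t^2) t :> Yt t * w t"
   using t0 Pnz[OF tb] by (auto intro!: derivative_eq_intros simp: Yt_def w_def Q_def field_simps eval_nat_numeral)
  thus "DERIV (%z. fst (par c z)) t :> Yc \<mu> (par c t) * den c t"
   by (simp add: c_def Yg) (simp add: g_def)
  have "Yt holomorphic_on B" unfolding Yt_def
   by (intro holomorphic_intros holomorphic_on_subset[OF Ph]) (auto simp: B_def)
  hence Y': "DERIV Yt t :> deriv Yt t"
   using tB by (intro holomorphic_derivI[of Yt B]) (auto simp: B_def)
  have "DERIV (%t. (Yt t)^2) t :> 2 * Yt t * deriv Yt t"
   by (auto intro!: derivative_eq_intros Y')
  moreover have "DERIV (%t. (Yt t)^2) t :> deriv (disc \<mu>) (1 / t^2) * (Yt t * w t)"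
   by (rule has_field_derivative_transform_within_open[OF DERIV_chain2[OF DERIV_disc x'], of B])
     (use tB Yd in \<open>auto simp: B_def\<close>)
  ultimately have "2 * Yt t * deriv Yt t = deriv (disc \<mu>) (1 / t^2) * (Yt t * w t)" by (rule DERIV_unique)
  hence d: "deriv Yt t = deriv (disc \<mu>) (1 / t^2) * w t / 2" using Ynz[OF tB] by (simp add: field_simps)
  have "DERIV Yt t :> deriv (disc \<mu>) (1 / t^2) * w t / 2" using Y' unfolding d .
  moreover have "(%z. Yc \<mu> (par c z)) = Yt" "fst (par c t) = 1 / t^2" "den c t = w t"
   by (simp_all add: c_def Yg) (simp add: g_def)
  ultimately show "DERIV (%z. Yc \<mu> (par c z)) t :> deriv (disc \<mu>) (fst (par c t)) * den c t / 2"
   by simp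
  show "DERIV (%z. prim c z $ i) t :> du_coeff i (par c t) * den c t" for i
   using A[OF tb, of i] t0 by (simp add: c_def f_def du_coeff_def g_def w_def power_divide field_simps eval_nat_numeral split: if_splits)
  show "coo c (par c t) = t" using zp[OF tB] by (simp add: c_def)
  show "den c t ~= 0" using Pnz[OF tb] t0 by (simp add: c_def w_def Q_def)
  show "coo c differentiable (at (par c t))"
  proof -
   have f1: "fst (g t) ~= 0" "1 / fst (g t) \<in> ball 0 R" using t0 sq[OF tb] by (auto simp: g_def)
   have "DERIV (%x. x^3 * q (1 / x)) (fst (g t)) :> deriv (%x. x^3 * q (1 / x)) (fst (g t))"
   proof (rule holomorphic_derivI[of _ "{x. x ~= 0 & 1 / x \<in> ball 0 R}"])
    show "(%x. x^3 * q (1 / x)) holomorphic_on {x. x ~= 0 & 1 / x \<in> ball 0 R}"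
     by (intro holomorphic_intros holomorphic_on_compose_gen[OF _ qh, unfolded o_def]) auto
    have "x ~= 0 & 1 / x \<in> ball 0 R \<longleftrightarrow> norm x > 1 / R" for x :: complex
     using R(1) by (cases "x = 0") (simp_all add: norm_divide field_simps)
    thus "open {x::complex. x ~= 0 & 1 / x \<in> ball 0 R}"
     by (simp only:) (intro open_Collect_less continuous_intros)
   qed (use f1 in auto)
   hence "(%x. x^3 * q (1 / x)) differentiable (at (fst (g t)))"
    unfolding has_field_derivative_def differentiable_def by blast
   hence "(%p. (fst p)^3 * q (1 / fst p)) differentiable (at (g t))"
    by (rule differentiable_compose[of "%x. x^3 * q (1 / x)" fst])
      (rule bounded_linear_imp_differentiable[OF bounded_linear_fst])
   moreover have "Yc \<mu> differentiable (at (g t))" using has_derivative_Yc[of \<mu> "g t"] by (auto simp: differentiable_def)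
   ultimately have "y differentiable (at (g t))" unfolding y_def
    using Ynz[OF tB] by (intro differentiable_divide) (auto simp: Yg)
   thus ?thesis by (simp add: c_def)
  qed
 qed (auto simp: c_def B_def)
 moreover have "dom c = ball 0 r - {0}" "prim c = A" "A 0 = 0" "!!t. fst (par c t) = 1 / t^2" "!!p. coo c p = y p"
  by (simp_all add: c_def B_def A_def g_def)
 moreover have "DERIV (%z. A z $ 1) t :> Q t * t^4"
   "DERIV (%z. A z $ 2) t :> Q t * t^2" "DERIV (%z. A z $ 3) t :> Q t"
   if "t \<in> ball 0 r" for t
  using A[OF that, of 1] A[OF that, of 2] A[OF that, of 3] by (simp_all add: f_def)
 moreover have "Q t ~= 0" if "t \<in> ball 0 r" for t using Pnz[OF that] by (simp add: Q_def)
 moreover have "y p ^ 2 = 1 / fst p" if "p \<in> patch c" for p using inv that patch by blast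
 ultimately show ?thesis
  using r(1) patch Qh odd by (intro exI[of _ c] exI[of _ r] exI[of _ A] exI[of _ Q] conjI ballI) simp_all
qed

section \<open>Integration along the curve\<close>

definition du_along :: "(nat => complex) => (real => complex \<times> complex) => real => complex^3" where
 "du_along \<mu> g t = (\<chi> i. du_coeff i (g t) * base_form_along \<mu> g t)"

text \<open>A relation instead of a value: it includes integrability, which the total operator in
  \<open>form_integral\<close> leaves open, and so supports concatenation and uniqueness.\<close>

definition path_val :: "(nat => complex) => (real => complex \<times> complex) => real => real => complex^3 => bool" where
 "path_val \<mu> g a b v \<longleftrightarrow> (du_along \<mu> g has_integral v) {a..b}"

definition cprim :: "curve_chart => complex \<times> complex => complex^3" where
 "cprim c p = prim c (coo c p)"

lemma path_val_form_integral:
 assumes "path_val \<mu> g a b v"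
 shows "form_integral \<mu> (du_coeff i) g a b = v $ i"
proof -
 have "((%t. du_along \<mu> g t $ i) has_integral v $ i) {a..b}"
  using has_integral_linear[OF assms[unfolded path_val_def] bounded_linear_vec_nth[of i]] by (simp add: o_def)
 thus ?thesis unfolding form_integral_def by (simp add: du_along_def integral_unique)
qed

lemma base_form_alt:
 "base_form_along \<mu> g t = (if Yc \<mu> (g t) ~= 0 then fst (vector_derivative g (at t)) / Yc \<mu> (g t)
   else - snd (vector_derivative g (at t)) / curve_poly_x \<mu> (fst (g t)) (snd (g t)))"
 by (cases "g t"; cases "vector_derivative g (at t)") (simp add: base_form_along_def curve_poly_y_eq)

lemma coo_patch:
 assumes "is_chart \<mu> c" "p \<in> patch c"
 shows "coo c p \<in> dom c" "par c (coo c p) = p"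
 using assms(2) is_chartD(5)[OF assms(1)] by (auto simp: patch_def)

lemma continuous_prim: "is_chart \<mu> c ==> continuous_on (dom c) (prim c)"
proof -
 assume c: "is_chart \<mu> c"
 have "continuous_on (dom c) (%z. \<chi> i. prim c z $ i)"
  by (intro continuous_on_vec_lambda continuous_at_imp_continuous_on ballI)
    (metis DERIV_isCont is_chartD(10)[OF c])
 thus ?thesis by simp
qed

lemma continuous_coo: "is_chart \<mu> c ==> continuous_on (patch c) (coo c)"
 by (intro continuous_at_imp_continuous_on ballI differentiable_imp_continuous_within)
   (auto simp: patch_def is_chartD(6))

lemma continuous_cprim: "is_chart \<mu> c ==> continuous_on (patch c) (cprim c)"
 unfolding cprim_def
 by (rule continuous_on_compose2[OF continuous_prim continuous_coo]) (auto dest: coo_patch)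

text \<open>The fundamental theorem of calculus for the chart primitive along the path. Both
  branches of \<open>base_form_along\<close> agree with the chart, as dx / f_y and - dy / f_x are
  two expressions of \<open>den\<close> dz; the velocity is compared through x and Y.\<close>

lemma chart_path:
 assumes ns: "nonsingular \<mu>" and c: "is_chart \<mu> c" and p: "p piecewise_C1_differentiable_on {a..b}"
  and im: "p ` {a..b} <= patch c" and ab: "a <= b"
 shows "path_val \<mu> p a b (cprim c (p b) - cprim c (p a))"
proof -
 obtain S D where S: "finite S" and D: "!!t. t \<in> {a..b} - S ==> (p has_vector_derivative D t) (at t)"
  and cont: "continuous_on {a..b} p"
  using p unfolding piecewise_C1_differentiable_on_def C1_differentiable_on_def by blast
 have "(du_along \<mu> p has_integral (cprim c (p b) - cprim c (p a))) {a..b}"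
 proof (rule fundamental_theorem_of_calculus_interior_strong[OF S ab])
  show "continuous_on {a..b} (%t. cprim c (p t))"
   by (rule continuous_on_compose2[OF continuous_cprim[OF c] cont im])
  fix t assume t: "t \<in> {a<..<b} - S"
  hence Dt: "(p has_vector_derivative D t) (at t)" using D by auto
  have near: "p s \<in> patch c" if "s \<in> {a<..<b}" for s using im that by auto
  define z where "z = (%s. coo c (p s))"
  have zdom: "z s \<in> dom c" "par c (z s) = p s" if "s \<in> {a<..<b}" for s
   using coo_patch[OF c near[OF that]] by (auto simp: z_def)
  have tt: "t \<in> {a<..<b}" using t by simp
  have "coo c differentiable (at (p t))" using is_chartD(6)[OF c zdom(1)[OF tt]] zdom(2)[OF tt] by simp
  then obtain L where L: "(coo c has_derivative L) (at (p t))" by (auto simp: differentiable_def)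
  define z' where "z' = L (D t)"
  have zd: "(z has_vector_derivative z') (at t)"
   unfolding z_def z'_def has_vector_derivative_def
   using has_derivative_compose[OF Dt[unfolded has_vector_derivative_def] L] linear_scale[OF has_derivative_linear[OF L]] by simp
  have tr: "((%s. g (p s)) has_vector_derivative z' * g') (at t)"
   if "DERIV (%w. g (par c w)) (z t) :> g'" for g :: "complex \<times> complex => complex" and g'
   by (rule has_vector_derivative_transform_within_open[OF field_vector_diff_chain_at[OF zd that], of "{a<..<b}"])
     (use tt zdom in auto)
  note cd = is_chartD[OF c] and zt = zdom[OF tt]
  have "((%s. fst (p s)) has_vector_derivative fst (D t)) (at t)"
   using bounded_linear.has_vector_derivative[OF bounded_linear_fst Dt] .
  hence dx: "fst (D t) = z' * (Yc \<mu> (p t) * den c (z t))"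
   using vector_derivative_unique_at tr[OF cd(8)[OF zt(1)]] zt(2) by metis
  have "((%s. Yc \<mu> (p s)) has_vector_derivative 2 * snd (D t) + deriv (hpol \<mu>) (fst (p t)) * fst (D t)) (at t)"
   using has_derivative_compose[OF Dt[unfolded has_vector_derivative_def] has_derivative_Yc]
   unfolding has_vector_derivative_def by (simp add: algebra_simps scaleR_conv_of_real)
  hence dY: "2 * snd (D t) + deriv (hpol \<mu>) (fst (p t)) * fst (D t) = z' * (deriv (disc \<mu>) (fst (p t)) * den c (z t) / 2)"
   using vector_derivative_unique_at tr[OF cd(9)[OF zt(1)]] zt(2) by metis
  have ga: "p t \<in> affine_curve \<mu>" using near[OF tt] cd(4) by blast
  have vd: "vector_derivative p (at t) = D t" using Dt by (rule vector_derivative_at)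
  have "base_form_along \<mu> p t = z' * den c (z t)"
  proof (cases "Yc \<mu> (p t) = 0")
   case False
   thus ?thesis using dx by (simp add: base_form_alt vd)
  next
   case True
   have P: "deriv (disc \<mu>) (fst (p t)) ~= 0" by (rule nonsingular_disc[OF ns ga True])
   have fx: "4 * curve_poly_x \<mu> (fst (p t)) (snd (p t)) = - deriv (disc \<mu>) (fst (p t))"
    using curve_poly_x_eq[of \<mu> "fst (p t)" "snd (p t)"] True by simp
   have "base_form_along \<mu> p t = - snd (D t) / curve_poly_x \<mu> (fst (p t)) (snd (p t))"
    using True by (simp add: base_form_alt vd)
   also have "\<dots> = - (4 * snd (D t)) / (4 * curve_poly_x \<mu> (fst (p t)) (snd (p t)))" by simp
   also have "4 * snd (D t) = z' * den c (z t) * deriv (disc \<mu>) (fst (p t))" using dY dx True by simp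
   finally show ?thesis unfolding fx using P by simp
  qed
  hence "((%s. cprim c (p s) $ i) has_vector_derivative du_along \<mu> p t $ i) (at t)" for i
   using field_vector_diff_chain_at[OF zd cd(10)[OF zt(1), of i]] zt(2)
   by (simp add: o_def cprim_def z_def du_along_def mult_ac)
  hence "((%s. cprim c (p s)) has_derivative (%h. h *\<^sub>R du_along \<mu> p t)) (at t)"
   by (intro has_derivative_vec_componentwise) (simp add: has_vector_derivative_def)
  thus "((%t. cprim c (p t)) has_vector_derivative du_along \<mu> p t) (at t)"
   by (simp add: has_vector_derivative_def)
 qed
 thus ?thesis by (simp add: path_val_def)
qed

section \<open>Chains of charts and paths\<close>

text \<open>Combinatorial integration: \<open>v\<close> adds up increments of chart primitives along
  a finite sequence of patches. Chains and piecewise smooth paths turn out to have the same values,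
  and chains admit induction. The set \<open>C\<close> is a parameter because a countable atlas is
  used for counting.\<close>

inductive chain :: "(nat => complex) => curve_chart set => complex \<times> complex => complex \<times> complex => complex^3 => bool"
 for \<mu> C where
 refl: "p \<in> affine_curve \<mu> ==> chain \<mu> C p p 0"
| step: "chain \<mu> C p q v ==> c \<in> C ==> q \<in> patch c ==> r \<in> patch c ==> chain \<mu> C p r (v + (cprim c r - cprim c q))"

lemma chain_trans: "chain \<mu> C q r w ==> chain \<mu> C p q v ==> chain \<mu> C p r (v + w)"
proof (induction rule: chain.induct)
 case (step q r' w c r)
 from chain.step[OF step.IH[OF step.prems] step.hyps(2-4)] show ?case by (simp add: add_ac)
qed simp

lemma chain_sym:
 assumes C: "!!c. c \<in> C ==> is_chart \<mu> c"
 shows "chain \<mu> C p q v ==> chain \<mu> C q p (- v)"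
proof (induction rule: chain.induct)
 case (refl p)
 thus ?case using chain.refl by simp
next
 case (step p q v c r)
 have "r \<in> affine_curve \<mu>" using is_chartD(4)[OF C[OF step.hyps(2)]] step.hyps by blast
 from chain.step[OF chain.refl[OF this] step.hyps(2,4,3)]
 have "chain \<mu> C r q (0 + (cprim c q - cprim c r))" .
 from chain_trans[OF step.IH this] show ?case by (simp add: algebra_simps)
qed

lemma chain_affine:
 assumes C: "!!c. c \<in> C ==> is_chart \<mu> c"
 shows "chain \<mu> C p q v ==> p \<in> affine_curve \<mu> & q \<in> affine_curve \<mu>"
 by (induction rule: chain.induct) (use is_chartD(4)[OF C] in auto)

text \<open>To have both an integral up to s and a chain with the same value is a property that
  passes, in both directions, along any interval mapped into one patch; connectedness of the
  parameter interval does the rest.\<close>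

lemma path_chain:
 assumes ns: "nonsingular \<mu>" and C: "!!c. c \<in> C ==> is_chart \<mu> c" and cov: "affine_curve \<mu> <= (\<Union>c\<in>C. patch c)"
  and g: "g piecewise_C1_differentiable_on {a..b}" and im: "g ` {a..b} <= affine_curve \<mu>" and ab: "a <= b"
 shows "\<exists>v. path_val \<mu> g a b v & chain \<mu> C (g a) (g b) v"
proof -
 have cont: "continuous_on {a..b} g" using g by (simp add: piecewise_C1_differentiable_on_def)
 define P where "P = (%s. \<exists>v. path_val \<mu> g a s v & chain \<mu> C (g a) (g s) v)"
 have "P b"
 proof (rule connected_induction_simple[where S="{a..b}" and a=a])
  have "path_val \<mu> g a a 0" by (simp add: path_val_def has_integral_refl)
  moreover have "g a \<in> affine_curve \<mu>" using im ab by auto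
  ultimately show "P a" unfolding P_def by (intro exI[of _ 0] conjI chain.refl)
  fix s0 assume s0: "s0 \<in> {a..b}"
  then obtain c where c: "c \<in> C" "g s0 \<in> patch c" using im cov by blast
  obtain O' where O': "open O'" "patch c = affine_curve \<mu> \<inter> O'"
   using is_chartD(3)[OF C[OF c(1)]] by (auto simp: openin_open)
  have "open O'" "g s0 \<in> O'" using O' c by auto
  then obtain e where e: "e > 0" "ball (g s0) e <= O'" using open_contains_ball by blast
  obtain d where d: "d > 0" "!!s. s \<in> {a..b} ==> dist s s0 < d ==> dist (g s) (g s0) < e"
   using cont s0 e(1) unfolding continuous_on_iff by metis
  define T where "T = {a..b} \<inter> ball s0 d"
  have inpatch: "g s \<in> patch c" if "s \<in> T" for s
  proof -
   have "s \<in> {a..b}" "dist s s0 < d" using that by (auto simp: T_def dist_commute)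
   hence "g s \<in> affine_curve \<mu>" "g s \<in> ball (g s0) e" using im d(2)[of s] by (auto simp: dist_commute)
   thus ?thesis using e(2) O'(2) by blast
  qed
  have Tint: "{x..y} <= T" if "x \<in> T" "y \<in> T" for x y
   using that by (auto simp: T_def dist_real_def)
  have pw: "g piecewise_C1_differentiable_on {x..y}" if "x \<in> T" "y \<in> T" for x y
   by (rule piecewise_C1_differentiable_on_subset[OF g]) (use Tint[OF that] in \<open>auto simp: T_def\<close>)
  have loc: "path_val \<mu> g x y (cprim c (g y) - cprim c (g x))" if "x \<in> T" "y \<in> T" "x <= y" for x y
   by (rule chart_path[OF ns C[OF c(1)] pw[OF that(1,2)] _ that(3)]) (use Tint[OF that(1,2)] inpatch in auto)
  have "P x ==> P y" if x: "x \<in> T" and y: "y \<in> T" for x y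
  proof -
   assume "P x"
   then obtain v where v: "path_val \<mu> g a x v" "chain \<mu> C (g a) (g x) v" by (auto simp: P_def)
   have "path_val \<mu> g a y (v + (cprim c (g y) - cprim c (g x)))"
   proof (cases "x <= y")
    case True
    from has_integral_combine[OF _ True v(1)[unfolded path_val_def] loc[OF x y True, unfolded path_val_def]] x
    show ?thesis by (simp add: path_val_def T_def)
   next
    case False
    hence yx: "y <= x" "a <= y" using y by (auto simp: T_def)
    have "du_along \<mu> g integrable_on {a..x}" using v(1) by (auto simp: path_val_def)
    hence "du_along \<mu> g integrable_on {a..y}" by (rule integrable_on_subinterval) (use yx in auto)
    then obtain w where w: "(du_along \<mu> g has_integral w) {a..y}" by auto
    from has_integral_combine[OF yx(2,1) w loc[OF y x yx(1), unfolded path_val_def]]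
    have "v = w + (cprim c (g x) - cprim c (g y))"
     using v(1) has_integral_unique by (auto simp: path_val_def)
    thus ?thesis using w by (simp add: path_val_def)
   qed
   thus "P y" unfolding P_def using chain.step[OF v(2) c(1) inpatch[OF x] inpatch[OF y]] by blast
  qed
  moreover have "openin (top_of_set {a..b}) T" unfolding T_def by (rule openin_open_Int) auto
  moreover have "s0 \<in> T" using s0 d by (simp add: T_def)
  ultimately show "\<exists>T. openin (top_of_set {a..b}) T & s0 \<in> T & (\<forall>x\<in>T. \<forall>y\<in>T. P x --> P y)" by blast
 qed (use ab in auto)
 thus ?thesis by (simp add: P_def)
qed

lemma path_val_cong:
 assumes "path_val \<mu> g a b v" "!!t. t \<in> {a<..<b} ==> g t = d t"
 shows "path_val \<mu> d a b v"
proof -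
 have "du_along \<mu> d t = du_along \<mu> g t" if t: "t \<in> {a<..<b}" for t
 proof -
  have "\<forall>\<^sub>F s in nhds t. s \<in> {a<..<b}" using t by (intro eventually_nhds_in_open) auto
  hence "\<forall>\<^sub>F s in nhds t. d s = g s" by eventually_elim (use assms(2) in auto)
  hence "vector_derivative d (at t) = vector_derivative g (at t)"
   by (intro vector_derivative_cong_eq) (auto elim: eventually_mono)
  thus ?thesis using assms(2)[OF t] by (simp add: du_along_def base_form_alt)
 qed
 thus ?thesis using assms(1) unfolding path_val_def
  by (metis box_real(1) cbox_interval has_integral_spike_interior)
qed

lemma path_val_join:
 assumes "path_val \<mu> g a c v" "path_val \<mu> d c b w" "a <= c" "c <= b"
 shows "path_val \<mu> (%t. if t <= c then g t else d t) a b (v + w)"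
proof -
 have "path_val \<mu> (%t. if t <= c then g t else d t) a c v" by (rule path_val_cong[OF assms(1)]) auto
 moreover have "path_val \<mu> (%t. if t <= c then g t else d t) c b w" by (rule path_val_cong[OF assms(2)]) auto
 ultimately show ?thesis unfolding path_val_def using has_integral_combine[OF assms(3,4)] by blast
qed

lemma holomorphic_par:
 assumes "is_chart \<mu> c"
 shows "(%z. fst (par c z)) holomorphic_on dom c" "(%z. snd (par c z)) holomorphic_on dom c"
proof -
 show 1: "(%z. fst (par c z)) holomorphic_on dom c"
  using is_chartD(8)[OF assms] by (auto simp: holomorphic_on_def field_differentiable_def intro: has_field_derivative_at_within)
 have 2: "(%z. Yc \<mu> (par c z)) holomorphic_on dom c"
  using is_chartD(9)[OF assms] by (auto simp: holomorphic_on_def field_differentiable_def intro: has_field_derivative_at_within)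
 have "(%z. (Yc \<mu> (par c z) - hpol \<mu> (fst (par c z))) / 2) holomorphic_on dom c"
  by (intro holomorphic_intros 1 2) auto
 thus "(%z. snd (par c z)) holomorphic_on dom c" by (simp add: Yc_def)
qed

lemma C1_compose_holomorphic:
 assumes G: "!!t. t \<in> S ==> (G has_vector_derivative G' t) (at t)" "continuous_on S G'" "G ` S <= D"
  and f: "f holomorphic_on D" "open D"
 shows "!!t. t \<in> S ==> ((%t. f (G t)) has_vector_derivative G' t * deriv f (G t)) (at t)"
  and "continuous_on S (%t. G' t * deriv f (G t))"
proof -
 show "((%t. f (G t)) has_vector_derivative G' t * deriv f (G t)) (at t)" if "t \<in> S" for t
  using field_vector_diff_chain_at[OF G(1)[OF that], of f "deriv f (G t)"] holomorphic_derivI[OF f] G(3) that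
  by (auto simp: o_def)
 have "continuous_on S G"
  by (intro continuous_at_imp_continuous_on ballI has_vector_derivative_continuous[OF G(1)])
 hence "continuous_on S (%t. deriv f (G t))"
  by (rule continuous_on_compose2[OF holomorphic_on_imp_continuous_on[OF holomorphic_deriv[OF f]]]) (use G(3) in auto)
 thus "continuous_on S (%t. G' t * deriv f (G t))" by (intro continuous_intros G(2))
qed

lemma chart_curve_pw:
 assumes c: "is_chart \<mu> c" and G: "!!t. t \<in> S ==> (G has_vector_derivative G' t) (at t)" "continuous_on S G'" "G ` S <= dom c"
 shows "(%t. par c (G t)) piecewise_C1_differentiable_on S"
proof -
 have X: "!!t. t \<in> S ==> ((%t. f (G t)) has_vector_derivative G' t * deriv f (G t)) (at t)"
  "continuous_on S (%t. G' t * deriv f (G t))" if "f holomorphic_on dom c" for f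
  using C1_compose_holomorphic[of S G G' "dom c" f] G that is_chartD(1)[OF c] by auto
 note Y = X[OF holomorphic_par(2)[OF c]] and X = X[OF holomorphic_par(1)[OF c]]
 have "((%t. par c (G t)) has_vector_derivative (G' t * deriv (%z. fst (par c z)) (G t), G' t * deriv (%z. snd (par c z)) (G t))) (at t)"
  if "t \<in> S" for t using has_vector_derivative_Pair[OF X(1)[OF that] Y(1)[OF that]] by simp
 moreover have "continuous_on S (%t. (G' t * deriv (%z. fst (par c z)) (G t), G' t * deriv (%z. snd (par c z)) (G t)))"
  by (intro continuous_on_Pair X(2) Y(2))
 ultimately have "(%t. par c (G t)) C1_differentiable_on S" unfolding C1_differentiable_on_def by (intro exI conjI ballI)
 thus ?thesis by (rule C1_differentiable_imp_piecewise)
qed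

text \<open>The coordinate domain is open and connected, so the two coordinates are joined inside it
  by a polynomial path, whose image on the curve is smooth.\<close>

lemma chart_connect:
 assumes ns: "nonsingular \<mu>" and c: "is_chart \<mu> c" and pq: "p \<in> patch c" "q \<in> patch c" and ab: "a < b"
 shows "\<exists>w. w piecewise_C1_differentiable_on {a..b} & w ` {a..b} <= patch c & w a = p & w b = q &
   path_val \<mu> w a b (cprim c q - cprim c p)"
proof -
 note cp = coo_patch[OF c pq(1)] and cq = coo_patch[OF c pq(2)]
 obtain g where g: "polynomial_function g" "path_image g <= dom c" "pathstart g = coo c p" "pathfinish g = coo c q"
  using connected_open_polynomial_connected[OF is_chartD(1,2)[OF c] cp(1) cq(1)] by blast
 obtain g' where g': "polynomial_function g'" "!!x. (g has_vector_derivative g' x) (at x)"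
  using has_vector_derivative_polynomial_function[OF g(1)] by blast
 define \<sigma> where "\<sigma> = (%t. (t - a) / (b - a))"
 define G where "G = (%t. g (\<sigma> t))"
 have "(\<sigma> has_vector_derivative 1 / (b - a)) (at t)" for t
  unfolding \<sigma>_def has_real_derivative_iff_has_vector_derivative[symmetric] using ab by (auto intro!: derivative_eq_intros)
 from vector_diff_chain_at[OF this g'(2)]
 have Gd: "(G has_vector_derivative (1 / (b - a)) *\<^sub>R g' (\<sigma> t)) (at t)" for t by (simp add: G_def o_def)
 have Gc: "continuous_on {a..b} (%t. (1 / (b - a)) *\<^sub>R g' (\<sigma> t))"
 proof -
  have "continuous_on {a..b} \<sigma>" unfolding \<sigma>_def using ab by (intro continuous_intros) auto
  hence "continuous_on {a..b} (%t. g' (\<sigma> t))"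
   by (rule continuous_on_compose2[OF continuous_on_polymonial_function[OF g'(1)]]) (rule subset_UNIV)
  thus ?thesis by (intro continuous_intros)
 qed
 have Gi: "G ` {a..b} <= dom c"
 proof
  fix z assume "z \<in> G ` {a..b}"
  then obtain t where "t \<in> {a..b}" "z = g (\<sigma> t)" by (auto simp: G_def)
  moreover from this have "\<sigma> t \<in> {0..1}" using ab by (auto simp: \<sigma>_def)
  ultimately show "z \<in> dom c" using g(2) by (auto simp: path_image_def)
 qed
 define w where "w = (%t. par c (G t))"
 have pw: "w piecewise_C1_differentiable_on {a..b}" unfolding w_def by (rule chart_curve_pw[OF c Gd Gc Gi])
 have im: "w ` {a..b} <= patch c" using Gi by (auto simp: w_def patch_def)
 have e: "w a = p" "w b = q" using g(3,4) cp cq ab by (auto simp: w_def G_def \<sigma>_def pathstart_def pathfinish_def)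
 show ?thesis using pw im e chart_path[OF ns c pw im] ab by (intro exI[of _ w]) auto
qed

lemma chain_path:
 assumes ns: "nonsingular \<mu>" and C: "!!c. c \<in> C ==> is_chart \<mu> c"
 shows "chain \<mu> C p q v ==> a < b ==> \<exists>g. g piecewise_C1_differentiable_on {a..b} & g ` {a..b} <= affine_curve \<mu> &
   g a = p & g b = q & path_val \<mu> g a b v"
proof (induction arbitrary: a b rule: chain.induct)
 case (refl p)
 have "(du_along \<mu> (%_. p) has_integral 0) {a..b}"
  by (rule has_integral_is_0) (simp add: du_along_def base_form_alt vec_eq_iff)
 thus ?case using refl by (intro exI[of _ "%_. p"]) (auto simp: path_val_def piecewise_C1_differentiable_on_def)
next
 case (step p q v c r)
 define m where "m = (a + b) / 2"
 have m: "a < m" "m < b" using step.prems by (auto simp: m_def)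
 obtain g where g: "g piecewise_C1_differentiable_on {a..m}" "g ` {a..m} <= affine_curve \<mu>" "g a = p" "g m = q" "path_val \<mu> g a m v"
  using step.IH[OF m(1)] by blast
 obtain d where d: "d piecewise_C1_differentiable_on {m..b}" "d ` {m..b} <= patch c" "d m = q" "d b = r" "path_val \<mu> d m b (cprim c r - cprim c q)"
  using chart_connect[OF ns C[OF step.hyps(2)] step.hyps(3,4) m(2)] by blast
 have "d ` {m..b} <= affine_curve \<mu>" using d(2) is_chartD(4)[OF C[OF step.hyps(2)]] by blast
 thus ?case
  using g d m path_val_join[OF g(5) d(5)] piecewise_C1_differentiable_cases[OF g(1) d(1)]
  by (intro exI[of _ "%t. if t <= m then g t else d t"]) auto
qed

section \<open>The chart at infinity, connectedness of the curve, and the period lattice\<close>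

text \<open>Fixes one chart at infinity. \<open>A\<close> is its primitive continued to t = 0 and
  normalized there, so near infinity it is the Abel map with base point infinity.\<close>

locale hyper_curve =
 fixes \<mu> :: "nat => complex" and ci :: curve_chart and r :: real and A :: "complex => complex^3" and Q :: "complex => complex"
 assumes ns: "nonsingular \<mu>" and ci: "is_chart \<mu> ci" and r: "r > 0" and dom_ci: "dom ci = ball 0 r - {0}"
  and prim_ci: "prim ci = A" and A0: "A 0 = 0"
  and patch_ci: "patch ci = {p \<in> affine_curve \<mu>. norm (fst p) > 1 / r^2}"
  and Q: "Q holomorphic_on ball 0 r" "!!t. t \<in> ball 0 r ==> Q t ~= 0"
  and dA: "!!t. t \<in> ball 0 r ==> DERIV (%z. A z $ 1) t :> Q t * t^4"
   "!!t. t \<in> ball 0 r ==> DERIV (%z. A z $ 2) t :> Q t * t^2"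
   "!!t. t \<in> ball 0 r ==> DERIV (%z. A z $ 3) t :> Q t"
  and A_odd: "!!t. t \<in> ball 0 r ==> A (- t) = - A t"
  and x_ci: "!!t. t \<in> dom ci ==> fst (par ci t) = 1 / t^2"
  and coo_ci: "!!p. p \<in> patch ci ==> coo ci p ^ 2 = 1 / fst p"

lemma nonsingular_hyper_curve: "nonsingular \<mu> ==> \<exists>ci r A Q. hyper_curve \<mu> ci r A Q"
proof -
 assume ns: "nonsingular \<mu>"
 obtain c r A Q where c: "is_chart \<mu> c & r > 0 & dom c = ball 0 r - {0} & prim c = A & A 0 = 0 &
   patch c = {p \<in> affine_curve \<mu>. norm (fst p) > 1 / r^2} &
   Q holomorphic_on ball 0 r & (\<forall>t\<in>ball 0 r. Q t ~= 0) &
   (\<forall>t\<in>ball 0 r. DERIV (%z. A z $ 1) t :> Q t * t^4) &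
   (\<forall>t\<in>ball 0 r. DERIV (%z. A z $ 2) t :> Q t * t^2) &
   (\<forall>t\<in>ball 0 r. DERIV (%z. A z $ 3) t :> Q t) &
   (\<forall>t\<in>ball 0 r. A (- t) = - A t) &
   (\<forall>t\<in>dom c. fst (par c t) = 1 / t^2) &
   (\<forall>p\<in>patch c. coo c p ^ 2 = 1 / fst p)" using chart_at_infinity[of \<mu>] by (elim exE)
 have "hyper_curve \<mu> c r A Q"
  unfolding hyper_curve_def using c ns by (intro conjI allI impI; (elim conjE)?; (assumption | blast))
 thus ?thesis by blast
qed

context hyper_curve
begin

abbreviation "rel \<equiv> chain \<mu> {c. is_chart \<mu> c}"

lemma isC: "c \<in> {c. is_chart \<mu> c} ==> is_chart \<mu> c" by simp

lemma chart_exists: "p \<in> affine_curve \<mu> ==> \<exists>c. is_chart \<mu> c & p \<in> patch c"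
 using chart_at_unramified[of p \<mu>] chart_at_ramified[of p \<mu>] nonsingular_disc[OF ns] by blast

lemma charts_cover: "affine_curve \<mu> <= (\<Union>c\<in>{c. is_chart \<mu> c}. patch c)"
 using chart_exists by blast

lemma rel_refl: "p \<in> affine_curve \<mu> ==> rel p p 0" by (rule chain.refl)

lemma rel_step: "rel p q v ==> is_chart \<mu> c ==> q \<in> patch c ==> s \<in> patch c ==> rel p s (v + (cprim c s - cprim c q))"
 by (rule chain.step) auto

lemma rel_chart: "is_chart \<mu> c ==> q \<in> patch c ==> s \<in> patch c ==> rel q s (cprim c s - cprim c q)"
 using rel_step[OF rel_refl, of q c s] is_chartD(4)[of \<mu> c] by auto

lemma rel_sym: "rel p q v ==> rel q p (- v)" by (rule chain_sym) auto

lemma rel_affine: "rel p q v ==> p \<in> affine_curve \<mu> & q \<in> affine_curve \<mu>"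
 by (rule chain_affine) auto

lemma rel_trans: "rel p q v ==> rel q s w ==> rel p s (v + w)" by (rule chain_trans)

lemma pt: assumes "t \<in> dom ci" shows "par ci t \<in> patch ci" "par ci t \<in> affine_curve \<mu>" "cprim ci (par ci t) = A t"
 using assms is_chartD(4,5)[OF ci] by (auto simp: patch_def cprim_def prim_ci)

lemma rel_pt: "s \<in> dom ci ==> t \<in> dom ci ==> rel (par ci s) (par ci t) (A t - A s)"
 using rel_chart[OF ci pt(1) pt(1), of s t] by (simp add: pt)

lemma ri: "of_real (r / 2) \<in> dom ci" using r by (simp add: dom_ci)

lemma affine_bounded: "\<exists>B. \<forall>p\<in>affine_curve \<mu>. norm (fst p) <= R --> norm p <= B"
proof -
 have c: "continuous_on (cball 0 R) (disc \<mu>)" "continuous_on (cball 0 R) (hpol \<mu>)"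
  using holomorphic_on_imp_continuous_on[OF holomorphic_disc[OF holomorphic_on_ident]]
   holomorphic_on_imp_continuous_on[OF holomorphic_hpol[OF holomorphic_on_ident]] by auto
 obtain B1 B2 where "\<forall>x\<in>cball 0 R. norm (disc \<mu> x) <= B1" "\<forall>x\<in>cball 0 R. norm (hpol \<mu> x) <= B2"
  using compact_imp_bounded[OF compact_continuous_image[OF c(1) compact_cball]]
   compact_imp_bounded[OF compact_continuous_image[OF c(2) compact_cball]]
  unfolding bounded_iff ball_simps by blast
 hence B: "!!x. norm x <= R ==> norm (disc \<mu> x) <= B1" "!!x. norm x <= R ==> norm (hpol \<mu> x) <= B2" by auto
 have "norm p <= R + (sqrt B1 + B2) / 2" if p: "p \<in> affine_curve \<mu>" "norm (fst p) <= R" for p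
 proof -
  have "norm (Yc \<mu> p)^2 <= B1" using p(1) B(1)[OF p(2)] by (simp add: affine_curve_iff flip: norm_power)
  hence "norm (Yc \<mu> p) <= sqrt B1" using real_le_rsqrt by blast
  moreover have "snd p = (Yc \<mu> p - hpol \<mu> (fst p)) / 2" by (simp add: Yc_def)
  hence "norm (snd p) <= (norm (Yc \<mu> p) + norm (hpol \<mu> (fst p))) / 2" using norm_triangle_ineq4[of "Yc \<mu> p" "hpol \<mu> (fst p)"] by (simp only: norm_divide norm_numeral divide_right_mono)
  ultimately have "norm (snd p) <= (sqrt B1 + B2) / 2" using B(2)[OF p(2)] by simp
  moreover have "norm p <= norm (fst p) + norm (snd p)" using norm_Pair_le[of "fst p" "snd p"] by simp
  ultimately show ?thesis using p(2) by linarith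
 qed
 thus ?thesis by blast
qed

lemma closed_affine: "closed (affine_curve \<mu>)"
proof -
 have "continuous_on UNIV (%p. disc \<mu> (fst p))"
  by (rule continuous_on_compose2[OF holomorphic_on_imp_continuous_on[OF holomorphic_disc[OF holomorphic_on_ident]] continuous_on_fst[OF continuous_on_id]]) auto
 hence "closed {p. Yc \<mu> p ^ 2 = disc \<mu> (fst p)}" by (intro closed_Collect_eq continuous_intros)
 moreover have "affine_curve \<mu> = {p. Yc \<mu> p ^ 2 = disc \<mu> (fst p)}" using affine_curve_iff by blast
 ultimately show ?thesis by simp
qed

text \<open>Constant x forces Y = 0 through the derivative of x, and then the derivative of Y
  contradicts nonsingularity.\<close>

lemma fst_par_not_constant:
 assumes c: "is_chart \<mu> c" and S: "open S" "S <= dom c" "z \<in> S" and k: "!!w. w \<in> S ==> fst (par c w) = k"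
 shows False
proof -
 note cd = is_chartD[OF c]
 have Y: "Yc \<mu> (par c w) = 0" if w: "w \<in> S" for w
 proof -
  have "DERIV (%w. fst (par c w)) w :> 0"
   by (rule has_field_derivative_transform_within_open[OF DERIV_const S(1) w]) (simp add: k)
  hence "Yc \<mu> (par c w) * den c w = 0" using cd(8)[of w] w S(2) DERIV_unique by blast
  thus ?thesis using cd(7)[of w] w S(2) by auto
 qed
 have z: "z \<in> dom c" using S by auto
 have "DERIV (%w. Yc \<mu> (par c w)) z :> 0"
  by (rule has_field_derivative_transform_within_open[OF DERIV_const S(1,3)]) (simp add: Y)
 hence "deriv (disc \<mu>) (fst (par c z)) * den c z / 2 = 0" using cd(9)[OF z] DERIV_unique by blast
 moreover have "deriv (disc \<mu>) (fst (par c z)) ~= 0"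
  by (rule nonsingular_disc[OF ns _ Y[OF S(3)]]) (use cd(4) z in \<open>auto simp: patch_def\<close>)
 ultimately show False using cd(7)[OF z] by simp
qed

text \<open>The points reachable from infinity form an open and closed set. Were its complement
 nonempty, it would be compact and \<open>x\<close> would attain its maximal modulus on it.\<close>

lemma rel_infinity: assumes q: "q \<in> affine_curve \<mu>" shows "\<exists>v. rel (par ci (of_real (r/2))) q v"
proof (rule ccontr)
 define p0 where "p0 = par ci (of_real (r/2))"
 define E where "E = {p \<in> affine_curve \<mu>. \<nexists>v. rel p0 p v}"
 assume "\<nexists>v. rel (par ci (of_real (r/2))) q v"
 hence qE: "q \<in> E" using q by (simp add: E_def p0_def)
 have step: "s \<in> E \<longleftrightarrow> s' \<in> E" if "is_chart \<mu> c" "s \<in> patch c" "s' \<in> patch c" for c s s'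
  unfolding E_def using rel_step[OF _ that] rel_step[OF _ that(1,3,2)] is_chartD(4)[OF that(1)] that by blast
 have p0: "p0 \<in> patch ci" "p0 ~: E" using pt[OF ri] rel_refl[OF pt(2)[OF ri]] by (auto simp: p0_def E_def)
 have bd: "norm (fst p) <= 1 / r^2" if "p \<in> E" for p
 proof (rule ccontr)
  assume "~ norm (fst p) <= 1 / r^2"
  hence "p \<in> patch ci" using that by (auto simp: patch_ci E_def)
  thus False using step[OF ci p0(1)] p0(2) that by blast
 qed
 have "openin (top_of_set (affine_curve \<mu>)) (affine_curve \<mu> - E)"
  unfolding openin_subopen[of _ "affine_curve \<mu> - E"]
 proof
  fix s assume s: "s \<in> affine_curve \<mu> - E"
  then obtain c where c: "is_chart \<mu> c" "s \<in> patch c" using chart_exists by blast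
  show "\<exists>T. openin (top_of_set (affine_curve \<mu>)) T & s \<in> T & T <= affine_curve \<mu> - E"
  proof (intro exI conjI)
   show "patch c <= affine_curve \<mu> - E" using s is_chartD(4)[OF c(1)] step[OF c] by blast
  qed (use is_chartD(3)[OF c(1)] c in auto)
 qed
 hence "closedin (top_of_set (affine_curve \<mu>)) (affine_curve \<mu> - (affine_curve \<mu> - E))"
  by (metis closedin_diff closedin_topspace topspace_euclidean_subtopology)
 moreover have "affine_curve \<mu> - (affine_curve \<mu> - E) = E" by (auto simp: E_def)
 ultimately have "closed E" using closedin_closed_trans[OF _ closed_affine] by metis
 moreover have "bounded E"
 proof -
  obtain B where "\<forall>p\<in>affine_curve \<mu>. norm (fst p) <= 1 / r^2 --> norm p <= B" using affine_bounded by blast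
  thus ?thesis using bd by (intro boundedI[of _ B]) (auto simp: E_def)
 qed
 ultimately have "compact E" by (simp add: compact_eq_bounded_closed)
 then obtain s where s: "s \<in> E" "!!p. p \<in> E ==> norm (fst p) <= norm (fst s)"
  using continuous_attains_sup[of E "%p. norm (fst p)", OF _ _ continuous_on_norm[OF continuous_on_fst[OF continuous_on_id]]] qE
  by blast
 obtain c where c: "is_chart \<mu> c" "s \<in> patch c" using chart_exists s(1) unfolding E_def by blast
 have "norm (fst (par c z)) <= norm (fst (par c (coo c s)))" if "z \<in> dom c" for z
  using s(2) step[OF c, of "par c z"] s(1) that coo_patch[OF c] by (auto simp: patch_def)
 hence "(%z. fst (par c z)) constant_on dom c"
  by (rule maximum_modulus_principle[OF holomorphic_par(1)[OF c(1)] is_chartD(1,2)[OF c(1)] is_chartD(1)[OF c(1)] order_refl coo_patch(1)[OF c]])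
 thus False using fst_par_not_constant[OF c(1) is_chartD(1)[OF c(1)] order_refl coo_patch(1)[OF c]]
  unfolding constant_on_def by blast
qed

lemma rel_exists: assumes "p \<in> affine_curve \<mu>" "q \<in> affine_curve \<mu>" shows "\<exists>v. rel p q v"
 using rel_infinity[OF assms(1)] rel_infinity[OF assms(2)] rel_sym rel_trans by blast

lemma rel_path: "rel p q v ==> a < b ==> \<exists>g. g piecewise_C1_differentiable_on {a..b} & g ` {a..b} <= affine_curve \<mu> &
   g a = p & g b = q & path_val \<mu> g a b v"
 by (rule chain_path[OF ns isC])

lemma path_rel: "g piecewise_C1_differentiable_on {a..b} ==> g ` {a..b} <= affine_curve \<mu> ==> a <= b ==>
  \<exists>v. path_val \<mu> g a b v & rel (g a) (g b) v"
 by (rule path_chain[OF ns isC charts_cover])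

abbreviation "\<Lambda> \<equiv> period_lattice \<mu>"

text \<open>Loops give chains and chains give loops; from here on periods are handled as values of
  closed chains.\<close>

lemma lattice_iff: "v \<in> \<Lambda> \<longleftrightarrow> (\<exists>p. rel p p v)"
proof
 assume "v \<in> \<Lambda>"
 then obtain g where g: "v = (\<chi> i. form_integral \<mu> (du_coeff i) g 0 1)" "curve_loop \<mu> g" by (auto simp: period_lattice_def)
 then obtain w where w: "path_val \<mu> g 0 1 w" "rel (g 0) (g 1) w" using path_rel[of g 0 1] by (auto simp: curve_loop_def)
 have "v = w" unfolding g(1) vec_eq_iff by (simp add: path_val_form_integral[OF w(1)])
 thus "\<exists>p. rel p p v" using w(2) g(2) unfolding curve_loop_def by metis
next
 assume "\<exists>p. rel p p v"
 then obtain p where "rel p p v" ..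
 from rel_path[OF this zero_less_one] obtain g where g: "g piecewise_C1_differentiable_on {0..1}"
  "g ` {0..1} <= affine_curve \<mu>" "g 0 = p" "g 1 = p" "path_val \<mu> g 0 1 v" by blast
 have "v = (\<chi> i. form_integral \<mu> (du_coeff i) g 0 1)"
  unfolding vec_eq_iff by (simp add: path_val_form_integral[OF g(5)])
 moreover have "curve_loop \<mu> g" using g by (simp add: curve_loop_def)
 ultimately show "v \<in> \<Lambda>" unfolding period_lattice_def by blast
qed

text \<open>A closed chain at one point is conjugated by a chain from \<open>p\<close> to that
  point.\<close>

lemma lattice_rel: assumes "v \<in> \<Lambda>" "p \<in> affine_curve \<mu>" shows "rel p p v"
proof -
 obtain q where q: "rel q q v" using assms(1) lattice_iff by blast
 obtain w where w: "rel p q w" using rel_exists[OF assms(2)] rel_affine[OF q] by blast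
 from rel_trans[OF rel_trans[OF w q] rel_sym[OF w]] show ?thesis by simp
qed

lemma lattice_0: "0 \<in> \<Lambda>" using lattice_iff rel_refl[OF pt(2)[OF ri]] by blast
lemma lattice_add: "v \<in> \<Lambda> ==> w \<in> \<Lambda> ==> v + w \<in> \<Lambda>"
 unfolding lattice_iff[of "v + w"] by (intro exI, rule rel_trans; rule lattice_rel[OF _ pt(2)[OF ri]])
end

section \<open>The Abel image and its secants\<close>

context hyper_curve
begin

lemma continuous_A: "continuous_on (ball 0 r) A"
proof -
 have "isCont (%z. A z $ i) t" if "t \<in> ball 0 r" for t i
  using dA[OF that, THEN DERIV_isCont] exhaust_3[of i] by auto
 hence "continuous_on (ball 0 r) (%z. \<chi> i. A z $ i)"
  by (intro continuous_on_vec_lambda continuous_at_imp_continuous_on ballI)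
 thus ?thesis by simp
qed

lemma norm_pt_ge: "t \<in> dom ci ==> 1 / norm t ^ 2 <= norm (par ci t)"
proof -
 assume "t \<in> dom ci"
 hence "norm (fst (par ci t)) = 1 / norm t ^ 2" by (simp add: x_ci norm_divide norm_power)
 thus ?thesis using norm_fst_le[of "fst (par ci t)" "snd (par ci t)"] by (simp only: prod.collapse)
qed

lemma dom_ci_scale: "t \<in> dom ci ==> 0 < s ==> s <= 1 ==> of_real s * t \<in> dom ci"
proof -
 assume "t \<in> dom ci" "0 < s" "s <= 1"
 moreover from this have "s * norm t <= norm t" by (intro mult_left_le_one_le) auto
 hence "norm (of_real s * t) <= norm t" using \<open>0 < s\<close> by (simp only: norm_mult norm_of_real abs_of_pos)
 ultimately show ?thesis unfolding dom_ci by (auto simp del: norm_mult)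
qed

text \<open>The path runs along the ray from 0 to \<open>t\<close> in the coordinate at infinity up
  to time 1/2, and then along a path realizing \<open>v\<close>. On the ray the integral is a
  difference of values of \<open>A\<close>, which is continuous at 0.\<close>

lemma abel_value_from_rel:
 assumes t: "t \<in> dom ci" and v: "rel (par ci t) p v"
 shows "A t + v \<in> abel_values \<mu> (Some p)"
proof -
 obtain d where d: "d piecewise_C1_differentiable_on {1/2..1}" "d ` {1/2..1} <= affine_curve \<mu>"
  "d (1/2) = par ci t" "d 1 = p" "path_val \<mu> d (1/2) 1 v"
  using rel_path[OF v, of "1/2" 1] by (auto simp del: split_paired_Ex)
 define G where "G = (%s::real. of_real (2 * s) * t)"
 have Gd: "(G has_vector_derivative 2 * t) (at s)" for s
  unfolding G_def by (auto intro!: derivative_eq_intros simp: has_vector_derivative_def scaleR_conv_of_real)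
 have Gdom: "G s \<in> dom ci" if "0 < s" "s <= 1/2" for s
  unfolding G_def by (rule dom_ci_scale[OF t]) (use that in auto)
 define g where "g = (%s. if s <= 1/2 then par ci (G s) else d s)"
 have pw: "g piecewise_C1_differentiable_on {e..1}" if e: "0 < e" "e < 1/2" for e
 proof -
  have "(%s. par ci (G s)) piecewise_C1_differentiable_on {e..1/2}"
   by (rule chart_curve_pw[OF ci Gd continuous_on_const]) (use Gdom e in auto)
  from piecewise_C1_differentiable_cases[OF this d(1)] show ?thesis unfolding g_def using e d(3) by (simp add: G_def)
 qed
 have val: "path_val \<mu> g e 1 (A t - A (G e) + v)" if e: "0 < e" "e < 1/2" for e
 proof -
  have "(%s. par ci (G s)) piecewise_C1_differentiable_on {e..1/2}"
   by (rule chart_curve_pw[OF ci Gd continuous_on_const]) (use Gdom e in auto)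
  from chart_path[OF ns ci this] have "path_val \<mu> (%s. par ci (G s)) e (1/2) (A t - A (G e))"
   using e pt(1,3)[OF Gdom] pt(3)[OF Gdom[of "1/2"]] by (auto simp: image_subset_iff G_def)
  from path_val_join[OF this d(5)] show ?thesis unfolding g_def using e by simp
 qed
 have small: "\<forall>\<^sub>F e in at_right 0. 0 < e & e < (1/2 :: real)"
  unfolding eventually_at_right_field by (auto intro!: exI[of _ "1/2"])
 have G0: "((%e. G e) \<longlongrightarrow> 0) (at_right 0)" unfolding G_def by (auto intro!: tendsto_eq_intros)
 show ?thesis unfolding abel_values_def option.case
 proof (intro CollectI exI[of _ g] conjI allI impI)
  show "g ` {0<..1} <= affine_curve \<mu>" using pt(2)[OF Gdom] d(2) by (auto simp: g_def)
  show "g 1 = p" using d by (simp add: g_def)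
  fix e :: real assume e: "0 < e & e < 1"
  show "g piecewise_C1_differentiable_on {e..1}"
   by (rule piecewise_C1_differentiable_on_subset[OF pw[of "min e (1/4)"]]) (use e in auto)
 next
  have "\<forall>\<^sub>F e in at_right 0. inverse (norm (G e) ^ 2) <= norm (g e)"
   using small by eventually_elim (use norm_pt_ge[OF Gdom] in \<open>auto simp: g_def field_simps\<close>)
  moreover have "((%e. norm (G e) ^ 2) \<longlongrightarrow> 0) (at_right 0)" using G0 by (auto intro!: tendsto_eq_intros)
  hence "filterlim (%e. norm (G e) ^ 2) (at_right 0) (at_right 0)"
   unfolding filterlim_at using small t
   by (auto simp: G_def dom_ci elim!: eventually_mono)
  hence "filterlim (%e. inverse (norm (G e) ^ 2)) at_top (at_right 0)"
   by (rule filterlim_compose[OF filterlim_inverse_at_top_right])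
  ultimately show "filterlim g at_infinity (at_right 0)"
   by (intro filterlim_norm_at_top_imp_at_infinity) (rule filterlim_at_top_mono)
 next
  fix i
  have "((%e. A (G e)) \<longlongrightarrow> A 0) (at_right 0)"
   by (rule isCont_tendsto_compose[OF _ G0]) (use continuous_A r in \<open>simp add: continuous_on_eq_continuous_at\<close>)
  hence "((%e. (A t - A (G e) + v) $ i) \<longlongrightarrow> (A t - 0 + v) $ i) (at_right 0)"
   unfolding A0 by (intro tendsto_intros)
  moreover have "\<forall>\<^sub>F e in at_right 0. (A t - A (G e) + v) $ i = form_integral \<mu> (du_coeff i) g e 1"
   using small by eventually_elim (use path_val_form_integral[OF val] in auto)
  ultimately show "((%e. form_integral \<mu> (du_coeff i) g e 1) \<longlongrightarrow> (A t + v) $ i) (at_right 0)"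
   by (rule_tac Lim_transform_eventually) auto
 qed
qed

text \<open>A path tending to infinity has unbounded x, because on the curve bounded x bounds y. Its
  initial part therefore lies in the patch at infinity with coordinate tending to 0, and the
  integral over that part is governed by \<open>A\<close>.\<close>

lemma rel_from_abel_value:
 assumes "v \<in> abel_values \<mu> (Some p)"
 shows "p \<in> affine_curve \<mu> & (\<exists>t\<in>dom ci. rel (par ci t) p (v - A t))"
proof -
 obtain f where g: "f ` {0<..1} <= affine_curve \<mu>" "f 1 = p"
  "!!e. 0 < e ==> e < 1 ==> f piecewise_C1_differentiable_on {e..1}" "filterlim f at_infinity (at_right 0)"
  "!!i. ((%e. form_integral \<mu> (du_coeff i) f e 1) \<longlongrightarrow> v $ i) (at_right 0)"
  using assms unfolding abel_values_def option.case by blast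
 have p: "p \<in> affine_curve \<mu>" using g(1,2) by force
 have xinf: "\<forall>\<^sub>F e in at_right 0. f e \<in> affine_curve \<mu> & norm (fst (f e)) > R" for R
 proof -
  obtain B where B: "!!p. p \<in> affine_curve \<mu> ==> norm (fst p) <= R ==> norm p <= B" using affine_bounded[of R] by blast
  have "\<forall>\<^sub>F e in at_right 0. \<bar>B\<bar> + 1 <= norm (f e)"
   using g(4) unfolding filterlim_at_infinity[OF order_refl] by auto
  moreover have "\<forall>\<^sub>F e in at_right 0. e \<in> {0<..1::real}" unfolding eventually_at_right_field by (auto intro!: exI[of _ 1])
  ultimately show ?thesis
  proof eventually_elim
   case (elim e)
   have "f e \<in> affine_curve \<mu>" using elim(2) g(1) by blast
   thus ?case using B[of "f e"] elim(1) by force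
  qed
 qed
 have "\<forall>\<^sub>F e in at_right 0. f e \<in> patch ci" using xinf[of "1 / r^2"] by eventually_elim (auto simp: patch_ci)
 then obtain b where b: "b > 0" "!!e. 0 < e ==> e < b ==> f e \<in> patch ci"
  unfolding eventually_at_right_field by blast
 define t0 where "t0 = min (b/2) (1/2)"
 have t0: "0 < t0" "t0 < b" "t0 < 1" using b(1) by (auto simp: t0_def)
 define z where "z = (%e. coo ci (f e))"
 have z: "z e \<in> dom ci" "par ci (z e) = f e" "cprim ci (f e) = A (z e)" if "0 < e" "e <= t0" for e
  using coo_patch[OF ci b(2)[of e]] that t0(2) by (auto simp: z_def cprim_def prim_ci)
 have "f ` {t0..1} <= affine_curve \<mu>" using g(1) t0 by force
 with path_rel[OF g(3)[OF t0(1,3)]] obtain w where w: "path_val \<mu> f t0 1 w" "rel (f t0) p w"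
  using t0 g(2) by (auto simp del: split_paired_Ex)
 have small: "\<forall>\<^sub>F e in at_right 0. 0 < e & e < t0" using t0(1) unfolding eventually_at_right_field by blast
 have val: "path_val \<mu> f e 1 ((A (z t0) - A (z e)) + w)" if e: "0 < e" "e < t0" for e
 proof -
  have "f piecewise_C1_differentiable_on {e..t0}"
   by (rule piecewise_C1_differentiable_on_subset[OF g(3)[of e]]) (use e t0 in auto)
  from chart_path[OF ns ci this] have "path_val \<mu> f e t0 (A (z t0) - A (z e))"
   using b(2) e t0 z(3)[of t0] z(3)[of e] by (auto simp: image_subset_iff)
  thus ?thesis using w(1) e t0 unfolding path_val_def by (intro has_integral_combine[where c=t0]) auto
 qed
 have z0: "(z \<longlongrightarrow> 0) (at_right 0)"
 proof (rule tendstoI)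
  fix d :: real assume d: "d > 0"
  show "\<forall>\<^sub>F e in at_right 0. dist (z e) 0 < d"
   using xinf[of "1 / d^2"] small
  proof eventually_elim
   case (elim e)
   have "norm (z e) ^ 2 = 1 / norm (fst (f e))"
    using coo_ci[OF b(2)[of e]] elim(2) t0(2) by (simp add: z_def norm_divide flip: norm_power)
   also have "\<dots> < d^2"
   proof -
    have "0 < 1 / d^2" using d by simp
    thus ?thesis using less_imp_inverse_less[of "1 / d^2" "norm (fst (f e))"] elim(1) by (simp add: inverse_eq_divide)
   qed
   finally show ?case using d by (simp add: power_less_imp_less_base)
  qed
 qed
 have "((%e. A (z e)) \<longlongrightarrow> A 0) (at_right 0)"
  by (rule isCont_tendsto_compose[OF _ z0]) (use continuous_A r in \<open>simp add: continuous_on_eq_continuous_at\<close>)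
 hence lim: "((%e. (A (z t0) - A (z e) + w) $ i) \<longlongrightarrow> (A (z t0) - 0 + w) $ i) (at_right 0)" for i
  unfolding A0 by (intro tendsto_intros)
 have "((%e. form_integral \<mu> (du_coeff i) f e 1) \<longlongrightarrow> (A (z t0) - 0 + w) $ i) (at_right 0)" for i
  by (rule Lim_transform_eventually[OF lim], use small in eventually_elim) (use path_val_form_integral[OF val] in auto)
 hence "v $ i = (A (z t0) - 0 + w) $ i" for i
  using tendsto_unique[OF _ g(5)[of i]] by simp
 hence "v = A (z t0) + w" by (simp add: vec_eq_iff)
 thus ?thesis using p z[OF t0(1) order_refl] w(2) by (intro conjI bexI[of _ "z t0"]) auto
qed

text \<open>The preimage in \<complex>^3 of the Abel image of the curve; the lattice is the part
  over infinity.\<close>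

definition \<Gamma> :: "(complex^3) set" where
 "\<Gamma> = (\<Union>P\<in>topspace (compact_curve \<mu>). abel_values \<mu> P)"

abbreviation AV :: "complex \<times> complex => (complex^3) set" where "AV p \<equiv> abel_values \<mu> (Some p)"

lemma AV_iff: "v \<in> AV p \<longleftrightarrow> (\<exists>t\<in>dom ci. rel (par ci t) p (v - A t))"
proof
 assume "\<exists>t\<in>dom ci. rel (par ci t) p (v - A t)"
 then obtain t where "t \<in> dom ci" "rel (par ci t) p (v - A t)" by blast
 from abel_value_from_rel[OF this] show "v \<in> AV p" by simp
qed (use rel_from_abel_value in blast)

lemma AV_affine: "v \<in> AV p ==> p \<in> affine_curve \<mu>" using rel_from_abel_value by blast

lemma AV_pt: "t \<in> dom ci ==> A t \<in> AV (par ci t)"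
 unfolding AV_iff using rel_refl[OF pt(2)] by (intro bexI[of _ t]) auto

lemma AV_rel: "v \<in> AV p ==> rel p q w ==> v + w \<in> AV q"
 unfolding AV_iff by (elim bexE, rule bexI, drule (1) rel_trans) (auto simp: algebra_simps)

lemma AV_diff: assumes "v \<in> AV p" "w \<in> AV q" shows "rel p q (w - v)"
proof -
 obtain s t where s: "s \<in> dom ci" "rel (par ci s) p (v - A s)" and t: "t \<in> dom ci" "rel (par ci t) q (w - A t)"
  using assms unfolding AV_iff by blast
 from rel_trans[OF rel_trans[OF rel_sym[OF s(2)] rel_pt[OF s(1) t(1)]] t(2)] show ?thesis by (simp add: algebra_simps)
qed

lemma AV_lattice: "v \<in> AV p ==> l \<in> \<Lambda> ==> v + l \<in> AV p"
 using AV_rel lattice_rel AV_affine by blast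

lemma AV_lattice_diff: "v \<in> AV p ==> w \<in> AV p ==> w - v \<in> \<Lambda>"
 using AV_diff lattice_iff by blast

lemma Gamma_eq: "\<Gamma> = \<Lambda> \<union> (\<Union>p. AV p)"
proof -
 have "topspace (compact_curve \<mu>) = insert None (Some ` affine_curve \<mu>)" by (simp add: compact_curve_def)
 hence "\<Gamma> = \<Lambda> \<union> (\<Union>p\<in>affine_curve \<mu>. AV p)" by (simp add: \<Gamma>_def abel_values_def[of \<mu> None])
 thus ?thesis using AV_affine by blast
qed

lemma Gamma_lattice: "v \<in> \<Gamma> ==> l \<in> \<Lambda> ==> v + l \<in> \<Gamma>"
 unfolding Gamma_eq using AV_lattice lattice_add by blast

lemma Gamma_A: "t \<in> ball 0 r ==> A t \<in> \<Gamma>"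
proof (cases "t = 0")
 case False
 moreover assume "t \<in> ball 0 r"
 ultimately have "t \<in> dom ci" by (simp add: dom_ci)
 thus ?thesis using AV_pt unfolding Gamma_eq by blast
qed (simp add: Gamma_eq lattice_0 A0)

lemma W2_eq: "W2_preimage \<mu> = {v + w | v w. v \<in> \<Gamma> & w \<in> \<Gamma>}"
proof (intro equalityI subsetI)
 fix u assume "u \<in> W2_preimage \<mu>"
 then obtain v w l where "v \<in> \<Gamma>" "w \<in> \<Gamma>" "l \<in> \<Lambda>" "u = v + (w + l)"
  unfolding W2_preimage_def \<Gamma>_def by (auto simp: add.assoc)
 thus "u \<in> {v + w | v w. v \<in> \<Gamma> & w \<in> \<Gamma>}" using Gamma_lattice by blast
next
 fix u assume "u \<in> {v + w | v w. v \<in> \<Gamma> & w \<in> \<Gamma>}"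
 then obtain v w where "v \<in> \<Gamma>" "w \<in> \<Gamma>" "u = v + w + 0" by auto
 thus "u \<in> W2_preimage \<mu>" unfolding W2_preimage_def \<Gamma>_def using lattice_0 by blast
qed

lemma W2_lattice: assumes "d \<in> W2_preimage \<mu>" "l \<in> \<Lambda>" shows "d + l \<in> W2_preimage \<mu>"
proof -
 obtain v w where "v \<in> \<Gamma>" "w \<in> \<Gamma>" "d = v + w" using assms(1) by (auto simp: W2_eq)
 hence "d + l = v + (w + l)" "v \<in> \<Gamma>" "w + l \<in> \<Gamma>" using Gamma_lattice assms(2) by auto
 thus ?thesis unfolding W2_eq by blast
qed

end

section \<open>Analytic continuation along the curve, and tangent vectors\<close>

context hyper_curve
begin

lemma AV_Gamma: "v \<in> AV p ==> v \<in> \<Gamma>" unfolding Gamma_eq by blast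

lemma W2I: "v \<in> \<Gamma> ==> w \<in> \<Gamma> ==> v + w \<in> W2_preimage \<mu>" unfolding W2_eq by blast

lemma openin_coo:
 assumes c: "is_chart \<mu> c" and B: "open B"
 shows "openin (top_of_set (affine_curve \<mu>)) {q \<in> patch c. coo c q \<in> B}"
proof -
 have "openin (top_of_set (patch c)) (patch c \<inter> coo c -` B)"
  by (rule continuous_openin_preimage_gen[OF continuous_coo[OF c] B])
 moreover have "patch c \<inter> coo c -` B = {q \<in> patch c. coo c q \<in> B}" by auto
 ultimately show ?thesis using openin_trans[OF _ is_chartD(3)[OF c]] by simp
qed

lemma open_par_preimage:
 assumes c: "is_chart \<mu> c" and T: "openin (top_of_set (affine_curve \<mu>)) T"
 shows "open {z \<in> dom c. par c z \<in> T}"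
proof -
 have "continuous_on (dom c) (%z. (fst (par c z), snd (par c z)))"
  by (intro continuous_on_Pair holomorphic_on_imp_continuous_on holomorphic_par[OF c])
 hence "continuous_on (dom c) (par c)" by simp
 moreover obtain V where V: "open V" "T = affine_curve \<mu> \<inter> V" using T by (auto simp: openin_open)
 ultimately have "open (dom c \<inter> par c -` V)" using is_chartD(1)[OF c] by (intro continuous_open_preimage)
 moreover have "dom c \<inter> par c -` V = {z \<in> dom c. par c z \<in> T}" using V is_chartD(4)[OF c] by (auto simp: patch_def)
 ultimately show ?thesis by simp
qed

text \<open>Both primitives are computed by integrating along one straight segment in the coordinate
  of \<open>b\<close>, short enough to stay in the patch of \<open>a\<close>.\<close>

lemma chart_transition:
 assumes a: "is_chart \<mu> a" and b: "is_chart \<mu> b" and q: "q \<in> patch a" "q \<in> patch b"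
 shows "\<exists>T. openin (top_of_set (affine_curve \<mu>)) T & q \<in> T &
  (\<forall>q'\<in>T. q' \<in> patch a & q' \<in> patch b & cprim a q' - cprim a q = cprim b q' - cprim b q)"
proof -
 define w where "w = coo b q"
 have w: "w \<in> dom b" "par b w = q" using coo_patch[OF b q(2)] by (auto simp: w_def)
 obtain e where e: "e > 0" "ball w e <= {z \<in> dom b. par b z \<in> patch a}"
  using open_par_preimage[OF b is_chartD(3)[OF a]] w q(1) open_contains_ball by blast
 have "cprim a q' - cprim a q = cprim b q' - cprim b q & q' \<in> patch a" if q': "q' \<in> patch b" "coo b q' \<in> ball w e" for q'
 proof -
  define z where "z = coo b q'"
  have z: "z \<in> ball w e" "par b z = q'" using q' coo_patch[OF b q'(1)] by (auto simp: z_def)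
  define G where "G = (%s::real. w + of_real s * (z - w))"
  have Gd: "(G has_vector_derivative (z - w)) (at s)" for s
   unfolding G_def by (auto intro!: derivative_eq_intros simp: has_vector_derivative_def scaleR_conv_of_real)
  have G: "G s \<in> ball w e" if "s \<in> {0..1}" for s
  proof -
   have "dist w (G s) = s * dist w z" using that by (simp add: G_def dist_norm norm_mult norm_minus_commute)
   also have "\<dots> <= dist w z" using that by (intro mult_left_le_one_le) auto
   finally show ?thesis using z(1) by simp
  qed
  have im: "par b (G s) \<in> patch a" "par b (G s) \<in> patch b" "G s \<in> dom b" if "s \<in> {0..1}" for s
   using G[OF that] e(2) by (auto simp: patch_def)
  have pw: "(%s. par b (G s)) piecewise_C1_differentiable_on {0..1}"
   by (rule chart_curve_pw[OF b Gd continuous_on_const]) (use im in auto)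
  have "path_val \<mu> (%s. par b (G s)) 0 1 (cprim a q' - cprim a q)" "path_val \<mu> (%s. par b (G s)) 0 1 (cprim b q' - cprim b q)"
   using chart_path[OF ns a pw] chart_path[OF ns b pw] im w z by (auto simp: G_def image_subset_iff)
  thus ?thesis using has_integral_unique im(1)[of 1] z(2) by (auto simp: path_val_def G_def)
 qed
 thus ?thesis using openin_coo[OF b open_ball] q w e(1)
  by (intro exI[of _ "{q \<in> patch b. coo b q \<in> ball w e}"]) (auto simp: w_def)
qed

lemma prim_derivative:
 assumes "is_chart \<mu> c" "z \<in> dom c" "entire F"
 shows "DERIV (%z. F (u + (prim c z - k))) z :> (\<Sum>i\<in>UNIV. partial i F (u + (prim c z - k)) * (du_coeff i (par c z) * den c z))"
 by (rule hol3_chain[OF assms(3)]) (auto intro!: derivative_eq_intros is_chartD(10)[OF assms(1,2)])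

text \<open>\<open>F\<close> vanishes on the local branch of the integrated curve through
  \<open>u\<close> above \<open>q\<close>. All charts at \<open>q\<close> are quantified over, so
  that the property can be handed from one to the next.\<close>

definition null_at :: "(complex^3 => complex) => complex \<times> complex => complex^3 => bool" where
 "null_at F q u \<longleftrightarrow> (\<forall>c. is_chart \<mu> c --> q \<in> patch c --> (\<forall>q'\<in>patch c. F (u + (cprim c q' - cprim c q)) = 0))"

text \<open>Vanishing near \<open>q\<close> in one chart passes to any other chart near
  \<open>q\<close>, because primitives agree up to a constant, and then to the whole connected
  domain by the identity theorem.\<close>

lemma null_at_start:
 assumes F: "entire F" and c: "is_chart \<mu> c" "q \<in> patch c"
  and T: "openin (top_of_set (affine_curve \<mu>)) T" "q \<in> T"
  and z: "!!q'. q' \<in> T ==> q' \<in> patch c ==> F (u + (cprim c q' - cprim c q)) = 0"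
 shows "null_at F q u"
 unfolding null_at_def
proof (intro allI impI ballI)
 fix b q' assume b: "is_chart \<mu> b" "q \<in> patch b" and q': "q' \<in> patch b"
 obtain T' where T': "openin (top_of_set (affine_curve \<mu>)) T'" "q \<in> T'"
  "!!q'. q' \<in> T' ==> q' \<in> patch c & cprim c q' - cprim c q = cprim b q' - cprim b q"
  using chart_transition[OF c(1) b(1) c(2) b(2)] by blast
 define h where "h = (%z. F (u + (prim b z - cprim b q)))"
 have h: "h holomorphic_on dom b"
  unfolding h_def holomorphic_on_open[OF is_chartD(1)[OF b(1)]] using prim_derivative[OF b(1) _ F] by blast
 define V where "V = {z \<in> dom b. par b z \<in> T \<inter> T'}"
 have V: "open V" "coo b q \<in> V" "V <= dom b"
  unfolding V_def using open_par_preimage[OF b(1) openin_Int[OF T(1) T'(1)]] coo_patch[OF b] T(2) T'(2) by auto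
 have "h z = 0" if "z \<in> V" for z
  using z[of "par b z"] T'(3)[of "par b z"] that is_chartD(5)[OF b(1), of z] by (auto simp: V_def h_def cprim_def)
 hence "h w = 0" if "w \<in> dom b" for w
  using analytic_continuation_open[OF V(1) is_chartD(1)[OF b(1)] _ is_chartD(2)[OF b(1)] V(3) h holomorphic_on_const, of 0] V(2) that by blast
 thus "F (u + (cprim b q' - cprim b q)) = 0" using coo_patch[OF b(1) q'] by (auto simp: h_def cprim_def)
qed

lemma null_at_rel:
 assumes F: "entire F"
 shows "rel p q w ==> null_at F p v ==> null_at F q (v + w)"
proof (induction rule: chain.induct)
 case (step p q w c s)
 note IH = step.IH[OF step.prems]
 have c: "is_chart \<mu> c" using step.hyps by simp
 have *: "F (v + (w + (cprim c s - cprim c q)) + (cprim c q' - cprim c s)) = 0" if "q' \<in> patch c" for q'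
  using IH[unfolded null_at_def, rule_format, OF c step.hyps(3) that] by (simp add: algebra_simps)
 show ?case by (rule null_at_start[OF F c step.hyps(4) is_chartD(3)[OF c] step.hyps(4)]) (rule *)
qed simp

lemma null_at_value: "null_at F p v ==> p \<in> affine_curve \<mu> ==> F v = 0"
 using chart_exists[of p] unfolding null_at_def by fastforce

lemma tendsto_A: "((%t. A t) \<longlongrightarrow> 0) (at 0)"
proof -
 have "isCont A 0" using continuous_A r by (simp add: continuous_on_eq_continuous_at)
 thus ?thesis by (simp add: isCont_def A0)
qed

lemma near_zero: "open O' ==> v \<in> O' ==> \<exists>d>0. d <= r & (\<forall>t. norm t < d --> A t + v \<in> O')"
proof -
 assume O': "open O'" "v \<in> O'"
 have "open (ball 0 r \<inter> (%t. A t + v) -` O')"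
  by (intro continuous_open_preimage continuous_intros continuous_A O') auto
 moreover have "0 \<in> ball 0 r \<inter> (%t. A t + v) -` O'" using r O' A0 by simp
 ultimately obtain e where "e > 0" "ball 0 e <= ball 0 r \<inter> (%t. A t + v) -` O'" using open_contains_ball by blast
 thus ?thesis using r by (intro exI[of _ "min e r"]) (auto simp: subset_iff)
qed

text \<open>Any two affine points are joined by a chain, which transports the vanishing. The points
  of the lattice, lying over infinity, are limits of \<open>A t + u\<close>.\<close>

lemma null_at_Gamma:
 assumes F: "entire F" and v: "v \<in> AV p" and n: "null_at F p v" and u: "u \<in> \<Gamma>"
 shows "F u = 0"
proof -
 have affine: "F u = 0" if "u \<in> AV q" for q u
  using null_at_value[OF null_at_rel[OF F AV_diff[OF v that] n] AV_affine[OF that]] by simp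
 show ?thesis
 proof (cases "u \<in> \<Lambda>")
  case True
  have "F (A t + u) = 0" if "t \<in> dom ci" for t using affine AV_lattice[OF AV_pt[OF that] True] by blast
  moreover have "\<forall>\<^sub>F t in at 0. t \<in> dom ci"
   unfolding dom_ci eventually_at using r by (auto intro!: exI[of _ r])
  ultimately have "\<forall>\<^sub>F t in at 0. F (A t + u) = 0" by (auto elim: eventually_mono)
  moreover have "isCont F (0 + u)" using hol3_continuous[OF F] by (simp add: continuous_on_eq_continuous_at)
  hence "((%t. F (A t + u)) \<longlongrightarrow> F (0 + u)) (at 0)"
   by (rule isCont_tendsto_compose) (intro tendsto_intros tendsto_A)
  ultimately have "((%t::complex. 0) \<longlongrightarrow> F (0 + u)) (at 0)" by (rule Lim_transform_eventually[rotated])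
  from LIM_unique[OF tendsto_const this] show ?thesis by simp
 qed (use u affine in \<open>unfold Gamma_eq, blast\<close>)
qed

lemma A_continuation:
 assumes F: "entire F" and O': "open O'" "t0 \<in> O'" "t0 \<in> dom ci" and l: "l \<in> \<Lambda>"
  and z: "!!t. t \<in> O' ==> t \<in> dom ci ==> F (A t + l) = 0" and u: "u \<in> \<Gamma>"
 shows "F u = 0"
proof (rule null_at_Gamma[OF F AV_lattice[OF AV_pt[OF O'(3)] l] _ u])
 have c: "coo ci (par ci t0) = t0" using is_chartD(5)[OF ci O'(3)] .
 show "null_at F (par ci t0) (A t0 + l)"
 proof (rule null_at_start[OF F ci pt(1)[OF O'(3)] openin_coo[OF ci O'(1)]])
  fix q assume "q \<in> {q \<in> patch ci. coo ci q \<in> O'}" "q \<in> patch ci"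
  with coo_patch[OF ci] z[of "coo ci q"] show "F (A t0 + l + (cprim ci q - cprim ci (par ci t0))) = 0"
   by (simp add: pt(3)[OF O'(3)]) (simp add: cprim_def prim_ci add_ac)
 qed (use O' c pt(1) in auto)
qed

text \<open>Irreducibility of \<open>\<Gamma>\<close>: the curve is connected, so vanishing on a
  nonempty relatively open part spreads everywhere. Near a lattice point the chart at infinity is
  entered at a parameter different from 0.\<close>

lemma Gamma_continuation:
 assumes F: "entire F" and O': "open O'" "v \<in> O'" and v: "v \<in> \<Gamma>"
  and z: "!!u. u \<in> \<Gamma> ==> u \<in> O' ==> F u = 0" and u: "u \<in> \<Gamma>"
 shows "F u = 0"
proof (cases "v \<in> \<Lambda>")
 case True
 obtain e where e: "e > 0" "e <= r" "!!t. norm t < e ==> A t + v \<in> O'" using near_zero[OF O'] by blast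
 show ?thesis
  by (rule A_continuation[OF F open_ball _ _ True _ u, of "of_real (e/2)" 0 e])
    (use e Gamma_A Gamma_lattice True z in \<open>auto simp: dom_ci\<close>)
next
 case False
 then obtain p where p: "v \<in> AV p" using v by (auto simp: Gamma_eq)
 obtain c where c: "is_chart \<mu> c" "p \<in> patch c" using chart_exists[OF AV_affine[OF p]] by blast
 have "continuous_on (patch c) (%q. v + (cprim c q - cprim c p))" by (intro continuous_intros continuous_cprim[OF c(1)])
 from continuous_openin_preimage_gen[OF this O'(1)]
 have T: "openin (top_of_set (affine_curve \<mu>)) (patch c \<inter> (%q. v + (cprim c q - cprim c p)) -` O')"
  using openin_trans is_chartD(3)[OF c(1)] by blast
 show ?thesis
 proof (rule null_at_Gamma[OF F p null_at_start[OF F c T] u])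
  fix q assume q: "q \<in> patch c \<inter> (%q. v + (cprim c q - cprim c p)) -` O'" "q \<in> patch c"
  have "v + (cprim c q - cprim c p) \<in> AV q" by (rule AV_rel[OF p rel_chart[OF c q(2)]])
  thus "F (v + (cprim c q - cprim c p)) = 0" using z[OF AV_Gamma] q by blast
 qed (use c O' in auto)
qed

text \<open>Irreducibility of the surface: the function is continued in one summand while the other
  is held near \<open>w\<close>, and then in the other.\<close>

lemma W2_continuation:
 assumes F: "entire F" and O': "open O'" "d \<in> O'" and d: "d \<in> W2_preimage \<mu>"
  and z: "!!u. u \<in> W2_preimage \<mu> ==> u \<in> O' ==> F u = 0" and u: "u \<in> W2_preimage \<mu>"
 shows "F u = 0"
proof -
 obtain v w where vw: "v \<in> \<Gamma>" "w \<in> \<Gamma>" "d = v + w" using d by (auto simp: W2_eq)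
 obtain u1 u2 where u12: "u1 \<in> \<Gamma>" "u2 \<in> \<Gamma>" "u = u1 + u2" using u by (auto simp: W2_eq)
 obtain e where e: "e > 0" "ball d e <= O'" using O' open_contains_ball by blast
 have tr: "hol3 (%x. F (x + y)) UNIV" for y by (rule hol3_translate[OF F]) auto
 have 1: "F (x + y) = 0" if x: "x \<in> \<Gamma>" and y: "y \<in> \<Gamma>" "y \<in> ball w (e/2)" for x y
 proof (rule Gamma_continuation[where O'="ball v (e/2)", OF tr open_ball _ vw(1) _ x])
  fix x' assume x': "x' \<in> \<Gamma>" "x' \<in> ball v (e/2)"
  have "dist (v + w) (x' + y) <= dist v x' + dist w y" by (rule dist_triangle_add)
  hence "x' + y \<in> ball d e" using x' y by (simp add: vw)
  thus "F (x' + y) = 0" using z[OF W2I[OF x'(1) y(1)]] e by blast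
 qed (use e in auto)
 have "F (u2 + u1) = 0"
 proof (rule Gamma_continuation[where O'="ball w (e/2)", OF tr open_ball _ vw(2) _ u12(2)])
  fix x' assume "x' \<in> \<Gamma>" "x' \<in> ball w (e/2)"
  thus "F (x' + u1) = 0" using 1[OF u12(1), of x'] by (simp add: add.commute[of x'])
 qed (use e in auto)
 thus ?thesis by (simp add: u12 add.commute)
qed

text \<open>The pairs of a point of \<open>\<Gamma>\<close> and a tangent vector of \<open>\<Gamma>\<close> there.\<close>

definition tang :: "complex^3 => complex^3 => bool" where
 "tang v w \<longleftrightarrow> (\<exists>p. v \<in> AV p & w = (\<chi> i. du_coeff i p)) | v \<in> \<Lambda> & w = axis 3 1"

lemma tang_pt: "t \<in> dom ci ==> tang (A t) (vector [1, 1 / t^2, 1 / t^4])"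
 unfolding tang_def by (intro disjI1 exI[of _ "par ci t"])
  (simp add: AV_pt vec_eq_iff forall_3 du_coeff_def x_ci power_divide flip: power_mult)

text \<open>At an affine point \<open>\<Gamma>\<close> is locally a chart primitive, with velocity
  \<open>w\<close> times the nonzero \<open>den\<close>. At a lattice point the velocity is
  \<open>Q 0\<close> times the third unit vector, since the other components carry the factors t^4
  and t^2.\<close>

lemma dird_Gamma:
 assumes F: "entire F" and z: "!!v. v \<in> \<Gamma> ==> F v = 0" and t: "tang v w"
 shows "dird w F v = 0"
 using t unfolding tang_def
proof (elim disjE exE conjE)
 fix p assume p: "v \<in> AV p" and w: "w = (\<chi> i. du_coeff i p)"
 obtain c where c: "is_chart \<mu> c" "p \<in> patch c" using chart_exists[OF AV_affine[OF p]] by blast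
 note q = coo_patch[OF c]
 have "F (v + (prim c z - cprim c p)) = 0" if "z \<in> dom c" for z
 proof -
  have "par c z \<in> patch c" "cprim c (par c z) = prim c z" using that is_chartD(5)[OF c(1) that] by (auto simp: patch_def cprim_def)
  with AV_rel[OF p rel_chart[OF c, of "par c z"]] have "v + (prim c z - cprim c p) \<in> \<Gamma>" using AV_Gamma by metis
  thus ?thesis by (rule z)
 qed
 hence "DERIV (%z. F (v + (prim c z - cprim c p))) (coo c p) :> 0"
  by (intro has_field_derivative_transform_within_open[OF DERIV_const is_chartD(1)[OF c(1)] q(1)]) auto
 with prim_derivative[OF c(1) q(1) F, of v "cprim c p"]
 have "(\<Sum>i\<in>UNIV. partial i F v * (du_coeff i p * den c (coo c p))) = 0" using DERIV_unique by (fastforce simp: cprim_def q(2))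
 hence "dird w F v * den c (coo c p) = 0" by (simp add: dird_def w sum_distrib_right mult.assoc)
 thus ?thesis using is_chartD(7)[OF c(1) q(1)] by simp
next
 assume l: "v \<in> \<Lambda>" and w: "w = axis 3 1"
 have "DERIV (%z. (A z + v) $ i) 0 :> Q 0 * axis 3 1 $ i" for i
  using dA[of 0] r exhaust_3[of i] by (auto intro!: derivative_eq_intros simp: axis_def)
 from hol3_chain[OF F _ this] have "DERIV (%z. F (A z + v)) 0 :> (\<Sum>i\<in>UNIV. partial i F v * (Q 0 * axis 3 1 $ i))"
  by (simp add: A0)
 moreover have "DERIV (%z. F (A z + v)) 0 :> 0"
  by (rule has_field_derivative_transform_within_open[OF DERIV_const open_ball[of 0 r]]) (use r z Gamma_lattice[OF Gamma_A l] in auto)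
 ultimately have "(\<Sum>i\<in>UNIV. partial i F v * (Q 0 * axis 3 1 $ i)) = 0" using DERIV_unique by blast
 hence "Q 0 * dird w F v = 0" by (simp add: dird_def w sum_distrib_left mult_ac)
 thus ?thesis using Q(2)[of 0] r by simp
qed

lemma dird_translate:
 assumes "entire F"
 shows "dird w (%x. F (x + y)) v = dird w F (v + y)"
proof -
 have "((%x. x + y) has_derivative (%h. h)) (at v)" by (auto intro!: derivative_eq_intros)
 from has_derivative_compose[OF this hol3_derivative[OF assms, of "v + y"]]
 have "((%x. F (x + y)) has_derivative (%h. \<Sum>i\<in>UNIV. (\<chi> i. partial i F (v + y)) $ i * h $ i)) (at v)" by simp
 from partial_eqI[OF this] show ?thesis by (simp add: dird_def)
qed

lemma dird_W2:
 assumes F: "entire F" and z: "!!d. d \<in> W2_preimage \<mu> ==> F d = 0"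
  and u: "u \<in> \<Gamma>" and t: "tang v w"
 shows "dird w F (v + u) = 0"
 using dird_Gamma[OF hol3_translate[OF F], of u v w] z u t dird_translate[OF F] by (fastforce simp: W2_eq)

text \<open>The first derivative in the direction \<open>w\<close> vanishes for every second
  summand, so it may be differentiated along the second summand.\<close>

lemma dird2_W2:
 assumes F: "entire F" and z: "!!d. d \<in> W2_preimage \<mu> ==> F d = 0"
  and t: "tang v w" "tang v' w'"
 shows "dird w' (dird w F) (v + v') = 0"
proof -
 have "dird w F (v + u) = 0" if "u \<in> \<Gamma>" for u by (rule dird_W2[OF F z that t(1)])
 hence "dird w' (%u. dird w F (u + v)) v' = 0"
  by (intro dird_Gamma[OF hol3_translate[OF hol3_dird[OF F]] _ t(2)]) (auto simp: add.commute)
 thus ?thesis by (simp add: dird_translate[OF hol3_dird[OF F]] add.commute)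
qed

end

section \<open>Countability of the periods; the surface has measure zero\<close>

context hyper_curve
begin

lemma countable_charts:
 "\<exists>C. countable C & (\<forall>c\<in>C. is_chart \<mu> c) & affine_curve \<mu> <= (\<Union>c\<in>C. patch c)"
proof -
 have op: "openin (top_of_set (affine_curve \<mu>)) S" if "S \<in> patch ` {c. is_chart \<mu> c}" for S
  using that by (auto intro: is_chartD(3))
 obtain \<F> where F: "\<F> <= patch ` {c. is_chart \<mu> c}" "countable \<F>" "\<Union>\<F> = \<Union>(patch ` {c. is_chart \<mu> c})"
  by (rule Lindelof_openin[OF op])
 obtain C where "countable C" "C <= {c. is_chart \<mu> c}" "\<F> = patch ` C"
  using F(1,2) countable_subset_image[of \<F> patch "{c. is_chart \<mu> c}"] by (elim iffE) (simp, metis)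
 moreover from this have "affine_curve \<mu> <= (\<Union>c\<in>C. patch c)" using F(3) charts_cover by simp
 ultimately show ?thesis by blast
qed

text \<open>The difference of two chart primitives is locally constant on the overlap, and by the
  Lindelof property countably many open sets of constancy suffice.\<close>

lemma countable_jumps:
 assumes a: "is_chart \<mu> a" and b: "is_chart \<mu> b"
 shows "countable ((%q. cprim a q - cprim b q) ` (patch a \<inter> patch b))"
proof -
 define \<F> where "\<F> = {T. openin (top_of_set (affine_curve \<mu>)) T & (\<exists>k. \<forall>q\<in>T. cprim a q - cprim b q = k)}"
 obtain \<G> where G: "\<G> <= \<F>" "countable \<G>" "\<Union>\<G> = \<Union>\<F>"
  using Lindelof_openin[of \<F> "affine_curve \<mu>"] by (auto simp: \<F>_def)
 have "\<forall>T\<in>\<G>. \<exists>k. \<forall>q\<in>T. cprim a q - cprim b q = k" using G(1) by (auto simp: \<F>_def)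
 then obtain k where k: "!!T q. T \<in> \<G> ==> q \<in> T ==> cprim a q - cprim b q = k T" by metis
 have "(%q. cprim a q - cprim b q) ` (patch a \<inter> patch b) <= k ` \<G>"
 proof
  fix y assume "y \<in> (%q. cprim a q - cprim b q) ` (patch a \<inter> patch b)"
  then obtain q where q: "q \<in> patch a" "q \<in> patch b" "y = cprim a q - cprim b q" by blast
  from chart_transition[OF a b q(1,2)] obtain T where T: "openin (top_of_set (affine_curve \<mu>)) T" "q \<in> T"
   "\<forall>q'\<in>T. cprim a q' - cprim a q = cprim b q' - cprim b q" by blast
  have "\<forall>q'\<in>T. cprim a q' - cprim b q' = cprim a q - cprim b q"
   using T(3) by (simp add: algebra_simps)
  hence "T \<in> \<F>" using T(1) unfolding \<F>_def by blast
  hence "q \<in> \<Union>\<G>" unfolding G(3) using T(2) by (rule UnionI)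
  then obtain T' where "T' \<in> \<G>" "q \<in> T'" by (rule UnionE)
  thus "y \<in> k ` \<G>" using k q(3) by blast
 qed
 thus ?thesis by (rule countable_subset) (rule countable_image[OF G(2)])
qed

text \<open>Increments telescope: the value of a chain is a difference of primitives at its ends
  plus a finite sum of jumps between charts, and there are countably many such sums.\<close>

lemma countable_chain_values:
 assumes C: "countable C" "!!c. c \<in> C ==> is_chart \<mu> c"
 shows "\<exists>J. countable J & (\<forall>p q v a b. chain \<mu> C p q v --> a \<in> C --> p \<in> patch a --> b \<in> C --> q \<in> patch b -->
   v - (cprim b q - cprim a p) \<in> J)"
proof -
 define K where "K = (\<Union>a\<in>C. \<Union>b\<in>C. (%q. cprim a q - cprim b q) ` (patch a \<inter> patch b))"
 have "countable K" unfolding K_def using C(1) countable_jumps[OF C(2) C(2)] by (intro countable_UN) auto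
 define J where "J = sum_list ` lists K"
 have "countable J" unfolding J_def using \<open>countable K\<close> by (intro countable_image countable_lists)
 have add: "x + y \<in> J" if xy: "x \<in> J" "y \<in> K" for x y
 proof -
  obtain xs where "xs \<in> lists K" "x = sum_list xs" using xy(1) by (auto simp: J_def)
  hence "x + y = sum_list (y # xs)" "y # xs \<in> lists K" using xy(2) by (auto simp: add.commute)
  thus ?thesis unfolding J_def by blast
 qed
 have J0: "0 \<in> J" unfolding J_def by (rule image_eqI[of _ _ "[]"]) auto
 have KI: "cprim a q - cprim b q \<in> K" if "a \<in> C" "b \<in> C" "q \<in> patch a" "q \<in> patch b" for a b q
  using that unfolding K_def by blast
 have "chain \<mu> C p q v ==> a \<in> C ==> p \<in> patch a ==> b \<in> C ==> q \<in> patch b ==> v - (cprim b q - cprim a p) \<in> J"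
  for p q v a b
 proof (induction arbitrary: b rule: chain.induct)
  case (refl p)
  show ?case using add[OF J0 KI[OF refl.prems(1,3,2,4)]] by simp
 next
  case (step p q v c s)
  from add[OF step.IH[OF step.prems(1,2) step.hyps(2,3)] KI[OF step.hyps(2) step.prems(3) step.hyps(4) step.prems(4)]]
  show ?case by (simp add: algebra_simps)
 qed
 thus ?thesis using \<open>countable J\<close> by blast
qed

text \<open>A chain through arbitrary charts is realized by a path, and the path by a chain through
  the countable atlas.\<close>

lemma rel_values:
 "\<exists>C J. countable C & (\<forall>c\<in>C. is_chart \<mu> c) & affine_curve \<mu> <= (\<Union>c\<in>C. patch c) & countable J &
   (\<forall>p q v a b. rel p q v --> a \<in> C --> p \<in> patch a --> b \<in> C --> q \<in> patch b --> v - (cprim b q - cprim a p) \<in> J)"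
proof -
 obtain C where C: "countable C" "!!c. c \<in> C ==> is_chart \<mu> c" "affine_curve \<mu> <= (\<Union>c\<in>C. patch c)"
  using countable_charts by blast
 obtain J where J: "countable J" "!!p q v a b. chain \<mu> C p q v ==> a \<in> C ==> p \<in> patch a ==> b \<in> C ==> q \<in> patch b ==>
   v - (cprim b q - cprim a p) \<in> J" using countable_chain_values[OF C(1,2)] by metis
 have "chain \<mu> C p q v" if "rel p q v" for p q v
 proof -
  from rel_path[OF that zero_less_one] obtain w where g: "w piecewise_C1_differentiable_on {0..1}" "w ` {0..1} <= affine_curve \<mu>"
   "w 0 = p" "w 1 = q" "path_val \<mu> w 0 1 v" by (auto simp del: split_paired_Ex)
  from path_chain[OF ns C(2,3) g(1,2) zero_le_one] obtain v' where "path_val \<mu> w 0 1 v'" "chain \<mu> C p q v'"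
   using g(3,4) by auto
  thus ?thesis using g(5) has_integral_unique unfolding path_val_def by blast
 qed
 thus ?thesis using C J by (intro exI[of _ C] exI[of _ J]) (simp del: split_paired_All)
qed

lemma countable_lattice: "countable \<Lambda>"
proof -
 obtain C J where C: "!!c. c \<in> C ==> is_chart \<mu> c" "affine_curve \<mu> <= (\<Union>c\<in>C. patch c)" and J: "countable J"
   "!!p q v a b. rel p q v ==> a \<in> C ==> p \<in> patch a ==> b \<in> C ==> q \<in> patch b ==> v - (cprim b q - cprim a p) \<in> J"
  using rel_values by metis
 define p where "p = par ci (of_real (r/2))"
 have p: "p \<in> affine_curve \<mu>" unfolding p_def by (rule pt(2)[OF ri])
 then obtain a where a: "a \<in> C" "p \<in> patch a" using C by blast
 have "\<Lambda> <= J" using J(2)[OF lattice_rel[OF _ p] a a] by auto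
 thus ?thesis using J(1) countable_subset by blast
qed

lemma Gamma_cover:
 "\<exists>X :: (complex set \<times> (complex => complex^3)) set. countable X & (\<forall>x\<in>X. \<forall>z\<in>fst x. snd x differentiable (at z)) &
   \<Gamma> <= (\<Union>x\<in>X. snd x ` fst x)"
proof -
 obtain C J where C: "countable C" "!!c. c \<in> C ==> is_chart \<mu> c" "affine_curve \<mu> <= (\<Union>c\<in>C. patch c)" and J: "countable J"
   "!!p q v a b. rel p q v ==> a \<in> C ==> p \<in> patch a ==> b \<in> C ==> q \<in> patch b ==> v - (cprim b q - cprim a p) \<in> J"
  using rel_values by metis
 define t where "t = complex_of_real (r/2)"
 have p: "par ci t \<in> affine_curve \<mu>" unfolding t_def by (rule pt(2)[OF ri])
 then obtain a where a: "a \<in> C" "par ci t \<in> patch a" using C(3) by blast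
 define k where "k = A t - cprim a (par ci t)"
 define X where "X = (%(b, j). (dom b, %z. prim b z + (k + j))) ` (C \<times> J) \<union> (%l. (UNIV, %_. l)) ` \<Lambda>"
 have "countable X" unfolding X_def using C(1) J(1) countable_lattice by (intro countable_Un countable_image countable_SIGMA)
 moreover have "snd x differentiable (at z)" if x: "x \<in> X" and z: "z \<in> fst x" for x z
 proof -
  have "prim b differentiable (at z)" if "b \<in> C" "z \<in> dom b" for b
  proof -
   have "(prim b has_derivative (%h. \<chi> i. (du_coeff i (par b z) * den b z) * h)) (at z)"
    using is_chartD(10)[OF C(2)[OF that(1)] that(2)]
    by (intro has_derivative_vec_componentwise) (simp add: has_field_derivative_def mult_commute_abs)
   thus ?thesis by (auto simp: differentiable_def)
  qed
  thus ?thesis using x z by (auto simp: X_def intro!: derivative_intros)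
 qed
 moreover have "v \<in> (\<Union>x\<in>X. snd x ` fst x)" if v: "v \<in> \<Gamma>" for v
 proof (cases "v \<in> \<Lambda>")
  case True
  have "v \<in> snd (UNIV, %_::complex. v) ` fst (UNIV, %_::complex. v)" by simp
  thus ?thesis using True unfolding X_def by blast
 next
  case False
  then obtain q where q: "v \<in> AV q" using v unfolding Gamma_eq by blast
  obtain b where b: "b \<in> C" "q \<in> patch b" using C(3) AV_affine[OF q] by blast
  have "t \<in> dom ci" unfolding t_def by (rule ri)
  define j where "j = v - A t - (cprim b q - cprim a (par ci t))"
  have j: "j \<in> J" unfolding j_def by (rule J(2)[OF AV_diff[OF AV_pt[OF \<open>t \<in> dom ci\<close>] q] a b])
  have "v = prim b (coo b q) + (k + j)" by (simp add: j_def k_def cprim_def)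
  hence "v \<in> snd (dom b, %z. prim b z + (k + j)) ` fst (dom b, %z. prim b z + (k + j))"
   using coo_patch(1)[OF C(2)[OF b(1)] b(2)] by simp
  moreover have "(dom b, %z. prim b z + (k + j)) \<in> X"
   unfolding X_def by (rule UnI1, rule image_eqI[of _ _ "(b, j)"]) (use b j in auto)
  ultimately show ?thesis by (rule UN_I[rotated])
 qed
 ultimately show ?thesis by (intro exI[of _ X] conjI ballI subsetI)
qed

text \<open>\<open>\<Gamma>\<close> is covered by countably many differentiable images of subsets of
  the plane, so the sums of two of its points lie in countably many differentiable images of sets in
  real dimension four inside real dimension six, a null set.\<close>

lemma W2_not_UNIV: "W2_preimage \<mu> ~= UNIV"
proof -
 obtain X :: "(complex set \<times> (complex => complex^3)) set" where X: "countable X" "!!x z. x \<in> X ==> z \<in> fst x ==> snd x differentiable (at z)"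
  "\<Gamma> <= (\<Union>x\<in>X. snd x ` fst x)" using Gamma_cover by blast
 define im where "im = (%(x :: complex set \<times> (complex => complex^3), y :: complex set \<times> (complex => complex^3)).
  (%p. snd x (fst p) + snd y (snd p)) ` (fst x \<times> fst y))"
 have "negligible (im (x, y))" if xy: "x \<in> X" "y \<in> X" for x y
  unfolding im_def prod.case
 proof (rule negligible_differentiable_image_lowdim)
  show "(%p. snd x (fst p) + snd y (snd p)) differentiable_on fst x \<times> fst y"
   unfolding differentiable_on_def
  proof
   fix p assume p: "p \<in> fst x \<times> fst y"
   obtain L L' where "(snd x has_derivative L) (at (fst p))" "(snd y has_derivative L') (at (snd p))"
    using X(2)[OF xy(1), of "fst p"] X(2)[OF xy(2), of "snd p"] p by (auto simp: differentiable_def)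
   from has_derivative_add[OF has_derivative_compose[OF has_derivative_fst[OF has_derivative_ident] this(1)]
    has_derivative_compose[OF has_derivative_snd[OF has_derivative_ident] this(2)]]
   show "(%p. snd x (fst p) + snd y (snd p)) differentiable (at p within fst x \<times> fst y)"
    unfolding differentiable_def by blast
  qed
 qed simp
 hence "negligible (\<Union>(im ` (X \<times> X)))"
  using X(1) by (intro negligible_countable_Union) auto
 moreover have "W2_preimage \<mu> <= \<Union>(im ` (X \<times> X))"
 proof
  fix d assume "d \<in> W2_preimage \<mu>"
  then obtain v w where vw: "v \<in> \<Gamma>" "w \<in> \<Gamma>" "d = v + w" by (auto simp: W2_eq)
  obtain x z where x: "x \<in> X" "z \<in> fst x" "v = snd x z" using X(3) vw(1) by blast
  obtain y z' where y: "y \<in> X" "z' \<in> fst y" "w = snd y z'" using X(3) vw(2) by blast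
  have "d \<in> im (x, y)" unfolding im_def prod.case by (rule image_eqI[of _ _ "(z, z')"]) (use x y vw(3) in auto)
  thus "d \<in> \<Union>(im ` (X \<times> X))" using x(1) y(1) by blast
 qed
 ultimately show ?thesis using negligible_subset non_negligible_UNIV by metis
qed

end

section \<open>Secant points, and the absence of invariant line directions\<close>

text \<open>\<open>K\<close> is a class closed under derivatives whose members vanish at
  \<open>x\<close>, so all derivatives of \<open>F\<close> along the line from \<open>x\<close> to
  \<open>u\<close> vanish at \<open>x\<close>.\<close>

lemma entire_zero_from_jets:
 assumes F: "entire F" "F \<in> K" and K: "!!G i. G \<in> K ==> entire G ==> partial i G \<in> K"
  and z: "!!G. G \<in> K ==> G x = 0" and lin: "!!G e. (!!i. partial i G \<in> K) ==> dird e G \<in> K"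
 shows "F u = 0"
proof -
 define e where "e = u - x"
 have c: "hol3 ((dird e ^^ n) F) UNIV & (dird e ^^ n) F \<in> K" for n
  by (induction n) (auto simp: F hol3_dird intro!: lin K)
 define h where "h = (%t. F (x + t *s e))"
 have d: "(deriv ^^ n) h = (%t. (dird e ^^ n) F (x + t *s e))" for n
 proof (induction n)
  case (Suc n)
  show ?case using line_dird[OF conjunct1[OF c], of _ _ e n] by (auto simp: Suc intro!: ext DERIV_imp_deriv)
 qed (simp add: h_def)
 have "h holomorphic_on ball 0 2" unfolding h_def by (rule line_holomorphic[OF F(1)]) auto
 moreover have "(deriv ^^ n) h 0 = 0" for n unfolding d using z[OF conjunct2[OF c]] by simp
 ultimately have "h 1 = 0" by (intro holomorphic_fun_eq_0_on_ball[of h 0 2 1]) auto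
 thus ?thesis by (simp add: h_def e_def)
qed

text \<open>The quadratic with coefficients \<open>p\<close> has the roots x and y, so it is
  \<open>p $ 3\<close> times (X - x)(X - y). This determines a gradient, up to a factor, from two
  tangent directions.\<close>

lemma gauss_map_kernel:
 fixes p :: "complex^3"
 assumes "p $ 1 + p $ 2 * x + p $ 3 * x^2 = 0" "p $ 1 + p $ 2 * y + p $ 3 * y^2 = 0" "x ~= y"
 shows "p $ 1 = p $ 3 * (x * y) & p $ 2 = - (p $ 3 * (x + y))"
proof -
 have "(x - y) * (p $ 2 + p $ 3 * (x + y)) = (p $ 1 + p $ 2 * x + p $ 3 * x^2) - (p $ 1 + p $ 2 * y + p $ 3 * y^2)"
  by (simp add: algebra_simps power2_eq_square)
 hence "(x - y) * (p $ 2 + p $ 3 * (x + y)) = 0" using assms(1,2) by simp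
 hence p2: "p $ 2 = - (p $ 3 * (x + y))" using assms(3) by (simp add: eq_neg_iff_add_eq_0)
 have "p $ 1 = - (p $ 2 * x) - p $ 3 * x^2" using assms(1) by (simp add: eq_diff_eq eq_neg_iff_add_eq_0 add_ac)
 hence "p $ 1 = p $ 3 * (x * y)" unfolding p2 by (simp add: algebra_simps power2_eq_square)
 with p2 show ?thesis by simp
qed

context hyper_curve
begin

lemma x_attained: "norm x > 1 / r^2 ==> \<exists>t\<in>dom ci. 1 / t^2 = x"
proof -
 assume x: "norm x > 1 / r^2"
 define t where "t = 1 / csqrt x"
 have x0: "x ~= 0" using x r by auto
 have t2: "1 / t^2 = x" by (simp add: t_def power_divide)
 hence "1 / norm t ^ 2 > 1 / r^2" using x by (metis norm_divide norm_one norm_power)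
 hence "norm t ^ 2 < r^2" using x0 r by (simp add: t_def field_simps)
 hence "norm t < r" using r by (simp add: power_less_imp_less_base)
 thus ?thesis using t2 x0 by (intro bexI[of _ t]) (auto simp: dom_ci t_def)
qed

text \<open>The expression pairs \<open>k\<close> with (x y, - x - y, 1), so it is nonzero exactly
  when \<open>k\<close> lies outside the plane spanned by (1, x, x^2) and (1, y, y^2). Pairs among x
  = B, B + 1, B + 2 exclude identical vanishing.\<close>

lemma generic_secant:
 fixes k :: "complex^3" assumes "k ~= 0"
 shows "\<exists>s\<in>dom ci. \<exists>t\<in>dom ci. 1 / s^2 ~= 1 / t^2 & k $ 1 * (1 / s^2 * (1 / t^2)) - k $ 2 * (1 / s^2 + 1 / t^2) + k $ 3 ~= 0"
proof -
 define B :: complex where "B = of_real (1 / r^2 + 1)"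
 have B: "norm (B + of_nat n) > 1 / r^2" for n
 proof -
  have "B + of_nat n = of_real (1 / r^2 + 1 + real n)" by (simp add: B_def)
  hence "norm (B + of_nat n) = 1 / r^2 + 1 + real n" by (simp only: norm_of_real) (simp add: add_nonneg_nonneg)
  thus ?thesis by simp
 qed
 have "\<exists>m n. m ~= n & k $ 1 * ((B + of_nat m) * (B + of_nat n)) - k $ 2 * ((B + of_nat m) + (B + of_nat n)) + k $ 3 ~= 0"
 proof (rule ccontr)
  assume neg: "~ ?thesis"
  have e: "k $ 1 * ((B + of_nat m) * (B + of_nat n)) - k $ 2 * ((B + of_nat m) + (B + of_nat n)) + k $ 3 = 0"
   if "m ~= n" for m n using neg that by blast
  have 1: "k $ 1 * (B * (B + 1)) - k $ 2 * (2 * B + 1) + k $ 3 = 0" using e[of 0 1] by (simp add: algebra_simps)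
  have 3: "k $ 1 * (B * (B + 2)) - k $ 2 * (2 * B + 2) + k $ 3 = 0" using e[of 0 2] by (simp add: algebra_simps)
  have "k $ 1 * B - k $ 2 = (k $ 1 * (B * (B + 2)) - k $ 2 * (2 * B + 2) + k $ 3) - (k $ 1 * (B * (B + 1)) - k $ 2 * (2 * B + 1) + k $ 3)"
   by (simp add: algebra_simps)
  hence 2: "k $ 1 * B = k $ 2" unfolding 1 3 by simp
  have "k $ 1 * ((B + 1) * (B + 2)) - k $ 2 * (2 * B + 3) + k $ 3 = 0" using e[of 1 2] by (simp add: algebra_simps)
  hence "k $ 1 = 0" using 1 unfolding 2[symmetric] by (simp add: algebra_simps)
  moreover from this have "k $ 2 = 0" using 2 by simp
  moreover from calculation have "k $ 3 = 0" using 1 by simp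
  ultimately have "k = 0" by (simp add: vec_eq_iff forall_3)
  thus False using assms by simp
 qed
 then obtain m n where mn: "m ~= n"
  "k $ 1 * ((B + of_nat m) * (B + of_nat n)) - k $ 2 * ((B + of_nat m) + (B + of_nat n)) + k $ 3 ~= 0" by blast
 obtain s t where "s \<in> dom ci" "1 / s^2 = B + of_nat m" "t \<in> dom ci" "1 / t^2 = B + of_nat n"
  using x_attained[OF B] by metis
 thus ?thesis using mn by (intro bexI[of _ s] bexI[of _ t]) auto
qed

lemma dird_vector: "dird (vector [1, x, y]) F u = partial 1 F u + partial 2 F u * x + partial 3 F u * y"
 by (simp add: dird_def sum_3)

lemma W2_A: "s \<in> ball 0 r ==> t \<in> ball 0 r ==> A s + A t \<in> W2_preimage \<mu>"
 by (intro W2I Gamma_A)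

lemma dird_A:
 assumes "entire F" "open O'" "t \<in> O'" "t \<in> dom ci" "!!s. s \<in> O' ==> s \<in> dom ci ==> F (A s + v) = 0"
 shows "partial 1 F (A t + v) + partial 2 F (A t + v) * (1 / t^2) + partial 3 F (A t + v) * (1 / t^2)^2 = 0"
proof -
 have t: "t \<in> ball 0 r" "t ~= 0" using assms(4) by (auto simp: dom_ci)
 have "DERIV (%s. F (A s + v)) t :> (\<Sum>i\<in>UNIV. partial i F (A t + v) * (if i = 1 then Q t * t^4 else if i = 2 then Q t * t^2 else Q t))"
  by (rule hol3_chain[OF assms(1)]) (use exhaust_3 dA[OF t(1)] in \<open>fastforce intro!: derivative_eq_intros\<close>)+
 moreover have "DERIV (%s. F (A s + v)) t :> 0"
  by (rule has_field_derivative_transform_within_open[OF DERIV_const open_Int[OF assms(2) is_chartD(1)[OF ci]]]) (use assms in auto)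
 ultimately have "(\<Sum>i\<in>UNIV. partial i F (A t + v) * (if i = 1 then Q t * t^4 else if i = 2 then Q t * t^2 else Q t)) = 0"
  using DERIV_unique by blast
 hence "Q t * t^4 * (partial 1 F (A t + v) + partial 2 F (A t + v) * (1 / t^2) + partial 3 F (A t + v) * (1 / t^2)^2) = 0"
  using t(2) by (simp add: sum_3 field_simps eval_nat_numeral)
 thus ?thesis using Q(2)[OF t(1)] t(2) by simp
qed

text \<open>At secant points whose tangent plane does not contain \<open>k\<close> the derivatives
  of \<open>F\<close> vanish in three independent directions. So all partial derivatives vanish on
  the same set, and the argument repeats for them. This yields the invertibility of the matrix
  inside theta.\<close>

lemma W2_no_line:
 assumes F: "entire F" and k: "k ~= 0"
  and z: "!!d s. d \<in> W2_preimage \<mu> ==> F (d + s *s k) = 0"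
 shows "F u = 0"
proof -
 obtain s0 t0 where st: "s0 \<in> dom ci" "t0 \<in> dom ci" "1 / s0^2 ~= 1 / t0^2"
  "k $ 1 * (1 / s0^2 * (1 / t0^2)) - k $ 2 * (1 / s0^2 + 1 / t0^2) + k $ 3 ~= 0" using generic_secant[OF k] by blast
 \<comment> \<open>Pairs of parameters whose secant point has a tangent plane not containing
   \<open>k\<close>. The set is open, which allows differentiation in each parameter
   separately.\<close>
 define X where "X = {p \<in> dom ci \<times> dom ci. 1 / fst p^2 ~= 1 / snd p^2 &
   k $ 1 * (1 / fst p^2 * (1 / snd p^2)) - k $ 2 * (1 / fst p^2 + 1 / snd p^2) + k $ 3 ~= 0}"
 have c: "continuous_on (dom ci \<times> dom ci) (%p. 1 / fst p^2 - 1 / snd p^2)"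
  "continuous_on (dom ci \<times> dom ci) (%p. k $ 1 * (1 / fst p^2 * (1 / snd p^2)) - k $ 2 * (1 / fst p^2 + 1 / snd p^2) + k $ 3)"
  by (auto intro!: continuous_intros simp: dom_ci)
 have S: "open (dom ci \<times> dom ci)" by (intro open_Times is_chartD(1)[OF ci])
 have "open {p \<in> dom ci \<times> dom ci. f p ~= 0}" if "continuous_on (dom ci \<times> dom ci) f" for f :: "complex \<times> complex => complex"
  using continuous_open_preimage[OF that S, of "- {0}"] by (simp add: Int_def vimage_def open_Compl)
 note o = open_Int[OF this[OF c(1)] this[OF c(2)]]
 have "open X" unfolding X_def by (rule subst[of _ _ "open", OF _ o]) auto
 define K where "K = {G. entire G & (\<forall>p\<in>X. \<forall>s. G (A (fst p) + A (snd p) + s *s k) = 0)}"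
 have "continuous_on UNIV (%t. (t, y))" "continuous_on UNIV (%t. (y, t))" for y :: complex
  by (intro continuous_intros)+
 from open_vimage[OF \<open>open X\<close> this(1)] open_vimage[OF \<open>open X\<close> this(2)]
 have sec: "open {t. (t, y) \<in> X}" "open {t. (y, t) \<in> X}" for y by (auto simp: vimage_def)
 have Kp: "partial i G \<in> K" if G: "G \<in> K" for G i
 proof -
  have hG: "entire G" using G by (simp add: K_def)
  have GX: "G (A s + A t + x *s k) = 0" if "(s, t) \<in> X" for s t x using G that by (fastforce simp: K_def)
  have "partial j G (A a + A b + s *s k) = 0" if p: "(a, b) \<in> X" for a b s j
  proof -
   define P where "P = (\<chi> j. partial j G (A a + A b + s *s k))"
   have ab: "a \<in> dom ci" "b \<in> dom ci" using p by (auto simp: X_def)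
   have "P $ 1 + P $ 2 * (1 / a^2) + P $ 3 * (1 / a^2)^2 = 0"
    using dird_A[OF hG sec(1)[of b] _ ab(1), of "A b + s *s k"] p GX by (simp add: P_def add.assoc)
   moreover have "P $ 1 + P $ 2 * (1 / b^2) + P $ 3 * (1 / b^2)^2 = 0"
    using dird_A[OF hG sec(2)[of a] _ ab(2), of "A a + s *s k"] p GX[of a] by (simp add: P_def add.left_commute add.assoc)
   ultimately have P: "P $ 1 = P $ 3 * (1 / a^2 * (1 / b^2))" "P $ 2 = - (P $ 3 * (1 / a^2 + 1 / b^2))"
    using gauss_map_kernel[of P "1 / a^2" "1 / b^2"] p by (auto simp: X_def)
   have "DERIV (%s. G (A a + A b + s *s k)) s :> 0"
    using G p by (auto simp: K_def)
   with line_dird[OF hG, of "A a + A b" s k] have "dird k G (A a + A b + s *s k) = 0" using DERIV_unique by blast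
   hence "P $ 1 * k $ 1 + P $ 2 * k $ 2 + P $ 3 * k $ 3 = 0" by (simp add: dird_def sum_3 P_def)
   hence "P $ 3 * (k $ 1 * (1 / a^2 * (1 / b^2)) - k $ 2 * (1 / a^2 + 1 / b^2) + k $ 3) = 0"
    unfolding P by (simp add: algebra_simps)
   hence "P $ 3 = 0" using p by (auto simp: X_def)
   hence "P $ j = 0" using P exhaust_3[of j] by auto
   thus ?thesis by (simp add: P_def)
  qed
  thus ?thesis using hol3_partial_hol3[OF hG] by (auto simp: K_def)
 qed
 have X0: "(s0, t0) \<in> X" using st by (simp add: X_def)
 show ?thesis
 proof (rule entire_zero_from_jets[OF F, of K "A s0 + A t0"])
  show "F \<in> K" using F z W2_A by (auto simp: K_def X_def dom_ci)
  show "G (A s0 + A t0) = 0" if "G \<in> K" for G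
   using that X0 by (auto simp: K_def dest!: bspec[OF _ X0] spec[of _ 0])
  show "dird e G \<in> K" if "!!i. partial i G \<in> K" for G e
   using that unfolding K_def dird_def by (auto intro!: hol3_sum hol3_mult)
 qed (rule Kp)
qed

end

section \<open>The sigma function\<close>

lemma partial_mult:
 assumes "hol3 f U" "hol3 g U" "u \<in> U"
 shows "partial i (%u. f u * g u) u = partial i f u * g u + f u * partial i g u"
 by (rule partial_eqI') (use DERIV_mult[OF hol3_partial[OF assms(1,3)] hol3_partial[OF assms(2,3)]] in \<open>simp add: mult_ac\<close>)

lemma partial_add:
 assumes "hol3 f U" "hol3 g U" "u \<in> U"
 shows "partial i (%u. f u + g u) u = partial i f u + partial i g u"
 by (rule partial_eqI') (rule DERIV_add[OF hol3_partial[OF assms(1,3)] hol3_partial[OF assms(2,3)]])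

lemma partial_uminus:
 assumes "hol3 f U" "u \<in> U"
 shows "partial i (%u. - f u) u = - partial i f u"
 by (rule partial_eqI') (rule DERIV_minus[OF hol3_partial[OF assms]])

lemma partial_divide:
 assumes "hol3 f U" "hol3 g U" "u \<in> U" "g u ~= 0"
 shows "partial i (%u. f u / g u) u = (partial i f u * g u - f u * partial i g u) / (g u * g u)"
 by (rule partial_eqI') (use DERIV_divide[OF hol3_partial[OF assms(1,3)] hol3_partial[OF assms(2,3)]] assms(4) in simp)

lemma partial_translate: "partial i (%u. F (u + v)) u = partial i F (u + v)"
 by (simp add: partial_def add_ac)

lemma partial_uminus_arg:
 assumes "hol3 F U" "- u \<in> U"
 shows "partial i (%u. F (- u)) u = - partial i F (- u)"
proof (rule partial_eqI')
 have *: "- (u + axis i t) = - u + axis i (- t)" for t by (simp add: vec_eq_iff axis_def)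
 have "DERIV (%t. F (- u + axis i (- t))) 0 :> partial i F (- u) * - 1"
  by (rule DERIV_chain'[of uminus _ _ _ "%t. F (- u + axis i t)"]) (use hol3_partial[OF assms] in \<open>auto intro!: derivative_eq_intros\<close>)
 thus "DERIV (%t. F (- (u + axis i t))) 0 :> - partial i F (- u)"
  unfolding * by simp
qed

text \<open>\<open>N\<close>, \<open>\<tau>\<close> and \<open>M\<close> stand for \<omega>'^-1,
  \<omega>'^-1 \<omega>'' and \<eta>' \<omega>'^-1. They enter as plain matrices, and what has to be
  known about them is extracted from \<open>theta_zero\<close>.\<close>

locale sigma_curve = hyper_curve +
 fixes \<sigma> :: "complex^3 => complex" and a b :: "complex^3" and N \<tau> M :: "complex^3^3" and c :: complex
 assumes half: "!!i. 2 * a $ i \<in> \<int>" "!!i. 2 * b $ i \<in> \<int>"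
  and theta_zero: "!!u. riemann_theta a b (N *v u) \<tau> = 0 \<longleftrightarrow> u \<in> W2_preimage \<mu>"
  and c: "c ~= 0"
  and sigma: "!!u. \<sigma> u = c * exp (1/2 * (\<Sum>i\<in>UNIV. u $ i * (M *v u) $ i)) * riemann_theta a b (N *v u) \<tau>"
begin

abbreviation "D \<equiv> W2_preimage \<mu>"
abbreviation "\<theta> z \<equiv> riemann_theta a b z \<tau>"
abbreviation "qf u \<equiv> 1/2 * (\<Sum>i\<in>UNIV. u $ i * (M *v u) $ i)"

lemma ex_off: "\<exists>u. u ~: D" using W2_not_UNIV by blast

lemma theta_quasi_space:
 "\<theta> \<in> quasi_space 1 (symmetrize \<tau>) (%j. expi2 (a $ j)) (%j. exp (- (of_real pi * \<i> * symmetrize \<tau> $ j $ j)) * expi2 (- (b $ j)))"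
proof -
 obtain u where "u ~: D" using ex_off by blast
 hence "\<theta> (N *v u) ~= 0" using theta_zero by blast
 thus ?thesis by (rule riemann_theta_quasi_space[OF half])
qed

lemma hol_theta: "entire \<theta>" using theta_quasi_space by (simp add: quasi_space_def)

lemma hol_theta_N: "hol3 (%u. \<theta> (N *v u)) UNIV"
 using hol3_affine[OF hol_theta, of UNIV N 0] by simp

lemma hol_qf: "entire qf"
 unfolding matrix_vector_mult_def by (intro hol3_mult hol3_const hol3_sum hol3_component) (auto intro!: hol3_mult hol3_sum hol3_component)

lemma hol_sigma: "entire \<sigma>"
 unfolding sigma by (intro hol3_mult hol3_const hol3_exp hol_qf hol_theta_N) auto

lemma sigma_zero: "\<sigma> u = 0 \<longleftrightarrow> u \<in> D" unfolding sigma using c theta_zero by simp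

lemma D_eq: "D = {u. \<sigma> u = 0}" using sigma_zero by blast

lemma closed_D: "closed D"
 unfolding D_eq using hol3_continuous[OF hol_sigma] by (intro closed_Collect_eq) auto

lemma hol_off: "entire F ==> hol3 F (- D)"
 by (rule hol3_subset) (use closed_D in auto)

lemma dense_off: "open O' ==> O' ~= {} ==> \<exists>x\<in>O'. x ~: D"
 using dense_nonzero[OF hol_sigma] ex_off sigma_zero by blast

lemma eq_off_dense:
 assumes "entire F" "entire G" "!!u. u ~: D ==> F u = G u"
 shows "F u = G u"
 by (rule continuous_eq_on_dense[of UNIV F G D]) (use assms hol3_continuous dense_off in auto)

lemma sigma_minus: "\<sigma> (- u) = expi2 (- (2 * (\<Sum>i\<in>UNIV. a $ i * b $ i))) * \<sigma> u"
proof -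
 have "M *v (- u) = - (M *v u)" "N *v (- u) = - (N *v u)" by (simp_all add: matrix_vector_mult_def vec_eq_iff sum_negf)
 thus ?thesis unfolding sigma by (simp add: riemann_theta_minus[OF half])
qed

lemma D_minus: "- u \<in> D \<longleftrightarrow> u \<in> D"
 unfolding D_eq by (simp add: sigma_minus)

lemma theta_preimage_eq: "theta_preimage \<mu> = D"
 unfolding theta_preimage_def using D_minus by (auto simp: image_iff)

text \<open>A kernel vector would make the zero set invariant along a line, and theta would vanish
  identically.\<close>

lemma N_ker: "N *v k = 0 ==> k = 0"
proof (rule ccontr)
 assume k: "N *v k = 0" "k ~= 0"
 have "N *v (d + s *s k) = N *v d" for d s
  using k(1) by (simp add: matrix_vector_right_distrib vector_scalar_commute)
 hence "\<theta> (N *v u) = 0" for u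
  using W2_no_line[OF hol_theta_N k(2)] theta_zero by simp
 thus False using theta_zero ex_off by blast
qed

definition "Ni = matrix_inv N"

lemma N_Ni [simp]: "N *v (Ni *v z) = z" and Ni_N [simp]: "Ni *v (N *v z) = z"
proof -
 have "invertible N" unfolding invertible_left_inverse matrix_left_invertible_ker using N_ker by blast
 hence "N ** Ni = mat 1 & Ni ** N = mat 1" unfolding Ni_def matrix_inv_def invertible_def by (rule someI_ex)
 thus "N *v (Ni *v z) = z" "Ni *v (N *v z) = z"
  by (auto simp: matrix_vector_mul_assoc)
qed

text \<open>Stated through \<open>\<sigma>\<close> alone, between the two lattices: the generators
  of the theta lattice are quasi-periods, and the quasi-periods are shown to be exactly
  \<open>\<Lambda>\<close>.\<close>

definition quasi_period :: "complex^3 => bool" where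
 "quasi_period l \<longleftrightarrow> (\<exists>m w. \<forall>u. \<sigma> (u + l) = exp (m + (\<Sum>i\<in>UNIV. w $ i * u $ i)) * \<sigma> u)"

lemma quasi_period_D: "quasi_period l ==> u + l \<in> D \<longleftrightarrow> u \<in> D"
 unfolding D_eq by (auto simp: quasi_period_def)

lemma quasi_period_add: "quasi_period l ==> quasi_period l' ==> quasi_period (l + l')"
proof -
 assume "quasi_period l" "quasi_period l'"
 then obtain m w m' w' where 1: "!!u. \<sigma> (u + l) = exp (m + (\<Sum>i\<in>UNIV. w $ i * u $ i)) * \<sigma> u"
  and 2: "!!u. \<sigma> (u + l') = exp (m' + (\<Sum>i\<in>UNIV. w' $ i * u $ i)) * \<sigma> u"
  by (auto simp: quasi_period_def)
 have "\<sigma> (u + (l + l')) = exp ((m + m' + (\<Sum>i\<in>UNIV. w' $ i * l $ i)) + (\<Sum>i\<in>UNIV. (w + w') $ i * u $ i)) * \<sigma> u" for u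
 proof -
  have "\<sigma> (u + (l + l')) = exp (m' + (\<Sum>i\<in>UNIV. w' $ i * (u + l) $ i)) * exp (m + (\<Sum>i\<in>UNIV. w $ i * u $ i)) * \<sigma> u"
   using 2[of "u + l"] 1[of u] by (simp add: add.assoc)
  thus ?thesis by (simp only: exp_add[symmetric]) (simp add: sum.distrib distrib_left distrib_right add_ac)
 qed
 thus ?thesis unfolding quasi_period_def by blast
qed

lemma quasi_period_minus: "quasi_period l ==> quasi_period (- l)"
proof -
 assume "quasi_period l"
 then obtain m w where 1: "!!u. \<sigma> (u + l) = exp (m + (\<Sum>i\<in>UNIV. w $ i * u $ i)) * \<sigma> u" by (auto simp: quasi_period_def)
 have "\<sigma> (u + - l) = exp ((- m + (\<Sum>i\<in>UNIV. w $ i * l $ i)) + (\<Sum>i\<in>UNIV. (- w) $ i * u $ i)) * \<sigma> u" for u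
 proof -
  have "exp (- m + (\<Sum>i\<in>UNIV. w $ i * l $ i) + (\<Sum>i\<in>UNIV. (- w) $ i * u $ i)) * exp (m + (\<Sum>i\<in>UNIV. w $ i * (u - l) $ i)) = 1"
   by (simp add: exp_add[symmetric] sum_negf sum_subtractf right_diff_distrib)
  thus ?thesis using 1[of "u - l"] by (simp add: mult.assoc[symmetric])
 qed
 thus ?thesis unfolding quasi_period_def by blast
qed

lemma quasi_period_0: "quasi_period 0"
 unfolding quasi_period_def by (intro exI[of _ 0] exI[of _ "0 :: complex^3"]) simp

lemma qf_add: "qf (u + l) = qf u + (qf l + (\<Sum>i\<in>UNIV. (\<Sum>k\<in>UNIV. (M $ i $ k + M $ k $ i) / 2 * l $ k) * u $ i))"
 by (simp add: matrix_vector_mult_def sum_3) (simp add: field_simps)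

lemma quasi_period_theta:
 assumes "!!z. \<theta> (z + N *v l) = exp (m + (\<Sum>i\<in>UNIV. w $ i * z $ i)) * \<theta> z"
 shows "quasi_period l"
proof -
 have Nu: "(\<Sum>i\<in>UNIV. w $ i * (N *v u) $ i) = (\<Sum>i\<in>UNIV. (\<Sum>k\<in>UNIV. w $ k * N $ k $ i) * u $ i)" for u :: "complex^3"
  by (simp add: matrix_vector_mult_def sum_3 algebra_simps)
 have "\<sigma> (u + l) = exp ((m + qf l) + (\<Sum>i\<in>UNIV. (\<chi> i. (\<Sum>k\<in>UNIV. (M $ i $ k + M $ k $ i) / 2 * l $ k) + (\<Sum>k\<in>UNIV. w $ k * N $ k $ i)) $ i * u $ i)) * \<sigma> u" for u
 proof -
  have "\<sigma> (u + l) = c * (exp (qf (u + l)) * exp (m + (\<Sum>i\<in>UNIV. w $ i * (N *v u) $ i))) * \<theta> (N *v u)"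
   unfolding sigma matrix_vector_right_distrib assms by simp
  also have "exp (qf (u + l)) * exp (m + (\<Sum>i\<in>UNIV. w $ i * (N *v u) $ i)) = exp ((m + qf l) + (\<Sum>i\<in>UNIV. (\<chi> i. (\<Sum>k\<in>UNIV. (M $ i $ k + M $ k $ i) / 2 * l $ k) + (\<Sum>k\<in>UNIV. w $ k * N $ k $ i)) $ i * u $ i)) * exp (qf u)"
   unfolding qf_add Nu by (simp add: exp_add[symmetric] sum.distrib distrib_right add_ac)
  finally show ?thesis unfolding sigma by simp
 qed
 thus ?thesis unfolding quasi_period_def by blast
qed

lemma quasi_period_axis: "quasi_period (Ni *v axis j 1)"
proof (rule quasi_period_theta[where w=0])
 fix z
 show "\<theta> (z + N *v (Ni *v axis j 1)) = exp (2 * of_real pi * \<i> * a $ j + (\<Sum>i\<in>UNIV. 0 $ i * z $ i)) * \<theta> z"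
  using theta_quasi_space by (simp add: quasi_space_def expi2_def)
qed

lemma quasi_period_column: "quasi_period (Ni *v column j (symmetrize \<tau>))"
proof (rule quasi_period_theta[where w="axis j (- (2 * of_real pi * \<i>))"])
 fix z
 have "(\<Sum>i\<in>UNIV. axis j (- (2 * of_real pi * \<i>)) $ i * z $ i) = - (2 * of_real pi * \<i> * z $ j)"
  using exhaust_3[of j] by (auto simp: sum_3 axis_def)
 hence "exp ((- (of_real pi * \<i> * symmetrize \<tau> $ j $ j) - 2 * of_real pi * \<i> * b $ j) + (\<Sum>i\<in>UNIV. axis j (- (2 * of_real pi * \<i>)) $ i * z $ i)) =
  exp (- (of_real pi * \<i> * symmetrize \<tau> $ j $ j)) * expi2 (- (b $ j)) * expi2 (- z $ j)"
  by (simp add: expi2_def exp_diff exp_minus exp_add field_simps)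
 thus "\<theta> (z + N *v (Ni *v column j (symmetrize \<tau>))) =
  exp ((- (of_real pi * \<i> * symmetrize \<tau> $ j $ j) - 2 * of_real pi * \<i> * b $ j) + (\<Sum>i\<in>UNIV. axis j (- (2 * of_real pi * \<i>)) $ i * z $ i)) * \<theta> z"
  using theta_quasi_space by (simp add: quasi_space_def)
qed

text \<open>The quotient of \<open>G\<close> by the m-th power of \<open>\<sigma>\<close> is
  invariant under all quasi-periods, with denominators cleared to cover the zeros of
  \<open>\<sigma>\<close>.\<close>

definition level :: "nat => (complex^3 => complex) set" where
 "level m = {G. entire G & (\<forall>l u. quasi_period l --> G (u + l) * \<sigma> u ^ m = G u * \<sigma> (u + l) ^ m)}"

lemma levelI:
 assumes "entire G" "!!u. u ~: D ==> G u = F u * \<sigma> u ^ m"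
  and "!!l u. quasi_period l ==> u ~: D ==> F (u + l) = F u" and m: "m > 0"
 shows "G \<in> level m"
proof -
 have "G (u + l) * \<sigma> u ^ m = G u * \<sigma> (u + l) ^ m" if l: "quasi_period l" for l u
 proof (cases "u \<in> D")
  case True
  hence "\<sigma> u = 0" "\<sigma> (u + l) = 0" using quasi_period_D[OF l, of u] sigma_zero by blast+
  thus ?thesis using m by (simp add: power_0_left)
 next
  case False
  thus ?thesis using quasi_period_D[OF l, of u] assms(2,3) l by simp
 qed
 thus ?thesis using assms(1) by (simp add: level_def)
qed

text \<open>Removing the Gaussian factor and passing to the coordinate z = N u turns an element of
  the level into a theta function of order \<open>m\<close>.\<close>

lemma level_dependent:
 assumes f: "!!i. i \<in> I ==> f i \<in> level m" and m: "m > 0" and I: "finite I" "card I > m ^ 3"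
 shows "\<exists>x. (\<exists>i\<in>I. x i ~= 0) & (\<forall>u. (\<Sum>i\<in>I. x i * f i u) = 0)"
proof -
 define L where "L = (%G z. G (Ni *v z) * exp (- (of_nat m * qf (Ni *v z))))"
 define k where "k = (%j. expi2 (a $ j))"
 define l where "l = (%j. exp (- (of_real pi * \<i> * symmetrize \<tau> $ j $ j)) * expi2 (- (b $ j)))"
 have th: "\<theta> (z + axis j 1) = k j * \<theta> z" "\<theta> (z + column j (symmetrize \<tau>)) = l j * expi2 (- z $ j) * \<theta> z" for z j
  using theta_quasi_space by (auto simp: quasi_space_def k_def l_def)
 have hL: "entire (L G)" if "G \<in> level m" for G
 proof -
  have "hol3 (%z. F (Ni *v z)) UNIV" if "entire F" for F
   using hol3_affine[OF that, of UNIV Ni 0] by simp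
  note * = this[of G] this[OF hol_qf]
  have "entire G" using that by (simp add: level_def)
  from hol3_mult[OF *(1)[OF this] hol3_exp[OF hol3_uminus[OF hol3_mult[OF hol3_const[OF open_UNIV] *(2)]]]]
  show ?thesis unfolding L_def .
 qed
 \<comment> \<open>Where theta is nonzero the relation that defines \<open>level\<close> can be
   divided by it; both sides are continuous, so the result extends by density.\<close>
 have shift: "L G (z + p) = e z ^ m * L G z"
  if G: "G \<in> level m" and p: "quasi_period (Ni *v p)" "!!z. \<theta> (z + p) = e z * \<theta> z" and e: "entire e" for G p e z
 proof (rule continuous_eq_on_dense[of UNIV _ _ "{z. \<theta> z = 0}"])
  show "continuous_on UNIV (%z. L G (z + p))" "continuous_on UNIV (%z. e z ^ m * L G z)"
   by (intro hol3_continuous hol3_translate[OF hL[OF G]] hol3_mult hol3_power e hL[OF G]; simp)+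
  obtain u where "\<theta> (N *v u) ~= 0" using theta_zero ex_off by blast
  thus "\<exists>x\<in>O'. x ~: {z. \<theta> z = 0}" if "open O'" "O' ~= {}" for O' by (rule dense_nonzero[OF hol_theta _ that])
  fix z assume z: "z ~: {z. \<theta> z = 0}"
  have s: "\<sigma> (Ni *v z) = c * exp (qf (Ni *v z)) * \<theta> z" for z unfolding sigma by simp
  define u v where "u = Ni *v z" and "v = Ni *v p"
  have uv: "Ni *v (z + p) = u + v" by (simp add: u_def v_def matrix_vector_right_distrib)
  have "G (u + v) * \<sigma> u ^ m = G u * \<sigma> (u + v) ^ m"
   using G p(1) by (auto simp: level_def v_def)
  also have "\<sigma> u = c * exp (qf u) * \<theta> z" using s[of z] by (simp add: u_def)
  also have "\<sigma> (u + v) = c * exp (qf (u + v)) * (e z * \<theta> z)" using s[of "z + p"] unfolding uv p(2) .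
  finally have "G (u + v) * exp (of_nat m * qf u) = G u * exp (of_nat m * qf (u + v)) * e z ^ m"
   using c z by (simp only: power_mult_distrib exp_of_nat_mult) simp
  moreover define E1 E2 where "E1 = exp (of_nat m * qf u)" and "E2 = exp (of_nat m * qf (u + v))"
  moreover from this have "E1 ~= 0" "E2 ~= 0" by simp_all
  ultimately have "G (u + v) * inverse E2 = e z ^ m * (G u * inverse E1)" by (simp add: field_simps)
  thus "L G (z + p) = e z ^ m * L G z"
   unfolding L_def uv exp_minus E1_def E2_def u_def .
 qed simp_all
 have LG: "L G \<in> quasi_space m (symmetrize \<tau>) (%j. k j ^ m) (%j. l j ^ m)" if G: "G \<in> level m" for G
 proof -
  have "expi2 (- z $ j) ^ m = expi2 (- (of_nat m * z $ j))" for z :: "complex^3" and j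
   by (simp add: expi2_def exp_of_nat_mult[symmetric] algebra_simps)
  hence "L G (z + column j (symmetrize \<tau>)) = l j ^ m * expi2 (- (of_nat m * z $ j)) * L G z" for z j
   using shift[OF G quasi_period_column th(2)] hol3_mult[OF hol3_const hol3_expi2[OF hol3_uminus[OF hol3_component]]]
   by (simp add: power_mult_distrib)
  moreover have "L G (z + axis j 1) = k j ^ m * L G z" for z j
   using shift[OF G quasi_period_axis th(1)] by simp
  ultimately show ?thesis using hL[OF G] by (simp add: quasi_space_def)
 qed
 have "\<exists>x. (\<exists>i\<in>I. x i ~= 0) & (\<forall>z. (\<Sum>i\<in>I. x i * L (f i) z) = 0)"
  by (rule quasi_space_dependent[OF LG[OF f] _ _ m I]) (auto simp: k_def l_def)
 then obtain x where x: "\<exists>i\<in>I. x i ~= 0" "!!z. (\<Sum>i\<in>I. x i * L (f i) z) = 0" by blast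
 have "(\<Sum>i\<in>I. x i * f i u) = 0" for u
 proof -
  have "(\<Sum>i\<in>I. x i * f i u) * exp (- (of_nat m * qf u)) = 0"
   using x(2)[of "N *v u"] by (simp only: L_def Ni_N) (simp add: sum_distrib_right mult.assoc)
  thus ?thesis by simp
 qed
 thus ?thesis using x(1) by blast
qed

end

section \<open>Logarithmic derivatives of sigma and first-order vanishing\<close>

text \<open>The numerator of minus the second logarithmic derivative at a zero of order n + 1. When
  g(p) is nonzero its order is exactly 2 n, with leading coefficient (n + 1) g(p)^2.\<close>

lemma log_derivative_factor:
 fixes g :: "complex => complex"
 assumes g: "g holomorphic_on ball p R" and h: "!!z. z \<in> ball p R ==> h z = (z - p) ^ Suc n * g z"
  and h1: "!!z. z \<in> ball p R ==> DERIV h z :> h1 z"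
  and h2: "!!z. z \<in> ball p R ==> DERIV h1 z :> h2 z" and z: "z \<in> ball p R"
 shows "h1 z ^ 2 - h z * h2 z = (z - p) ^ (2 * n) * (of_nat (Suc n) * g z ^ 2 + (z - p)^2 * (deriv g z ^ 2 - g z * deriv (deriv g) z))"
proof -
 have dg: "DERIV g z :> deriv g z" "DERIV (deriv g) z :> deriv (deriv g) z"
  if "z \<in> ball p R" for z
  using that by (auto intro: holomorphic_derivI[OF g] holomorphic_derivI[OF holomorphic_deriv[OF g]])
 have e1: "h1 z = of_nat (Suc n) * (z - p) ^ n * g z + (z - p) ^ Suc n * deriv g z" if z: "z \<in> ball p R" for z
 proof -
  have "DERIV (%z. (z - p) ^ Suc n * g z) z :> of_nat (Suc n) * (z - p) ^ n * g z + (z - p) ^ Suc n * deriv g z"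
   by (auto intro!: derivative_eq_intros dg[OF z] simp del: power_Suc simp: algebra_simps)
  hence "DERIV h z :> of_nat (Suc n) * (z - p) ^ n * g z + (z - p) ^ Suc n * deriv g z"
   by (rule has_field_derivative_transform_within_open[OF _ open_ball z]) (simp add: h)
  thus ?thesis using h1[OF z] DERIV_unique by blast
 qed
 have "((%z. of_nat (Suc n) * (z - p) ^ n * g z + (z - p) ^ Suc n * deriv g z) has_field_derivative
   of_nat (Suc n) * (of_nat n * (z - p) ^ (n - 1)) * g z + 2 * of_nat (Suc n) * (z - p) ^ n * deriv g z + (z - p) ^ Suc n * deriv (deriv g) z) (at z)"
  by (auto intro!: derivative_eq_intros dg[OF z] simp del: power_Suc simp: algebra_simps)
 hence "(h1 has_field_derivative
   of_nat (Suc n) * (of_nat n * (z - p) ^ (n - 1)) * g z + 2 * of_nat (Suc n) * (z - p) ^ n * deriv g z + (z - p) ^ Suc n * deriv (deriv g) z) (at z)"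
  by (rule has_field_derivative_transform_within_open[OF _ open_ball z]) (simp add: e1)
 hence e2: "h2 z = of_nat (Suc n) * (of_nat n * (z - p) ^ (n - 1)) * g z + 2 * of_nat (Suc n) * (z - p) ^ n * deriv g z + (z - p) ^ Suc n * deriv (deriv g) z"
  using h2[OF z] DERIV_unique by blast
 define w where "w = z - p"
 show ?thesis
 proof (cases n)
  case 0
  thus ?thesis unfolding e1[OF z] e2 h[OF z] w_def[symmetric] by (simp add: power2_eq_square algebra_simps)
 next
  case (Suc k)
  have "w ^ (2 * n) = w ^ k * w ^ k * (w * w)" by (simp add: Suc mult_2[of k] power_add)
  moreover have "w ^ n = w * w ^ k" "w ^ Suc n = w * w * w ^ k" "n - 1 = k" by (simp_all add: Suc)
  moreover define N :: complex where "N = of_nat n"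
  ultimately show ?thesis unfolding e1[OF z] e2 h[OF z] w_def[symmetric]
   by (simp only: of_nat_Suc N_def[symmetric]) (simp add: power2_eq_square algebra_simps)
 qed
qed

lemma dird_add_left: "dird (x + y) F u = dird x F u + dird y F u"
 by (simp add: dird_def distrib_left sum.distrib)

lemma dird_scale_left: "dird (s *s x) F u = s * dird x F u"
 by (simp add: dird_def sum_distrib_left mult_ac)

lemma partial_dird:
 assumes "hol3 F U" "u \<in> U"
 shows "partial i (dird e F) u = (\<Sum>j\<in>UNIV. partial i (partial j F) u * e $ j)"
proof (rule partial_eqI')
 show "DERIV (%t. dird e F (u + axis i t)) 0 :> (\<Sum>j\<in>UNIV. partial i (partial j F) u * e $ j)"
  unfolding dird_def by (intro DERIV_sum DERIV_cmult_right hol3_partial[OF hol3_partial_hol3[OF assms(1)] assms(2)])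
qed

lemma dird_dird:
 assumes "hol3 F U" "u \<in> U"
 shows "dird e' (dird e F) u = (\<Sum>i\<in>UNIV. \<Sum>j\<in>UNIV. partial i (partial j F) u * e $ j * e' $ i)"
 by (simp add: dird_def[of e'] partial_dird[OF assms] sum_distrib_right)

lemma dird_dird_expand:
 assumes F: "hol3 F U" "u \<in> U"
 shows "dird (x + s *s y) (dird (x + s *s y) F) u =
  dird x (dird x F) u + s * (dird x (dird y F) u + dird y (dird x F) u) + s^2 * dird y (dird y F) u"
 unfolding dird_dird[OF F] by (simp add: sum_3) (simp add: algebra_simps power2_eq_square)

context sigma_curve
begin

lemma hol_partials: "entire (partial i \<sigma>)" "hol3 (partial i (partial j \<sigma>)) UNIV"
 by (intro hol3_partial_hol3 hol_sigma)+

lemma hol_log: "hol3 (%v. partial j \<sigma> v / \<sigma> v) (- D)"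
 by (intro hol3_divide hol_off hol_partials hol_sigma) (auto simp: sigma_zero)

lemma hol_foldr_partial: "hol3 f (- D) ==> hol3 (foldr partial is f) (- D)"
 by (induction "is") (auto intro: hol3_partial_hol3)

lemma wp_Cons:
 assumes "js ~= []" "u ~: D"
 shows "wp \<sigma> (i # js) u = partial i (wp \<sigma> js) u"
proof -
 have "partial i (wp \<sigma> js) u = - partial i (foldr partial (butlast js) (%v. partial (last js) \<sigma> v / \<sigma> v)) u"
  unfolding wp_def[abs_def] by (rule partial_uminus[OF hol_foldr_partial[OF hol_log]]) (use assms in auto)
 thus ?thesis using assms by (simp add: wp_def)
qed

lemma partial_quasi_period:
 assumes "!!u. \<sigma> (u + l) = exp (m + (\<Sum>i\<in>UNIV. w $ i * u $ i)) * \<sigma> u"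
 shows "partial i \<sigma> (u + l) = exp (m + (\<Sum>i\<in>UNIV. w $ i * u $ i)) * (partial i \<sigma> u + w $ i * \<sigma> u)"
proof -
 have e: "hol3 (%u. exp (m + (\<Sum>i\<in>UNIV. w $ i * u $ i))) UNIV"
  by (intro hol3_exp hol3_add hol3_sum hol3_mult hol3_const hol3_component) auto
 have "partial i (%u. exp (m + (\<Sum>i\<in>UNIV. w $ i * u $ i))) u = w $ i * exp (m + (\<Sum>i\<in>UNIV. w $ i * u $ i))"
 proof (rule partial_eqI')
  have "(%t. \<Sum>j\<in>UNIV. w $ j * (u + axis i t) $ j) = (%t. (\<Sum>j\<in>UNIV. w $ j * u $ j) + w $ i * t)"
   using exhaust_3[of i] by (auto simp: fun_eq_iff sum_3 axis_def algebra_simps)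
  hence *: "(\<Sum>j\<in>UNIV. w $ j * (u + axis i t) $ j) = (\<Sum>j\<in>UNIV. w $ j * u $ j) + w $ i * t" for t by metis
  show "DERIV (%t. exp (m + (\<Sum>j\<in>UNIV. w $ j * (u + axis i t) $ j))) 0 :> w $ i * exp (m + (\<Sum>i\<in>UNIV. w $ i * u $ i))"
   unfolding * by (auto intro!: derivative_eq_intros)
 qed
 with partial_mult[OF e hol_sigma, of u i] show ?thesis
  using partial_translate[of i \<sigma> l u] by (simp add: assms algebra_simps)
qed

lemma log_quasi_period:
 assumes "quasi_period l"
 shows "\<exists>k. \<forall>u. u ~: D --> partial j \<sigma> (u + l) / \<sigma> (u + l) = partial j \<sigma> u / \<sigma> u + k"
proof -
 obtain m w where 1: "!!u. \<sigma> (u + l) = exp (m + (\<Sum>i\<in>UNIV. w $ i * u $ i)) * \<sigma> u" using assms by (auto simp: quasi_period_def)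
 show ?thesis
  by (rule exI[of _ "w $ j"]) (auto simp: partial_quasi_period[OF 1] 1 add_divide_distrib distrib_left sigma_zero)
qed

lemma partial_periodic:
 assumes l: "quasi_period l" and F: "hol3 F (- D)" "!!u. u ~: D ==> F (u + l) = F u + k" and u: "u ~: D"
 shows "partial i F (u + l) = partial i F u"
proof -
 have "partial i F (u + l) = partial i (%u. F (u + l)) u" by (simp add: partial_translate)
 also have "\<dots> = partial i (%u. F u + k) u"
  by (rule partial_cong_open[of "- D"]) (use closed_D u F(2) in auto)
 also have "\<dots> = partial i F u" using partial_add[OF F(1) hol3_const, of u i k] closed_D u by auto
 finally show ?thesis .
qed

text \<open>A quasi-period changes the logarithmic derivative by a constant, which the next
  derivative removes; hence at least two indices.\<close>

lemma wp_periodic: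
 assumes l: "quasi_period l" and u: "u ~: D"
 shows "wp \<sigma> (i # j # js) (u + l) = wp \<sigma> (i # j # js) u"
proof -
 have "foldr partial (i # is) (%v. partial j \<sigma> v / \<sigma> v) (u + l) = foldr partial (i # is) (%v. partial j \<sigma> v / \<sigma> v) u" if "u ~: D" for u j i "is"
  using that
 proof (induction "is" arbitrary: i u)
  case Nil
  obtain k where "!!u. u ~: D ==> partial j \<sigma> (u + l) / \<sigma> (u + l) = partial j \<sigma> u / \<sigma> u + k" using log_quasi_period[OF l] by blast
  from partial_periodic[OF l hol_log this Nil] show ?case by simp
 next
  case (Cons i' "is")
  have "partial i (foldr partial (i' # is) (%v. partial j \<sigma> v / \<sigma> v)) (u + l) = partial i (foldr partial (i' # is) (%v. partial j \<sigma> v / \<sigma> v)) u"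
   by (rule partial_periodic[OF l hol_foldr_partial[OF hol_log] _ Cons.prems, of _ _ 0]) (use Cons.IH in simp)
  thus ?case by simp
 qed
 from this[OF u, of i "butlast (j # js)"] show ?thesis by (simp add: wp_def)
qed

lemma wp2: "u ~: D ==> wp \<sigma> [i, j] u = (partial i \<sigma> u * partial j \<sigma> u - \<sigma> u * partial i (partial j \<sigma>) u) / \<sigma> u ^ 2"
proof -
 assume u: "u ~: D"
 have "partial i (%v. partial j \<sigma> v / \<sigma> v) u = (partial i (partial j \<sigma>) u * \<sigma> u - partial j \<sigma> u * partial i \<sigma> u) / (\<sigma> u * \<sigma> u)"
  by (rule partial_divide[OF hol_partials(1) hol_sigma]) (use u sigma_zero in auto)
 thus ?thesis using u sigma_zero by (simp add: wp_def power2_eq_square diff_divide_distrib)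
qed

text \<open>The numerator over \<open>\<sigma>^2\<close> of minus the second derivative of log
  \<open>\<sigma>\<close> in the direction \<open>e\<close>.\<close>

definition nn :: "complex^3 => complex^3 => complex" where
 "nn e u = dird e \<sigma> u ^ 2 - \<sigma> u * dird e (dird e \<sigma>) u"

lemma hol_nn: "entire (nn e)"
 unfolding nn_def[abs_def] by (intro hol3_diff hol3_mult hol3_power hol3_dird hol_sigma)

lemma nn_wp: "u ~: D ==> nn e u / \<sigma> u ^ 2 = (\<Sum>i\<in>UNIV. \<Sum>j\<in>UNIV. wp \<sigma> [i, j] u * e $ i * e $ j)"
 unfolding nn_def dird_dird[OF hol_sigma UNIV_I]
 by (simp add: wp2 dird_def sum_3 sigma_zero field_simps power2_eq_square)

text \<open>\<open>nn\<close> is quadratic in the direction, so an arbitrary direction is reached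
  from three others, which can be chosen to lead out of D.\<close>

lemma nn_second_difference: "nn (x + s *s y) u + nn (x + (- s) *s y) u - 2 * nn x u = 2 * s^2 * nn y u"
proof -
 have d: "dird (x + s *s y) \<sigma> u = dird x \<sigma> u + s * dird y \<sigma> u" for s by (simp add: dird_add_left dird_scale_left)
 show ?thesis unfolding nn_def dird_dird_expand[OF hol_sigma UNIV_I] d by (simp add: algebra_simps power2_eq_square)
qed

lemma line_sigma: "DERIV (%t. \<sigma> (u + t *s e)) t :> dird e \<sigma> (u + t *s e)"
 "DERIV (%t. dird e \<sigma> (u + t *s e)) t :> dird e (dird e \<sigma>) (u + t *s e)"
 by (intro line_dird[OF hol_sigma] line_dird[OF hol3_dird[OF hol_sigma]] UNIV_I)+

lemma line_factor:
 assumes nz: "\<sigma> (u + t1 *s e) ~= 0" and z: "\<sigma> (u + p *s e) = 0"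
 obtains g R n where "R > 0" "g holomorphic_on ball p R" "!!t. t \<in> ball p R ==> \<sigma> (u + t *s e) = (t - p) ^ Suc n * g t & g t ~= 0"
  "!!t. t \<in> ball p R ==> nn e (u + t *s e) = (t - p) ^ (2 * n) * (of_nat (Suc n) * g t ^ 2 + (t - p)^2 * (deriv g t ^ 2 - g t * deriv (deriv g) t))"
proof -
 have h: "(%t. \<sigma> (u + t *s e)) holomorphic_on UNIV" by (rule line_holomorphic[OF hol_sigma]) auto
 have nc: "~ (%t. \<sigma> (u + t *s e)) constant_on UNIV" using nz z unfolding constant_on_def by (metis UNIV_I)
 obtain g R n where g: "0 < n" "0 < R" "ball p R <= UNIV" "g holomorphic_on ball p R"
  "!!w. w \<in> ball p R ==> \<sigma> (u + w *s e) = (w - p) ^ n * g w" "!!w. w \<in> ball p R ==> g w ~= 0"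
  using holomorphic_factor_zero_nonconstant[OF h open_UNIV connected_UNIV UNIV_I z nc] by metis
 obtain n' where n': "n = Suc n'" using g(1) gr0_implies_Suc by blast
 show thesis
 proof (rule that[OF g(2,4)])
  show "\<sigma> (u + t *s e) = (t - p) ^ Suc n' * g t & g t ~= 0" if "t \<in> ball p R" for t using g(5,6)[OF that] n' by simp
  show "nn e (u + t *s e) = (t - p) ^ (2 * n') * (of_nat (Suc n') * g t ^ 2 + (t - p)^2 * (deriv g t ^ 2 - g t * deriv (deriv g) t))"
   if "t \<in> ball p R" for t
   unfolding nn_def by (rule log_derivative_factor[OF g(4) _ line_sigma that]) (use g(5) n' in simp)
 qed
qed

text \<open>With vanishing gradient along D, a zero of \<open>\<sigma>\<close> on a line not
  contained in D has order n + 1 >= 2, while \<open>nn\<close> vanishes there to order at least 2 n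
  >= n + 1; so the quotient has limits along lines. By \<open>nz\<close> the line through
  \<open>u0\<close> itself leaves D.\<close>

lemma nn_extension_direction:
 assumes crit: "!!u i. u \<in> D ==> partial i \<sigma> u = 0" and nz: "u0 + e ~: D"
 shows "\<exists>h>0. \<exists>G. hol3 G (ball u0 h) & (\<forall>u\<in>ball u0 h. u ~: D --> G u = nn e u / \<sigma> u)"
proof -
 have "(%t. \<sigma> (u0 + t *s e)) holomorphic_on UNIV" by (rule line_holomorphic[OF hol_sigma]) auto
 from non_zero_neighbour_alt[OF this open_UNIV connected_UNIV UNIV_I, of 1 0]
 have "\<forall>\<^sub>F t in at 0. \<sigma> (u0 + t *s e) ~= 0" using nz by (auto simp: sigma_zero elim: eventually_mono)
 then obtain d where d: "d > 0" "!!t. t ~= 0 ==> norm t < d ==> \<sigma> (u0 + t *s e) ~= 0" unfolding eventually_at by auto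
 have lim: "\<exists>L. ((%t. nn e (u + t *s e) / \<sigma> (u + t *s e)) \<longlongrightarrow> L) (at p)" if p: "\<sigma> (u + p *s e) = 0" for u p
 proof (cases "\<exists>t1. \<sigma> (u + t1 *s e) ~= 0")
  case False
  \<comment> \<open>On a line inside D the quotient is identically 0, being a division by
    zero.\<close>
  thus ?thesis by (intro exI[of _ 0]) simp
 next
  case True
  then obtain t1 where t1: "\<sigma> (u + t1 *s e) ~= 0" by blast
  obtain g R n where g: "R > 0" "g holomorphic_on ball p R" "!!t. t \<in> ball p R ==> \<sigma> (u + t *s e) = (t - p) ^ Suc n * g t & g t ~= 0"
   "!!t. t \<in> ball p R ==> nn e (u + t *s e) = (t - p) ^ (2 * n) * (of_nat (Suc n) * g t ^ 2 + (t - p)^2 * (deriv g t ^ 2 - g t * deriv (deriv g) t))"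
   using line_factor[OF t1 p] by metis
  have "n ~= 0"
  proof
   assume n: "n = 0"
   have pb: "p \<in> ball p R" using g(1) by simp
   have "DERIV (%t. (t - p) * g t) p :> g p"
    using holomorphic_derivI[OF g(2) open_ball pb] by (auto intro!: derivative_eq_intros)
   hence "DERIV (%t. \<sigma> (u + t *s e)) p :> g p"
    by (rule has_field_derivative_transform_within_open[OF _ open_ball pb]) (use g(3) n in simp)
   hence "g p = dird e \<sigma> (u + p *s e)" using line_sigma(1) DERIV_unique by blast
   thus False using crit[of "u + p *s e"] p g(3)[OF pb] by (simp add: dird_def sigma_zero)
  qed
  then obtain k where k: "n = Suc k" using not0_implies_Suc by blast
  define K where "K = (%t. (t - p) ^ k * (of_nat (Suc n) * g t ^ 2 + (t - p)^2 * (deriv g t ^ 2 - g t * deriv (deriv g) t)) / g t)"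
  have "continuous_on (ball p R) K" unfolding K_def
   by (intro continuous_intros holomorphic_on_imp_continuous_on holomorphic_deriv g(2)) (use g(3) in auto)
  hence "(K \<longlongrightarrow> K p) (at p)" using g(1) by (simp add: continuous_on_eq_continuous_at isCont_def)
  hence "((%t. nn e (u + t *s e) / \<sigma> (u + t *s e)) \<longlongrightarrow> K p) (at p)"
  proof (rule Lim_transform_within_open[OF _ open_ball[of p R]])
   fix t assume t: "t \<in> ball p R" "t ~= p"
   have "(t - p) ^ (2 * n) = (t - p) ^ Suc n * (t - p) ^ k" by (simp add: k mult_2[of k] flip: power_add)
   thus "K t = nn e (u + t *s e) / \<sigma> (u + t *s e)" using t g(3)[OF t(1)] g(4)[OF t(1)] by (simp add: K_def)
  qed (use g(1) in simp)
  thus ?thesis by blast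
 qed
 have "hol3 (%u. nn e u / \<sigma> u) {u \<in> UNIV. \<sigma> u ~= 0}"
 proof -
  have "{u \<in> UNIV. \<sigma> u ~= 0} = - D" by (auto simp: sigma_zero)
  thus ?thesis using hol3_divide[OF hol_off[OF hol_nn] hol_off[OF hol_sigma]] by (simp add: sigma_zero)
 qed
 moreover have "\<exists>h>0. \<forall>M. open M & M ~= {} & M <= ball u0 h --> (\<exists>u\<in>M. \<forall>p. norm p < d / 2 & \<sigma> (u + p *s e) = 0 -->
   (\<exists>L. ((%t. nn e (u + t *s e) / \<sigma> (u + t *s e)) \<longlongrightarrow> L) (at p)))"
 proof (intro exI[of _ 1] conjI allI impI)
  fix M assume "open M & M ~= {} & M <= ball u0 1"
  then obtain u where "u \<in> M" by blast
  thus "\<exists>u\<in>M. \<forall>p. norm p < d / 2 & \<sigma> (u + p *s e) = 0 --> (\<exists>L. ((%t. nn e (u + t *s e) / \<sigma> (u + t *s e)) \<longlongrightarrow> L) (at p))"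
   by (rule bexI[rotated]) (intro allI impI lim, blast)
 qed simp
 moreover have "\<sigma> (u0 + t *s e) ~= 0" if "norm t = d / 2" for t
  using d(1) that by (intro d(2)) auto
 ultimately have "\<exists>h>0. \<exists>G. ball u0 h <= UNIV & hol3 G (ball u0 h) & (\<forall>u\<in>ball u0 h. \<sigma> u ~= 0 --> G u = nn e u / \<sigma> u)"
  using d(1) by (intro general_extension[OF hol_sigma, of _ "d/2" "d/2 + 1"]) auto
 thus ?thesis by (simp add: sigma_zero)
qed

lemma nn_extension:
 assumes crit: "!!u i. u \<in> D ==> partial i \<sigma> u = 0"
 shows "\<exists>G. entire G & (\<forall>u. u ~: D --> G u = nn e u / \<sigma> u)"
proof (rule extension_glue[OF hol3_divide[OF hol_off[OF hol_nn] hol_off[OF hol_sigma]] dense_off])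
 fix u0 assume "u0 \<in> D"
 obtain v where v: "v ~: D" using ex_off by blast
 \<comment> \<open>The direction from \<open>u0\<close> to a point outside D. For small s the
   directions x + s e and x - s e lead out of D as well, and polarization gives the direction
   \<open>e\<close> itself.\<close>
 define x where "x = v - u0"
 have "open ((%s. v + s *s e) -` (- D))"
  by (intro open_vimage continuous_intros) (use closed_D in auto)
 moreover have "0 \<in> (%s. v + s *s e) -` (- D)" using v by simp
 ultimately obtain d where d: "d > 0" "ball 0 d <= (%s. v + s *s e) -` (- D)" using open_contains_ball by blast
 define s where "s = complex_of_real (d / 2)"
 have s: "s ~= 0" "u0 + x ~: D" "u0 + (x + s *s e) ~: D" "u0 + (x + (- s) *s e) ~: D"
 proof -
  have "s \<in> ball 0 d" "- s \<in> ball 0 d" using d(1) by (auto simp: s_def)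
  moreover have "v + t *s e ~: D" if "t \<in> ball 0 d" for t using d(2) that by blast
  ultimately have "v + s *s e ~: D" "v + (- s) *s e ~: D" by blast+
  thus "s ~= 0" "u0 + x ~: D" "u0 + (x + s *s e) ~: D" "u0 + (x + (- s) *s e) ~: D" using v d(1) by (auto simp: s_def x_def)
 qed
 obtain d1 G1 where 1: "d1 > 0" "hol3 G1 (ball u0 d1)" "!!u. u \<in> ball u0 d1 ==> u ~: D ==> G1 u = nn x u / \<sigma> u"
  using nn_extension_direction[OF crit s(2)] by blast
 obtain d2 G2 where 2: "d2 > 0" "hol3 G2 (ball u0 d2)" "!!u. u \<in> ball u0 d2 ==> u ~: D ==> G2 u = nn (x + s *s e) u / \<sigma> u"
  using nn_extension_direction[OF crit s(3)] by blast
 obtain d3 G3 where 3: "d3 > 0" "hol3 G3 (ball u0 d3)" "!!u. u \<in> ball u0 d3 ==> u ~: D ==> G3 u = nn (x + (- s) *s e) u / \<sigma> u"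
  using nn_extension_direction[OF crit s(4)] by blast
 define h where "h = min d1 (min d2 d3)"
 define G where "G = (%u. (G2 u + G3 u - 2 * G1 u) * (1 / (2 * s^2)))"
 have sub: "ball u0 h <= ball u0 d1" "ball u0 h <= ball u0 d2" "ball u0 h <= ball u0 d3" by (auto simp: h_def)
 have "hol3 G (ball u0 h)" unfolding G_def
  by (intro hol3_mult hol3_diff hol3_add hol3_const hol3_subset[OF 1(2) sub(1)] hol3_subset[OF 2(2) sub(2)] hol3_subset[OF 3(2) sub(3)] open_ball)
 moreover have "G u = nn e u / \<sigma> u" if u: "u \<in> ball u0 h - D" for u
 proof -
  have "G2 u + G3 u - 2 * G1 u = (nn (x + s *s e) u + nn (x + (- s) *s e) u - 2 * nn x u) / \<sigma> u"
   using 1(3)[of u] 2(3)[of u] 3(3)[of u] u sub by (simp add: subset_iff add_divide_distrib diff_divide_distrib)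
  thus ?thesis unfolding nn_second_difference G_def using s(1) by simp
 qed
 ultimately show "\<exists>h>0. \<exists>G. hol3 G (ball u0 h) & (\<forall>u\<in>ball u0 h - D. G u = nn e u / \<sigma> u)"
  using 1(1) 2(1) 3(1) by (intro exI[of _ h] conjI exI[of _ G]) (auto simp: h_def)
qed (auto simp: sigma_zero)

lemma zero_in_D: "0 \<in> D"
 using W2I[OF Gamma_A Gamma_A, of 0 0] r A0 by simp

text \<open>If \<open>\<sigma>\<close> vanished to second order along its zero set, the functions \<open>\<wp>\<^sub>i\<^sub>j \<sigma>\<close> would be entire,
 hence multiples of \<open>\<sigma>\<close>, and \<open>\<wp>\<^sub>i\<^sub>j\<close> would be constant, although it has a pole at the origin.\<close>

lemma ex_regular: "\<exists>d\<in>D. \<exists>i. partial i \<sigma> d ~= 0"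
proof (rule ccontr)
 assume "~ (\<exists>d\<in>D. \<exists>i. partial i \<sigma> d ~= 0)"
 hence crit: "!!u i. u \<in> D ==> partial i \<sigma> u = 0" by blast
 obtain e where e: "e ~: D" using ex_off by blast
 obtain G where G: "entire G" "!!u. u ~: D ==> G u = nn e u / \<sigma> u" using nn_extension[OF crit] by blast
 have GL: "G \<in> level 1"
 proof (rule levelI[OF G(1)])
  show "G u = (nn e u / \<sigma> u ^ 2) * \<sigma> u ^ 1" if "u ~: D" for u
   using G(2)[OF that] that sigma_zero by (simp add: power2_eq_square)
  show "nn e (u + l) / \<sigma> (u + l) ^ 2 = nn e u / \<sigma> u ^ 2" if "quasi_period l" "u ~: D" for l u
   using nn_wp[of u e] nn_wp[of "u + l" e] quasi_period_D[OF that(1), of u] wp_periodic[OF that] that(2) by simp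
 qed simp
 have SL: "\<sigma> \<in> level 1" by (rule levelI[OF hol_sigma, of "%_. 1"]) auto
 \<comment> \<open>Level one has dimension at most 1, so \<open>\<sigma>\<close> and
   \<open>G\<close> are proportional.\<close>
 define f where "f = (%i::nat. if i = 0 then \<sigma> else G)"
 have "\<exists>x. (\<exists>i\<in>{0, 1}. x i ~= 0) & (\<forall>u. (\<Sum>i\<in>{0, 1}. x i * f i u) = 0)"
  by (rule level_dependent[of _ _ 1]) (use GL SL in \<open>auto simp: f_def\<close>)
 then obtain x where x: "\<exists>i\<in>{0, 1}. x i ~= 0" "!!u. (\<Sum>i\<in>{0, 1}. x i * f i u) = 0" by blast
 from x(1) have x01: "x 0 ~= 0 | x 1 ~= 0" by blast
 have x2: "x 0 * \<sigma> u + x 1 * G u = 0" for u using x(2)[of u] by (simp add: f_def)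
 have "\<sigma> e ~= 0" using e sigma_zero by blast
 hence "x 0 = 0" if "x 1 = 0" using x2[of e] unfolding that by simp
 hence x1: "x 1 ~= 0" using x01 by blast
 define k where "k = - x 0 / x 1"
 have nk: "nn e u = k * \<sigma> u ^ 2" if "u ~: D" for u
 proof -
  have "G u = k * \<sigma> u" using x2[of u] x1 by (simp add: k_def field_simps eq_neg_iff_add_eq_0)
  thus ?thesis using G(2)[OF that] that sigma_zero by (simp add: field_simps power2_eq_square)
 qed
 have e1: "\<sigma> (0 + 1 *s e) ~= 0" "\<sigma> (0 + 0 *s e) = 0" using e zero_in_D by (auto simp: sigma_zero)
 obtain g R n where g: "R > 0" "g holomorphic_on ball 0 R" "!!t. t \<in> ball 0 R ==> \<sigma> (0 + t *s e) = (t - 0) ^ Suc n * g t & g t ~= 0"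
   "!!t. t \<in> ball 0 R ==> nn e (0 + t *s e) = (t - 0) ^ (2 * n) * (of_nat (Suc n) * g t ^ 2 + (t - 0)^2 * (deriv g t ^ 2 - g t * deriv (deriv g) t))"
  using line_factor[OF e1] by metis
 \<comment> \<open>\<open>K 0\<close> is the leading coefficient (n + 1) g(0)^2, as the other terms
   carry t^2; proportionality to \<open>\<sigma>^2\<close> would force it to be 0.\<close>
 define K where "K = (%t. of_nat (Suc n) * g t ^ 2 + t^2 * (deriv g t ^ 2 - g t * deriv (deriv g) t) - k * t^2 * g t ^ 2)"
 have "continuous_on (ball 0 R) K" unfolding K_def
  by (intro continuous_intros holomorphic_on_imp_continuous_on holomorphic_deriv g(2)) auto
 hence "(K \<longlongrightarrow> K 0) (at 0)" using g(1) by (simp add: continuous_on_eq_continuous_at isCont_def)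
 moreover have "(K \<longlongrightarrow> 0) (at 0)"
 proof (rule Lim_transform_within_open[OF tendsto_const open_ball[of 0 R]])
  fix t assume t: "t \<in> ball 0 R" "t ~= (0::complex)"
  have "\<sigma> (t *s e) ~= 0" using g(3)[OF t(1)] t(2) by simp
  hence "nn e (t *s e) = k * (t ^ Suc n * g t)^2" using nk[of "t *s e"] sigma_zero g(3)[OF t(1)] by simp
  moreover have "(t ^ Suc n * g t)^2 = t ^ (2 * n) * (t^2 * g t ^ 2)" by (simp add: power2_eq_square mult_2[of n] power_add)
  moreover have "nn e (t *s e) = t ^ (2 * n) * (K t + k * t^2 * g t ^ 2)" using g(4)[OF t(1)] by (simp add: K_def)
  ultimately have "t ^ (2 * n) * K t = 0" by (simp add: distrib_left)
  thus "0 = K t" using t(2) by simp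
 qed (use g(1) in simp)
 ultimately have "K 0 = 0" using LIM_unique by blast
 thus False using g(3)[of 0] g(1) by (simp add: K_def del: of_nat_Suc)
qed

text \<open>If some zero had a neighbourhood without regular zeros, the partial derivatives would
  vanish on an open part of D and, by continuation, on all of it.\<close>

lemma regular_dense: "D <= closure {v. regular_zero \<sigma> v}"
proof
 fix d assume d: "d \<in> D"
 show "d \<in> closure {v. regular_zero \<sigma> v}"
 proof (rule ccontr)
  assume n: "d ~: closure {v. regular_zero \<sigma> v}"
  have "partial i \<sigma> u = 0" if "u \<in> D" for i u
  proof (rule W2_continuation[OF hol_partials(1) _ _ d _ that])
   show "open (- closure {v. regular_zero \<sigma> v})" "d \<in> - closure {v. regular_zero \<sigma> v}" using n by auto
   fix v assume v: "v \<in> D" "v \<in> - closure {v. regular_zero \<sigma> v}"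
   hence "~ regular_zero \<sigma> v" using closure_subset[of "{v. regular_zero \<sigma> v}"] by auto
   thus "partial i \<sigma> v = 0" using v(1) by (auto simp: regular_zero_def sigma_zero)
  qed
  thus False using ex_regular by blast
 qed
qed

lemma sigma_divides:
 assumes "entire F" "!!u. u \<in> D ==> F u = 0"
 shows "\<exists>G. entire G & (\<forall>u. F u = G u * \<sigma> u)"
proof -
 obtain w where "w ~: D" using ex_off by blast
 hence "\<sigma> w ~= 0" using sigma_zero by blast
 from division_entire[OF hol_sigma assms(1) regular_dense[unfolded D_eq] _ this] show ?thesis
  using assms(2) sigma_zero by blast
qed

end

section \<open>Generic secants; quasi-periods and periods coincide\<close>

lemma fsigma_ball: "fsigma (ball (z :: complex) r)"
proof -
 have "s \<in> (\<Union>n. cball z (r - inverse (real (Suc n))))" if "s \<in> ball z r" for s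
  using reals_Archimedean[of "r - dist z s"] that by (auto simp: less_eq_real_def algebra_simps)
 moreover have "r - inverse (real (Suc n)) < r" for n by simp
 hence "(\<Union>n. cball z (r - inverse (real (Suc n)))) <= ball z r"
  by (intro UN_least subsetI) (metis le_less_trans mem_ball mem_cball)
 ultimately have "ball z r = (\<Union>n. cball z (r - inverse (real (Suc n))))" by blast
 thus ?thesis unfolding fsigma_Union_compact by (intro exI[of _ "%n. cball z (r - inverse (real (Suc n)))"]) auto
qed

context hyper_curve
begin

lemma W2_from_A_local:
 assumes F: "entire F" and O1: "open O1" "s0 \<in> O1" "s0 \<in> dom ci" and O2: "open O2" "t0 \<in> O2" "t0 \<in> dom ci"
  and z: "!!s t. s \<in> O1 ==> s \<in> dom ci ==> t \<in> O2 ==> t \<in> dom ci ==> F (A s + A t) = 0" and d: "d \<in> W2_preimage \<mu>"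
 shows "F d = 0"
proof -
 obtain v w where vw: "v \<in> \<Gamma>" "w \<in> \<Gamma>" "d = v + w" using d by (auto simp: W2_eq)
 have tr: "hol3 (%x. F (x + y)) UNIV" for y by (rule hol3_translate[OF F]) auto
 have 1: "F (v + A t) = 0" if t: "t \<in> O2" "t \<in> dom ci" for t
  by (rule A_continuation[OF tr O1 lattice_0 _ vw(1)]) (use z t in auto)
 have "F (w + v) = 0"
  by (rule A_continuation[OF tr O2 lattice_0 _ vw(2)]) (use 1 in \<open>simp add: add.commute\<close>)
 thus ?thesis by (simp add: vw add.commute)
qed

lemma W2_from_A:
 assumes F: "entire F" and z: "!!s t. s \<in> dom ci ==> t \<in> dom ci ==> s^2 ~= t^2 ==> F (A s + A t) = 0"
  and d: "d \<in> W2_preimage \<mu>"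
 shows "F d = 0"
\<comment> \<open>The radius 3 r / 8 separates r / 4 from r / 2, so s and t have different absolute
  values and hence different squares.\<close>
proof (rule W2_from_A_local[OF F, of "{s. 3 * r / 8 < norm s}" "of_real (r/2)" "{s. norm s < 3 * r / 8}" "of_real (r/4)"])
 fix s t :: complex assume st: "s \<in> {s. 3 * r / 8 < norm s}" "s \<in> dom ci" "t \<in> {s. norm s < 3 * r / 8}" "t \<in> dom ci"
 have "s^2 ~= t^2"
 proof
  assume "s^2 = t^2"
  hence "norm s = norm t" by (auto simp: power2_eq_iff)
  thus False using st by simp
 qed
 thus "F (A s + A t) = 0" using z st by blast
qed (use r d in \<open>auto simp: dom_ci intro!: open_Collect_less continuous_intros\<close>)

text \<open>For fixed nonzero n and fixed k the equation n A(s) = k has countably many solutions,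
  because the third component of \<open>A\<close> has the nonvanishing derivative \<open>Q\<close>;
  a nonempty open set is uncountable.\<close>

lemma generic_avoid:
 assumes K: "countable K" and S: "open S" "S ~= {}" "S <= ball 0 r"
 shows "\<exists>s\<in>S. \<forall>n::int. n ~= 0 --> of_int n *s A s ~: K"
proof (rule ccontr)
 assume neg: "~ ?thesis"
 have sub: "S <= (\<Union>n\<in>UNIV - {0}. \<Union>k\<in>K. {s \<in> ball 0 r. of_int n *s A s = k})"
 proof
  fix s assume s: "s \<in> S"
  then obtain n :: int where "n ~= 0" "of_int n *s A s \<in> K" using neg by blast
  moreover have "s \<in> ball 0 r" using s S(3) by blast
  ultimately show "s \<in> (\<Union>n\<in>UNIV - {0}. \<Union>k\<in>K. {s \<in> ball 0 r. of_int n *s A s = k})" by blast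
 qed
 have "countable {s \<in> ball 0 r. of_int n *s A s = k}" if "n ~= 0" for n :: int and k
 proof -
  define f where "f = (%s. A s $ 3 - k $ 3 / of_int n)"
  have d: "DERIV f s :> Q s" if "s \<in> ball 0 r" for s
   unfolding f_def using dA(3)[OF that] by (auto intro!: derivative_eq_intros)
  have "f holomorphic_on ball 0 r" unfolding holomorphic_on_open[OF open_ball] using d by blast
  moreover have "~ f constant_on ball 0 r"
  proof
   assume "f constant_on ball 0 r"
   then obtain y where y: "!!s. s \<in> ball 0 r ==> f s = y" unfolding constant_on_def by blast
   have "DERIV f 0 :> 0"
    by (rule has_field_derivative_transform_within_open[OF DERIV_const open_ball[of 0 r]]) (use y r in auto)
   thus False using d[of 0] Q(2)[of 0] r DERIV_unique by fastforce
  qed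
  ultimately have "countable {s \<in> ball 0 r. f s = 0}"
   by (intro holomorphic_countable_zeros) (auto intro: fsigma_ball)
  moreover have "{s \<in> ball 0 r. of_int n *s A s = k} <= {s \<in> ball 0 r. f s = 0}" using that by (auto simp: f_def)
  ultimately show ?thesis using countable_subset by blast
 qed
 hence "countable (\<Union>n\<in>UNIV - {0::int}. \<Union>k\<in>K. {s \<in> ball 0 r. of_int n *s A s = k})"
  using K by (intro countable_UN) auto
 hence "countable S" using countable_subset[OF sub] by blast
 moreover obtain s e where "e > 0" "ball s e <= S" using S(1,2) open_contains_ball by blast
 ultimately show False using uncountable_ball[of e s] countable_subset by blast
qed

text \<open>Two points of the curve with the same x are equal or exchanged by the hyperelliptic
  involution, which near infinity is t to -t; and \<open>A\<close> is odd.\<close>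

lemma AV_of_x:
 assumes v: "v \<in> AV q" and s: "s \<in> dom ci" and x: "fst q = 1 / s^2"
 shows "v - A s \<in> \<Lambda> | v + A s \<in> \<Lambda>"
proof -
 have "norm s ^ 2 < r^2" "s ~= 0" using s by (auto simp: dom_ci power_strict_mono)
 hence "norm (fst q) > 1 / r^2" using r by (simp add: x norm_divide norm_power divide_strict_left_mono)
 hence q: "q \<in> patch ci" using AV_affine[OF v] by (simp add: patch_ci)
 define z where "z = coo ci q"
 have z: "z \<in> dom ci" "par ci z = q" using coo_patch[OF ci q] by (auto simp: z_def)
 have "z^2 = s^2" using coo_ci[OF q] x by (simp add: z_def)
 hence "z = s | z = - s" by (simp add: power2_eq_iff)
 moreover have "v - A z \<in> \<Lambda>" using AV_lattice_diff[OF _ v, of "A z"] AV_pt[OF z(1)] z(2) by simp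
 moreover have "A (- s) = - A s" by (rule A_odd) (use s in \<open>simp add: dom_ci\<close>)
 ultimately show ?thesis by auto
qed

end

context sigma_curve
begin

lemma quasi_period_int: "quasi_period l ==> quasi_period (of_int k *s l)"
proof -
 assume l: "quasi_period l"
 have "quasi_period (of_nat n *s l)" for n
  by (induction n) (auto simp: quasi_period_0 vector_sadd_rdistrib intro: quasi_period_add l)
 from this[of "nat k"] quasi_period_minus[OF this[of "nat (- k)"]] show ?thesis
  by (cases "k >= 0") (auto simp: of_nat_nat vector_smult_lneg)
qed

text \<open>Translation by a period preserves D, so the ratio of the translate of
  \<open>\<sigma>\<close> to \<open>\<sigma>\<close> is entire. Without its Gaussian factor it is a
  theta function of order zero whose multipliers along the columns are given by p = N l; an integer
  mode with these multipliers puts p into the lattice of theta.\<close>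

lemma lattice_quasi_period: assumes l: "l \<in> \<Lambda>" shows "quasi_period l"
proof -
 have "hol3 (%u. \<sigma> (u + l)) UNIV" by (rule hol3_translate[OF hol_sigma]) auto
 moreover have "\<sigma> (u + l) = 0" if "u \<in> D" for u using W2_lattice[OF that l] sigma_zero by blast
 ultimately obtain G where G: "entire G" "!!u. \<sigma> (u + l) = G u * \<sigma> u"
  using sigma_divides[of "%u. \<sigma> (u + l)"] by blast
 define p where "p = N *v l"
 define H where "H = (%z. G (Ni *v z) * exp (qf (Ni *v z) - qf (Ni *v z + l)))"
 have H: "\<theta> (z + p) = H z * \<theta> z" for z
 proof -
  have "N *v (Ni *v z + l) = z + p" by (simp add: matrix_vector_right_distrib p_def)
  hence "c * exp (qf (Ni *v z + l)) * \<theta> (z + p) = G (Ni *v z) * (c * exp (qf (Ni *v z)) * \<theta> z)"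
   using G(2)[of "Ni *v z"] unfolding sigma by simp
  moreover define E1 E2 where "E1 = exp (qf (Ni *v z + l))" and "E2 = exp (qf (Ni *v z))"
  ultimately have "c * E1 * \<theta> (z + p) = G (Ni *v z) * (c * E2 * \<theta> z)" "E1 ~= 0" by simp_all
  hence "\<theta> (z + p) = G (Ni *v z) * (E2 / E1) * \<theta> z" using c by (simp add: field_simps)
  thus ?thesis unfolding H_def exp_diff E1_def E2_def .
 qed
 have hH: "entire H"
 proof -
  have "hol3 (%z. F (Ni *v z + w)) UNIV" if "entire F" for F w
   by (rule hol3_affine[OF that]) auto
  from hol3_mult[OF this[OF G(1), of 0] hol3_exp[OF hol3_diff[OF this[OF hol_qf, of 0] this[OF hol_qf, of l]]]]
  show ?thesis unfolding H_def by simp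
 qed
 define be where "be = (%j. exp (- (of_real pi * \<i> * symmetrize \<tau> $ j $ j)) * expi2 (- (b $ j)))"
 have th: "\<theta> (z + axis j 1) = expi2 (a $ j) * \<theta> z" "\<theta> (z + column j (symmetrize \<tau>)) = be j * expi2 (- z $ j) * \<theta> z" for z j
  using theta_quasi_space by (auto simp: quasi_space_def be_def)
 have per: "H (z + q) = k * H z" if e: "!!z. e z ~= 0" "!!z. \<theta> (z + q) = e z * \<theta> z" "!!z. e (z + p) = k * e z" for q e k z
 proof (rule continuous_eq_on_dense[of UNIV _ _ "{z. \<theta> z = 0}"])
  show "continuous_on UNIV (%z. H (z + q))" "continuous_on UNIV (%z. k * H z)"
   by (intro hol3_continuous hol3_translate[OF hH] hol3_mult hH; simp)+
  obtain u where "\<theta> (N *v u) ~= 0" using theta_zero ex_off by blast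
  thus "\<exists>x\<in>O'. x ~: {z. \<theta> z = 0}" if "open O'" "O' ~= {}" for O' by (rule dense_nonzero[OF hol_theta _ that])
  fix z assume "z ~: {z. \<theta> z = 0}"
  hence z: "\<theta> z ~= 0" by simp
  have "H (z + q) * (e z * \<theta> z) = \<theta> ((z + p) + q)" using H[of "z + q"] e(2)[of z] by (simp add: add_ac)
  also have "\<dots> = k * e z * (H z * \<theta> z)" unfolding e(2) e(3) H by simp
  finally show "H (z + q) = k * H z" using z e(1)[of z] by simp
 qed simp_all
 have "H (z + axis j 1) = 1 * H z" for z j by (rule per[OF _ th(1)]) auto
 moreover have "H (z + column j (symmetrize \<tau>)) = expi2 (- (p $ j)) * H z" for z j
  by (rule per[OF _ th(2)]) (auto simp: be_def expi2_add[symmetric] expi2_diff[symmetric] algebra_simps)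
 ultimately have HQ: "H \<in> quasi_space 0 (symmetrize \<tau>) (%_. 1) (%j. expi2 (- (p $ j)))"
  using hH by (simp add: quasi_space_def)
 obtain u where "u + l ~: D" using ex_off by (metis diff_add_cancel)
 hence "\<theta> (N *v u + p) ~= 0" using theta_zero[of "u + l"] by (simp add: p_def matrix_vector_right_distrib)
 hence "H (N *v u) ~= 0" using H by simp
 from quasi_space_0_mode[OF HQ _ this] obtain n where n: "int_vec n" "!!j. expi2 (- (p $ j)) * fmode n (column j (symmetrize \<tau>)) = 1" by auto
 have pj: "p $ j + (\<Sum>k\<in>UNIV. n $ k * symmetrize \<tau> $ k $ j) \<in> \<int>" for j
 proof -
  have "expi2 (- (p $ j + (\<Sum>k\<in>UNIV. n $ k * symmetrize \<tau> $ k $ j))) = 1"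
   using n(2)[of j] by (simp add: fmode_def column_def expi2_add[symmetric])
  thus ?thesis by (simp only: expi2_eq_1_iff minus_in_Ints_iff)
 qed
 have "\<forall>j. \<exists>k::int. n $ j = of_int k" using n(1) by (auto simp: int_vec_def elim: Ints_cases)
 then obtain n' where n': "!!j. n $ j = of_int (n' j)" by metis
 have "\<forall>j. \<exists>k::int. p $ j + (\<Sum>k\<in>UNIV. n $ k * symmetrize \<tau> $ k $ j) = of_int k" using pj by (auto elim: Ints_cases)
 then obtain m' where m': "!!j. p $ j + (\<Sum>k\<in>UNIV. n $ k * symmetrize \<tau> $ k $ j) = of_int (m' j)" by metis
 \<comment> \<open>The relation just found, solved for \<open>p\<close>: coefficients
   \<open>m'\<close> on the unit vectors and \<open>- n'\<close> on the columns, by symmetry of the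
   matrix.\<close>
 have "p = (\<Sum>j\<in>UNIV. of_int (m' j) *s axis j 1 + of_int (- n' j) *s column j (symmetrize \<tau>))"
 proof (rule vec_eq_iff[THEN iffD2], rule allI)
  fix j show "p $ j = (\<Sum>j\<in>UNIV. of_int (m' j) *s axis j 1 + of_int (- n' j) *s column j (symmetrize \<tau>)) $ j"
   using m'[of j] exhaust_3[of j] symmetrize_sym[of \<tau>]
   by (auto simp: sum_3 n' column_def axis_def algebra_simps)
 qed
 hence "Ni *v p = (\<Sum>j\<in>UNIV. of_int (m' j) *s (Ni *v axis j 1) + of_int (- n' j) *s (Ni *v column j (symmetrize \<tau>)))"
  by (simp only: matrix_vector_right_distrib sum_3 vector_scalar_commute)
 moreover have "quasi_period \<dots>"
  unfolding sum_3 by (intro quasi_period_add quasi_period_int quasi_period_axis quasi_period_column)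
 ultimately show ?thesis by (simp add: p_def)
qed

lemma secant_partials:
 assumes "s \<in> dom ci" "t \<in> dom ci" "s^2 ~= t^2"
 shows "partial 1 \<sigma> (A s + A t) = partial 3 \<sigma> (A s + A t) * (1 / s^2 * (1 / t^2))"
  "partial 2 \<sigma> (A s + A t) = - (partial 3 \<sigma> (A s + A t) * (1 / s^2 + 1 / t^2))"
proof -
 have z: "\<sigma> d = 0" if "d \<in> D" for d using that sigma_zero by blast
 define p where "p = (\<chi> i. partial i \<sigma> (A s + A t))"
 have st: "s \<in> ball 0 r" "t \<in> ball 0 r" using assms by (auto simp: dom_ci)
 have "p $ 1 + p $ 2 * (1 / s^2) + p $ 3 * (1 / s^2)^2 = 0"
  using dird_W2[OF hol_sigma z Gamma_A[OF st(2)] tang_pt[OF assms(1)]] by (simp add: dird_vector p_def power_divide flip: power_mult)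
 moreover have "p $ 1 + p $ 2 * (1 / t^2) + p $ 3 * (1 / t^2)^2 = 0"
  using dird_W2[OF hol_sigma z Gamma_A[OF st(1)] tang_pt[OF assms(2)]] by (simp add: dird_vector p_def power_divide add.commute flip: power_mult)
 moreover have "1 / s^2 ~= 1 / t^2" using assms(3) by simp
 ultimately show "partial 1 \<sigma> (A s + A t) = partial 3 \<sigma> (A s + A t) * (1 / s^2 * (1 / t^2))"
  "partial 2 \<sigma> (A s + A t) = - (partial 3 \<sigma> (A s + A t) * (1 / s^2 + 1 / t^2))"
  using gauss_map_kernel[of p "1 / s^2" "1 / t^2"] by (auto simp: p_def)
qed

lemma ex_secant: "\<exists>s\<in>dom ci. \<exists>t\<in>dom ci. s^2 ~= t^2 & partial 3 \<sigma> (A s + A t) ~= 0"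
proof (rule ccontr)
 assume n: "~ ?thesis"
 have "partial i \<sigma> d = 0" if "d \<in> D" for d i
 proof (rule W2_from_A[OF hol_partials(1) _ that])
  fix s t assume st: "s \<in> dom ci" "t \<in> dom ci" "s^2 ~= t^2"
  hence "partial 3 \<sigma> (A s + A t) = 0" using n by blast
  thus "partial i \<sigma> (A s + A t) = 0" using secant_partials[OF st] exhaust_3[of i] by auto
 qed
 thus False using ex_regular by blast
qed

text \<open>The theorem of the square for the Gauss map: a quasi-period \<open>l\<close> maps the secant point
 \<open>A s + A t\<close> to a point of \<open>D\<close> with the same tangent plane, and this plane determines the
 pair of points of the curve up to the involution.\<close>

lemma quasi_period_lattice: assumes l: "quasi_period l" shows "l \<in> \<Lambda>"
proof -
 obtain s0 t0 where st0: "s0 \<in> dom ci" "t0 \<in> dom ci" "s0^2 ~= t0^2" "partial 3 \<sigma> (A s0 + A t0) ~= 0" using ex_secant by blast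
 define X where "X = {p \<in> dom ci \<times> dom ci. (fst p ^ 2 - snd p ^ 2) * partial 3 \<sigma> (A (fst p) + A (snd p)) ~= 0}"
 have dc: "dom ci <= ball 0 r" by (auto simp: dom_ci)
 have cA: "continuous_on (dom ci \<times> dom ci) (%p. A (fst p) + A (snd p))"
  by (intro continuous_intros continuous_on_compose2[OF continuous_A]) (use dc in auto)
 have "continuous_on (dom ci \<times> dom ci) (%p. (fst p ^ 2 - snd p ^ 2) * partial 3 \<sigma> (A (fst p) + A (snd p)))"
  by (intro continuous_intros continuous_on_compose2[OF hol3_continuous[OF hol_partials(1)] cA]) auto
 from continuous_open_preimage[OF this open_Times[OF is_chartD(1)[OF ci] is_chartD(1)[OF ci]], of "- {0}"]
 have "open X" by (simp add: X_def Int_def vimage_def open_Compl)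
 moreover have "(s0, t0) \<in> X" using st0 by (simp add: X_def)
 ultimately obtain S T where ST: "open S" "s0 \<in> S" "open T" "t0 \<in> T" "S \<times> T <= X"
  using open_prod_elim by (metis mem_Sigma_iff)
 have sub: "S <= dom ci" "T <= dom ci" using ST by (auto simp: X_def)
 have "countable ((%k. l - k) ` \<Lambda>)" by (intro countable_image countable_lattice)
 from generic_avoid[OF this ST(1)] obtain s where s: "s \<in> S" "!!n::int. n ~= 0 ==> of_int n *s A s ~: (%k. l - k) ` \<Lambda>"
  using ST(2) sub dc by blast
 have "countable (\<Union>m::int. (%k. l - k - of_int m *s A s) ` \<Lambda>)" by (intro countable_UN countable_image countable_lattice) auto
 from generic_avoid[OF this ST(3)] obtain t where t: "t \<in> T"
  "!!n::int. n ~= 0 ==> of_int n *s A t ~: (\<Union>m::int. (%k. l - k - of_int m *s A s) ` \<Lambda>)"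
  using ST(4) sub dc by blast
 \<comment> \<open>By the generic choice of s and t, no integer combination of \<open>A s\<close>
   and \<open>A t\<close> is congruent to \<open>l\<close> modulo the lattice unless both
   coefficients are 0.\<close>
 have only: "l \<in> \<Lambda>" if "l = of_int m *s A s + of_int n *s A t + k" "k \<in> \<Lambda>" for m n :: int and k
 proof -
  have "n = 0"
  proof (rule ccontr)
   assume "n ~= 0"
   moreover have "of_int n *s A t = l - k - of_int m *s A s" using that(1) by simp
   ultimately show False using t(2)[of n] that(2) by auto
  qed
  moreover have "m = 0" if "n = 0"
  proof (rule ccontr)
   assume "m ~= 0"
   moreover have "of_int m *s A s = l - k" using \<open>l = _\<close> that by simp
   ultimately show False using s(2)[of m] \<open>k \<in> \<Lambda>\<close> by blast
  qed
  ultimately show ?thesis using that by simp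
 qed
 have st: "s \<in> dom ci" "t \<in> dom ci" "s^2 ~= t^2" "partial 3 \<sigma> (A s + A t) ~= 0" using s(1) t(1) ST(5) by (auto simp: X_def)
 define d where "d = A s + A t + l"
 have AD: "A s + A t \<in> D" by (rule W2_A) (use st dc in auto)
 hence "d \<in> D" using quasi_period_D[OF l] by (simp add: d_def)
 then obtain v1 v2 where v: "v1 \<in> \<Gamma>" "v2 \<in> \<Gamma>" "d = v1 + v2" by (auto simp: W2_eq)
 obtain m w where mw: "!!u. \<sigma> (u + l) = exp (m + (\<Sum>i\<in>UNIV. w $ i * u $ i)) * \<sigma> u" using l by (auto simp: quasi_period_def)
 define E where "E = exp (m + (\<Sum>i\<in>UNIV. w $ i * (A s + A t) $ i))"
 have "\<sigma> (A s + A t) = 0" using AD sigma_zero by blast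
 hence E: "E ~= 0" "partial i \<sigma> d = E * partial i \<sigma> (A s + A t)" for i
  using partial_quasi_period[OF mw, of i "A s + A t"] by (simp_all add: d_def E_def)
 have D0: "\<sigma> d = 0" if "d \<in> D" for d using that sigma_zero by blast
 \<comment> \<open>The gradient at \<open>d\<close> annihilates the tangent vector at each summand,
   so the x-coordinate of a summand is a root of the quadratic with roots 1/s^2 and 1/t^2. A summand
   over infinity is excluded by the nonzero third partial derivative.\<close>
 have cases: "v - A s \<in> \<Lambda> | v + A s \<in> \<Lambda> | v - A t \<in> \<Lambda> | v + A t \<in> \<Lambda>" if vw: "v \<in> \<Gamma>" "w \<in> \<Gamma>" "d = v + w" for v w
 proof -
  have dd: "dird w' \<sigma> d = 0" if "tang v w'" for w'
   using dird_W2[OF hol_sigma D0 vw(2) that] vw(3) by simp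
  have "v ~: \<Lambda>"
  proof
   assume "v \<in> \<Lambda>"
   hence "dird (axis 3 1) \<sigma> d = 0" by (intro dd) (simp add: tang_def)
   hence "partial 3 \<sigma> d = 0" by (simp add: dird_def sum_3 axis_def)
   thus False using E st(4) by simp
  qed
  then obtain q where q: "v \<in> AV q" using vw(1) by (auto simp: Gamma_eq)
  have "dird (\<chi> i. du_coeff i q) \<sigma> d = 0" by (rule dd) (use q in \<open>unfold tang_def, blast\<close>)
  hence "partial 1 \<sigma> d + partial 2 \<sigma> d * fst q + partial 3 \<sigma> d * fst q ^ 2 = 0" by (simp add: dird_def sum_3 du_coeff_def)
  hence "E * partial 3 \<sigma> (A s + A t) * ((fst q - 1 / s^2) * (fst q - 1 / t^2)) = 0"
   unfolding E(2) secant_partials[OF st(1-3)] by (simp add: algebra_simps power2_eq_square)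
  hence "fst q = 1 / s^2 | fst q = 1 / t^2" using E(1) st(4) by simp
  thus ?thesis using AV_of_x[OF q st(1)] AV_of_x[OF q st(2)] by blast
 qed
 have ex: "\<exists>m n k. k \<in> \<Lambda> & v = of_int m *s A s + of_int n *s A t + k" if vw: "v \<in> \<Gamma>" "w \<in> \<Gamma>" "d = v + w" for v w
  using cases[OF vw]
 proof (elim disjE)
  assume "v - A s \<in> \<Lambda>" thus ?thesis by (intro exI[of _ 1] exI[of _ 0] exI[of _ "v - A s"]) simp
 next
  assume "v + A s \<in> \<Lambda>" thus ?thesis by (intro exI[of _ "-1"] exI[of _ 0] exI[of _ "v + A s"]) simp
 next
  assume "v - A t \<in> \<Lambda>" thus ?thesis by (intro exI[of _ 0] exI[of _ 1] exI[of _ "v - A t"]) simp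
 next
  assume "v + A t \<in> \<Lambda>" thus ?thesis by (intro exI[of _ 0] exI[of _ "-1"] exI[of _ "v + A t"]) simp
 qed
 obtain m1 n1 k1 where 1: "k1 \<in> \<Lambda>" "v1 = of_int m1 *s A s + of_int n1 *s A t + k1" using ex[OF v] by blast
 obtain m2 n2 k2 where 2: "k2 \<in> \<Lambda>" "v2 = of_int m2 *s A s + of_int n2 *s A t + k2"
  using ex[OF v(2,1)] v(3) by (auto simp: add.commute)
 have "l = v1 + v2 - A s - A t" using v(3) by (simp add: d_def vec_eq_iff algebra_simps)
 also have "\<dots> = of_int (m1 + m2 - 1) *s A s + of_int (n1 + n2 - 1) *s A t + (k1 + k2)"
  unfolding 1(2) 2(2) by (simp add: vec_eq_iff algebra_simps)
 finally show ?thesis by (rule only) (rule lattice_add[OF 1(1) 2(1)])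
qed

end

section \<open>Expansion of sigma at the origin\<close>

lemma double_zero_limit:
 assumes h: "!!z. DERIV h z :> h1 z" "DERIV h1 0 :> d" "h 0 = 0" "h1 0 = (0::complex)"
 shows "((%z. h z / z^2) \<longlongrightarrow> d / 2) (at 0)"
proof -
 have hh: "h holomorphic_on UNIV" using h(1) by (auto simp: holomorphic_on_open)
 define g where "g = (%z. if z = 0 then 0 else h z / z)"
 have "g holomorphic_on UNIV"
  using pole_lemma[OF hh, of 0] h DERIV_imp_deriv[OF h(1)[of 0]] by (simp add: g_def cong: if_cong)
 hence dg: "DERIV g z :> deriv g z" for z by (simp add: holomorphic_derivI)
 have hg: "h z = z * g z" for z using h(3) by (simp add: g_def)
 have e: "h1 z = g z + z * deriv g z" for z
 proof -
  have "DERIV h z :> g z + z * deriv g z"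
   unfolding hg[abs_def] by (auto intro!: derivative_eq_intros dg)
  thus ?thesis using h(1) DERIV_unique by blast
 qed
 have g0: "g 0 = 0" by (simp add: g_def)
 have "DERIV (deriv g) 0 :> deriv (deriv g) 0"
  by (rule holomorphic_derivI[OF holomorphic_deriv[OF \<open>g holomorphic_on UNIV\<close>]]) auto
 hence "DERIV h1 0 :> 2 * deriv g 0"
  unfolding e[abs_def] by (auto intro!: derivative_eq_intros dg)
 hence d: "d = 2 * deriv g 0" using h(2) DERIV_unique by blast
 have "((%z. g z / z) \<longlongrightarrow> deriv g 0) (at 0)" using dg[of 0] by (simp add: has_field_derivative_iff g0)
 thus ?thesis
  by (rule Lim_transform_within[OF _ zero_less_one, THEN back_subst[of "%l. (_ \<longlongrightarrow> l) _"]]) (auto simp: d hg power2_eq_square)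
qed

context hyper_curve
begin

lemma x_family: "\<exists>B. \<forall>n::nat. \<exists>t\<in>dom ci. 1 / t^2 = B + of_nat n"
proof -
 have "\<exists>t\<in>dom ci. 1 / t^2 = of_real (1 / r^2 + 1) + of_nat n" for n
 proof (rule x_attained)
  have "of_real (1 / r^2 + 1) + of_nat n = complex_of_real (1 / r^2 + 1 + real n)" by simp
  hence "norm (of_real (1 / r^2 + 1) + of_nat n :: complex) = 1 / r^2 + 1 + real n"
   by (simp only: norm_of_real) (simp add: add_nonneg_nonneg)
  thus "norm (of_real (1 / r^2 + 1) + of_nat n :: complex) > 1 / r^2" by simp
 qed
 thus ?thesis by blast
qed

text \<open>The chart at infinity takes infinitely many values of x, even after finitely many
  parameters are removed.\<close>

lemma poly_zero_on_x:
 assumes "!!t. t \<in> dom ci ==> t ~: E ==> poly p (1 / t^2) = 0" "finite E"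
 shows "p = 0"
proof (rule ccontr)
 assume p: "p ~= 0"
 obtain B :: complex where B: "!!n::nat. \<exists>t\<in>dom ci. 1 / t^2 = B + of_nat n" using x_family by blast
 have "range (%n::nat. B + of_nat n) <= {x. poly p x = 0} \<union> (%t. 1 / t^2) ` E"
 proof
  fix x assume "x \<in> range (%n::nat. B + of_nat n)"
  then obtain n :: nat where "x = B + of_nat n" by blast
  then obtain t where "t \<in> dom ci" "x = 1 / t^2" using B[of n] by auto
  thus "x \<in> {x. poly p x = 0} \<union> (%t. 1 / t^2) ` E" using assms(1)[of t] by auto
 qed
 hence "finite (range (%n::nat. B + of_nat n))" using poly_roots_finite[OF p] assms(2) finite_subset by blast
 moreover have "inj (%n::nat. B + of_nat n)" by (simp add: inj_def)
 ultimately show False using finite_imageD by blast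
qed

end

context sigma_curve
begin

lemma sigma_on_D: "d \<in> D ==> \<sigma> d = 0" by (simp add: sigma_zero)

lemma A_cancel: "t \<in> dom ci ==> A t + A (- t) = 0 & - t \<in> dom ci"
 using A_odd[of t] by (simp add: dom_ci)

text \<open>The origin is \<open>A t + A (- t)\<close> for every t, so the gradient there
  annihilates (1, x, x^2) for infinitely many x.\<close>

lemma grad_0: "partial i \<sigma> 0 = 0"
proof -
 have "[:partial 1 \<sigma> 0, partial 2 \<sigma> 0, partial 3 \<sigma> 0:] = 0"
 proof (rule poly_zero_on_x[of "{}"])
  fix t assume t: "t \<in> dom ci"
  have t4: "1 / t^4 = (1 / t^2)^2" by (simp add: power_divide flip: power_mult)
  have "A (- t) \<in> \<Gamma>" by (rule Gamma_A) (use t in \<open>simp add: dom_ci\<close>)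
  from dird_W2[OF hol_sigma sigma_on_D this tang_pt[OF t]]
  have "dird (vector [1, 1 / t^2, (1 / t^2)^2]) \<sigma> 0 = 0" using A_cancel[OF t] t4 by simp
  thus "poly [:partial 1 \<sigma> 0, partial 2 \<sigma> 0, partial 3 \<sigma> 0:] (1 / t^2) = 0"
   unfolding dird_vector by (simp only: poly_pCons poly_0) (simp only: power2_eq_square ring_distribs mult_ac add_ac mult_zero_left add_0_right)
 qed simp
 thus ?thesis using exhaust_3[of i] by auto
qed

text \<open>The quadratic part of \<open>\<sigma>\<close> at the origin turns out to be
  \<open>\<kappa>\<close> times u1 u3 - u2^2.\<close>

definition "\<kappa> = partial 1 (partial 3 \<sigma>) 0"

lemma hess_sym: "partial i (partial j \<sigma>) u = partial j (partial i \<sigma>) u"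
 by (rule partial_commute[OF hol_sigma UNIV_I])

text \<open>The parameters t and -t have the same x, so the mixed second derivative along the two
  branches is the Hessian on (1, x, x^2) taken twice: a polynomial of degree four in x with
  infinitely many zeros. Only its middle coefficient mixes two entries, which leaves one free
  parameter.\<close>

lemma hess_0:
 "partial 1 (partial 1 \<sigma>) 0 = 0" "partial 1 (partial 2 \<sigma>) 0 = 0" "partial 1 (partial 3 \<sigma>) 0 = \<kappa>"
 "partial 2 (partial 1 \<sigma>) 0 = 0" "partial 2 (partial 2 \<sigma>) 0 = - 2 * \<kappa>" "partial 2 (partial 3 \<sigma>) 0 = 0"
 "partial 3 (partial 1 \<sigma>) 0 = \<kappa>" "partial 3 (partial 2 \<sigma>) 0 = 0" "partial 3 (partial 3 \<sigma>) 0 = 0"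
proof -
 define H where "H = (%i j. partial i (partial j \<sigma>) 0)"
 have sym: "H 2 1 = H 1 2" "H 3 1 = H 1 3" "H 3 2 = H 2 3" by (auto simp: H_def intro: hess_sym)
 have "[:H 1 1, 2 * H 1 2, 2 * H 1 3 + H 2 2, 2 * H 2 3, H 3 3:] = 0"
 proof (rule poly_zero_on_x[of "{}"])
  fix t assume t: "t \<in> dom ci"
  have "dird (vector [1, 1 / t^2, 1 / t^4]) (dird (vector [1, 1 / t^2, 1 / t^4]) \<sigma>) (A t + A (- t)) = 0"
   using dird2_W2[OF hol_sigma sigma_on_D tang_pt[OF t] tang_pt[of "- t"]] A_cancel[OF t] by simp
  moreover have "1 / t^4 = (1 / t^2)^2" by (simp add: power_divide flip: power_mult)
  moreover define x where "x = 1 / t^2"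
  ultimately have "dird (vector [1, x, x^2]) (dird (vector [1, x, x^2]) \<sigma>) 0 = 0" using A_cancel[OF t] by simp
  thus "poly [:H 1 1, 2 * H 1 2, 2 * H 1 3 + H 2 2, 2 * H 2 3, H 3 3:] (1 / t^2) = 0"
   unfolding dird_dird[OF hol_sigma UNIV_I] x_def[symmetric]
   by (simp add: sum_3 sym[unfolded H_def] H_def algebra_simps power2_eq_square)
 qed simp
 hence "H 1 1 = 0" "H 1 2 = 0" "2 * H 1 3 + H 2 2 = 0" "H 2 3 = 0" "H 3 3 = 0" by simp_all
 thus "partial 1 (partial 1 \<sigma>) 0 = 0" "partial 1 (partial 2 \<sigma>) 0 = 0" "partial 1 (partial 3 \<sigma>) 0 = \<kappa>"
 "partial 2 (partial 1 \<sigma>) 0 = 0" "partial 2 (partial 2 \<sigma>) 0 = - 2 * \<kappa>" "partial 2 (partial 3 \<sigma>) 0 = 0"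
 "partial 3 (partial 1 \<sigma>) 0 = \<kappa>" "partial 3 (partial 2 \<sigma>) 0 = 0" "partial 3 (partial 3 \<sigma>) 0 = 0"
  using sym by (simp_all add: H_def \<kappa>_def eq_neg_iff_add_eq_0 add.commute)
qed

lemma line_zero: "((%t. t *s w) \<longlongrightarrow> (0 :: complex^3)) (at (0::complex))"
proof -
 have "isCont (%t. t *s w) (0::complex)" by (rule continuous_on_interior[of UNIV]) (auto intro!: continuous_intros)
 thus ?thesis by (simp add: isCont_def)
qed

lemma line_limit: "entire F ==> ((%t. F (t *s w)) \<longlongrightarrow> F 0) (at 0)"
 using hol3_continuous[of F UNIV] by (intro isCont_tendsto_compose[OF _ line_zero]) (simp add: continuous_on_eq_continuous_at)

lemma partial_limit:
 "((%t. partial i \<sigma> (t *s w) / t) \<longlongrightarrow> (if i = 1 then \<kappa> * w $ 3 else if i = 2 then - 2 * \<kappa> * w $ 2 else \<kappa> * w $ 1)) (at 0)"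
proof -
 have "DERIV (%t. partial i \<sigma> (0 + t *s w)) 0 :> dird w (partial i \<sigma>) (0 + 0 *s w)"
  by (rule line_dird[OF hol_partials(1)]) auto
 hence "((%t. partial i \<sigma> (t *s w) / t) \<longlongrightarrow> dird w (partial i \<sigma>) 0) (at 0)"
  by (simp add: has_field_derivative_iff grad_0)
 thus ?thesis using exhaust_3[of i] by (auto simp: dird_def sum_3 hess_0)
qed

lemma sigma_limit: "((%t. \<sigma> (t *s w) / t^2) \<longlongrightarrow> \<kappa> * (w $ 1 * w $ 3 - (w $ 2)^2)) (at 0)"
proof -
 have "((%t. \<sigma> (0 + t *s w) / t^2) \<longlongrightarrow> dird w (dird w \<sigma>) (0 + 0 *s w) / 2) (at 0)"
  by (rule double_zero_limit[OF line_sigma]) (auto simp: dird_def grad_0 sigma_on_D[OF zero_in_D])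
 moreover have "dird w (dird w \<sigma>) (0 + 0 *s w) / 2 = \<kappa> * (w $ 1 * w $ 3 - (w $ 2)^2)"
  by (simp add: dird_dird[OF hol_sigma] sum_3 hess_0 field_simps power2_eq_square)
 ultimately show ?thesis by simp
qed

text \<open>The exponents are affine in u, so the contributions of \<open>w\<close> and
  \<open>- w\<close> cancel. Varying \<open>w\<close> gives a supply of elements of level
  two.\<close>

lemma product_level: "(%u. \<sigma> (u + w) * \<sigma> (u - w)) \<in> level 2"
proof -
 have "\<sigma> (u + l + w) * \<sigma> (u + l - w) * \<sigma> u ^ 2 = \<sigma> (u + w) * \<sigma> (u - w) * \<sigma> (u + l) ^ 2" if l: "quasi_period l" for l u
 proof -
  obtain m k where mk: "!!u. \<sigma> (u + l) = exp (m + (\<Sum>i\<in>UNIV. k $ i * u $ i)) * \<sigma> u" using l by (auto simp: quasi_period_def)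
  have "exp (m + (\<Sum>i\<in>UNIV. k $ i * (u + w) $ i)) * exp (m + (\<Sum>i\<in>UNIV. k $ i * (u - w) $ i)) = exp (m + (\<Sum>i\<in>UNIV. k $ i * u $ i)) ^ 2"
   by (simp add: exp_add[symmetric] power2_eq_square sum_3 algebra_simps)
  moreover have "\<sigma> (u + l + w) = exp (m + (\<Sum>i\<in>UNIV. k $ i * (u + w) $ i)) * \<sigma> (u + w)"
   "\<sigma> (u + l - w) = exp (m + (\<Sum>i\<in>UNIV. k $ i * (u - w) $ i)) * \<sigma> (u - w)"
   using mk[of "u + w"] mk[of "u - w"] by (simp_all add: algebra_simps)
  ultimately show ?thesis by (simp add: mk power_mult_distrib mult_ac)
 qed
 moreover have "hol3 (%u. \<sigma> (u + w) * \<sigma> (u + - w)) UNIV"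
  by (intro hol3_mult hol3_translate[OF hol_sigma]) auto
 ultimately show ?thesis by (simp add: level_def)
qed

definition n2 :: "3 => 3 => complex^3 => complex" where
 "n2 i j u = partial i \<sigma> u * partial j \<sigma> u - \<sigma> u * partial i (partial j \<sigma>) u"

lemma hol_n2: "entire (n2 i j)"
 unfolding n2_def[abs_def] by (intro hol3_diff hol3_mult hol_partials hol_sigma)

lemma wp2_n2: "u ~: D ==> wp \<sigma> [i, j] u = n2 i j u / \<sigma> u ^ 2"
 by (simp add: wp2 n2_def)

lemma n2_level: "n2 i j \<in> level 2"
 by (rule levelI[OF hol_n2, where F="wp \<sigma> [i, j]"]) (auto simp: wp2_n2 sigma_zero wp_periodic)

lemma one_level: "(%u. \<sigma> u ^ m) \<in> level m"
 using hol3_power[OF hol_sigma] by (simp add: level_def)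

text \<open>A quadric through all gradient directions (x y, - x - y, 1) gives a polynomial P(x, y)
  that vanishes for independent values of x and y, hence has zero coefficients.\<close>

lemma quadric_relation:
 assumes z: "!!d. d \<in> D ==> x11 * partial 1 \<sigma> d ^ 2 + x12 * partial 1 \<sigma> d * partial 2 \<sigma> d + x13 * partial 1 \<sigma> d * partial 3 \<sigma> d
  + x22 * partial 2 \<sigma> d ^ 2 + x23 * partial 2 \<sigma> d * partial 3 \<sigma> d + x33 * partial 3 \<sigma> d ^ 2 = 0"
 shows "x11 = 0 & x12 = 0 & x13 = 0 & x22 = 0 & x23 = 0 & x33 = 0"
proof -
 define P where "P = (%x y. x11 * (x * y)^2 - x12 * (x * y) * (x + y) + x13 * (x * y) + x22 * (x + y)^2 - x23 * (x + y) + x33)"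
 have 1: "partial 3 \<sigma> (A s + A t) ^ 2 * P (1 / s^2) (1 / t^2) = 0" if st: "s \<in> dom ci" "t \<in> dom ci" "s^2 ~= t^2" for s t
 proof -
  have "A s + A t \<in> D" by (rule W2_A) (use st in \<open>auto simp: dom_ci\<close>)
  from z[OF this] show ?thesis unfolding secant_partials[OF st] P_def
   by (simp add: algebra_simps power2_eq_square)
 qed
 have P0: "P (1 / s^2) (1 / t^2) = 0" if st: "s \<in> dom ci" "t \<in> dom ci" "s^2 ~= t^2" for s t
 proof (rule ccontr)
  assume "P (1 / s^2) (1 / t^2) ~= 0"
  define X where "X = {p \<in> dom ci \<times> dom ci. (fst p ^ 2 - snd p ^ 2) * P (1 / fst p^2) (1 / snd p^2) ~= 0}"
  have "continuous_on (dom ci \<times> dom ci) (%p. (fst p ^ 2 - snd p ^ 2) * P (1 / fst p^2) (1 / snd p^2))"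
   unfolding P_def by (intro continuous_intros) (auto simp: dom_ci)
  from continuous_open_preimage[OF this open_Times[OF is_chartD(1)[OF ci] is_chartD(1)[OF ci]], of "- {0}"]
  have "open X" by (simp add: X_def Int_def vimage_def open_Compl)
  moreover have "(s, t) \<in> X" using st \<open>P _ _ ~= 0\<close> by (simp add: X_def)
  ultimately obtain S T where ST: "open S" "s \<in> S" "open T" "t \<in> T" "S \<times> T <= X"
   using open_prod_elim by (metis mem_Sigma_iff)
  have "partial i \<sigma> d = 0" if "d \<in> D" for i d
  proof (rule W2_from_A_local[OF hol_partials(1) ST(1,2) st(1) ST(3,4) st(2) _ that])
   fix s t assume "s \<in> S" "s \<in> dom ci" "t \<in> T" "t \<in> dom ci"
   hence X: "(s, t) \<in> X" using ST(5) by blast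
   hence st: "s \<in> dom ci" "t \<in> dom ci" "s^2 ~= t^2" by (auto simp: X_def)
   have "partial 3 \<sigma> (A s + A t) = 0" using 1[OF st] X by (auto simp: X_def)
   thus "partial i \<sigma> (A s + A t) = 0" using secant_partials[OF st] exhaust_3[of i] by auto
  qed
  thus False using ex_regular by blast
 qed
 \<comment> \<open>P(x, y) as a polynomial in x for fixed y. Since P is symmetric, its coefficients
   are the same three quadratic polynomials, now evaluated at y.\<close>
 have q: "[:x33, - x23, x22:] + [:y:] * [:- x23, x13 + 2 * x22, - x12:] + [:y^2:] * [:x22, - x12, x11:] = 0" if y: "y = 1 / t^2" "t \<in> dom ci" for y t
 proof (rule poly_zero_on_x[of "{t, - t}"])
  fix s assume s: "s \<in> dom ci" "s ~: {t, - t}"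
  hence "s^2 ~= t^2" by (auto simp: power2_eq_iff)
  moreover define z where "z = 1 / s^2"
  ultimately have "P z y = 0" using P0[OF s(1) y(2)] y(1) by simp
  thus "poly ([:x33, - x23, x22:] + [:y:] * [:- x23, x13 + 2 * x22, - x12:] + [:y^2:] * [:x22, - x12, x11:]) (1 / s^2) = 0"
   unfolding z_def[symmetric] P_def by (simp add: algebra_simps power2_eq_square)
 qed simp
 have q': "poly [:x33, - x23, x22:] y = 0 & poly [:- x23, x13 + 2 * x22, - x12:] y = 0 & poly [:x22, - x12, x11:] y = 0"
  if "y = 1 / t^2" "t \<in> dom ci" for y t using q[OF that] by (simp add: algebra_simps power2_eq_square)
 have "[:x33, - x23, x22:] = 0" "[:- x23, x13 + 2 * x22, - x12:] = 0" "[:x22, - x12, x11:] = 0"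
  by ((rule poly_zero_on_x[of "{}"]; use q'[OF HOL.refl] in blast)+)
 thus ?thesis by auto
qed

text \<open>If \<open>\<sigma>\<close> vanished to order three at the origin, then so many products of level two would vanish
 to order four there that the nine functions below, from a space of dimension at most eight, would be independent.\<close>

lemma kappa_nz: "\<kappa> ~= 0"
proof
 assume k0: "\<kappa> = 0"
 obtain w where w: "w ~: D" using ex_off by blast
 obtain v i0 where v: "v \<in> D" "partial i0 \<sigma> v ~= 0" using ex_regular by blast
 \<comment> \<open>A direction in which \<open>\<sigma>\<close> vanishes exactly to first order at
   \<open>v\<close>, so that the product \<open>F v\<close> vanishes exactly to second order along
   the line through the origin.\<close>
 define e where "e = (axis i0 1 :: complex^3)"
 have dv: "dird e \<sigma> v ~= 0" using v(2) exhaust_3[of i0] by (auto simp: dird_def e_def sum_3 axis_def)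
 define F where "F = (%w u. \<sigma> (u + w) * \<sigma> (u - w))"
 define f where "f = (!) [%u. \<sigma> u ^ 2, n2 1 1, n2 1 2, n2 1 3, n2 2 2, n2 2 3, n2 3 3, F w, F v]"
 have fl: "f i \<in> level 2" if "i < 9" for i
  using that product_level n2_level one_level[of 2] by (auto simp: f_def F_def less_Suc_eq numeral_eq_Suc)
 have "\<exists>x. (\<exists>i\<in>{..<9}. x i ~= 0) & (\<forall>u. (\<Sum>i\<in>{..<9}. x i * f i u) = 0)"
  by (rule level_dependent[of _ _ 2]) (use fl in auto)
 then obtain x where x: "\<exists>i\<in>{..<9}. x i ~= 0" "!!u. (\<Sum>i\<in>{..<9::nat}. x i * f i u) = 0" by blast
 have sum9: "(\<Sum>i<9. x i * f i u) = x 0 * \<sigma> u ^ 2 + x 1 * n2 1 1 u + x 2 * n2 1 2 u + x 3 * n2 1 3 u + x 4 * n2 2 2 u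
  + x 5 * n2 2 3 u + x 6 * n2 3 3 u + x 7 * F w u + x 8 * F v u" for u
  by (simp add: f_def numeral_eq_Suc)
 have x: "\<exists>i\<in>{..<9}. x i ~= 0" and rel: "x 0 * \<sigma> u ^ 2 + x 1 * n2 1 1 u + x 2 * n2 1 2 u + x 3 * n2 1 3 u + x 4 * n2 2 2 u
  + x 5 * n2 2 3 u + x 6 * n2 3 3 u + x 7 * F w u + x 8 * F v u = 0" for u
  using x(1) x(2)[of u] sum9 by auto
 define h where "h = expi2 (- (2 * (\<Sum>i\<in>UNIV. a $ i * b $ i)))"
 have eps: "h ~= 0" "\<sigma> (- u) = h * \<sigma> u" for u by (simp_all add: h_def sigma_minus)
 have F0: "F w 0 ~= 0" "F v 0 = 0" using eps w sigma_zero v(1) by (auto simp: F_def)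
 have x7: "x 7 = 0"
  using rel[of 0] F0 sigma_on_D[OF zero_in_D] by (simp add: n2_def grad_0)
 have p0: "((%t. partial i \<sigma> (t *s e) / t) \<longlongrightarrow> 0) (at 0)" for i
  using partial_limit[of i e] by (simp add: k0 cong: if_cong)
 have lim: "((%t. n2 i j (t *s e) / t^2) \<longlongrightarrow> 0) (at 0)" for i j
 proof -
  have "((%t. partial i \<sigma> (t *s e) / t * (partial j \<sigma> (t *s e) / t) - \<sigma> (t *s e) / t^2 * partial i (partial j \<sigma>) (t *s e)) \<longlongrightarrow>
   0 * 0 - 0 * partial i (partial j \<sigma>) 0) (at 0)"
   using sigma_limit[of e] by (intro tendsto_intros line_limit hol_partials p0) (simp add: k0)
  thus ?thesis by (simp add: n2_def power2_eq_square diff_divide_distrib)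
 qed
 have lim0: "((%t. \<sigma> (t *s e) ^ 2 / t^2) \<longlongrightarrow> 0) (at 0)"
 proof -
  have "((%t. \<sigma> (t *s e) / t^2 * \<sigma> (t *s e)) \<longlongrightarrow> 0 * \<sigma> 0) (at 0)"
   by (intro tendsto_intros line_limit hol_sigma) (use sigma_limit in \<open>simp add: k0\<close>)
  thus ?thesis by (simp add: power2_eq_square)
 qed
 have limF: "((%t. F v (t *s e) / t^2) \<longlongrightarrow> dird e \<sigma> v * dird e \<sigma> (- v)) (at 0)"
 proof -
  have "((%t. \<sigma> (y + t *s e) / t) \<longlongrightarrow> dird e \<sigma> y) (at 0)" if "y \<in> D" for y
   using line_sigma(1)[of y e 0] sigma_on_D[OF that] by (simp add: has_field_derivative_iff)
  from tendsto_mult[OF this[OF v(1)] this[of "- v"]] v(1) D_minus[of v]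
  show ?thesis by (simp add: F_def power2_eq_square add.commute)
 qed
 have "dird e \<sigma> (- v) = - (h * dird e \<sigma> v)"
 proof -
  have "- partial i \<sigma> (- v) = h * partial i \<sigma> v" for i
   using partial_uminus_arg[OF hol_sigma UNIV_I, of i v] partial_mult[OF hol3_const[OF open_UNIV] hol_sigma UNIV_I, of i h v]
   by (simp add: eps(2))
  hence "partial i \<sigma> (- v) = - (h * partial i \<sigma> v)" for i by (metis minus_minus)
  thus ?thesis by (simp add: dird_def sum_3 algebra_simps)
 qed
 hence nz: "dird e \<sigma> v * dird e \<sigma> (- v) ~= 0" using dv eps(1) by simp
 have "((%t. x 0 * (\<sigma> (t *s e) ^ 2 / t^2) + x 1 * (n2 1 1 (t *s e) / t^2) + x 2 * (n2 1 2 (t *s e) / t^2) + x 3 * (n2 1 3 (t *s e) / t^2)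
  + x 4 * (n2 2 2 (t *s e) / t^2) + x 5 * (n2 2 3 (t *s e) / t^2) + x 6 * (n2 3 3 (t *s e) / t^2) + x 8 * (F v (t *s e) / t^2)) \<longlongrightarrow>
  x 0 * 0 + x 1 * 0 + x 2 * 0 + x 3 * 0 + x 4 * 0 + x 5 * 0 + x 6 * 0 + x 8 * (dird e \<sigma> v * dird e \<sigma> (- v))) (at 0)"
  by (intro tendsto_intros lim lim0 limF)
 moreover have "x 0 * (\<sigma> (t *s e) ^ 2 / t^2) + x 1 * (n2 1 1 (t *s e) / t^2) + x 2 * (n2 1 2 (t *s e) / t^2) + x 3 * (n2 1 3 (t *s e) / t^2)
  + x 4 * (n2 2 2 (t *s e) / t^2) + x 5 * (n2 2 3 (t *s e) / t^2) + x 6 * (n2 3 3 (t *s e) / t^2) + x 8 * (F v (t *s e) / t^2) = 0" for t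
  using rel[of "t *s e"] by (simp add: x7 flip: add_divide_distrib)
 ultimately have "x 8 * (dird e \<sigma> v * dird e \<sigma> (- v)) = 0" using LIM_unique[OF tendsto_const] by fastforce
 hence x8: "x 8 = 0" using nz by simp
 \<comment> \<open>On D only the products of first derivatives survive in \<open>n2\<close>, so the
   remaining relation is a quadric through all gradients.\<close>
 have "x 1 = 0 & x 2 = 0 & x 3 = 0 & x 4 = 0 & x 5 = 0 & x 6 = 0"
 proof (rule quadric_relation)
  fix d assume "d \<in> D"
  thus "x 1 * partial 1 \<sigma> d ^ 2 + x 2 * partial 1 \<sigma> d * partial 2 \<sigma> d + x 3 * partial 1 \<sigma> d * partial 3 \<sigma> d
  + x 4 * partial 2 \<sigma> d ^ 2 + x 5 * partial 2 \<sigma> d * partial 3 \<sigma> d + x 6 * partial 3 \<sigma> d ^ 2 = 0"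
   using rel[of d] x7 x8 by (simp add: n2_def sigma_on_D power2_eq_square mult.assoc)
 qed
 moreover from this have "x 0 = 0" using rel[of w] x7 x8 w by (simp add: sigma_zero)
 moreover obtain i where "i < 9" "x i ~= 0" using x by blast
 moreover from this have "i = 0 | i = 1 | i = 2 | i = 3 | i = 4 | i = 5 | i = 6 | i = 7 | i = 8" by linarith
 ultimately show False using x7 x8 by (elim conjE disjE) simp_all
qed

end

section \<open>The numerators of the 27 functions\<close>

context sigma_curve
begin

abbreviation "\<sigma>1 i \<equiv> partial i \<sigma>"
abbreviation "\<sigma>2 i j \<equiv> partial i (partial j \<sigma>)"
abbreviation "\<sigma>3 i j k \<equiv> partial i (partial j (partial k \<sigma>))"

lemma hol_\<sigma>3: "entire (\<sigma>3 i j k)"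
 by (intro hol3_partial_hol3 hol_sigma)

lemmas hol_intros = hol3_add hol3_diff hol3_uminus hol3_mult hol3_power hol3_const[OF open_UNIV] hol_sigma hol_partials hol_\<sigma>3 hol_n2

definition n3 :: "3 => 3 => 3 => complex^3 => complex" where
 "n3 i j k u = \<sigma> u * (\<sigma>2 i j u * \<sigma>1 k u + \<sigma>2 i k u * \<sigma>1 j u + \<sigma>2 j k u * \<sigma>1 i u) - 2 * \<sigma>1 i u * \<sigma>1 j u * \<sigma>1 k u - \<sigma> u ^ 2 * \<sigma>3 i j k u"

lemma partial_n2: "partial i (n2 j k) u = \<sigma>2 i j u * \<sigma>1 k u + \<sigma>2 i k u * \<sigma>1 j u - \<sigma>1 i u * \<sigma>2 j k u - \<sigma> u * \<sigma>3 i j k u"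
proof (rule partial_eqI')
 have p: "DERIV (%t. F (u + axis i t)) 0 :> partial i F u" if "entire F" for F
  by (rule hol3_partial[OF that]) simp
 show "DERIV (%t. n2 j k (u + axis i t)) 0 :> \<sigma>2 i j u * \<sigma>1 k u + \<sigma>2 i k u * \<sigma>1 j u - \<sigma>1 i u * \<sigma>2 j k u - \<sigma> u * \<sigma>3 i j k u"
  unfolding n2_def by (auto intro!: derivative_eq_intros p hol_intros)
qed

lemma partial_quotient:
 assumes F: "entire F" and f: "!!u. u ~: D ==> f u = F u / \<sigma> u ^ m" and u: "u ~: D"
 shows "partial i f u = (\<sigma> u * partial i F u - of_nat m * \<sigma>1 i u * F u) / \<sigma> u ^ Suc m"
proof -
 have nz: "\<sigma> u ~= 0" using u by (simp add: sigma_zero)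
 have "partial i f u = partial i (%u. F u / \<sigma> u ^ m) u"
  by (rule partial_cong_open[of "- D"]) (use closed_D u f in auto)
 also have "\<dots> = (\<sigma> u * partial i F u - of_nat m * \<sigma>1 i u * F u) / \<sigma> u ^ Suc m"
 proof (rule partial_eqI')
  have p: "DERIV (%t. F (u + axis i t)) 0 :> partial i F u"
   "DERIV (%t. \<sigma> (u + axis i t)) 0 :> \<sigma>1 i u"
   by (auto intro: hol3_partial F hol_sigma)
  have "(partial i F u * \<sigma> u ^ m - F u * (of_nat m * (\<sigma>1 i u * \<sigma> u ^ (m - Suc 0)))) / (\<sigma> u ^ m * \<sigma> u ^ m) =
    (\<sigma> u * partial i F u - of_nat m * \<sigma>1 i u * F u) / \<sigma> u ^ Suc m"
   by (cases m) (simp_all add: nz field_simps)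
  with DERIV_divide[OF p(1) DERIV_power[OF p(2), of m]] nz
  show "DERIV (%t. F (u + axis i t) / \<sigma> (u + axis i t) ^ m) 0 :> (\<sigma> u * partial i F u - of_nat m * \<sigma>1 i u * F u) / \<sigma> u ^ Suc m"
   by simp
 qed
 finally show ?thesis .
qed

lemma wp3: "u ~: D ==> wp \<sigma> [i, j, k] u = n3 i j k u / \<sigma> u ^ 3"
proof -
 assume u: "u ~: D"
 have "wp \<sigma> [i, j, k] u = partial i (wp \<sigma> [j, k]) u" by (rule wp_Cons) (use u in auto)
 also have "\<dots> = (\<sigma> u * partial i (n2 j k) u - of_nat 2 * \<sigma>1 i u * n2 j k u) / \<sigma> u ^ Suc 2"
  by (rule partial_quotient[OF hol_n2 wp2_n2 u])
 also have "\<sigma> u * partial i (n2 j k) u - of_nat 2 * \<sigma>1 i u * n2 j k u = n3 i j k u"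
  unfolding partial_n2 n2_def n3_def by (simp add: algebra_simps power2_eq_square)
 finally show ?thesis by simp
qed

lemma hol_n3: "entire (n3 i j k)"
 unfolding n3_def[abs_def] by (intro hol_intros)

definition n4 :: "complex^3 => complex" where
 "n4 u = 6 * \<sigma>1 2 u ^ 4 - 12 * \<sigma> u * \<sigma>1 2 u ^ 2 * \<sigma>2 2 2 u + 3 * \<sigma> u ^ 2 * \<sigma>2 2 2 u ^ 2 + 4 * \<sigma> u ^ 2 * \<sigma>1 2 u * \<sigma>3 2 2 2 u
   - \<sigma> u ^ 3 * partial 2 (\<sigma>3 2 2 2) u"

lemma wp4: "u ~: D ==> wp \<sigma> [2, 2, 2, 2] u = n4 u / \<sigma> u ^ 4"
proof -
 assume u: "u ~: D"
 have p: "DERIV (%t. F (u + axis 2 t)) 0 :> partial 2 F u" if "entire F" for F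
  by (rule hol3_partial[OF that]) simp
 have d: "partial 2 (n3 2 2 2) u = 3 * \<sigma> u * \<sigma>2 2 2 u ^ 2 - 3 * \<sigma>1 2 u ^ 2 * \<sigma>2 2 2 u + \<sigma> u * \<sigma>1 2 u * \<sigma>3 2 2 2 u - \<sigma> u ^ 2 * partial 2 (\<sigma>3 2 2 2) u"
  unfolding n3_def by (rule partial_eqI') (auto intro!: derivative_eq_intros p hol_intros simp: algebra_simps power2_eq_square)
 have "wp \<sigma> [2, 2, 2, 2] u = partial 2 (wp \<sigma> [2, 2, 2]) u" by (rule wp_Cons) (use u in auto)
 also have "\<dots> = (\<sigma> u * partial 2 (n3 2 2 2) u - of_nat 3 * \<sigma>1 2 u * n3 2 2 2 u) / \<sigma> u ^ Suc 3"
  by (rule partial_quotient[OF hol_n3 wp3 u])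
 also have "\<sigma> u * partial 2 (n3 2 2 2) u - of_nat 3 * \<sigma>1 2 u * n3 2 2 2 u = n4 u"
  unfolding d n4_def n3_def by (simp add: algebra_simps power2_eq_square eval_nat_numeral)
 finally show ?thesis by simp
qed

text \<open>Up to sign, the factor of the first power of \<open>\<sigma>\<close> in the numerator of
  \<Delta> over \<open>\<sigma>^4\<close>, hence the obstruction to a pole of order two.\<close>

definition Bf :: "complex^3 => complex" where
 "Bf u = \<sigma>1 1 u ^ 2 * \<sigma>2 3 3 u + \<sigma>1 3 u ^ 2 * \<sigma>2 1 1 u - \<sigma>1 1 u * \<sigma>1 2 u * \<sigma>2 2 3 u - \<sigma>1 2 u * \<sigma>1 3 u * \<sigma>2 1 2 u
   - 2 * \<sigma>1 1 u * \<sigma>1 3 u * \<sigma>2 1 3 u + \<sigma>1 1 u * \<sigma>1 3 u * \<sigma>2 2 2 u + \<sigma>1 2 u ^ 2 * \<sigma>2 1 3 u"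

lemma hol_Bf: "entire Bf"
 unfolding Bf_def[abs_def] by (intro hol_intros)

text \<open>At \<open>A s + A t\<close>, with \<open>x = 1/s\<^sup>2\<close> and \<open>y = 1/t\<^sup>2\<close>, the gradient is proportional to
 \<open>(x y, - x - y, 1)\<close>, and \<open>Bf\<close> becomes the mixed second derivative along the two branches.\<close>

lemma Bf_zero: "d \<in> D ==> Bf d = 0"
proof (rule W2_from_A[OF hol_Bf])
 fix s t assume st: "s \<in> dom ci" "t \<in> dom ci" "s^2 ~= t^2"
 define x y where "x = 1 / s^2" and "y = 1 / t^2"
 define d where "d = A s + A t"
 have xy4: "1 / s^4 = x^2" "1 / t^4 = y^2" by (simp_all add: x_def y_def power_divide flip: power_mult)
 have "dird (vector [1, y, y^2]) (dird (vector [1, x, x^2]) \<sigma>) d = 0"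
  using dird2_W2[OF hol_sigma sigma_on_D tang_pt[OF st(1)] tang_pt[OF st(2)]]
  unfolding xy4 x_def[symmetric] y_def[symmetric] d_def .
 hence h: "\<sigma>2 1 1 d + \<sigma>2 1 2 d * (x + y) + \<sigma>2 1 3 d * (x^2 + y^2) + \<sigma>2 2 2 d * (x * y) + \<sigma>2 2 3 d * (x * y * (x + y)) + \<sigma>2 3 3 d * (x * y)^2 = 0"
  unfolding dird_dird[OF hol_sigma UNIV_I] sum_3 vector_3 hess_sym[of 2 1] hess_sym[of 3 1] hess_sym[of 3 2]
  by (simp add: algebra_simps power2_eq_square)
 define g where "g = \<sigma>1 3 d"
 have g: "\<sigma>1 1 d = g * (x * y)" "\<sigma>1 2 d = - (g * (x + y))" "\<sigma>1 3 d = g"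
  using secant_partials[OF st] by (simp_all add: g_def x_def y_def d_def)
 have "Bf d = g ^ 2 * (\<sigma>2 1 1 d + \<sigma>2 1 2 d * (x + y) + \<sigma>2 1 3 d * (x^2 + y^2) + \<sigma>2 2 2 d * (x * y) + \<sigma>2 2 3 d * (x * y * (x + y)) + \<sigma>2 3 3 d * (x * y)^2)"
  unfolding Bf_def g by (simp add: algebra_simps power2_eq_square)
 hence "Bf d = 0" unfolding h by simp
 thus "Bf (A s + A t) = 0" by (simp add: d_def)
qed

definition "Ef = (SOME E. entire E & (\<forall>u. Bf u = E u * \<sigma> u))"

lemma Ef: "entire Ef" "Bf u = Ef u * \<sigma> u"
proof -
 have "\<exists>E. entire E & (\<forall>u. Bf u = E u * \<sigma> u)"
  by (rule sigma_divides[OF hol_Bf]) (rule Bf_zero)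
 from someI_ex[OF this] have "entire Ef & (\<forall>u. Bf u = Ef u * \<sigma> u)" unfolding Ef_def .
 thus "entire Ef" "Bf u = Ef u * \<sigma> u" by blast+
qed

definition Dl :: "complex^3 => complex" where
 "Dl u = \<sigma>2 1 1 u * \<sigma>2 3 3 u - \<sigma>2 1 2 u * \<sigma>2 2 3 u - \<sigma>2 1 3 u ^ 2 + \<sigma>2 1 3 u * \<sigma>2 2 2 u - Ef u"

lemma hol_Dl: "entire Dl"
 unfolding Dl_def[abs_def] by (intro hol_intros Ef)

text \<open>The part of the numerator free of \<open>\<sigma>\<close> cancels identically, and
  \<open>Bf\<close> contributes a further factor \<open>\<sigma>\<close> through \<open>Ef\<close>,
  so that \<open>Dl\<close> over \<open>\<sigma>^2\<close> remains.\<close>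

lemma Delta_quotient: "u ~: D ==> Delta_fun \<sigma> u = Dl u / \<sigma> u ^ 2"
proof -
 assume u: "u ~: D"
 hence nz: "\<sigma> u ~= 0" by (simp add: sigma_zero)
 have "n2 1 1 u * n2 3 3 u - n2 1 2 u * n2 2 3 u - n2 1 3 u ^ 2 + n2 1 3 u * n2 2 2 u
  = \<sigma> u * (\<sigma> u * (Dl u + Ef u) - Bf u)"
  unfolding n2_def Dl_def Bf_def by (simp add: algebra_simps power2_eq_square)
 also have "\<dots> = \<sigma> u ^ 2 * Dl u" unfolding Ef(2) by (simp add: algebra_simps power2_eq_square)
 finally have e: "n2 1 1 u * n2 3 3 u - n2 1 2 u * n2 2 3 u - n2 1 3 u ^ 2 + n2 1 3 u * n2 2 2 u = \<sigma> u ^ 2 * Dl u" .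
 have "Delta_fun \<sigma> u = (n2 1 1 u * n2 3 3 u - n2 1 2 u * n2 2 3 u - n2 1 3 u ^ 2 + n2 1 3 u * n2 2 2 u) / (\<sigma> u ^ 2 * \<sigma> u ^ 2)"
  unfolding Delta_fun_def wp2_n2[OF u] by (simp add: power_divide add_divide_distrib diff_divide_distrib power2_eq_square)
 thus ?thesis unfolding e using nz by (simp only: mult_divide_mult_cancel_left power_not_zero simp_thms)
qed

definition minor_hat :: "3 => 3 => 3 => 3 => complex^3 => complex" where
 "minor_hat i k j l u = \<sigma>1 i u * \<sigma>1 l u * \<sigma>2 k j u + \<sigma>1 k u * \<sigma>1 j u * \<sigma>2 i l u - \<sigma>1 i u * \<sigma>1 j u * \<sigma>2 k l u - \<sigma>1 k u * \<sigma>1 l u * \<sigma>2 i j u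
   + \<sigma> u * (\<sigma>2 i j u * \<sigma>2 k l u - \<sigma>2 i l u * \<sigma>2 k j u)"

text \<open>The matrix of products of first derivatives has rank one, so the leading part of a 2 by
  2 minor cancels and the denominator falls from the fourth to the third power.\<close>

lemma minor_quotient: "u ~: D ==> wp \<sigma> [i, j] u * wp \<sigma> [k, l] u - wp \<sigma> [i, l] u * wp \<sigma> [k, j] u = minor_hat i k j l u / \<sigma> u ^ 3"
proof -
 assume u: "u ~: D"
 have "n2 i j u * n2 k l u - n2 i l u * n2 k j u = \<sigma> u * minor_hat i k j l u"
  unfolding n2_def minor_hat_def by (simp add: algebra_simps power2_eq_square)
 thus ?thesis using u by (simp add: wp2_n2 sigma_zero divide_simps eval_nat_numeral)
qed

definition T_hat :: "complex^3 => complex" where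
 "T_hat u = \<sigma>2 2 2 u ^ 3 - 2 * \<sigma>1 2 u * \<sigma>2 2 2 u * \<sigma>3 2 2 2 u + \<sigma>1 2 u ^ 2 * partial 2 (\<sigma>3 2 2 2) u
   + \<sigma> u * (\<sigma>3 2 2 2 u ^ 2 - \<sigma>2 2 2 u * partial 2 (\<sigma>3 2 2 2) u)"

text \<open>The coefficients in T are such that the terms of degree 0, 1 and 2 in
  \<open>\<sigma>\<close> all cancel in the numerator over \<open>\<sigma>^6\<close>; in degree 0
  this is 2 + 4 - 6 = 0.\<close>

lemma T_quotient: "u ~: D ==> T_fun \<sigma> u = T_hat u / \<sigma> u ^ 3"
proof -
 assume u: "u ~: D"
 hence nz: "\<sigma> u ~= 0" by (simp add: sigma_zero)
 have "2 * n2 2 2 u ^ 3 + n3 2 2 2 u ^ 2 - n2 2 2 u * n4 u = \<sigma> u ^ 3 * T_hat u"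
  unfolding n2_def n3_def n4_def T_hat_def by (simp add: algebra_simps eval_nat_numeral)
 hence e: "(2 * n2 2 2 u ^ 3 + n3 2 2 2 u ^ 2 - n2 2 2 u * n4 u) / (\<sigma> u ^ 3 * \<sigma> u ^ 3) = T_hat u / \<sigma> u ^ 3"
  using nz by (simp only: mult_divide_mult_cancel_left power_not_zero simp_thms)
 have "T_fun \<sigma> u = (2 * n2 2 2 u ^ 3 + n3 2 2 2 u ^ 2 - n2 2 2 u * n4 u) / (\<sigma> u ^ 3 * \<sigma> u ^ 3)"
  unfolding T_fun_eq wp2_n2[OF u] wp3[OF u] wp4[OF u]
  by (simp add: power_divide add_divide_distrib diff_divide_distrib flip: power_mult power_add)
 thus ?thesis unfolding e .
qed

text \<open>A function together with its numerator over \<open>\<sigma>^3\<close>. Invariance is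
  under quasi-periods, as the dimension count requires, and the values on D are left open.\<close>

definition good :: "(complex^3 => complex) => (complex^3 => complex) => bool" where
 "good f F \<longleftrightarrow> entire F & (\<forall>u. u ~: D --> f u = F u / \<sigma> u ^ 3) &
   (\<forall>l u. quasi_period l --> u ~: D --> f (u + l) = f u)"

lemma hol_of_quotient:
 assumes "entire F" "!!u. u ~: D ==> f u = F u / \<sigma> u ^ m"
 shows "hol3 f (- D)"
 by (rule hol3_cong[OF hol3_divide[OF hol_off[OF assms(1)] hol_off[OF hol3_power[OF hol_sigma, of m]]]])
   (use assms(2) sigma_zero in auto)

lemma good_level: "good f F ==> F \<in> level 3"
 unfolding good_def by (rule levelI[where F=f]) (auto simp: sigma_zero)

lemma local_equation_sigma: "local_equation D UNIV \<sigma>"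
 unfolding local_equation_def
proof (intro conjI hol_sigma)
 have "{v. regular_zero \<sigma> v} <= {u \<in> D \<inter> UNIV. ~ (\<sigma> has_derivative (%_. 0)) (at u)}"
 proof
  fix v assume "v \<in> {v. regular_zero \<sigma> v}"
  then obtain i where v: "\<sigma> v = 0" "\<sigma>1 i v ~= 0" by (auto simp: regular_zero_def)
  have "~ (\<sigma> has_derivative (%_. 0)) (at v)"
   using partial_eqI[of \<sigma> 0 v i] v(2) by auto
  thus "v \<in> {u \<in> D \<inter> UNIV. ~ (\<sigma> has_derivative (%_. 0)) (at u)}" using v(1) sigma_zero by blast
 qed
 thus "D \<inter> UNIV <= closure {u \<in> D \<inter> UNIV. ~ (\<sigma> has_derivative (%_. 0)) (at u)}"
  using regular_dense closure_mono by blast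
qed (auto simp: sigma_zero)

text \<open>\<open>\<sigma>\<close> itself serves as local equation of D at every point; it is
  reduced because regular zeros are dense.\<close>

lemma good_Gamma: assumes g: "good f F" shows "off D f \<in> Gamma_space \<mu> 3"
proof -
 have F: "entire F" "!!u. u ~: D ==> f u = F u / \<sigma> u ^ 3" using g by (auto simp: good_def)
 have "hol3 (off D f) (- D)"
  by (rule hol3_cong[OF hol_of_quotient[OF F]]) (simp_all add: off_def)
 moreover have "\<forall>u\<in>UNIV - D. off D f u * \<sigma> u ^ 3 = F u" using F(2) sigma_zero by (auto simp: off_def)
 ultimately have "meromorphic_poles_le D 3 (off D f)"
  unfolding meromorphic_poles_le_def using local_equation_sigma F(1) by blast
 moreover have "off D f (u + l) = off D f u" if "l \<in> \<Lambda>" for u l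
 proof -
  have "f (u + l) = f u" if "u ~: D" using g lattice_quasi_period[OF \<open>l \<in> \<Lambda>\<close>] that unfolding good_def by blast
  thus ?thesis using quasi_period_D[OF lattice_quasi_period[OF that], of u] by (simp add: off_def)
 qed
 ultimately show ?thesis by (simp add: Gamma_space_def theta_preimage_eq) (simp add: off_def fun_eq_iff)
qed

lemma good_one: "good (%u. 1) (%u. \<sigma> u ^ 3)"
 unfolding good_def by (auto simp: sigma_zero intro: hol_intros)

lemma good_wp2: "good (wp \<sigma> [i, j]) (%u. \<sigma> u * n2 i j u)"
 unfolding good_def by (auto simp: sigma_zero wp2_n2 wp_periodic eval_nat_numeral intro: hol_intros)

lemma good_wp3: "good (wp \<sigma> [i, j, k]) (n3 i j k)"
 unfolding good_def by (auto simp: wp3 wp_periodic intro: hol_n3)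

lemma Delta_periodic: "quasi_period l ==> u ~: D ==> Delta_fun \<sigma> (u + l) = Delta_fun \<sigma> u"
 by (simp add: Delta_fun_def wp_periodic)

lemma good_Delta: "good (Delta_fun \<sigma>) (%u. \<sigma> u * Dl u)"
 unfolding good_def
 by (auto simp: sigma_zero Delta_quotient Delta_periodic eval_nat_numeral intro: hol_intros hol_Dl)

lemma good_partial_Delta: "good (partial i (Delta_fun \<sigma>)) (%u. \<sigma> u * partial i Dl u - 2 * \<sigma>1 i u * Dl u)"
 unfolding good_def
proof (intro conjI allI impI)
 show "partial i (Delta_fun \<sigma>) u = (\<sigma> u * partial i Dl u - 2 * \<sigma>1 i u * Dl u) / \<sigma> u ^ 3" if "u ~: D" for u
  using partial_quotient[OF hol_Dl Delta_quotient that, of i] by simp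
 show "partial i (Delta_fun \<sigma>) (u + l) = partial i (Delta_fun \<sigma>) u" if "quasi_period l" "u ~: D" for l u
  by (rule partial_periodic[OF that(1) hol_of_quotient[OF hol_Dl Delta_quotient] _ that(2), where k=0]) (simp_all add: Delta_periodic[OF that(1)])
qed (intro hol_intros hol3_partial_hol3 hol_Dl)

lemma good_minor: "good (%u. wp \<sigma> [i, j] u * wp \<sigma> [k, l] u - wp \<sigma> [i, l] u * wp \<sigma> [k, j] u) (minor_hat i k j l)"
proof -
 have "entire (minor_hat i k j l)" unfolding minor_hat_def[abs_def] by (intro hol_intros)
 thus ?thesis unfolding good_def by (auto simp: minor_quotient wp_periodic)
qed

lemma good_T: "good (T_fun \<sigma>) T_hat"
proof -
 have "entire T_hat" unfolding T_hat_def[abs_def] by (intro hol_intros hol3_partial_hol3[of "\<sigma>3 2 2 2"])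
 moreover have "T_fun \<sigma> (u + l) = T_fun \<sigma> u" if "quasi_period l" "u ~: D" for l u
  using that by (simp add: T_fun_eq wp_periodic)
 ultimately show ?thesis unfolding good_def using T_quotient by blast
qed

end

section \<open>Leading terms at the origin\<close>

text \<open>The leading homogeneous part at the origin, read off on every complex line through it.
  \<open>L\<close> may be 0, so a mere lower bound on the order can be expressed as well.\<close>

definition lead :: "(complex^3 => complex) => nat => (complex^3 => complex) => bool" where
 "lead F d L \<longleftrightarrow> (\<forall>w. ((%t. F (t *s w) / t ^ d) \<longlongrightarrow> L w) (at 0))"

lemma lead_mult: "lead F d L ==> lead G e M ==> lead (%u. F u * G u) (d + e) (%w. L w * M w)"
 unfolding lead_def power_add times_divide_times_eq[symmetric] by (intro allI tendsto_mult) blast+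

lemma lead_add: "lead F d L ==> lead G e M ==> d = e ==> lead (%u. F u + G u) d (%w. L w + M w)"
 unfolding lead_def by (simp add: add_divide_distrib tendsto_add)

lemma lead_diff: "lead F d L ==> lead G e M ==> d = e ==> lead (%u. F u - G u) d (%w. L w - M w)"
 unfolding lead_def by (simp add: diff_divide_distrib tendsto_diff)

lemma lead_power: "lead F d L ==> lead (%u. F u ^ n) (n * d) (%w. L w ^ n)"
 unfolding lead_def mult.commute[of n] power_mult power_divide[symmetric] by (intro allI tendsto_power) blast

lemma lead_const: "lead (%u. c) 0 (%w. c)"
 by (simp add: lead_def)

lemma lead_higher: "lead F d L ==> e < d ==> lead F e (%w. 0)"
proof -
 assume F: "lead F d L" and e: "e < d"
 have "((%t. F (t *s w) / t ^ e) \<longlongrightarrow> 0) (at 0)" for w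
 proof -
  have "((%t. F (t *s w) / t ^ d * t ^ (d - e)) \<longlongrightarrow> L w * 0 ^ (d - e)) (at 0)"
   using F by (intro tendsto_intros) (simp add: lead_def)
  hence "((%t. F (t *s w) / t ^ d * t ^ (d - e)) \<longlongrightarrow> 0) (at 0)" using e by (simp add: power_0_left)
  thus ?thesis
  proof (rule Lim_transform_within[OF _ zero_less_one])
   fix t :: complex assume "0 < dist t 0"
   moreover have "t ^ d = t ^ e * t ^ (d - e)" using e by (simp flip: power_add)
   ultimately show "F (t *s w) / t ^ d * t ^ (d - e) = F (t *s w) / t ^ e" by simp
  qed
 qed
 thus ?thesis by (simp add: lead_def)
qed

lemma lead_eq: "lead F d L ==> d = d' ==> (!!w. L w = L' w) ==> lead F d' L'"
 by (simp add: lead_def)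

lemma lead_unique: "lead F d L ==> lead F d M ==> L w = M w"
 unfolding lead_def using LIM_unique by blast

text \<open>After division by t^m the terms of higher degree tend to 0, and those of lower degree
  have coefficient 0 by \<open>low\<close>.\<close>

lemma lead_combination:
 assumes I: "finite I" and z: "!!u. (\<Sum>i\<in>I. x i * F i u) = 0" and l: "!!i. i \<in> I ==> lead (F i) (d i) (L i)"
  and low: "!!i. i \<in> I ==> d i < m ==> x i = 0"
 shows "(\<Sum>i\<in>I. if d i = m then x i * L i w else 0) = 0"
proof -
 have "((%t. \<Sum>i\<in>I. x i * (F i (t *s w) / t ^ m)) \<longlongrightarrow> (\<Sum>i\<in>I. if d i = m then x i * L i w else 0)) (at 0)"
 proof (rule tendsto_sum)
  fix i assume i: "i \<in> I"
  consider "d i < m" | "d i = m" | "m < d i" by linarith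
  thus "((%t. x i * (F i (t *s w) / t ^ m)) \<longlongrightarrow> (if d i = m then x i * L i w else 0)) (at 0)"
  proof cases
   case 1
   thus ?thesis using low[OF i] by simp
  next
   case 2
   hence "((%t. F i (t *s w) / t ^ m) \<longlongrightarrow> L i w) (at 0)" using l[OF i] by (simp add: lead_def)
   from tendsto_mult[OF tendsto_const[of "x i"] this] show ?thesis using 2 by simp
  next
   case 3
   hence "((%t. F i (t *s w) / t ^ m) \<longlongrightarrow> 0) (at 0)" using lead_higher[OF l[OF i] 3] by (simp add: lead_def)
   from tendsto_mult[OF tendsto_const[of "x i"] this] show ?thesis using 3 by simp
  qed
 qed
 moreover have "(\<Sum>i\<in>I. x i * (F i (t *s w) / t ^ m)) = 0" for t
 proof -
  have "(\<Sum>i\<in>I. x i * (F i (t *s w) / t ^ m)) = (\<Sum>i\<in>I. x i * F i (t *s w)) / t ^ m"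
   by (simp add: sum_divide_distrib)
  thus ?thesis by (simp add: z)
 qed
 ultimately show ?thesis using LIM_unique[OF tendsto_const] by fastforce
qed

text \<open>Gradient, Hessian and value of the leading form \<open>u\<^sub>1 u\<^sub>3 - u\<^sub>2\<^sup>2\<close> of \<open>\<sigma>\<close> at the origin.\<close>

definition gq :: "3 => complex^3 => complex" where
 "gq i w = (if i = 1 then w $ 3 else if i = 2 then - 2 * w $ 2 else w $ 1)"

definition Hq :: "3 => 3 => complex" where
 "Hq i j = (if i = 2 & j = 2 then - 2 else if i = 1 & j = 3 | i = 3 & j = 1 then 1 else 0)"

definition qq :: "complex^3 => complex" where
 "qq w = w $ 1 * w $ 3 - (w $ 2)^2"

context sigma_curve
begin

lemma lead_entire: "entire F ==> lead F 0 (%w. F 0)"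
 by (simp add: lead_def line_limit)

lemma lead_\<sigma>: "lead \<sigma> 2 (%w. \<kappa> * qq w)"
 by (simp add: lead_def qq_def sigma_limit)

lemma lead_\<sigma>1: "lead (\<sigma>1 i) 1 (%w. \<kappa> * gq i w)"
proof -
 have "\<kappa> * gq i w = (if i = 1 then \<kappa> * w $ 3 else if i = 2 then - 2 * \<kappa> * w $ 2 else \<kappa> * w $ 1)" for w
  by (simp add: gq_def)
 thus ?thesis unfolding lead_def using partial_limit[of i] by simp
qed

lemma lead_\<sigma>2: "lead (\<sigma>2 i j) 0 (%w. \<kappa> * Hq i j)"
 by (rule lead_eq[OF lead_entire[OF hol_partials(2)]]) (use exhaust_3[of i] exhaust_3[of j] in \<open>auto simp: hess_0 Hq_def\<close>)

lemma lead_n2: "lead (n2 i j) 2 (%w. \<kappa>^2 * (gq i w * gq j w - qq w * Hq i j))"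
 unfolding n2_def
 by (rule lead_eq, (rule lead_diff lead_mult lead_\<sigma> lead_\<sigma>1 lead_\<sigma>2 | (simp; fail))+) (simp_all add: algebra_simps power2_eq_square)

lemma lead_one: "lead (%u. \<sigma> u ^ 3) 6 (%w. \<kappa>^3 * qq w ^ 3)"
 by (rule lead_eq[OF lead_power[OF lead_\<sigma>]]) (simp_all add: power_mult_distrib)

lemma lead_wp2: "lead (%u. \<sigma> u * n2 i j u) 4 (%w. \<kappa>^3 * (qq w * (gq i w * gq j w - qq w * Hq i j)))"
 by (rule lead_eq[OF lead_mult[OF lead_\<sigma> lead_n2]]) (simp_all add: eval_nat_numeral)

lemma lead_n3: "lead (n3 i j k) 3 (%w. \<kappa>^3 * (qq w * (Hq i j * gq k w + Hq i k * gq j w + Hq j k * gq i w) - 2 * gq i w * gq j w * gq k w))"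
proof -
 have h: "lead (%u. \<sigma> u ^ 2 * \<sigma>3 i j k u) 3 (%w. 0)"
  by (rule lead_higher[OF lead_mult[OF lead_power[OF lead_\<sigma>] lead_entire[OF hol_\<sigma>3]]]) simp
 show ?thesis unfolding n3_def
  by (rule lead_eq, (rule h lead_add lead_diff lead_mult lead_const lead_\<sigma> lead_\<sigma>1 lead_\<sigma>2 | (simp; fail))+)
    (simp_all add: algebra_simps eval_nat_numeral)
qed

text \<open>The value of \<open>Ef\<close> at the origin is the ratio of the leading forms of
  \<open>Bf\<close> and \<open>\<sigma>\<close>, compared in the direction (1, 0, 1), where u1 u3 -
  u2^2 is 1. It is -4 \<open>\<kappa>^2\<close>, and the Hessian terms contribute -3
  \<open>\<kappa>^2\<close>.\<close>

lemma Dl_0: "Dl 0 = \<kappa>^2"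
proof -
 have 1: "lead Bf 2 (%w. \<kappa>^3 * (gq 3 w * (0 - 0) - 2 * gq 1 w * gq 3 w - 2 * gq 1 w * gq 3 w + gq 2 w ^ 2))"
  unfolding Bf_def
  by (rule lead_eq, (rule lead_add lead_diff lead_mult lead_const lead_power lead_\<sigma> lead_\<sigma>1 lead_\<sigma>2 | (simp; fail))+)
    (simp_all add: algebra_simps eval_nat_numeral Hq_def)
 have 2: "lead Bf 2 (%w. Ef 0 * (\<kappa> * qq w))"
  unfolding Ef(2) by (rule lead_eq[OF lead_mult[OF lead_entire[OF Ef(1)] lead_\<sigma>]]) simp_all
 have "\<kappa>^3 * (- 4) = Ef 0 * \<kappa>"
  using lead_unique[OF 1 2, of "vector [1, 0, 1]"] by (simp add: gq_def qq_def)
 moreover have "(Ef 0 - - 4 * \<kappa>^2) * \<kappa> = Ef 0 * \<kappa> - \<kappa>^3 * (- 4)" by (simp add: eval_nat_numeral algebra_simps)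
 ultimately have "(Ef 0 - - 4 * \<kappa>^2) * \<kappa> = 0" by simp
 hence "Ef 0 = - 4 * \<kappa>^2" using kappa_nz by (simp add: eq_neg_iff_add_eq_0)
 thus ?thesis by (simp add: Dl_def hess_0 power2_eq_square)
qed

lemma lead_Dl: "lead Dl 0 (%w. \<kappa>^2)"
 using lead_entire[OF hol_Dl] by (simp add: Dl_0)

lemma lead_Delta: "lead (%u. \<sigma> u * Dl u) 2 (%w. \<kappa>^3 * qq w)"
 by (rule lead_eq[OF lead_mult[OF lead_\<sigma> lead_Dl]]) (simp_all add: eval_nat_numeral)

lemma lead_partial_Delta: "lead (%u. \<sigma> u * partial i Dl u - 2 * \<sigma>1 i u * Dl u) 1 (%w. \<kappa>^3 * (- 2 * gq i w))"
proof -
 have h: "lead (%u. \<sigma> u * partial i Dl u) 1 (%w. 0)"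
  by (rule lead_higher[OF lead_mult[OF lead_\<sigma> lead_entire[OF hol3_partial_hol3[OF hol_Dl]]]]) simp
 show ?thesis
  by (rule lead_eq, (rule h lead_diff lead_mult lead_const lead_\<sigma>1 lead_Dl | (simp; fail))+) (simp_all add: eval_nat_numeral)
qed

lemma lead_minor: "lead (minor_hat i k j l) 2 (%w. \<kappa>^3 * (gq i w * gq l w * Hq k j + gq k w * gq j w * Hq i l - gq i w * gq j w * Hq k l
  - gq k w * gq l w * Hq i j + qq w * (Hq i j * Hq k l - Hq i l * Hq k j)))"
 unfolding minor_hat_def
 by (rule lead_eq, (rule lead_add lead_diff lead_mult lead_const lead_\<sigma> lead_\<sigma>1 lead_\<sigma>2 | (simp; fail))+)
   (simp_all add: algebra_simps eval_nat_numeral)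

lemma lead_T: "lead T_hat 0 (%w. \<kappa>^3 * (- 8))"
proof -
 have "entire T_hat" using good_T by (simp add: good_def)
 from lead_entire[OF this] show ?thesis
  by (rule lead_eq) (simp_all add: T_hat_def hess_0 grad_0 sigma_on_D[OF zero_in_D] eval_nat_numeral)
qed

section \<open>The 27 functions: independence and span\<close>

definition basis_funs :: "(complex^3 => complex) list" where
 "basis_funs = [%u. 1, wp \<sigma> [1,1], wp \<sigma> [1,2], wp \<sigma> [1,3], wp \<sigma> [2,2], wp \<sigma> [2,3], wp \<sigma> [3,3],
    Delta_fun \<sigma>,
    wp \<sigma> [1,1,1], wp \<sigma> [1,1,2], wp \<sigma> [1,1,3], wp \<sigma> [1,2,2], wp \<sigma> [1,2,3],
    wp \<sigma> [1,3,3], wp \<sigma> [2,2,2], wp \<sigma> [2,2,3], wp \<sigma> [2,3,3], wp \<sigma> [3,3,3],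
    partial 1 (Delta_fun \<sigma>), partial 2 (Delta_fun \<sigma>), partial 3 (Delta_fun \<sigma>),
    wp_minor \<sigma> 1 1, wp_minor \<sigma> 1 2, wp_minor \<sigma> 1 3, wp_minor \<sigma> 2 3, wp_minor \<sigma> 3 3,
    T_fun \<sigma>]"

text \<open>Numerators over \<open>\<sigma>^3\<close>, aligned with \<open>basis_funs\<close>. In
  the index tuples of the minors the two rows precede the two columns.\<close>

definition hats :: "(complex^3 => complex) list" where
 "hats = (%u. \<sigma> u ^ 3) # map (%(i, j) u. \<sigma> u * n2 i j u) [(1,1), (1,2), (1,3), (2,2), (2,3), (3,3)] @ [%u. \<sigma> u * Dl u] @
   map (%(i, j, k). n3 i j k) [(1,1,1), (1,1,2), (1,1,3), (1,2,2), (1,2,3), (1,3,3), (2,2,2), (2,2,3), (2,3,3), (3,3,3)] @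
   map (%i u. \<sigma> u * partial i Dl u - 2 * \<sigma>1 i u * Dl u) [1, 2, 3] @
   map (%(i, k, j, l). minor_hat i k j l) [(2,3,2,3), (2,3,1,3), (2,3,1,2), (1,3,1,2), (1,2,1,2)] @ [T_hat]"

text \<open>Degree and leading form of each entry of \<open>hats\<close>, with the common factor
  \<open>\<kappa>^3\<close> removed.\<close>

definition leads :: "(nat \<times> (complex^3 => complex)) list" where
 "leads = (6, %w. qq w ^ 3) # map (%(i, j). (4, %w. qq w * (gq i w * gq j w - qq w * Hq i j))) [(1,1), (1,2), (1,3), (2,2), (2,3), (3,3)] @
   [(2, qq)] @
   map (%(i, j, k). (3, %w. qq w * (Hq i j * gq k w + Hq i k * gq j w + Hq j k * gq i w) - 2 * gq i w * gq j w * gq k w))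
    [(1,1,1), (1,1,2), (1,1,3), (1,2,2), (1,2,3), (1,3,3), (2,2,2), (2,2,3), (2,3,3), (3,3,3)] @
   map (%i. (1, %w. - 2 * gq i w)) [1, 2, 3] @
   map (%(i, k, j, l). (2, %w. gq i w * gq l w * Hq k j + gq k w * gq j w * Hq i l - gq i w * gq j w * Hq k l
    - gq k w * gq l w * Hq i j + qq w * (Hq i j * Hq k l - Hq i l * Hq k j))) [(2,3,2,3), (2,3,1,3), (2,3,1,2), (1,3,1,2), (1,2,1,2)] @
   [(0, %w. - 8)]"

lemma wp_minor_good:
 "good (wp_minor \<sigma> 1 1) (minor_hat 2 3 2 3)" "good (wp_minor \<sigma> 1 2) (minor_hat 2 3 1 3)" "good (wp_minor \<sigma> 1 3) (minor_hat 2 3 1 2)"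
 "good (wp_minor \<sigma> 2 3) (minor_hat 1 3 1 2)" "good (wp_minor \<sigma> 3 3) (minor_hat 1 2 1 2)"
 unfolding wp_minor_def[abs_def] other_indices_def by (simp_all add: good_minor)

lemma good_basis: "list_all2 good basis_funs hats"
 unfolding basis_funs_def hats_def
 by (simp add: good_one good_wp2 good_wp3 good_Delta good_partial_Delta wp_minor_good good_T)

lemma lead_hats: "list_all2 (%F (d, L). lead F d (%w. \<kappa>^3 * L w)) hats leads"
 unfolding hats_def leads_def
 by (simp only: list.map append.simps list_all2_Cons list_all2_Nil prod.case simp_thms)
   (intro conjI lead_one lead_wp2 lead_n3 lead_Delta lead_partial_Delta lead_minor lead_T)

lemma length_lists: "length basis_funs = 27" "length hats = 27" "length leads = 27"
 by (simp_all add: basis_funs_def hats_def leads_def)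

end

lemma sum_27: "(\<Sum>i<27::nat. f i) = f 0 + f 1 + f 2 + f 3 + f 4 + f 5 + f 6 + f 7 + f 8 + f 9 + f 10 + f 11 + f 12 + f 13 + f 14 + f 15
 + f 16 + f 17 + f 18 + f 19 + f 20 + f 21 + f 22 + f 23 + f 24 + f 25 + (f 26 :: complex)"
 by (simp add: eval_nat_numeral)

lemma all_27: "(\<forall>i<27::nat. P i) \<longleftrightarrow> P 0 & P 1 & P 2 & P 3 & P 4 & P 5 & P 6 & P 7 & P 8 & P 9 & P 10 & P 11 & P 12 & P 13
 & P 14 & P 15 & P 16 & P 17 & P 18 & P 19 & P 20 & P 21 & P 22 & P 23 & P 24 & P 25 & P 26"
 by (simp add: eval_nat_numeral All_less_Suc conj_ac)

text \<open>Coefficients are indexed by positions, so a repeated entry would itself give a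
  nontrivial relation; distinctness and independence come together.\<close>

lemma basis_from_coefficients:
 assumes "!!x :: nat => complex. (!!u. (\<Sum>i<length bs. x i * (bs ! i) u) = 0) ==> \<forall>i<length bs. x i = 0"
 shows "distinct bs & fun_space.independent (set bs)"
proof -
 have d: "distinct bs"
 proof (rule ccontr)
  assume "~ distinct bs"
  then obtain i j where ij: "i < length bs" "j < length bs" "i ~= j" "bs ! i = bs ! j" by (auto simp: distinct_conv_nth)
  define x where "x = (%k. if k = i then 1 else if k = j then - 1 else 0 :: complex)"
  have "(\<Sum>k<length bs. x k * (bs ! k) u) = (\<Sum>k\<in>{i, j}. x k * (bs ! k) u)" for u
   by (rule sum.mono_neutral_right) (use ij in \<open>auto simp: x_def\<close>)
  hence "(\<Sum>k<length bs. x k * (bs ! k) u) = 0" for u using ij(3,4) by (simp add: x_def)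
  from assms[OF this] ij(1) show False by (auto simp: x_def)
 qed
 have "fun_space.independent (set bs)"
 proof (rule fun_space.independent_if_scalars_zero)
  fix f v assume z: "(\<Sum>x\<in>set bs. fun_scale (f x) x) = 0" and v: "v \<in> set bs"
  have apply_sum: "(\<Sum>x\<in>S. g x) u = (\<Sum>x\<in>S. g x u)" if "finite S" for S and g :: "('a => complex) => 'a => complex" and u
   using that by (induction S) auto
  have "(\<Sum>i<length bs. f (bs ! i) * (bs ! i) u) = 0" for u
  proof -
   have "(\<Sum>i<length bs. f (bs ! i) * (bs ! i) u) = (\<Sum>x\<in>set bs. f x * x u)"
    using sum.reindex_bij_betw[OF bij_betw_nth[OF d HOL.refl HOL.refl], of "%x. f x * x u"] by simp
   also have "\<dots> = (\<Sum>x\<in>set bs. fun_scale (f x) x) u" by (simp add: apply_sum fun_scale_def)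
   finally show ?thesis by (simp add: z)
  qed
  from assms[OF this] show "f v = 0" using v by (auto simp: in_set_conv_nth)
 qed simp
 with d show ?thesis by blast
qed

lemma add_sub_zero: "x + y = 0 ==> y - x = 0 ==> x = 0 & y = (0::complex)"
proof -
 assume "x + y = 0" "y - x = 0"
 moreover have "2 * y = (x + y) + (y - x)" by simp
 ultimately show ?thesis by simp
qed

context sigma_curve
begin

text \<open>Coefficients are eliminated in the order of the degrees 0, 1, 2, 3, 4, 6, which occur 1,
  3, 6, 10, 6, 1 times. Up to degree three the leading forms are as many as the monomials of that
  degree; those of degree four are q = u1 u3 - u2^2 times quadratic forms, and the last is q^3. Each
  degree is settled at small integer points.\<close>

lemma hats_independent:
 assumes z: "!!u. (\<Sum>i<27. x i * (hats ! i) u) = 0"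
 shows "\<forall>i<27. x i = 0"
proof -
 have R: "(\<Sum>i<27. if fst (leads ! i) = m then x i * snd (leads ! i) w else 0) = 0"
  if "\<forall>i<27. fst (leads ! i) < m --> x i = 0" for m w
 proof -
  have "(\<Sum>i<27. if fst (leads ! i) = m then x i * (\<kappa>^3 * snd (leads ! i) w) else 0) = 0"
  proof (rule lead_combination[OF _ z])
   show "lead (hats ! i) (fst (leads ! i)) (%w. \<kappa>^3 * snd (leads ! i) w)" if "i \<in> {..<27}" for i
    using list_all2_nthD[OF lead_hats, of i] that length_lists by (simp add: case_prod_beta)
  qed (use that in auto)
  also have "(\<Sum>i<27. if fst (leads ! i) = m then x i * (\<kappa>^3 * snd (leads ! i) w) else 0) =
    \<kappa>^3 * (\<Sum>i<27. if fst (leads ! i) = m then x i * snd (leads ! i) w else 0)"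
   unfolding sum_distrib_left by (rule sum.cong) auto
  finally show ?thesis using kappa_nz by simp
 qed
 define v where "v = (%a b c. vector [a, b, c] :: complex^3)"
 define degs :: "nat list" where "degs = [6, 4, 4, 4, 4, 4, 4, 2, 3, 3, 3, 3, 3, 3, 3, 3, 3, 3, 1, 1, 1, 2, 2, 2, 2, 2, 0]"
 define vals where "vals = (%a b c :: complex. let q = a * c - b^2 in [q^3, q * c^2, q * (- 2 * b * c), q * b^2, q * (2 * b^2 + 2 * a * c),
  q * (- 2 * a * b), q * a^2, q, - 2 * c^3, 4 * b * c^2, - 2 * b^2 * c, - 6 * b^2 * c - 2 * a * c^2, 2 * a * b * c + 2 * b^3, - 2 * a * b^2,
  4 * b^3 + 12 * a * b * c, - 6 * a * b^2 - 2 * a^2 * c, 4 * a^2 * b, - 2 * a^3, - 2 * c, 4 * b, - 2 * a,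
  2 * a^2, - 2 * a * b, 2 * b^2, - 2 * b * c, 2 * c^2, - 8])"
 have "map fst leads = degs" by (simp add: leads_def degs_def)
 hence degs: "fst (leads ! i) = degs ! i" if "i < 27" for i using length_lists that by (metis nth_map)
 have "map (%l. snd l (v a b c)) leads = vals a b c" for a b c
  by (simp add: leads_def vals_def v_def gq_def Hq_def qq_def Let_def algebra_simps power2_eq_square power3_eq_cube)
 hence vals: "snd (leads ! i) (v a b c) = vals a b c ! i" if "i < 27" for i a b c using length_lists that by (metis nth_map)
 have R: "(\<Sum>i<27. if degs ! i = m then x i * vals a b c ! i else 0) = 0" if "\<forall>i<27. degs ! i < m --> x i = 0" for m a b c
 proof -
  have "(\<Sum>i<27. if degs ! i = m then x i * vals a b c ! i else 0) = (\<Sum>i<27. if fst (leads ! i) = m then x i * snd (leads ! i) (v a b c) else 0)"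
   by (rule sum.cong) (auto simp: degs vals)
  thus ?thesis using R[of m "v a b c"] that degs by simp
 qed
 note R = R[unfolded sum_27 all_27]
 note l = degs_def vals_def Let_def
 have "x 26 = 0" using R[of 0 0 0 0] by (simp add: l)
 note x = this
 have R1: "x 18 * (- 2 * c) + x 19 * (4 * b) + x 20 * (- 2 * a) = 0" for a b c
  using R[of 1 a b c] x by (simp add: l)
 \<comment> \<open>The arguments of \<open>of\<close> follow the order in which the variables occur
   in the statement: c, b, a here and in degree three, but a, c, b in degrees two and four.\<close>
 have "x 18 = 0" "x 19 = 0" "x 20 = 0" using R1[of 1 0 0] R1[of 0 1 0] R1[of 0 0 1] by simp_all
 note x = x this
 have R2: "x 7 * (a * c - b^2) + x 21 * (2 * a^2) + x 22 * (- 2 * a * b) + x 23 * (2 * b^2) + x 24 * (- 2 * b * c) + x 25 * (2 * c^2) = 0" for a b c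
  using R[of 2 a b c] x by (simp add: l)
 have 1: "x 21 = 0" "x 25 = 0" using R2[of 1 0 0] R2[of 0 1 0] by simp_all
 have 2: "x 7 = 0" using R2[of 1 1 0] 1 by simp
 have "x 23 = 0" "x 22 = 0" "x 24 = 0" using R2[of 0 0 1] R2[of 1 0 1] R2[of 0 1 1] 1 2 by simp_all
 note x = x 1 2 this
 have R3: "x 8 * (- 2 * c^3) + x 9 * (4 * b * c^2) + x 10 * (- 2 * b^2 * c) + x 11 * (- 6 * b^2 * c - 2 * a * c^2)
  + x 12 * (2 * a * b * c + 2 * b^3) + x 13 * (- 2 * a * b^2) + x 14 * (4 * b^3 + 12 * a * b * c) + x 15 * (- 6 * a * b^2 - 2 * a^2 * c)
  + x 16 * (4 * a^2 * b) + x 17 * (- 2 * a^3) = 0" for a b c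
  using R[of 3 a b c] x by (simp add: l)
 have 1: "x 8 = 0" "x 17 = 0" using R3[of 1 0 0] R3[of 0 0 1] by simp_all
 \<comment> \<open>Points that differ in the sign of one coordinate separate the forms even in it
   from those odd in it.\<close>
 have "x 11 + x 15 = 0" "x 15 - x 11 = 0" using R3[of 1 0 1] R3[of "-1" 0 1] 1 by (simp_all add: algebra_simps)
 hence 2: "x 11 = 0" "x 15 = 0" using add_sub_zero by blast+
 have "2 * x 12 + 4 * x 14 = 0" using R3[of 0 1 0] 1 2 by (simp add: algebra_simps)
 moreover have "2 * x 12 + 4 * x 14 = 2 * (x 12 + 2 * x 14)" by simp
 ultimately have "2 * (x 12 + 2 * x 14) = 0" by (simp only:)
 hence b: "x 12 + 2 * x 14 = 0" by (simp only: mult_eq_0_iff) simp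
 have b': "x 12 = - (2 * x 14)" using b by (simp add: eq_neg_iff_add_eq_0)
 have "4 * x 9 + 2 * x 10 = 0" "2 * x 10 - 4 * x 9 = 0" using R3[of "-1" 1 0] R3[of 1 1 0] 1 2 by (simp_all add: b' algebra_simps)
 hence 3: "x 9 = 0" "x 10 = 0" using add_sub_zero[of "4 * x 9" "2 * x 10"] by simp_all
 have "4 * x 16 + 2 * x 13 = 0" "2 * x 13 - 4 * x 16 = 0" using R3[of 0 1 "-1"] R3[of 0 1 1] 1 2 by (simp_all add: b' algebra_simps)
 hence 4: "x 16 = 0" "x 13 = 0" using add_sub_zero[of "4 * x 16" "2 * x 13"] by simp_all
 have "x 14 = 0" using R3[of 1 1 1] 1 2 3 4 by (simp add: b' algebra_simps)
 hence "x 12 = 0" "x 14 = 0" using b' by simp_all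
 note x = x 1 2 3 4 this
 have R4: "(a * c - b^2) * (x 1 * c^2 + x 2 * (- 2 * b * c) + x 3 * b^2 + x 4 * (2 * b^2 + 2 * a * c) + x 5 * (- 2 * a * b) + x 6 * a^2) = 0" for a b c
  using R[of 4 a b c] x by (simp add: l algebra_simps)
 \<comment> \<open>The common factor q is cancelled where it does not vanish; the sample points
   below avoid its zeros.\<close>
 have R4': "x 1 * c^2 + x 2 * (- 2 * b * c) + x 3 * b^2 + x 4 * (2 * b^2 + 2 * a * c) + x 5 * (- 2 * a * b) + x 6 * a^2 = 0"
  if "a * c - b^2 ~= 0" for a b c using R4[of a c b] that by simp
 have 1: "x 1 + 2 * x 4 + x 6 = 0" "x 1 - 2 * x 4 + x 6 = 0" "4 * x 1 + 4 * x 4 + x 6 = 0" "x 3 + 2 * x 4 = 0"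
  subgoal using R4'[of 1 1 0] by (simp add: mult.commute)
  subgoal using R4'[of 1 "-1" 0] by (simp add: mult.commute)
  subgoal using R4'[of 1 2 0] by (simp add: mult.commute)
  subgoal using R4'[of 0 0 1] by (simp add: mult.commute)
  done
 have "4 * x 4 = (x 1 + 2 * x 4 + x 6) - (x 1 - 2 * x 4 + x 6)" by simp
 hence 2: "x 4 = 0" unfolding 1 by simp
 have e: "x 1 + x 6 = 0" "4 * x 1 + x 6 = 0" using 1(1,3) 2 by simp_all
 have "3 * x 1 = (4 * x 1 + x 6) - (x 1 + x 6)" by simp
 hence 3: "x 1 = 0" unfolding e by simp
 have 4: "x 6 = 0" "x 3 = 0" using 1 2 3 by simp_all
 have "x 2 = 0" "x 5 = 0" using R4'[of 0 1 1] R4'[of 1 0 1] 2 3 4 by simp_all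
 note x = x 2 3 4 this
 have "x 0 = 0" using R[of 6 1 0 1] x by (simp add: l)
 thus ?thesis unfolding all_27 using x by simp
qed

lemma nth_basis_good: "i < 27 ==> good (basis_funs ! i) (hats ! i)"
 using list_all2_nthD[OF good_basis, of i] length_lists by simp

text \<open>A local equation f is reduced and has the zeros of \<open>\<sigma>\<close>, so
  \<open>\<sigma>\<close> = G f locally; then g \<open>\<sigma>^3\<close> = G^3 (g f^3) extends
  holomorphically, and the extensions glue. Invariance under quasi-periods comes from
  \<open>quasi_period_lattice\<close>.\<close>

lemma Gamma_good:
 assumes g: "g \<in> Gamma_space \<mu> 3"
 shows "off D g = g & (\<exists>F. good g F)"
proof -
 have m: "meromorphic_poles_le D 3 g" and o: "off D g = g" and per: "!!u l. l \<in> \<Lambda> ==> g (u + l) = g u"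
  using g by (auto simp: Gamma_space_def theta_preimage_eq)
 have hg: "hol3 g (- D)" using m by (simp add: meromorphic_poles_le_def)
 have "\<exists>F. entire F & (\<forall>u. u ~: D --> F u = g u * \<sigma> u ^ 3)"
 proof (rule extension_glue[OF hol3_mult[OF hg hol_off[OF hol3_power[OF hol_sigma]]] dense_off])
  fix u0 assume "u0 \<in> D"
  then obtain U f h where U: "u0 \<in> U" "local_equation D U f" "hol3 h U" "!!u. u \<in> U - D ==> g u * f u ^ 3 = h u"
   using m unfolding meromorphic_poles_le_def by blast
  have p: "hol3 f U" "{u \<in> U. f u = 0} = D \<inter> U"
   "D \<inter> U <= closure {u \<in> D \<inter> U. ~ (f has_derivative (%_. 0)) (at u)}" using U(2) by (auto simp: local_equation_def)
  have "{u \<in> D \<inter> U. ~ (f has_derivative (%_. 0)) (at u)} <= {v \<in> U. regular_zero f v}"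
  proof
   fix u assume u: "u \<in> {u \<in> D \<inter> U. ~ (f has_derivative (%_. 0)) (at u)}"
   have "\<exists>i. partial i f u ~= 0"
   proof (rule ccontr)
    assume "~ ?thesis"
    hence "(f has_derivative (%_. 0)) (at u)" using hol3_derivative[OF p(1), of u] u by simp
    thus False using u by simp
   qed
   thus "u \<in> {v \<in> U. regular_zero f v}" using u p(2) by (auto simp: regular_zero_def)
  qed
  hence red: "{v \<in> U. f v = 0} <= closure {v \<in> U. regular_zero f v}" using p(2,3) closure_mono by blast
  have van: "\<sigma> v = 0" if "v \<in> U" "f v = 0" for v using that p(2) sigma_zero by blast
  obtain d G where G: "d > 0" "ball u0 d <= U" "hol3 G (ball u0 d)" "!!u. u \<in> ball u0 d ==> \<sigma> u = G u * f u"
   using division_local[OF p(1) hol3_subset[OF hol_sigma subset_UNIV hol3_open[OF p(1)]] red van U(1)] by blast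
  show "\<exists>d>0. \<exists>F. hol3 F (ball u0 d) & (\<forall>u\<in>ball u0 d - D. F u = g u * \<sigma> u ^ 3)"
  proof (intro exI[of _ d] conjI exI[of _ "%u. G u ^ 3 * h u"] ballI G(1))
   show "hol3 (%u. G u ^ 3 * h u) (ball u0 d)"
    by (intro hol3_mult hol3_power G(3) hol3_subset[OF U(3) G(2)] open_ball)
   show "G u ^ 3 * h u = g u * \<sigma> u ^ 3" if "u \<in> ball u0 d - D" for u
   proof -
    have "g u * f u ^ 3 = h u" by (rule U(4)) (use that G(2) in blast)
    thus ?thesis using G(4)[of u] that by (simp add: power_mult_distrib)
   qed
  qed
 qed auto
 then obtain F where F: "entire F" "!!u. u ~: D ==> F u = g u * \<sigma> u ^ 3" by blast
 have "good g F" unfolding good_def using F per quasi_period_lattice by (auto simp: sigma_zero)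
 thus ?thesis using o by blast
qed

lemma Gamma_iff: "g \<in> Gamma_space \<mu> 3 \<longleftrightarrow> off D g = g & (\<exists>F. good g F)"
 using Gamma_good good_Gamma by metis

lemma off_fixed: "off S f = f \<longleftrightarrow> (\<forall>u\<in>S. f u = 0)"
 by (auto simp: off_def fun_eq_iff)

lemma Gamma_subspace: "fun_space.subspace (Gamma_space \<mu> 3)"
proof (rule fun_space.subspaceI)
 have "good 0 (%_. 0)" unfolding good_def by simp
 moreover have "off D 0 = 0" by (simp add: off_def fun_eq_iff)
 ultimately show "0 \<in> Gamma_space \<mu> 3" unfolding Gamma_iff by blast
next
 fix f g assume "f \<in> Gamma_space \<mu> 3" "g \<in> Gamma_space \<mu> 3"
 then obtain F G where fg: "off D f = f" "good f F" "off D g = g" "good g G" unfolding Gamma_iff by blast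
 have "good (f + g) (%u. F u + G u)" using fg(2,4) by (auto simp: good_def add_divide_distrib intro: hol3_add)
 moreover have "off D (f + g) = f + g" using fg(1,3) by (simp add: off_fixed)
 ultimately show "f + g \<in> Gamma_space \<mu> 3" unfolding Gamma_iff by blast
next
 fix f k assume "f \<in> Gamma_space \<mu> 3"
 then obtain F where f: "off D f = f" "good f F" unfolding Gamma_iff by blast
 have "good (fun_scale k f) (%u. k * F u)" using f(2) by (auto simp: good_def fun_scale_def intro: hol3_mult)
 moreover have "off D (fun_scale k f) = fun_scale k f" using f(1) by (simp add: off_fixed fun_scale_def)
 ultimately show "fun_scale k f \<in> Gamma_space \<mu> 3" unfolding Gamma_iff by blast
qed

lemma basis_independent:
 "distinct (map (off D) basis_funs) & fun_space.independent (set (map (off D) basis_funs))"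
proof (rule basis_from_coefficients)
 fix x assume z: "!!u. (\<Sum>i<length (map (off D) basis_funs). x i * (map (off D) basis_funs ! i) u) = 0"
 have "(\<Sum>i<27. x i * (hats ! i) u) = 0" for u
 proof (rule eq_off_dense)
  show "hol3 (%u. \<Sum>i<27. x i * (hats ! i) u) UNIV"
   by (intro hol3_sum hol3_mult hol3_const) (use nth_basis_good in \<open>auto simp: good_def\<close>)
  fix u assume u: "u ~: D"
  have "(\<Sum>i<27. x i * (hats ! i) u) = (\<Sum>i<27. x i * (basis_funs ! i) u * \<sigma> u ^ 3)"
   by (rule sum.cong) (use nth_basis_good u in \<open>auto simp: good_def sigma_zero\<close>)
  also have "\<dots> = (\<Sum>i<27. x i * (basis_funs ! i) u) * \<sigma> u ^ 3" by (simp add: sum_distrib_right)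
  also have "(\<Sum>i<27. x i * (basis_funs ! i) u) = 0" using z[of u] u by (simp add: length_lists off_def)
  finally show "(\<Sum>i<27. x i * (hats ! i) u) = 0" by simp
 qed simp
 from hats_independent[OF this] show "\<forall>i<length (map (off D) basis_funs). x i = 0" by (simp add: length_lists)
qed

text \<open>One more numerator makes 28 elements of a level of dimension at most 27; independence of
  the other 27 makes its coefficient in the resulting relation nonzero.\<close>

lemma basis_span: "fun_space.span (set (map (off D) basis_funs)) = Gamma_space \<mu> 3"
proof (rule equalityI)
 have "off D (basis_funs ! i) \<in> Gamma_space \<mu> 3" if "i < 27" for i by (rule good_Gamma[OF nth_basis_good[OF that]])
 hence "set (map (off D) basis_funs) <= Gamma_space \<mu> 3"
  using length_lists by (auto simp: in_set_conv_nth)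
 thus "fun_space.span (set (map (off D) basis_funs)) <= Gamma_space \<mu> 3" by (rule fun_space.span_minimal[OF _ Gamma_subspace])
next
 show "Gamma_space \<mu> 3 <= fun_space.span (set (map (off D) basis_funs))"
 proof
  fix g assume "g \<in> Gamma_space \<mu> 3"
  then obtain F where g: "off D g = g" "good g F" unfolding Gamma_iff by blast
  define f where "f = (%i. if i < 27 then hats ! i else F)"
  have "\<exists>x. (\<exists>i\<in>{..<28}. x i ~= 0) & (\<forall>u. (\<Sum>i\<in>{..<28::nat}. x i * f i u) = 0)"
   by (rule level_dependent[of _ _ 3]) (use good_level g(2) nth_basis_good in \<open>auto simp: f_def\<close>)
  then obtain x where x: "\<exists>i<28::nat. x i ~= 0" "!!u. (\<Sum>i<28::nat. x i * f i u) = 0" by blast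
  have "{..<28} = insert 27 {..<27::nat}" by auto
  hence rel: "x 27 * F u + (\<Sum>i<27. x i * (hats ! i) u) = 0" for u using x(2)[of u] by (simp add: f_def)
  have x27: "x 27 ~= 0"
  proof
   assume x27: "x 27 = 0"
   hence "\<forall>i<27. x i = 0" using rel by (intro hats_independent) simp
   moreover have "i < 27 | i = 27" if "i < 28" for i :: nat using that by linarith
   ultimately show False using x(1) x27 by blast
  qed
  have "g = (\<Sum>i<27. fun_scale (- x i / x 27) (off D (basis_funs ! i)))"
  proof
   fix u
   have apply_sum: "(\<Sum>i<n. h i) u = (\<Sum>i<n. h i u)" for n :: nat and h :: "nat => complex^3 => complex"
    by (induction n) auto
   show "g u = (\<Sum>i<27. fun_scale (- x i / x 27) (off D (basis_funs ! i))) u"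
   proof (cases "u \<in> D")
    case True
    hence "g u = 0" using g(1) by (metis off_def)
    thus ?thesis using True by (simp add: apply_sum fun_scale_def off_def)
   next
    case False
    have "(\<Sum>i<27. x i * (hats ! i) u) = (\<Sum>i<27. x i * (basis_funs ! i) u * \<sigma> u ^ 3)"
     by (rule sum.cong) (use nth_basis_good False in \<open>auto simp: good_def sigma_zero\<close>)
    hence "(x 27 * g u + (\<Sum>i<27. x i * (basis_funs ! i) u)) * \<sigma> u ^ 3 = 0"
     using rel[of u] g(2) False by (simp add: good_def sigma_zero distrib_right sum_distrib_right)
    hence "x 27 * g u + (\<Sum>i<27. x i * (basis_funs ! i) u) = 0" using False by (simp add: sigma_zero)
    hence "g u = - (\<Sum>i<27. x i * (basis_funs ! i) u) / x 27" using x27 by (simp add: field_simps eq_neg_iff_add_eq_0)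
    thus ?thesis using False
     by (simp add: apply_sum fun_scale_def off_def sum_divide_distrib sum_negf[symmetric] divide_simps x27)
   qed
  qed
  also have "\<dots> \<in> fun_space.span (set (map (off D) basis_funs))"
   by (intro fun_space.span_sum fun_space.span_scale fun_space.span_base) (use length_lists in auto)
  finally show "g \<in> fun_space.span (set (map (off D) basis_funs))" .
 qed
qed

end

theorem theorem3p3:
  fixes \<mu> :: "nat \<Rightarrow> complex" and \<sigma> :: "complex ^ 3 \<Rightarrow> complex"
  assumes "nonsingular \<mu>" and "kleinian_sigma \<mu> \<sigma>"
  shows "is_basis
    (map (off (theta_preimage \<mu>))
      [\<lambda>u. 1, wp \<sigma> [1,1], wp \<sigma> [1,2], wp \<sigma> [1,3], wp \<sigma> [2,2], wp \<sigma> [2,3], wp \<sigma> [3,3],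
       Delta_fun \<sigma>,
       wp \<sigma> [1,1,1], wp \<sigma> [1,1,2], wp \<sigma> [1,1,3], wp \<sigma> [1,2,2], wp \<sigma> [1,2,3],
       wp \<sigma> [1,3,3], wp \<sigma> [2,2,2], wp \<sigma> [2,2,3], wp \<sigma> [2,3,3], wp \<sigma> [3,3,3],
       partial 1 (Delta_fun \<sigma>), partial 2 (Delta_fun \<sigma>), partial 3 (Delta_fun \<sigma>),
       wp_minor \<sigma> 1 1, wp_minor \<sigma> 1 2, wp_minor \<sigma> 1 3, wp_minor \<sigma> 2 3, wp_minor \<sigma> 3 3,
       T_fun \<sigma>])
    (Gamma_space \<mu> 3)"
proof -
  obtain ci r A Q where "hyper_curve \<mu> ci r A Q" using nonsingular_hyper_curve[OF assms(1)] by blast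
  then interpret hyper_curve \<mu> ci r A Q .
  obtain \<alpha> \<beta> h a b c where
    k: "riemann_constant_characteristic \<mu> (period_matrix \<mu> du_coeff \<alpha>) (period_matrix \<mu> du_coeff \<beta>) a b" "c \<noteq> 0"
    and s: "\<And>u. \<sigma> u = c * exp (1/2 * (\<Sum>i\<in>UNIV. u $ i * ((period_matrix \<mu> (\<lambda>i. regular_fun (h i)) \<alpha> ** matrix_inv (period_matrix \<mu> du_coeff \<alpha>)) *v u) $ i))
       * riemann_theta a b (matrix_inv (period_matrix \<mu> du_coeff \<alpha>) *v u) (matrix_inv (period_matrix \<mu> du_coeff \<alpha>) ** period_matrix \<mu> du_coeff \<beta>)"
    using assms(2) unfolding kleinian_sigma_def Let_def by blast
  interpret sigma_curve \<mu> ci r A Q \<sigma> a b "matrix_inv (period_matrix \<mu> du_coeff \<alpha>)"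
    "matrix_inv (period_matrix \<mu> du_coeff \<alpha>) ** period_matrix \<mu> du_coeff \<beta>"
    "period_matrix \<mu> (\<lambda>i. regular_fun (h i)) \<alpha> ** matrix_inv (period_matrix \<mu> du_coeff \<alpha>)" c
    by unfold_locales (use k s in \<open>auto simp: riemann_constant_characteristic_def\<close>)
  show ?thesis
    using basis_independent basis_span unfolding is_basis_def theta_preimage_eq basis_funs_def by blast
qed

end
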